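(* Let $x$ take positive integer values, let $N=x$, and let $R_{2N}(2x)$ be defined by $$I_0(2x)K_0(2x)=\frac{1}{4x}\sum_{k=0}^{2N-1}\frac{((2k)!)^3}{(k!)^4(16x)^{2k}}+R_{2N}(2x).$$ Then the error resulting from $K_0(2x)/I_0(2x)$ in the Brent–McMillan algorithm at optimal truncation, namely $R_{2N}(2x)/(I_0(2x))^2$, has the expansion $$\frac{R_{2N}(2x)}{(I_0(2x))^2}=\frac{7\sqrt{2\pi}\,e^{-8x}}{12\,x^{1/2}}\left\{1-\frac{191}{630\,x}+\frac{18211}{376320\,x^2}-\frac{799201}{16257024\,x^3}+\frac{116774621369177}{4221897110323200\,x^4}+\cdots\right\}$$ as $x\to+\infty$.
   Context: $I_0$ and $K_0$ are the standard modified Bessel functions. The Brent–McMillan algorithm computes Euler's constant $\gamma$ from the identity $$\gamma=\frac{S_0(2x)}{I_0(2x)}-\log x-\frac{K_0(2x)}{I_0(2x)},\qquad S_0(x)=\sum_{n=0}^\infty\frac{H_n}{(n!)^2}\left(\tfrac12x\right)^{2n},\qquad H_n=1+\tfrac12+\cdots+\tfrac1n,$$ with $x$ a positive integer. The term $K_0(2x)/I_0(2x)$ is computed as $I_0(2x)K_0(2x)/(I_0(2x))^2$, with the product $I_0(2x)K_0(2x)$ replaced by its large-$x$ asymptotic series $\frac1{4x}\sum_{k}\frac{((2k)!)^3}{(k!)^4(16x)^{2k}}$ truncated optimally (at, or near, its least term), here after the terms $k=0,\dots,2N-1$ with $N=x$. The resulting error in $K_0(2x)/I_0(2x)$ is 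$R_{2N}(2x)/(I_0(2x))^2$.
   Formalization: The printed coefficient of x^{-4}, 116774621369177/4221897110323200, is incorrect; the formal theorem proves the expansion with 427334077931/15450675609600 in its place, all other terms as stated. *)

theory Defs
  imports "HOL-Analysis.Analysis" "HOL-Library.Landau_Symbols"
begin

definition bessel_I0 :: "real \<Rightarrow> real" where
  "bessel_I0 z = (\<Sum>n. (z / 2) ^ (2 * n) / (fact n)\<^sup>2)"

(* Classical integral definition of K_0 on the positive half-line. For z <= 0 the
   integral diverges and the value is irrelevant. *)
definition bessel_K0 :: "real \<Rightarrow> real" where
  "bessel_K0 z = integral {0..} (\<lambda>t. exp (- z * cosh t))"

lemma bessel_I0_summable: "summable (\<lambda>n. (z / 2) ^ (2 * n) / (fact n)\<^sup>2 :: real)"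
proof (rule summable_comparison_test')
  show "summable (\<lambda>n. ((z / 2)\<^sup>2) ^ n /\<^sub>R fact n)"
    by (rule summable_exp_generic)
  fix n :: nat
  have "(fact n :: real) * 1 \<le> fact n * fact n"
    by (intro mult_left_mono fact_ge_1) auto
  then show "norm ((z / 2) ^ (2 * n) / (fact n)\<^sup>2) \<le> ((z / 2)\<^sup>2) ^ n /\<^sub>R fact n"
    by (simp add: power_mult power2_eq_square divide_simps)
      (use mult_left_mono[OF fact_ge_1[of n, where 'a = real], of "z ^ n * z ^ n"] in
        \<open>auto simp: zero_le_square\<close>)
qed

lemma bessel_K0_integrable:
  fixes z :: real
  assumes "z > 0"
  shows "(\<lambda>t. exp (- z * cosh t)) integrable_on {0..}"
proof -
  have "continuous_on {0..} (\<lambda>t::real. exp (- z * cosh t))"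
    by (intro continuous_intros)
  then have meas: "(\<lambda>t::real. exp (- z * cosh t)) \<in> borel_measurable (lebesgue_on {0..})"
    by (intro continuous_imp_measurable_on_sets_lebesgue) auto
  have bound: "norm (exp (- z * cosh t)) \<le> exp (- (z / 2) * t)" for t :: real
  proof -
    have "t \<le> exp t"
      using exp_ge_add_one_self[of t] by linarith
    also have "exp t \<le> exp t + exp (- t)"
      by simp
    finally have "t \<le> exp t + exp (- t)" .
    then have "t / 2 \<le> cosh t"
      by (simp add: cosh_field_def)
    then have "z * (t / 2) \<le> z * cosh t"
      using assms by (intro mult_left_mono) auto
    then show ?thesis by simp
  qed
  have "(\<lambda>t. exp (- (z / 2) * t)) integrable_on {0..}"
    using assms by (intro integrable_on_exp_minus_to_infinity) auto
  then show ?thesis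
    by (rule measurable_bounded_by_integrable_imp_integrable[OF meas]) (use bound in auto)
qed

(* The product I_0(z) K_0(z) has the divergent asymptotic series
   1/(2z) * sum_k ((2k)!)^3 / ((k!)^4 (8z)^(2k)); at z = 2x the prefactor is 1/(4x)
   and the powers are (16x)^(2k). *)
definition I0K0_trunc :: "nat \<Rightarrow> real \<Rightarrow> real" where
  "I0K0_trunc M z = 1 / (2 * z) * (\<Sum>k<M. (fact (2 * k)) ^ 3 / ((fact k) ^ 4 * (8 * z) ^ (2 * k)))"

definition I0K0_remainder :: "nat \<Rightarrow> real \<Rightarrow> real" where
  "I0K0_remainder M z = bessel_I0 z * bessel_K0 z - I0K0_trunc M z"

(* In the expansion of I0K0_remainder (2 * x) (2 * x) / (bessel_I0 (2 * x))^2 for integers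
   x tending to infinity, the coefficient of x^(-4) is 427334077931 / 15450675609600
   = 0.02765795417...  The literature also prints it as
   116774621369177 / 4221897110323200 = 0.02765927693..., which is incorrect. *)

end

theory Submission
  imports Defs "HOL-Real_Asymp.Real_Asymp"
begin

text \<open>
  The remainder has the exact integral representation
  \<open>\<pi>\<^sup>2 / 2 * R\<^sub>M(z) = \<integral> (v^(2M) * K\<^sub>0(z v)\<^sup>2 - K\<^sub>0(z)\<^sup>2) / (1 - v\<^sup>2) dv\<close> over \<open>v > 0\<close>: for \<open>M = 0\<close> it
  follows from \<open>K\<^sub>0(u)\<^sup>2 = 2 * \<integral> K\<^sub>0(2 u cosh a) da\<close> and a Hilbert-type kernel, and raising \<open>M\<close> removes
  one moment of \<open>K\<^sub>0\<^sup>2\<close>, which is one term of the divergent series. At optimal truncation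
  \<open>2M = 2z = m\<close> the saddle point of \<open>v^m * exp(-m v)\<close> is \<open>v = 1\<close> and coincides with the pole.
  Since the principal value of \<open>\<integral> 1 / (1 - v\<^sup>2) dv\<close> over \<open>v > 0\<close> is \<open>0\<close>, the singular part of the
  integral is \<open>pv m\<close>, whose difference \<open>pv (m + 1) - pv m\<close> is a Laplace integral with a regular
  integrand; its expansion is obtained from this recursion. What remains are regular Laplace
  integrals at \<open>v = 1\<close>, which Taylor expansion reduces to central moments of the Gamma density,
  and the factor \<open>I\<^sub>0(z)\<^sup>2\<close>, treated by Laplace's method as well.
\<close>

section \<open>An integral representation of the remainder\<close>

text \<open>The obstacle is that at optimal truncation the pole of
  \<open>1 / (1 - v\<^sup>2)\<close> lies exactly on the saddle, so no Taylor expansion of the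
  integrand at \<open>v = 1\<close> is available, while the subtracted term
  \<open>K\<^sub>0(z)\<^sup>2\<close> does not concentrate there at all. The recursion for
  \<open>pv\<close> determines its formal series completely, but its actual solutions still differ
  by an additive constant; \<open>pv_tendsto_0\<close> excludes this constant, and for that a bound
  near the pole is needed which is uniform in \<open>m\<close>. The integral representation is
  derived in \<open>ennreal\<close>: each exchange of integrals is then Tonelli's theorem, and
  finiteness is inherited at the end from a side that is already known to be a real number. All
  expansions are in powers of \<open>1 / m\<close> with \<open>m = 2 * M\<close> and Bessel argument
  \<open>m / 2\<close>; the passage to \<open>m = 4 * x\<close> is a rescaling of coefficients at
  the very end.\<close>

lemma ennreal_mult_cancel_const:
  assumes "c > 0" "ennreal c * X = Y"
  shows "X = ennreal (1 / c) * Y"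
proof -
  have "ennreal (1 / c) * Y = ennreal (1 / c * c) * X"
    using assms by (subst ennreal_mult) (auto simp: mult.assoc)
  then show ?thesis using assms(1) by simp
qed

text \<open>A nonnegative Borel function fails to be absolutely integrable exactly when its
  nonnegative integral diverges. Recording the value \<open>\<infinity>\<close> makes the rule
  usable before integrability is known; it links the gauge integral, in which
  \<open>bessel_K0\<close> and the substitution rule are stated, with Tonelli's theorem.\<close>

lemma nn_integral_set_absolutely_integrable:
  fixes h :: "real \<Rightarrow> real"
  assumes [measurable]: "h \<in> borel_measurable borel" "A \<in> sets borel"
    and nonneg: "\<And>x. x \<in> A \<Longrightarrow> 0 \<le> h x"
  shows "(\<integral>\<^sup>+x. ennreal (h x) * indicator A x \<partial>lborel) =
    (if h absolutely_integrable_on A then ennreal (integral A h) else \<infinity>)"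
proof -
  have eq: "(\<integral>\<^sup>+x. ennreal (h x) * indicator A x \<partial>lborel) =
      (\<integral>\<^sup>+x. ennreal (indicator A x *\<^sub>R h x) \<partial>lborel)"
    by (intro nn_integral_cong) (auto split: split_indicator)
  have iff: "h absolutely_integrable_on A \<longleftrightarrow> integrable lborel (\<lambda>x. indicator A x *\<^sub>R h x)"
    unfolding set_integrable_def by (subst integrable_completion) auto
  show ?thesis
  proof (cases "h absolutely_integrable_on A")
    case True
    then have int: "integrable lborel (\<lambda>x. indicator A x *\<^sub>R h x)"
      using iff by simp
    have "(\<integral>\<^sup>+x. ennreal (indicator A x *\<^sub>R h x) \<partial>lborel) = ennreal (\<integral>x. indicator A x *\<^sub>R h x \<partial>lborel)"
      by (intro nn_integral_eq_integral int) (auto split: split_indicator simp: nonneg)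
    also have "(\<integral>x. indicator A x *\<^sub>R h x \<partial>lborel) = integral A h"
      using set_borel_integral_eq_integral(2)[of A h] int
      by (simp add: set_integrable_def set_lebesgue_integral_def)
    finally show ?thesis using True eq by simp
  next
    case False
    then have "\<not> integrable lborel (\<lambda>x. indicator A x *\<^sub>R h x)"
      using iff by simp
    then have "(\<integral>\<^sup>+x. ennreal (norm (indicator A x *\<^sub>R h x)) \<partial>lborel) = \<infinity>"
      unfolding integrable_iff_bounded by (simp add: less_top[symmetric])
    moreover have "(\<integral>\<^sup>+x. ennreal (norm (indicator A x *\<^sub>R h x)) \<partial>lborel) =
        (\<integral>\<^sup>+x. ennreal (indicator A x *\<^sub>R h x) \<partial>lborel)"
      by (intro nn_integral_cong) (auto split: split_indicator simp: nonneg)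
    ultimately show ?thesis using False eq by simp
  qed
qed

text \<open>The substitution rule for absolute integrals is an equivalence of integrability on both
  sides, so the equation survives when both sides are infinite.\<close>

lemma nn_integral_change_of_variables:
  fixes f g g' :: "real \<Rightarrow> real"
  assumes [measurable]: "f \<in> borel_measurable borel" "g \<in> borel_measurable borel"
      "g' \<in> borel_measurable borel" "S \<in> sets borel" "T \<in> sets borel"
    and der: "\<And>x. x \<in> S \<Longrightarrow> (g has_field_derivative g' x) (at x)"
    and inj: "inj_on g S" and image: "g ` S = T"
    and nonneg: "\<And>y. y \<in> T \<Longrightarrow> 0 \<le> f y"
  shows "(\<integral>\<^sup>+y. ennreal (f y) * indicator T y \<partial>lborel) =
    (\<integral>\<^sup>+x. ennreal (\<bar>g' x\<bar> * f (g x)) * indicator S x \<partial>lborel)"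
proof -
  have der': "\<And>x. x \<in> S \<Longrightarrow> (g has_field_derivative g' x) (at x within S)"
    using der has_field_derivative_at_within by blast
  have S: "S \<in> sets lebesgue" by simp
  note cov = has_absolute_integral_change_of_variables_1'[OF S der' inj, of f, unfolded image]
  have "(f absolutely_integrable_on T) = ((\<lambda>x. \<bar>g' x\<bar> * f (g x)) absolutely_integrable_on S)"
    using cov by blast
  moreover have "f absolutely_integrable_on T \<Longrightarrow> integral T f = integral S (\<lambda>x. \<bar>g' x\<bar> * f (g x))"
    using cov[of "integral T f"] by simp
  moreover have "\<And>x. x \<in> S \<Longrightarrow> 0 \<le> \<bar>g' x\<bar> * f (g x)"
    using nonneg image by fastforce
  ultimately show ?thesis
    using nonneg by (subst (1 2) nn_integral_set_absolutely_integrable) auto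
qed

lemma cosh_measurable [measurable]: "cosh \<in> borel_measurable (borel :: real measure)"
  and sinh_measurable [measurable]: "sinh \<in> borel_measurable (borel :: real measure)"
  by (intro borel_measurable_continuous_onI continuous_intros)+

lemma cosh_image: "cosh ` {0::real<..} = {1<..}"
proof (intro equalityI subsetI)
  fix y :: real assume "y \<in> cosh ` {0<..}"
  then show "y \<in> {1<..}" using cosh_real_strict_mono[of 0] by auto
next
  fix u :: real assume "u \<in> {1<..}"
  then obtain t where "t \<ge> 0" "cosh t = u"
    using arcosh_nonneg_real cosh_arcosh_real by (metis greaterThan_iff order_less_imp_le)
  moreover from this \<open>u \<in> {1<..}\<close> have "t \<noteq> 0" by auto
  ultimately show "u \<in> cosh ` {0<..}" by force
qed

lemma cosh_inj_on: "inj_on cosh {0::real<..}"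
  by (intro inj_onI) simp

lemma nn_integral_cosh_subst:
  fixes f :: "real \<Rightarrow> real"
  assumes [measurable]: "f \<in> borel_measurable borel"
    and nonneg: "\<And>u. u > 1 \<Longrightarrow> 0 \<le> f u"
  shows "(\<integral>\<^sup>+u. ennreal (f u / sqrt (u\<^sup>2 - 1)) * indicator {1<..} u \<partial>lborel) =
     (\<integral>\<^sup>+t. ennreal (f (cosh t)) * indicator {0<..} t \<partial>lborel)"
proof -
  have "(\<integral>\<^sup>+u. ennreal (f u / sqrt (u\<^sup>2 - 1)) * indicator {1<..} u \<partial>lborel) =
    (\<integral>\<^sup>+t. ennreal (\<bar>sinh t\<bar> * (f (cosh t) / sqrt ((cosh t)\<^sup>2 - 1))) * indicator {0<..} t \<partial>lborel)"
    by (rule nn_integral_change_of_variables)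
       (auto intro!: derivative_eq_intros nonneg divide_nonneg_nonneg cosh_inj_on cosh_image)
  also have "\<dots> = (\<integral>\<^sup>+t. ennreal (f (cosh t)) * indicator {0<..} t \<partial>lborel)"
    by (intro nn_integral_cong) (auto simp: cosh_square_eq split: split_indicator)
  finally show ?thesis .
qed

lemma bessel_K0_nonneg: "0 \<le> bessel_K0 z"
  unfolding bessel_K0_def
  by (cases "(\<lambda>t. exp (- z * cosh t)) integrable_on {0..}")
     (auto intro: integral_nonneg simp: not_integrable_integral)

text \<open>True for every real \<open>z\<close>: where the defining integral diverges, the default
  value \<open>0\<close> of \<open>integral\<close> agrees with
  \<open>enn2real \<infinity> = 0\<close>. Measurability of \<open>bessel_K0\<close> on the whole
  line follows.\<close>

lemma bessel_K0_eq_nn_integral: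
  "bessel_K0 z = enn2real (\<integral>\<^sup>+t. ennreal (exp (- z * cosh t)) * indicator {0..} t \<partial>lborel)"
proof -
  have "(\<lambda>t. exp (- z * cosh t)) absolutely_integrable_on {0..} \<longleftrightarrow> (\<lambda>t. exp (- z * cosh t)) integrable_on {0..}"
    using nonnegative_absolutely_integrable_1[of "\<lambda>t. exp (- z * cosh t)" "{0..}"]
    by (auto dest: set_lebesgue_integral_eq_integral(1))
  then show ?thesis
    using bessel_K0_nonneg[of z] unfolding bessel_K0_def
    by (subst nn_integral_set_absolutely_integrable) (auto simp: not_integrable_integral)
qed

lemma bessel_K0_measurable [measurable]: "bessel_K0 \<in> borel_measurable borel"
  unfolding bessel_K0_eq_nn_integral[abs_def] by measurable

lemma nn_integral_bessel_K0:
  assumes "z > 0"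
  shows "(\<integral>\<^sup>+t. ennreal (exp (- z * cosh t)) * indicator {0<..} t \<partial>lborel) = ennreal (bessel_K0 z)"
proof -
  have "(\<integral>\<^sup>+t. ennreal (exp (- z * cosh t)) * indicator {0<..} t \<partial>lborel) =
     (\<integral>\<^sup>+t. ennreal (exp (- z * cosh t)) * indicator {0..} t \<partial>lborel)"
    by (intro nn_integral_cong_AE eventually_mono[OF AE_lborel_singleton[of 0]])
       (auto split: split_indicator)
  also have "\<dots> = ennreal (bessel_K0 z)"
    using bessel_K0_integrable[OF assms]
    by (subst nn_integral_set_absolutely_integrable)
       (auto simp: bessel_K0_def intro!: nonnegative_absolutely_integrable_1)
  finally show ?thesis .
qed

lemma nn_integral_bessel_K0_algebraic:
  assumes "z > 0"
  shows "(\<integral>\<^sup>+u. ennreal (exp (- z * u) / sqrt (u\<^sup>2 - 1)) * indicator {1<..} u \<partial>lborel) = ennreal (bessel_K0 z)"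
  by (subst nn_integral_cosh_subst) (simp_all add: nn_integral_bessel_K0[OF assms, simplified])

section \<open>Wallis integrals; \<open>central_coeff n\<close> is the central binomial coefficient
  divided by \<open>4 ^ n\<close>\<close>

definition central_coeff :: "nat \<Rightarrow> real" where
  "central_coeff n = fact (2 * n) / (4 ^ n * (fact n)\<^sup>2)"

lemma central_coeff_0 [simp]: "central_coeff 0 = 1"
  by (simp add: central_coeff_def)

lemma central_coeff_Suc: "central_coeff (Suc n) = (2 * n + 1) / (2 * n + 2) * central_coeff n"
proof -
  have "(fact (2 * Suc n) :: real) = (2 * n + 2) * ((2 * n + 1) * fact (2 * n))"
    by (simp add: algebra_simps)
  moreover have "(fact (Suc n) :: real)\<^sup>2 = (real n + 1)\<^sup>2 * (fact n)\<^sup>2"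
    by (simp add: power_mult_distrib add.commute)
  ultimately show ?thesis
    unfolding central_coeff_def by (simp add: divide_simps) (simp add: power2_eq_square algebra_simps)?
qed

lemma central_coeff_pos: "central_coeff n > 0"
  by (simp add: central_coeff_def)

lemma sin_power_integral: "((\<lambda>t. sin t ^ (2 * n)) has_integral pi / 2 * central_coeff n) {0..pi/2}"
proof (induction n)
  case 0
  show ?case using has_integral_const_real[of "1::real" 0 "pi/2"] by simp
next
  case (Suc n)
  \<comment> \<open>Integration by parts, written as the derivative of
    \<open>- sin t ^ (2 * n + 1) * cos t\<close>, whose boundary values both vanish.\<close>
  have "((\<lambda>t. (2 * n + 2) * sin t ^ (2 * n + 2) - (2 * n + 1) * sin t ^ (2 * n)) has_integral
      (- (sin (pi/2) ^ (2 * n + 1) * cos (pi/2))) - (- (sin 0 ^ (2 * n + 1) * cos 0))) {0..pi/2}"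
  proof (rule fundamental_theorem_of_calculus)
    fix t :: real
    have "((\<lambda>t. - (sin t ^ (2 * n + 1) * cos t)) has_real_derivative
      - ((2 * n + 1) * sin t ^ (2 * n) * cos t * cos t - sin t ^ (2 * n + 1) * sin t)) (at t within {0..pi/2})"
      unfolding Suc_eq_plus1[symmetric]
      by (rule derivative_eq_intros refl | simp)+ (simp add: algebra_simps)?
    also have "- ((2 * n + 1) * sin t ^ (2 * n) * cos t * cos t - sin t ^ (2 * n + 1) * sin t) =
       (2 * n + 2) * sin t ^ (2 * n + 2) - (2 * n + 1) * sin t ^ (2 * n)"
    proof -
      have "cos t * cos t = 1 - sin t * sin t"
        using sin_cos_squared_add[of t] by (simp add: power2_eq_square)
      then show ?thesis by (simp add: mult.assoc) (simp add: algebra_simps)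
    qed
    finally show "((\<lambda>t. - (sin t ^ (2 * n + 1) * cos t)) has_vector_derivative
       (2 * n + 2) * sin t ^ (2 * n + 2) - (2 * n + 1) * sin t ^ (2 * n)) (at t within {0..pi/2})"
      by (simp add: has_real_derivative_iff_has_vector_derivative)
  qed auto
  then have "((\<lambda>t. (2 * n + 2) * sin t ^ (2 * n + 2) - (2 * n + 1) * sin t ^ (2 * n)) has_integral 0) {0..pi/2}"
    by simp
  from has_integral_add[OF this has_integral_mult_right[OF Suc, of "2 * n + 1"]]
  have "((\<lambda>t. (2 * n + 2) * sin t ^ (2 * n + 2)) has_integral (2 * n + 1) * (pi / 2 * central_coeff n)) {0..pi/2}"
    by simp
  from has_integral_mult_right[OF this, of "1 / (2 * n + 2)"]
  have *: "((\<lambda>t. 1 / real (2 * n + 2) * (real (2 * n + 2) * sin t ^ (2 * n + 2))) has_integral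
      1 / real (2 * n + 2) * (real (2 * n + 1) * (pi / 2 * central_coeff n))) {0..pi/2}"
    by simp
  have 1: "1 / real (2 * n + 2) * (real (2 * n + 2) * sin t ^ (2 * n + 2)) = sin t ^ (2 * Suc n)" for t :: real
    by (simp add: divide_simps)
  have 2: "1 / real (2 * n + 2) * (real (2 * n + 1) * (pi / 2 * central_coeff n)) = pi / 2 * central_coeff (Suc n)"
    by (simp add: central_coeff_Suc field_simps)
  show ?case using * unfolding 1 2 .
qed

lemma sin_image: "sin ` {0<..<pi/2} = {0<..<1}"
proof (intro equalityI subsetI)
  fix y assume "y \<in> sin ` {0<..<pi/2}"
  then obtain t where t: "t \<in> {0<..<pi/2}" "y = sin t" by auto
  have "0 < sin t" using t by (intro sin_gt_zero) auto
  moreover have "sin t < sin (pi/2)" using t by (intro sin_monotone_2pi) auto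
  ultimately show "y \<in> {0<..<1}" using t by simp
next
  fix u :: real assume "u \<in> {0<..<1}"
  then have "u = sin (arcsin u)" "0 < arcsin u" "arcsin u < pi/2"
    using arcsin_less_arcsin[of 0 u] arcsin_less_arcsin[of u 1] by auto
  then show "u \<in> sin ` {0<..<pi/2}" by (metis greaterThanLessThan_iff image_eqI)
qed

lemma nn_integral_power_sqrt:
  "(\<integral>\<^sup>+v. ennreal (v ^ (2 * n) / sqrt (1 - v\<^sup>2)) * indicator {0<..<1} v \<partial>lborel) =
    ennreal (pi / 2 * central_coeff n)"
proof -
  have "(\<integral>\<^sup>+v. ennreal (v ^ (2 * n) / sqrt (1 - v\<^sup>2)) * indicator {0<..<1} v \<partial>lborel) =
    (\<integral>\<^sup>+t. ennreal (\<bar>cos t\<bar> * (sin t ^ (2 * n) / sqrt (1 - (sin t)\<^sup>2))) * indicator {0<..<pi/2} t \<partial>lborel)"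
  proof (rule nn_integral_change_of_variables)
    show "inj_on sin {0<..<pi/2}"
      by (intro inj_onI) (metis greaterThanLessThan_iff arcsin_sin order_less_imp_le minus_pi_half_less_zero order.strict_trans)
  qed (auto intro!: derivative_eq_intros sin_image simp: power_le_one)
  also have "\<dots> = (\<integral>\<^sup>+t. ennreal (sin t ^ (2 * n)) * indicator {0..pi/2} t \<partial>lborel)"
  proof (intro nn_integral_cong_AE eventually_mono[OF eventually_conj[OF AE_lborel_singleton[of 0] AE_lborel_singleton[of "pi/2"]]])
    fix t :: real assume t: "t \<noteq> 0 \<and> t \<noteq> pi/2"
    have "\<bar>cos t\<bar> * (sin t ^ (2 * n) / sqrt (1 - (sin t)\<^sup>2)) = sin t ^ (2 * n)" if "t \<in> {0<..<pi/2}"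
    proof -
      have "cos t > 0" using that by (intro cos_gt_zero) auto
      moreover have "1 - (sin t)\<^sup>2 = (cos t)\<^sup>2" by (simp add: cos_squared_eq)
      ultimately show ?thesis by simp
    qed
    then show "ennreal (\<bar>cos t\<bar> * (sin t ^ (2 * n) / sqrt (1 - (sin t)\<^sup>2))) * indicator {0<..<pi/2} t =
       ennreal (sin t ^ (2 * n)) * indicator {0..pi/2} t"
      using t by (auto split: split_indicator)
  qed
  also have "\<dots> = ennreal (pi / 2 * central_coeff n)"
  proof -
    have nonneg: "0 \<le> sin t ^ (2 * n)" for t :: real
      by simp
    show ?thesis
      using sin_power_integral[of n] nonneg integral_unique[OF sin_power_integral[of n]]
      by (subst nn_integral_set_absolutely_integrable)
         (auto simp: nonnegative_absolutely_integrable_1 simp del: divide_const_simps times_divide_eq_left)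
  qed
  finally show ?thesis .
qed

text \<open>The substitution \<open>v = 1 / cosh t\<close> leads back to the Wallis integral over
  \<open>(0, 1)\<close>.\<close>

lemma nn_integral_cosh_power:
  "(\<integral>\<^sup>+t. ennreal (1 / cosh t ^ (2 * n + 1)) * indicator {0<..} t \<partial>lborel) =
    ennreal (pi / 2 * central_coeff n)"
proof -
  have img: "(\<lambda>t::real. 1 / cosh t) ` {0<..} = {0<..<1}"
  proof -
    have "(\<lambda>t::real. 1 / cosh t) ` {0<..} = (\<lambda>u. 1 / u) ` cosh ` {0<..}" by (simp add: image_image)
    also have "\<dots> = (\<lambda>u. 1 / u) ` {1<..}" by (simp only: cosh_image)
    also have "\<dots> = {0<..<1}"
    proof safe
      fix u :: real assume "u \<in> {0<..<1}"
      then have "u = 1 / (1 / u)" "1 / u \<in> {1<..}" by auto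
      then show "u \<in> (\<lambda>u. 1 / u) ` {1<..}" by blast
    qed auto
    finally show ?thesis .
  qed
  have "ennreal (pi / 2 * central_coeff n) =
    (\<integral>\<^sup>+v. ennreal (v ^ (2 * n) / sqrt (1 - v\<^sup>2)) * indicator {0<..<1} v \<partial>lborel)"
    by (simp add: nn_integral_power_sqrt)
  also have "\<dots> = (\<integral>\<^sup>+t. ennreal (\<bar>- sinh t / (cosh t)\<^sup>2\<bar> * ((1 / cosh t) ^ (2 * n) / sqrt (1 - (1 / cosh t)\<^sup>2))) * indicator {0<..} t \<partial>lborel)"
  proof (rule nn_integral_change_of_variables)
    show "inj_on (\<lambda>t::real. 1 / cosh t) {0<..}"
      using cosh_inj_on by (auto simp: inj_on_def)
  qed (auto intro!: derivative_eq_intros img simp: power_le_one, simp add: power2_eq_square)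
  also have "\<dots> = (\<integral>\<^sup>+t. ennreal (1 / cosh t ^ (2 * n + 1)) * indicator {0<..} t \<partial>lborel)"
  proof (intro nn_integral_cong)
    fix t :: real
    have "\<bar>- sinh t / (cosh t)\<^sup>2\<bar> * ((1 / cosh t) ^ (2 * n) / sqrt (1 - (1 / cosh t)\<^sup>2)) = 1 / cosh t ^ (2 * n + 1)" if "t > 0"
    proof -
      have s: "sinh t > 0" and c: "cosh t > 0" using that by simp_all
      have "1 - (1 / cosh t)\<^sup>2 = (sinh t / cosh t)\<^sup>2"
        using c by (simp add: power_divide sinh_square_eq field_simps)
      then have "sqrt (1 - (1 / cosh t)\<^sup>2) = sinh t / cosh t"
        using s c by (simp add: real_sqrt_abs)
      then show ?thesis using s c by (simp add: power_divide field_simps power2_eq_square)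
    qed
    then show "ennreal (\<bar>- sinh t / (cosh t)\<^sup>2\<bar> * ((1 / cosh t) ^ (2 * n) / sqrt (1 - (1 / cosh t)\<^sup>2))) * indicator {0<..} t = ennreal (1 / cosh t ^ (2 * n + 1)) * indicator {0<..} t"
      by (auto split: split_indicator)
  qed
  finally show ?thesis by simp
qed


section \<open>Integral representations of I_0 and of the product I_0 K_0\<close>

lemma bessel_I0_nonneg: "0 \<le> bessel_I0 z"
  unfolding bessel_I0_def by (intro suminf_nonneg bessel_I0_summable) (simp add: power_mult)

lemma cosh_sums: "(\<lambda>n. x ^ (2 * n) / fact (2 * n)) sums cosh (x :: real)"
proof -
  have sums: "(\<lambda>n. if even n then x ^ n /\<^sub>R fact n else 0) sums cosh x"
    using cosh_converges[of x] by simp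
  have "(\<lambda>n. (\<lambda>n. if even n then x ^ n /\<^sub>R fact n else 0) (2 * n)) sums cosh x"
  proof (subst sums_mono_reindex)
    show "strict_mono ((*) (2 :: nat))" by (intro strict_monoI) auto
  qed (use sums in \<open>auto elim: evenE\<close>)
  then show ?thesis by (simp add: field_simps)
qed

text \<open>Folding \<open>(-1, 1)\<close> at \<open>0\<close> cancels the odd powers of
  \<open>v\<close>, so the exponential series becomes one with nonnegative terms and may be
  integrated termwise.\<close>

lemma nn_integral_bessel_I0:
  "(\<integral>\<^sup>+v. ennreal (exp (z * v) / sqrt (1 - v\<^sup>2)) * indicator {-1<..<1} v \<partial>lborel) =
    ennreal (pi * bessel_I0 z)"
proof -
  define f where "f v = exp (z * v) / sqrt (1 - v\<^sup>2)" for v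
  have [measurable]: "f \<in> borel_measurable borel" unfolding f_def by measurable
  have refl: "(\<integral>\<^sup>+v. ennreal (f v) * indicator {-1<..<0} v \<partial>lborel) =
      (\<integral>\<^sup>+v. ennreal (f (- v)) * indicator {0<..<1} v \<partial>lborel)"
    by (subst nn_integral_real_affine[where c = "-1" and t = 0])
       (auto intro!: nn_integral_cong split: split_indicator)
  have "(\<integral>\<^sup>+v. ennreal (f v) * indicator {-1<..<1} v \<partial>lborel) =
    (\<integral>\<^sup>+v. ennreal (f v) * indicator {-1<..<0} v + ennreal (f v) * indicator {0<..<1} v \<partial>lborel)"
    by (intro nn_integral_cong_AE eventually_mono[OF AE_lborel_singleton[of 0]])
       (auto split: split_indicator)
  also have "\<dots> = (\<integral>\<^sup>+v. ennreal (f (-v)) * indicator {0<..<1} v + ennreal (f v) * indicator {0<..<1} v \<partial>lborel)"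
    by (simp add: nn_integral_add refl)
  also have "\<dots> = (\<integral>\<^sup>+v. (\<Sum>n. ennreal (2 * z ^ (2 * n) / fact (2 * n)) *
      (ennreal (v ^ (2 * n) / sqrt (1 - v\<^sup>2)) * indicator {0<..<1} v)) \<partial>lborel)"
  proof (intro nn_integral_cong)
    fix v :: real
    have "ennreal (f (- v)) + ennreal (f v) =
        (\<Sum>n. ennreal (2 * z ^ (2 * n) / fact (2 * n)) * ennreal (v ^ (2 * n) / sqrt (1 - v\<^sup>2)))"
      if v: "v \<in> {0<..<1}"
    proof -
      have v2: "v\<^sup>2 < 1" using v by (simp add: power2_eq_square mult_strict_mono'[of v 1 v 1, simplified])
      have "(\<lambda>n. 2 / sqrt (1 - v\<^sup>2) * ((z * v) ^ (2 * n) / fact (2 * n))) sums (2 / sqrt (1 - v\<^sup>2) * cosh (z * v))"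
        by (intro sums_mult cosh_sums)
      moreover have "2 / sqrt (1 - v\<^sup>2) * cosh (z * v) = f (- v) + f v"
        by (simp add: f_def cosh_field_def add_divide_distrib)
      moreover have "(\<lambda>n. 2 / sqrt (1 - v\<^sup>2) * ((z * v) ^ (2 * n) / fact (2 * n))) =
        (\<lambda>n. 2 * z ^ (2 * n) / fact (2 * n) * (v ^ (2 * n) / sqrt (1 - v\<^sup>2)))"
        by (simp add: power_mult_distrib field_simps)
      ultimately have "(\<lambda>n. 2 * z ^ (2 * n) / fact (2 * n) * (v ^ (2 * n) / sqrt (1 - v\<^sup>2))) sums (f (- v) + f v)"
        by simp
      then have "(\<Sum>n. ennreal (2 * z ^ (2 * n) / fact (2 * n) * (v ^ (2 * n) / sqrt (1 - v\<^sup>2)))) = ennreal (f (- v) + f v)"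
        using v2 by (intro suminf_ennreal_eq) (auto simp: power_mult)
      then show ?thesis
        using v2 by (simp add: f_def ennreal_plus[symmetric] ennreal_mult[symmetric] power_mult del: ennreal_plus)
    qed
    then show "ennreal (f (- v)) * indicator {0<..<1} v + ennreal (f v) * indicator {0<..<1} v =
       (\<Sum>n. ennreal (2 * z ^ (2 * n) / fact (2 * n)) *
        (ennreal (v ^ (2 * n) / sqrt (1 - v\<^sup>2)) * indicator {0<..<1} v))"
      by (auto split: split_indicator)
  qed
  also have "\<dots> = (\<Sum>n. ennreal (2 * z ^ (2 * n) / fact (2 * n)) * ennreal (pi / 2 * central_coeff n))"
    by (subst nn_integral_suminf) (simp_all add: nn_integral_cmult nn_integral_power_sqrt)
  also have "\<dots> = (\<Sum>n. ennreal (pi * ((z / 2) ^ (2 * n) / (fact n)\<^sup>2)))"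
  proof (intro suminf_cong)
    fix n
    have "2 * z ^ (2 * n) / fact (2 * n) * (pi / 2 * central_coeff n) = pi * ((z / 2) ^ (2 * n) / (fact n)\<^sup>2)"
      by (simp add: central_coeff_def power_divide power_mult field_simps power2_eq_square flip: power_mult_distrib)
    then show "ennreal (2 * z ^ (2 * n) / fact (2 * n)) * ennreal (pi / 2 * central_coeff n) =
        ennreal (pi * ((z / 2) ^ (2 * n) / (fact n)\<^sup>2))"
      by (simp add: ennreal_mult[symmetric] power_mult less_imp_le[OF central_coeff_pos])
  qed
  also have "\<dots> = ennreal (pi * bessel_I0 z)"
    unfolding bessel_I0_def
    by (intro suminf_ennreal_eq sums_mult summable_sums bessel_I0_summable) (simp add: power_mult)
  finally show ?thesis by (simp add: f_def)
qed

text \<open>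
  Both sides are complete elliptic integrals; the Moebius map in \<open>s\<^sup>2\<close> below matches the four
  branch points.
\<close>

lemma elliptic_substitution:
  fixes r :: real
  assumes r: "r > 0"
  shows "(\<integral>\<^sup>+v. ennreal (1 / sqrt ((1 - v\<^sup>2) * ((v + 2 * r)\<^sup>2 - 1))) * indicator {max (-1) (1 - 2 * r)<..<1} v \<partial>lborel) =
    (\<integral>\<^sup>+s. ennreal (1 / sqrt ((1 - s\<^sup>2) * (r\<^sup>2 - s\<^sup>2))) * indicator {0<..<min 1 r} s \<partial>lborel)"
proof -
  \<comment> \<open>In the variable \<open>y = s\<^sup>2\<close> the Moebius map sends
    \<open>0\<close>, \<open>1\<close>, \<open>r\<^sup>2\<close>, \<open>\<infinity>\<close> to the
    branch points \<open>1\<close>, \<open>-1\<close>, \<open>1 - 2 * r\<close>,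
    \<open>-1 - 2 * r\<close>; the four factors computed below show this.\<close>
  define g where "g s = (r - (1 + 2 * r) * s\<^sup>2) / (r + s\<^sup>2)" for s
  define g' where "g' s = - (4 * r * (1 + r) * s) / (r + s\<^sup>2)\<^sup>2" for s
  have pos: "r + s\<^sup>2 > 0" for s using r by (simp add: add_pos_nonneg)
  then have nz [simp]: "r + s\<^sup>2 \<noteq> 0" for s by (metis less_irrefl)
  have e1: "1 - g s = 2 * s\<^sup>2 * (1 + r) / (r + s\<^sup>2)" for s
    unfolding g_def by (simp add: divide_simps) (simp add: algebra_simps)
  have e2: "1 + g s = 2 * r * (1 - s\<^sup>2) / (r + s\<^sup>2)" for s
    unfolding g_def by (simp add: divide_simps) (simp add: algebra_simps)
  have e3: "g s + 2 * r - 1 = 2 * (r\<^sup>2 - s\<^sup>2) / (r + s\<^sup>2)" for s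
    unfolding g_def by (simp add: divide_simps) (simp add: algebra_simps power2_eq_square)
  have e4: "g s + 2 * r + 1 = 2 * r * (1 + r) / (r + s\<^sup>2)" for s
    unfolding g_def by (simp add: divide_simps) (simp add: algebra_simps power2_eq_square)
  have sq: "s\<^sup>2 < 1" "s\<^sup>2 < r\<^sup>2" if "s \<in> {0<..<min 1 r}" for s
    using that power_strict_mono[of s 1 2] power_strict_mono[of s r 2] by auto
  have img: "g ` {0<..<min 1 r} = {max (-1) (1 - 2 * r)<..<1}"
  proof (intro equalityI subsetI)
    fix v assume "v \<in> g ` {0<..<min 1 r}"
    then obtain s where s: "s \<in> {0<..<min 1 r}" "v = g s" by auto
    have "1 - g s > 0" "1 + g s > 0" "g s + 2 * r - 1 > 0"
      unfolding e1 e2 e3 using s sq[OF s(1)] pos[of s] r by auto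
    then show "v \<in> {max (-1) (1 - 2 * r)<..<1}" using s by auto
  next
    fix v assume v: "v \<in> {max (-1) (1 - 2 * r)<..<1}"
    define y where "y = r * (1 - v) / (v + 1 + 2 * r)"
    have d: "v + 1 + 2 * r > 0" using v r by auto
    have y0: "y > 0" using v r d by (simp add: y_def)
    have "r * (1 - v) < v + 1 + 2 * r"
    proof -
      have "(r + 1) * (1 + v) > 0" using v r by (intro mult_pos_pos) auto
      then show ?thesis by (simp add: algebra_simps)
    qed
    then have y1: "y < 1" using d by (simp add: y_def)
    have "1 - v < r * (v + 1 + 2 * r)"
    proof -
      have "(1 + r) * (v - 1 + 2 * r) > 0" using v r by (intro mult_pos_pos) auto
      then show ?thesis by (simp add: algebra_simps)
    qed
    then have "r * (1 - v) < r\<^sup>2 * (v + 1 + 2 * r)"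
      using r by (simp add: power2_eq_square mult.assoc)
    then have y2: "y < r\<^sup>2" using d by (simp add: y_def pos_divide_less_eq)
    have "g (sqrt y) = v"
    proof -
      have yr: "y * (v + 1 + 2 * r) = r * (1 - v)" using d by (simp add: y_def)
      have "r - (1 + 2 * r) * y = v * (r + y)" using yr by (simp add: algebra_simps)
      moreover have "r + y > 0" using y0 r by simp
      ultimately show ?thesis using y0 by (simp add: g_def)
    qed
    moreover have "sqrt y \<in> {0<..<min 1 r}"
      using y0 y1 y2 r real_sqrt_less_mono[OF y2] by auto
    ultimately show "v \<in> g ` {0<..<min 1 r}" by force
  qed
  have inj: "inj_on g {0<..<min 1 r}"
  proof (intro inj_onI)
    fix s t assume st: "s \<in> {0<..<min 1 r}" "t \<in> {0<..<min 1 r}" "g s = g t"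
    from st(3) have "(r - (1 + 2 * r) * s\<^sup>2) * (r + t\<^sup>2) = (r - (1 + 2 * r) * t\<^sup>2) * (r + s\<^sup>2)"
      by (simp add: g_def frac_eq_eq)
    then have "2 * r * (1 + r) * (s\<^sup>2 - t\<^sup>2) = 0" by algebra
    then have "s\<^sup>2 = t\<^sup>2" using r by simp
    then show "s = t" using st by (auto simp: power2_eq_iff)
  qed
  have "(\<integral>\<^sup>+v. ennreal (1 / sqrt ((1 - v\<^sup>2) * ((v + 2 * r)\<^sup>2 - 1))) * indicator {max (-1) (1 - 2 * r)<..<1} v \<partial>lborel) =
    (\<integral>\<^sup>+s. ennreal (\<bar>g' s\<bar> * (1 / sqrt ((1 - (g s)\<^sup>2) * ((g s + 2 * r)\<^sup>2 - 1)))) * indicator {0<..<min 1 r} s \<partial>lborel)"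
  proof (rule nn_integral_change_of_variables[OF _ _ _ _ _ _ inj img])
    show "g \<in> borel_measurable borel" "g' \<in> borel_measurable borel"
      unfolding g_def g'_def by measurable
  next
    fix s
    have "(g has_field_derivative ((- ((1 + 2 * r) * (2 * s)) * (r + s\<^sup>2) - (r - (1 + 2 * r) * s\<^sup>2) * (2 * s)) / ((r + s\<^sup>2) * (r + s\<^sup>2)))) (at s)"
      unfolding g_def by (auto intro!: derivative_eq_intros)
    also have "(- ((1 + 2 * r) * (2 * s)) * (r + s\<^sup>2) - (r - (1 + 2 * r) * s\<^sup>2) * (2 * s)) = - (4 * r * (1 + r) * s)"
      by (simp add: algebra_simps power2_eq_square)
    finally show "(g has_field_derivative g' s) (at s)"
      by (simp add: g'_def power2_eq_square)
  next
    fix v assume "v \<in> {max (-1) (1 - 2 * r)<..<1}"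
    then show "0 \<le> 1 / sqrt ((1 - v\<^sup>2) * ((v + 2 * r)\<^sup>2 - 1))"
      using abs_square_less_1[of v] one_le_power[of "v + 2 * r" 2]
      by (auto intro!: divide_nonneg_nonneg mult_nonneg_nonneg)
  qed auto
  also have "\<dots> = (\<integral>\<^sup>+s. ennreal (1 / sqrt ((1 - s\<^sup>2) * (r\<^sup>2 - s\<^sup>2))) * indicator {0<..<min 1 r} s \<partial>lborel)"
  proof (intro nn_integral_cong)
    fix s
    have "\<bar>g' s\<bar> * (1 / sqrt ((1 - (g s)\<^sup>2) * ((g s + 2 * r)\<^sup>2 - 1))) = 1 / sqrt ((1 - s\<^sup>2) * (r\<^sup>2 - s\<^sup>2))"
      if s: "s \<in> {0<..<min 1 r}"
    proof -
      have "(1 - (g s)\<^sup>2) * ((g s + 2 * r)\<^sup>2 - 1) = (1 - g s) * (1 + g s) * ((g s + 2 * r - 1) * (g s + 2 * r + 1))"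
        by (simp add: algebra_simps power2_eq_square)
      also have "\<dots> = (g' s)\<^sup>2 * ((1 - s\<^sup>2) * (r\<^sup>2 - s\<^sup>2))"
      proof -
        have "2 * s\<^sup>2 * (1 + r) / d * (2 * r * q / d) * (2 * p / d * (2 * r * (1 + r) / d)) =
          (- (4 * r * (1 + r) * s) / d\<^sup>2)\<^sup>2 * (q * p)" for d p q
          by (simp add: power2_eq_square power_divide)
        then show ?thesis unfolding e1 e2 e3 e4 g'_def .
      qed
      finally have "sqrt ((1 - (g s)\<^sup>2) * ((g s + 2 * r)\<^sup>2 - 1)) = \<bar>g' s\<bar> * sqrt ((1 - s\<^sup>2) * (r\<^sup>2 - s\<^sup>2))"
        by (simp add: real_sqrt_mult)
      moreover have "g' s \<noteq> 0" using s r by (auto simp: g'_def)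
      ultimately show ?thesis by simp
    qed
    then show "ennreal (\<bar>g' s\<bar> * (1 / sqrt ((1 - (g s)\<^sup>2) * ((g s + 2 * r)\<^sup>2 - 1)))) * indicator {0<..<min 1 r} s =
       ennreal (1 / sqrt ((1 - s\<^sup>2) * (r\<^sup>2 - s\<^sup>2))) * indicator {0<..<min 1 r} s"
      by (auto split: split_indicator)
  qed
  finally show ?thesis .
qed

text \<open>Multiply the integrals for \<open>I\<^sub>0\<close> (over \<open>v\<close>) and
  \<open>K\<^sub>0\<close> (over \<open>u\<close>) and put \<open>t = u - v\<close>: the
  exponentials depend on \<open>t\<close> alone, and for fixed \<open>t\<close> the
  \<open>v\<close>-integral is a complete elliptic integral. Its transformed form, with
  \<open>r = t / 2\<close>, lets the \<open>t\<close>-integral be carried out for fixed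
  \<open>s\<close>, and the result is \<open>K\<^sub>0\<close> again.\<close>

lemma bessel_I0_times_K0:
  assumes z: "z > 0"
  shows "(\<integral>\<^sup>+s. ennreal (bessel_K0 (2 * z * s) / sqrt (1 - s\<^sup>2)) * indicator {0<..<1} s \<partial>lborel) =
    ennreal (pi / 2 * (bessel_I0 z * bessel_K0 z))"
proof -
  define A where "A v = ennreal (exp (z * v) / sqrt (1 - v\<^sup>2)) * indicator {-1<..<1} v" for v
  define B where "B u = ennreal (exp (- z * u) / sqrt (u\<^sup>2 - 1)) * indicator {1<..} u" for u
  define E where "E t = ennreal (exp (- z * t)) * indicator {0<..} t" for t :: real
  define P where "P t v = ennreal (1 / sqrt ((1 - v\<^sup>2) * ((v + t)\<^sup>2 - 1))) * indicator {max (-1) (1 - t)<..<1} v" for t v :: real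
  define Q where "Q t s = ennreal (1 / sqrt ((1 - s\<^sup>2) * ((t/2)\<^sup>2 - s\<^sup>2))) * indicator {0<..<min 1 (t/2)} s" for t s :: real
  have [measurable]: "A \<in> borel_measurable borel" "B \<in> borel_measurable borel" "E \<in> borel_measurable borel"
    unfolding A_def B_def E_def by measurable
  have [measurable]: "case_prod P \<in> borel_measurable (borel \<Otimes>\<^sub>M borel)"
  proof -
    have "case_prod P = (\<lambda>(t, v). ennreal (1 / sqrt ((1 - v\<^sup>2) * ((v + t)\<^sup>2 - 1))) * (if max (-1) (1 - t) < v \<and> v < 1 then 1 else 0))"
      by (auto simp: P_def fun_eq_iff split: split_indicator)
    then show ?thesis by simp
  qed
  have [measurable]: "case_prod Q \<in> borel_measurable (borel \<Otimes>\<^sub>M borel)"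
  proof -
    have "case_prod Q = (\<lambda>(t, s). ennreal (1 / sqrt ((1 - s\<^sup>2) * ((t/2)\<^sup>2 - s\<^sup>2))) * (if 0 < s \<and> s < min 1 (t/2) then 1 else 0))"
      by (auto simp: Q_def fun_eq_iff split: split_indicator)
    then show ?thesis by simp
  qed
  have [measurable]: "\<And>t. P t \<in> borel_measurable borel" "\<And>t. Q t \<in> borel_measurable borel"
    unfolding P_def Q_def by measurable
  have "ennreal (pi * bessel_I0 z) * ennreal (bessel_K0 z) = (\<integral>\<^sup>+v. A v \<partial>lborel) * (\<integral>\<^sup>+u. B u \<partial>lborel)"
    using nn_integral_bessel_I0[of z] nn_integral_bessel_K0_algebraic[OF z] by (simp add: A_def B_def)
  also have "\<dots> = (\<integral>\<^sup>+v. A v * (\<integral>\<^sup>+u. B u \<partial>lborel) \<partial>lborel)"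
    by (simp add: nn_integral_multc)
  also have "\<dots> = (\<integral>\<^sup>+v. (\<integral>\<^sup>+t. A v * B (v + t) \<partial>lborel) \<partial>lborel)"
  proof (intro nn_integral_cong)
    fix v
    have "(\<integral>\<^sup>+u. B u \<partial>lborel) = (\<integral>\<^sup>+t. B (v + t) \<partial>lborel)"
      using nn_integral_real_affine[of B 1 v] by simp
    then show "A v * (\<integral>\<^sup>+u. B u \<partial>lborel) = (\<integral>\<^sup>+t. A v * B (v + t) \<partial>lborel)"
      by (simp add: nn_integral_cmult)
  qed
  also have "\<dots> = (\<integral>\<^sup>+v. (\<integral>\<^sup>+t. E t * P t v \<partial>lborel) \<partial>lborel)"
  proof (intro nn_integral_cong)
    fix v t :: real
    have "exp (z * v) / sqrt (1 - v\<^sup>2) * (exp (- z * (v + t)) / sqrt ((v + t)\<^sup>2 - 1)) =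
       exp (- z * t) * (1 / sqrt ((1 - v\<^sup>2) * ((v + t)\<^sup>2 - 1)))"
      by (simp add: real_sqrt_mult distrib_left flip: exp_add)
    moreover have "v\<^sup>2 \<le> 1" if "-1 < v" "v < 1" using that abs_square_le_1[of v] by auto
    moreover have "(v + t)\<^sup>2 \<ge> 1" if "1 - t < v" using that one_le_power[of "v + t" 2] by auto
    ultimately show "A v * B (v + t) = E t * P t v"
      by (auto simp: A_def B_def E_def P_def ennreal_mult[symmetric] split: split_indicator)
  qed
  also have "\<dots> = (\<integral>\<^sup>+t. (\<integral>\<^sup>+v. E t * P t v \<partial>lborel) \<partial>lborel)"
    by (rule lborel_pair.Fubini') measurable
  also have "\<dots> = (\<integral>\<^sup>+t. (\<integral>\<^sup>+s. E t * Q t s \<partial>lborel) \<partial>lborel)"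
  proof (rule nn_integral_cong)
    fix t :: real
    have "t > 0 \<Longrightarrow> (\<integral>\<^sup>+v. P t v \<partial>lborel) = (\<integral>\<^sup>+s. Q t s \<partial>lborel)"
      using elliptic_substitution[of "t/2"] by (simp add: P_def Q_def)
    then show "(\<integral>\<^sup>+v. E t * P t v \<partial>lborel) = (\<integral>\<^sup>+s. E t * Q t s \<partial>lborel)"
      by (cases "t > 0") (simp_all add: nn_integral_cmult E_def)
  qed
  also have "\<dots> = (\<integral>\<^sup>+s. (\<integral>\<^sup>+t. E t * Q t s \<partial>lborel) \<partial>lborel)"
    by (rule lborel_pair.Fubini'[symmetric]) measurable
  also have "\<dots> = (\<integral>\<^sup>+s. ennreal 2 * (ennreal (bessel_K0 (2 * z * s) / sqrt (1 - s\<^sup>2)) * indicator {0<..<1} s) \<partial>lborel)"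
  proof (intro nn_integral_cong)
    fix s :: real
    show "(\<integral>\<^sup>+t. E t * Q t s \<partial>lborel) = ennreal 2 * (ennreal (bessel_K0 (2 * z * s) / sqrt (1 - s\<^sup>2)) * indicator {0<..<1} s)"
    proof (cases "0 < s \<and> s < 1")
      case False
      then have "Q t s = 0" for t by (auto simp: Q_def)
      then show ?thesis using False by simp
    next
      case True
      then have s2: "s\<^sup>2 < 1" using abs_square_less_1[of s] by auto
      \<comment> \<open>Scaling by \<open>t = 2 * s * u\<close> moves the lower limit
        \<open>t = 2 * s\<close> to \<open>u = 1\<close>, where the algebraic form of the integral
        for \<open>K\<^sub>0\<close> starts.\<close>
      have "(\<integral>\<^sup>+t. E t * Q t s \<partial>lborel) = ennreal (2 * s) * (\<integral>\<^sup>+u. E (2 * s * u) * Q (2 * s * u) s \<partial>lborel)"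
        using nn_integral_real_affine[of "\<lambda>t. E t * Q t s" "2 * s" 0] True by simp
      also have "(\<integral>\<^sup>+u. E (2 * s * u) * Q (2 * s * u) s \<partial>lborel) =
         (\<integral>\<^sup>+u. ennreal (1 / (s * sqrt (1 - s\<^sup>2))) * (ennreal (exp (- (2 * z * s) * u) / sqrt (u\<^sup>2 - 1)) * indicator {1<..} u) \<partial>lborel)"
      proof (intro nn_integral_cong)
        fix u :: real
        have "exp (- z * (2 * s * u)) * (1 / sqrt ((1 - s\<^sup>2) * ((s * u)\<^sup>2 - s\<^sup>2))) =
           1 / (s * sqrt (1 - s\<^sup>2)) * (exp (- (2 * z * s) * u) / sqrt (u\<^sup>2 - 1))"
        proof -
          have "(s * u)\<^sup>2 - s\<^sup>2 = s\<^sup>2 * (u\<^sup>2 - 1)" by (simp add: algebra_simps power2_eq_square)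
          then have "sqrt ((1 - s\<^sup>2) * ((s * u)\<^sup>2 - s\<^sup>2)) = sqrt (1 - s\<^sup>2) * (s * sqrt (u\<^sup>2 - 1))"
            using True by (simp only: real_sqrt_mult) simp
          then show ?thesis by (simp add: mult_ac)
        qed
        moreover have "u > 1 \<Longrightarrow> u\<^sup>2 \<ge> 1" by simp
        moreover have "2 * s * u > 0 \<and> s < s * u \<longleftrightarrow> u > 1"
          using True by (auto simp: zero_less_mult_iff)
        moreover have "s < s * u \<longleftrightarrow> u > 1" using True by auto
        ultimately show "E (2 * s * u) * Q (2 * s * u) s =
          ennreal (1 / (s * sqrt (1 - s\<^sup>2))) * (ennreal (exp (- (2 * z * s) * u) / sqrt (u\<^sup>2 - 1)) * indicator {1<..} u)"
          using True s2 by (auto simp: E_def Q_def ennreal_mult[symmetric] split: split_indicator)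
      qed
      also have "\<dots> = ennreal (1 / (s * sqrt (1 - s\<^sup>2))) * ennreal (bessel_K0 (2 * z * s))"
        using nn_integral_bessel_K0_algebraic[of "2 * z * s"] True z by (subst nn_integral_cmult) simp_all
      also have "ennreal (2 * s) * \<dots> = ennreal 2 * ennreal (bessel_K0 (2 * z * s) / sqrt (1 - s\<^sup>2))"
        using True s2 by (simp add: ennreal_mult[symmetric] bessel_K0_nonneg del: ennreal_numeral)
      finally show ?thesis using True by simp
    qed
  qed
  finally have eq: "ennreal (pi * bessel_I0 z) * ennreal (bessel_K0 z) =
      ennreal 2 * (\<integral>\<^sup>+s. ennreal (bessel_K0 (2 * z * s) / sqrt (1 - s\<^sup>2)) * indicator {0<..<1} s \<partial>lborel)"
    by (simp add: nn_integral_cmult del: ennreal_numeral)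
  show ?thesis
  proof -
    have "pi / 2 * (bessel_I0 z * bessel_K0 z) = 1 / 2 * (pi * bessel_I0 z * bessel_K0 z)" by simp
    then have "ennreal (pi / 2 * (bessel_I0 z * bessel_K0 z)) = ennreal (1 / 2) * (ennreal (pi * bessel_I0 z) * ennreal (bessel_K0 z))"
      by (simp only: ennreal_mult bessel_I0_nonneg bessel_K0_nonneg mult_nonneg_nonneg pi_ge_zero) (simp add: ennreal_mult bessel_I0_nonneg bessel_K0_nonneg)?
    also have "\<dots> = (\<integral>\<^sup>+s. ennreal (bessel_K0 (2 * z * s) / sqrt (1 - s\<^sup>2)) * indicator {0<..<1} s \<partial>lborel)"
      by (rule ennreal_mult_cancel_const[OF _ eq[symmetric], symmetric]) simp
    finally show ?thesis by simp
  qed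
qed

section \<open>The square of K_0 as a double integral\<close>

lemma nn_integral_even:
  fixes f :: "real \<Rightarrow> ennreal"
  assumes [measurable]: "f \<in> borel_measurable borel" and even: "\<And>x. f (- x) = f x"
  shows "(\<integral>\<^sup>+x. f x \<partial>lborel) = 2 * (\<integral>\<^sup>+x. f x * indicator {0<..} x \<partial>lborel)"
proof -
  have "(\<integral>\<^sup>+x. f x \<partial>lborel) = (\<integral>\<^sup>+x. f x * indicator {..<0} x + f x * indicator {0<..} x \<partial>lborel)"
    by (intro nn_integral_cong_AE eventually_mono[OF AE_lborel_singleton[of 0]])
       (auto split: split_indicator)
  also have "\<dots> = (\<integral>\<^sup>+x. f x * indicator {..<0} x \<partial>lborel) + (\<integral>\<^sup>+x. f x * indicator {0<..} x \<partial>lborel)"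
    by (rule nn_integral_add) measurable
  also have "(\<integral>\<^sup>+x. f x * indicator {..<0} x \<partial>lborel) = (\<integral>\<^sup>+x. f x * indicator {0<..} x \<partial>lborel)"
    by (subst nn_integral_real_affine[where c = "-1" and t = 0])
       (auto intro!: nn_integral_cong simp: even split: split_indicator)
  finally show ?thesis by (simp add: mult_2)
qed

lemma nn_integral_bessel_K0_UNIV:
  assumes "z > 0"
  shows "(\<integral>\<^sup>+t. ennreal (exp (- z * cosh t)) \<partial>lborel) = 2 * ennreal (bessel_K0 z)"
  using nn_integral_bessel_K0[OF assms] by (subst nn_integral_even) auto

text \<open>Since \<open>cosh (a - b) + cosh (a + b) = 2 * cosh a * cosh b\<close>, rotating the
  variables in the double integral for the square makes the inner integral a
  \<open>K\<^sub>0\<close>. The rotation is composed of two affine substitutions in one variable,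
  first \<open>t = s + 2 * b\<close> with Jacobian \<open>2\<close>, then
  \<open>s = a - b\<close>.\<close>

lemma bessel_K0_square:
  assumes u: "u > 0"
  shows "(\<integral>\<^sup>+b. ennreal (bessel_K0 (2 * u * cosh b)) * indicator {0<..} b \<partial>lborel) = ennreal ((bessel_K0 u)\<^sup>2 / 2)"
proof -
  define f where "f t = ennreal (exp (- u * cosh t))" for t :: real
  have [measurable]: "f \<in> borel_measurable borel" unfolding f_def by measurable
  have "f \<in> borel_measurable lborel" by simp
  have "4 * ennreal ((bessel_K0 u)\<^sup>2) = (2 * ennreal (bessel_K0 u)) * (2 * ennreal (bessel_K0 u))"
    by (simp add: power2_eq_square ennreal_mult bessel_K0_nonneg algebra_simps)
  also have "\<dots> = (\<integral>\<^sup>+s. f s \<partial>lborel) * (\<integral>\<^sup>+t. f t \<partial>lborel)"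
    using nn_integral_bessel_K0_UNIV[OF u] by (simp add: f_def)
  also have "\<dots> = (\<integral>\<^sup>+s. f s * (2 * (\<integral>\<^sup>+b. f (s + 2 * b) \<partial>lborel)) \<partial>lborel)"
  proof -
    have "(\<integral>\<^sup>+t. f t \<partial>lborel) = 2 * (\<integral>\<^sup>+b. f (s + 2 * b) \<partial>lborel)" for s
      by (subst nn_integral_real_affine[where c = 2 and t = s]) simp_all
    then have "(\<integral>\<^sup>+s. f s * (2 * (\<integral>\<^sup>+b. f (s + 2 * b) \<partial>lborel)) \<partial>lborel) = (\<integral>\<^sup>+s. f s * (\<integral>\<^sup>+t. f t \<partial>lborel) \<partial>lborel)"
      by metis
    then show ?thesis by (simp only: nn_integral_multc[OF \<open>f \<in> borel_measurable lborel\<close>])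
  qed
  also have "\<dots> = 2 * (\<integral>\<^sup>+s. (\<integral>\<^sup>+b. f s * f (s + 2 * b) \<partial>lborel) \<partial>lborel)"
    by (simp add: nn_integral_cmult[symmetric] algebra_simps)
  also have "(\<integral>\<^sup>+s. (\<integral>\<^sup>+b. f s * f (s + 2 * b) \<partial>lborel) \<partial>lborel) = (\<integral>\<^sup>+b. (\<integral>\<^sup>+s. f s * f (s + 2 * b) \<partial>lborel) \<partial>lborel)"
    by (rule lborel_pair.Fubini') measurable
  also have "\<dots> = (\<integral>\<^sup>+b. (\<integral>\<^sup>+a. f (a - b) * f (a + b) \<partial>lborel) \<partial>lborel)"
  proof (rule nn_integral_cong)
    fix b
    show "(\<integral>\<^sup>+s. f s * f (s + 2 * b) \<partial>lborel) = (\<integral>\<^sup>+a. f (a - b) * f (a + b) \<partial>lborel)"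
      using nn_integral_real_affine[of "\<lambda>s. f s * f (s + 2 * b)" 1 "- b"] by (simp add: algebra_simps)
  qed
  also have "\<dots> = (\<integral>\<^sup>+b. (\<integral>\<^sup>+a. ennreal (exp (- (2 * u * cosh b) * cosh a)) \<partial>lborel) \<partial>lborel)"
    by (intro nn_integral_cong)
       (simp add: f_def ennreal_mult[symmetric] exp_add[symmetric] cosh_add cosh_diff algebra_simps)
  also have "\<dots> = (\<integral>\<^sup>+b. 2 * ennreal (bessel_K0 (2 * u * cosh b)) \<partial>lborel)"
    by (intro nn_integral_cong nn_integral_bessel_K0_UNIV) (use u in simp)
  also have "\<dots> = 2 * (2 * (\<integral>\<^sup>+b. ennreal (bessel_K0 (2 * u * cosh b)) * indicator {0<..} b \<partial>lborel))"
    by (subst nn_integral_cmult, measurable) (subst nn_integral_even, auto)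
  finally have eq: "4 * ennreal ((bessel_K0 u)\<^sup>2) =
      8 * (\<integral>\<^sup>+b. ennreal (bessel_K0 (2 * u * cosh b)) * indicator {0<..} b \<partial>lborel)"
    by (simp add: mult.assoc[symmetric])
  then have eq: "ennreal 8 * (\<integral>\<^sup>+b. ennreal (bessel_K0 (2 * u * cosh b)) * indicator {0<..} b \<partial>lborel) =
      ennreal 4 * ennreal ((bessel_K0 u)\<^sup>2)"
    by simp
  show ?thesis
  proof -
    have "(bessel_K0 u)\<^sup>2 / 2 = 1 / 8 * (4 * (bessel_K0 u)\<^sup>2)" by simp
    then have "ennreal ((bessel_K0 u)\<^sup>2 / 2) = ennreal (1 / 8) * (ennreal 4 * ennreal ((bessel_K0 u)\<^sup>2))"
      by (simp only:) (subst ennreal_mult, simp, simp, subst ennreal_mult, simp_all)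
    also have "\<dots> = (\<integral>\<^sup>+b. ennreal (bessel_K0 (2 * u * cosh b)) * indicator {0<..} b \<partial>lborel)"
      by (rule ennreal_mult_cancel_const[OF _ eq, symmetric]) simp
    finally show ?thesis by simp
  qed
qed

section \<open>A Hilbert-type kernel and its integrals in each variable\<close>

lemma nn_integral_exp_interval:
  fixes p q l :: real
  assumes "l > 0" "p \<le> q" "0 \<le> p"
  shows "(\<integral>\<^sup>+w. ennreal (l * exp (- l * w)) * indicator {p<..q} w \<partial>lborel) = ennreal (exp (- l * p) - exp (- l * q))"
proof -
  have "(\<integral>\<^sup>+w. ennreal (l * exp (- l * w)) * indicator {p<..q} w \<partial>lborel) =
    (\<integral>\<^sup>+w. ennreal (l * exp (- l * w)) * indicator {p..q} w \<partial>lborel)"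
    by (intro nn_integral_cong_AE eventually_mono[OF AE_lborel_singleton[of p]]) (auto split: split_indicator)
  also have "\<dots> = ennreal (- exp (- l * q) - (- exp (- l * p)))"
    using assms by (intro nn_integral_FTC_Icc) (auto intro!: derivative_eq_intros)
  finally show ?thesis by simp
qed

lemma nn_integral_exp_tail:
  fixes p l :: real
  assumes "l > 0"
  shows "(\<integral>\<^sup>+w. ennreal (l * exp (- l * w)) * indicator {p<..} w \<partial>lborel) = ennreal (exp (- l * p))"
proof -
  have "(\<integral>\<^sup>+w. ennreal (l * exp (- l * w)) * indicator {p<..} w \<partial>lborel) =
    (\<integral>\<^sup>+w. ennreal (l * exp (- l * w)) * indicator {p..} w \<partial>lborel)"
    by (intro nn_integral_cong_AE eventually_mono[OF AE_lborel_singleton[of p]]) (auto split: split_indicator)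
  also have "\<dots> = ennreal (0 - (- exp (- l * p)))"
  proof (intro nn_integral_FTC_atLeast)
    have "((\<lambda>x. - exp (- l * x)) \<longlongrightarrow> - 0) at_top"
      using assms by (intro tendsto_minus filterlim_compose[OF exp_at_bot] filterlim_tendsto_neg_mult_at_bot[OF tendsto_const]) (auto simp: filterlim_ident)
    then show "((\<lambda>x. - exp (- l * x)) \<longlongrightarrow> 0) at_top" by simp
  qed (use assms in \<open>auto intro!: derivative_eq_intros\<close>)
  finally show ?thesis by simp
qed

text \<open>The difference of \<open>exp (- l * (v * c))\<close> and \<open>exp (- l * c)\<close> is
  the integral of \<open>l * exp (- l * w)\<close> between the two endpoints, and for both orders of
  the endpoints its quotient by \<open>1 - v\<^sup>2\<close> has a nonnegative density in
  \<open>w\<close>. Spreading the quotient over \<open>w\<close> in this way opens it to Tonelli's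
  theorem.\<close>

definition hilbert_kernel :: "real \<Rightarrow> real \<Rightarrow> real \<Rightarrow> real" where
  "hilbert_kernel v c w =
    (if v * c < w \<and> w \<le> c then 1 / (1 - v\<^sup>2) else if c < w \<and> w \<le> v * c then 1 / (v\<^sup>2 - 1) else 0)"

lemma hilbert_kernel_measurable [measurable]:
  assumes [measurable]: "f \<in> borel_measurable M" "g \<in> borel_measurable M" "h \<in> borel_measurable M"
  shows "(\<lambda>x. hilbert_kernel (f x) (g x) (h x)) \<in> borel_measurable M"
  unfolding hilbert_kernel_def by measurable

lemma nn_integral_hilbert_kernel_exp:
  assumes l: "l > 0" and v: "v > 0" "v \<noteq> 1" and c: "c > 0"
  shows "(\<integral>\<^sup>+w. ennreal (l * exp (- l * w)) * ennreal (hilbert_kernel v c w) \<partial>lborel) =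
    ennreal ((exp (- l * (v * c)) - exp (- l * c)) / (1 - v\<^sup>2))"
proof (cases "v < 1")
  case True
  then have v2: "v\<^sup>2 < 1" using v abs_square_less_1[of v] by auto
  have vc: "v * c \<le> c" using True v c by simp
  have "(\<integral>\<^sup>+w. ennreal (l * exp (- l * w)) * ennreal (hilbert_kernel v c w) \<partial>lborel) =
    (\<integral>\<^sup>+w. (ennreal (l * exp (- l * w)) * indicator {v * c<..c} w) * ennreal (1 / (1 - v\<^sup>2)) \<partial>lborel)"
    using vc by (intro nn_integral_cong) (auto simp: hilbert_kernel_def split: split_indicator)
  also have "\<dots> = ennreal (exp (- l * (v * c)) - exp (- l * c)) * ennreal (1 / (1 - v\<^sup>2))"
    using l vc v c by (subst nn_integral_multc) (simp_all add: nn_integral_exp_interval[simplified])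
  also have "\<dots> = ennreal ((exp (- l * (v * c)) - exp (- l * c)) / (1 - v\<^sup>2))"
    using l vc v2 by (subst ennreal_mult[symmetric]) auto
  finally show ?thesis .
next
  case False
  then have v1: "v > 1" using v by simp
  then have v2: "v\<^sup>2 > 1" by simp
  have vc: "c \<le> v * c" using v1 c by simp
  have "(\<integral>\<^sup>+w. ennreal (l * exp (- l * w)) * ennreal (hilbert_kernel v c w) \<partial>lborel) =
    (\<integral>\<^sup>+w. (ennreal (l * exp (- l * w)) * indicator {c<..v * c} w) * ennreal (1 / (v\<^sup>2 - 1)) \<partial>lborel)"
    using vc by (intro nn_integral_cong) (auto simp: hilbert_kernel_def split: split_indicator)
  also have "\<dots> = ennreal (exp (- l * c) - exp (- l * (v * c))) * ennreal (1 / (v\<^sup>2 - 1))"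
    using l vc v c by (subst nn_integral_multc) (simp_all add: nn_integral_exp_interval[simplified])
  also have "\<dots> = ennreal ((exp (- l * c) - exp (- l * (v * c))) / (v\<^sup>2 - 1))"
    using l vc v2 by (subst ennreal_mult[symmetric]) auto
  also have "(exp (- l * c) - exp (- l * (v * c))) / (v\<^sup>2 - 1) = (exp (- l * (v * c)) - exp (- l * c)) / (1 - v\<^sup>2)"
    by (metis minus_diff_eq minus_divide_divide)
  finally show ?thesis .
qed

text \<open>For \<open>w < c\<close> the admissible \<open>v\<close> fill \<open>(0, w / c)\<close>
  and give an artanh, for \<open>w > c\<close> they fill the ray beyond \<open>w / c\<close> and
  give an arcoth; the absolute value merges both into one logarithm.\<close>

lemma nn_integral_hilbert_kernel:
  assumes w: "w > 0" and c: "c > 0" and wc: "w \<noteq> c"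
  shows "(\<integral>\<^sup>+v. ennreal (hilbert_kernel v c w) * indicator {0<..} v \<partial>lborel) = ennreal (ln \<bar>(c + w) / (c - w)\<bar> / 2)"
proof (cases "w < c")
  case True
  have "(\<integral>\<^sup>+v. ennreal (hilbert_kernel v c w) * indicator {0<..} v \<partial>lborel) =
    (\<integral>\<^sup>+v. ennreal (1 / (1 - v\<^sup>2)) * indicator {0..w / c} v \<partial>lborel)"
    using True c w
    by (intro nn_integral_cong_AE eventually_mono[OF eventually_conj[OF AE_lborel_singleton[of 0] AE_lborel_singleton[of "w / c"]]])
       (auto simp: hilbert_kernel_def field_simps split: split_indicator)
  also have "\<dots> = ennreal (artanh (w / c) - artanh 0)"
  proof (intro nn_integral_FTC_Icc)
    fix v assume v: "v \<in> {0..w / c}"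
    have "w / c < 1" using True c by simp
    then have v1: "v < 1" "v \<ge> 0" using v by auto
    then show "(artanh has_real_derivative 1 / (1 - v\<^sup>2)) (at v)"
      by (auto intro!: derivative_eq_intros)
    show "0 \<le> 1 / (1 - v\<^sup>2)" using v1 by (simp add: power_le_one)
  qed (use w c in auto)
  also have "artanh (w / c) - artanh 0 = ln \<bar>(c + w) / (c - w)\<bar> / 2"
  proof -
    have "(1 + w / c) / (1 - w / c) = (c + w) / (c - w)" using True c by (simp add: field_simps)
    then show ?thesis using True w c by (simp add: artanh_def)
  qed
  finally show ?thesis .
next
  case False
  then have cw: "c < w" using wc by simp
  have pos: "0 < x" if "w \<le> x * c" for x
    using that w c zero_less_mult_pos2[of x c] by auto
  have "(\<integral>\<^sup>+v. ennreal (hilbert_kernel v c w) * indicator {0<..} v \<partial>lborel) =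
    (\<integral>\<^sup>+v. ennreal (1 / (v\<^sup>2 - 1)) * indicator {w / c..} v \<partial>lborel)"
    using cw c w
    by (intro nn_integral_cong)
       (auto simp: hilbert_kernel_def field_simps dest: pos split: split_indicator)
  also have "\<dots> = ennreal (0 - (ln (w / c - 1) - ln (w / c + 1)) / 2)"
  proof (intro nn_integral_FTC_atLeast)
    fix v assume v: "w / c \<le> v"
    have "w / c > 1" using cw c by simp
    then have v1: "v > 1" using v by auto
    then have "v\<^sup>2 > 1" by simp
    then show "0 \<le> 1 / (v\<^sup>2 - 1)" by simp
    have nz: "v\<^sup>2 - 1 \<noteq> 0" using \<open>v\<^sup>2 > 1\<close> by simp
    have "((\<lambda>v. (ln (v - 1) - ln (v + 1)) / 2) has_real_derivative (1 / (v - 1) - 1 / (v + 1)) / 2) (at v)"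
      using v1 by (auto intro!: derivative_eq_intros)
    also have "(1 / (v - 1) - 1 / (v + 1)) / 2 = 1 / (v\<^sup>2 - 1)"
    proof -
      have "v\<^sup>2 - 1 = (v - 1) * (v + 1)" by (simp add: power2_eq_square algebra_simps)
      then show ?thesis using v1 by (simp add: diff_frac_eq)
    qed
    finally show "((\<lambda>v. (ln (v - 1) - ln (v + 1)) / 2) has_real_derivative 1 / (v\<^sup>2 - 1)) (at v)" .
  next
    show "((\<lambda>v::real. (ln (v - 1) - ln (v + 1)) / 2) \<longlongrightarrow> 0) at_top" by real_asymp
  qed measurable
  also have "(ln (w / c - 1) - ln (w / c + 1)) = ln ((w / c - 1) / (w / c + 1))"
  proof -
    define p q where "p = w / c - 1" and "q = w / c + 1"
    have "q > 0" "p > 0" unfolding p_def q_def using divide_pos_pos[OF w c] cw c by (linarith, simp)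
    then have "ln p - ln q = ln (p / q)" by (simp add: ln_div)
    then show ?thesis by (simp only: p_def q_def)
  qed
  also have "0 - ln ((w / c - 1) / (w / c + 1)) / 2 = ln \<bar>(c + w) / (c - w)\<bar> / 2"
  proof -
    have "w / c - 1 = (w - c) / c" "w / c + 1 = (c + w) / c" using c by (simp_all add: field_simps)
    then have "(w / c - 1) / (w / c + 1) = (w - c) / (c + w)" using c by simp
    moreover have "\<bar>(c + w) / (c - w)\<bar> = inverse ((w - c) / (c + w))" using cw w c by simp
    moreover have "(w - c) / (c + w) > 0" using cw w c by simp
    ultimately show ?thesis by (simp only: ln_inverse)
  qed
  finally show ?thesis .
qed

text \<open>With \<open>k = sqrt (1 - b\<^sup>2)\<close> the denominator is
  \<open>k\<^sup>2 + (sinh a)\<^sup>2\<close>, so \<open>arctan (sinh a / k) / k\<close> is a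
  primitive.\<close>

lemma nn_integral_cosh_resolvent:
  assumes b: "0 \<le> b" "b < 1"
  shows "(\<integral>\<^sup>+a. ennreal (cosh a / ((cosh a)\<^sup>2 - b\<^sup>2)) * indicator {0<..} a \<partial>lborel) = ennreal (pi / 2 / sqrt (1 - b\<^sup>2))"
proof -
  define k where "k = sqrt (1 - b\<^sup>2)"
  have b2: "b\<^sup>2 < 1" using b abs_square_less_1[of b] by auto
  have k: "k > 0" "k\<^sup>2 = 1 - b\<^sup>2" using b2 by (simp_all add: k_def)
  have d: "(cosh a)\<^sup>2 - b\<^sup>2 = k\<^sup>2 + (sinh a)\<^sup>2" for a by (simp add: k cosh_square_eq)
  have dpos: "k\<^sup>2 + (sinh a)\<^sup>2 > 0" for a using k(1) by (intro add_pos_nonneg) auto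
  have "(\<integral>\<^sup>+a. ennreal (cosh a / ((cosh a)\<^sup>2 - b\<^sup>2)) * indicator {0<..} a \<partial>lborel) =
    (\<integral>\<^sup>+a. ennreal (cosh a / ((cosh a)\<^sup>2 - b\<^sup>2)) * indicator {0..} a \<partial>lborel)"
    by (intro nn_integral_cong_AE eventually_mono[OF AE_lborel_singleton[of 0]]) (auto split: split_indicator)
  also have "\<dots> = ennreal (pi / 2 / k - arctan (sinh 0 / k) / k)"
  proof (intro nn_integral_FTC_atLeast)
    fix a :: real
    show "0 \<le> cosh a / ((cosh a)\<^sup>2 - b\<^sup>2)" unfolding d using dpos[of a] by (intro divide_nonneg_pos) auto
    have "((\<lambda>a. arctan (sinh a / k) / k) has_real_derivative (inverse (1 + (sinh a / k)\<^sup>2) * (cosh a / k)) / k) (at a)"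
      using k by (intro DERIV_cdivide DERIV_chain2[where f = arctan and g = "\<lambda>a. sinh a / k"] DERIV_arctan)
        (auto intro!: derivative_eq_intros)
    also have "(inverse (1 + (sinh a / k)\<^sup>2) * (cosh a / k)) / k = cosh a / ((cosh a)\<^sup>2 - b\<^sup>2)"
    proof -
      have e1: "1 + (sinh a / k)\<^sup>2 = (k\<^sup>2 + (sinh a)\<^sup>2) / k\<^sup>2"
        using k(1) by (simp add: add_divide_distrib power_divide)
      have e2: "inverse (q / k\<^sup>2) * (cosh a / k) / k = cosh a / q" for q
        using k(1) by (simp add: power2_eq_square)
      show ?thesis unfolding e1 e2 d ..
    qed
    finally show "((\<lambda>a. arctan (sinh a / k) / k) has_real_derivative cosh a / ((cosh a)\<^sup>2 - b\<^sup>2)) (at a)" .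
  next
    have "filterlim (\<lambda>a. sinh a / k) at_top at_top"
      using k by (auto simp: divide_inverse mult.commute intro!: filterlim_tendsto_pos_mult_at_top[OF tendsto_const] sinh_real_at_top)
    then have "((\<lambda>a. arctan (sinh a / k)) \<longlongrightarrow> pi / 2) at_top"
      by (rule filterlim_compose[OF tendsto_arctan_at_top])
    then show "((\<lambda>a. arctan (sinh a / k) / k) \<longlongrightarrow> pi / 2 / k) at_top"
      by (intro tendsto_divide tendsto_const) (use k in auto)
  qed measurable
  finally show ?thesis by (simp add: k_def)
qed


text \<open>The integrand is the \<open>b\<close>-derivative of \<open>artanh (b / cosh a)\<close>.
  Turning the logarithm into an integral over \<open>(0, w)\<close> prepares the exchange with the
  integral over \<open>a\<close>.\<close>

lemma ln_cosh_quotient_le_1: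
  assumes w: "0 < w" "w \<le> 1" and a: "a > 0"
  shows "ennreal (ln \<bar>(cosh a + w) / (cosh a - w)\<bar> / 2) =
    (\<integral>\<^sup>+b. ennreal (cosh a / ((cosh a)\<^sup>2 - b\<^sup>2)) * indicator {0<..<w} b \<partial>lborel)"
proof -
  define c where "c = cosh a"
  have c: "c > 1" using cosh_real_strict_mono[of 0 a] a by (simp add: c_def)
  have "(\<integral>\<^sup>+b. ennreal (c / (c\<^sup>2 - b\<^sup>2)) * indicator {0<..<w} b \<partial>lborel) =
    (\<integral>\<^sup>+b. ennreal (c / (c\<^sup>2 - b\<^sup>2)) * indicator {0..w} b \<partial>lborel)"
    by (intro nn_integral_cong_AE eventually_mono[OF eventually_conj[OF AE_lborel_singleton[of 0] AE_lborel_singleton[of w]]])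
       (auto split: split_indicator)
  also have "\<dots> = ennreal (artanh (w / c) - artanh (0 / c))"
  proof (intro nn_integral_FTC_Icc)
    fix b assume b: "b \<in> {0..w}"
    then have bc: "0 \<le> b" "b < c" using c w by auto
    have c2: "b\<^sup>2 < c\<^sup>2" using bc by (intro power_strict_mono) auto
    then show "0 \<le> c / (c\<^sup>2 - b\<^sup>2)" using c by simp
    have "((\<lambda>b. artanh (b / c)) has_real_derivative 1 / (1 - (b / c)\<^sup>2) * (1 / c)) (at b)"
    proof (rule DERIV_chain2[where f = artanh and g = "\<lambda>b. b / c"])
      show "(artanh has_real_derivative 1 / (1 - (b / c)\<^sup>2)) (at (b / c))"
        using bc by (intro artanh_real_has_field_derivative) auto
      show "((\<lambda>b. b / c) has_real_derivative 1 / c) (at b)"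
        using c by (auto intro!: derivative_eq_intros)
    qed
    also have "1 / (1 - (b / c)\<^sup>2) * (1 / c) = c / (c\<^sup>2 - b\<^sup>2)"
      using c c2 by (simp add: field_simps power2_eq_square)
    finally show "((\<lambda>b. artanh (b / c)) has_real_derivative c / (c\<^sup>2 - b\<^sup>2)) (at b)" .
  qed (use w in auto)
  also have "artanh (w / c) - artanh (0 / c) = ln \<bar>(c + w) / (c - w)\<bar> / 2"
  proof -
    have "1 + w / c = (c + w) / c" "1 - w / c = (c - w) / c" using c by (simp_all add: field_simps)
    then have "(1 + w / c) / (1 - w / c) = (c + w) / (c - w)" using c by simp
    then show ?thesis using w c by (simp add: artanh_def)
  qed
  finally show ?thesis by (simp add: c_def)
qed

text \<open>Kept as an unevaluated and possibly infinite constant: comparison with the case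
  \<open>w = 1\<close> supplies its value.\<close>

definition log_coth_integral :: ennreal where
  "log_coth_integral = (\<integral>\<^sup>+x. ennreal (ln \<bar>cosh (x / 2) / sinh (x / 2)\<bar>) \<partial>lborel)"

text \<open>Independence of \<open>B\<close> is the translation invariance of Lebesgue measure.\<close>

lemma nn_integral_ln_cosh_quotient:
  "(\<integral>\<^sup>+a. ennreal (ln \<bar>(cosh a + cosh B) / (cosh a - cosh B)\<bar> / 2) * indicator {0<..} a \<partial>lborel) =
    ennreal (1 / 2) * log_coth_integral"
proof -
  define h where "h x = ln \<bar>cosh (x / 2) / sinh (x / 2)\<bar>" for x :: real
  have [measurable]: "h \<in> borel_measurable borel" unfolding h_def by measurable
  have h_nonneg: "0 \<le> h x" for x
  proof (cases "x = 0")
    case False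
    have "\<bar>sinh (x / 2)\<bar> \<le> cosh (x / 2)"
      using sinh_le_cosh_real[of "x/2"] sinh_le_cosh_real[of "- (x/2)"] by (auto simp: abs_le_iff)
    then show ?thesis using False unfolding h_def by (intro ln_ge_zero) (auto simp: abs_divide divide_simps)
  qed (simp add: h_def)
  define F where "F a = ln \<bar>(cosh a + cosh B) / (cosh a - cosh B)\<bar> / 2" for a
  have [measurable]: "F \<in> borel_measurable borel" unfolding F_def by measurable
  \<comment> \<open>Product formulas for \<open>cosh a + cosh B\<close> and
    \<open>cosh a - cosh B\<close> split the logarithm into two translates of \<open>h\<close>; the
    degenerate points \<open>B\<close> and \<open>- B\<close> form a null set.\<close>
  have F: "F a = (h (B + a) + h (- B + a)) / 2" if "a \<noteq> B" "a \<noteq> - B" for a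
  proof -
    have p: "cosh a + cosh B = 2 * (cosh ((B + a) / 2) * cosh ((- B + a) / 2))"
      using cosh_add[of "(B + a) / 2" "(- B + a) / 2"] cosh_diff[of "(B + a) / 2" "(- B + a) / 2"]
      by (simp add: field_simps)
    have m: "cosh a - cosh B = 2 * (sinh ((B + a) / 2) * sinh ((- B + a) / 2))"
      using cosh_add[of "(B + a) / 2" "(- B + a) / 2"] cosh_diff[of "(B + a) / 2" "(- B + a) / 2"]
      by (simp add: field_simps)
    have "\<bar>(cosh a + cosh B) / (cosh a - cosh B)\<bar> =
      \<bar>cosh ((B + a) / 2) / sinh ((B + a) / 2)\<bar> * \<bar>cosh ((- B + a) / 2) / sinh ((- B + a) / 2)\<bar>"
      unfolding p m by (simp add: abs_mult abs_divide)
    moreover have "\<bar>cosh ((B + a) / 2) / sinh ((B + a) / 2)\<bar> > 0" "\<bar>cosh ((- B + a) / 2) / sinh ((- B + a) / 2)\<bar> > 0"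
      using that by auto
    ultimately show ?thesis by (simp only: F_def h_def ln_mult_pos)
  qed
  have shift: "(\<integral>\<^sup>+a. ennreal (h (C + a)) \<partial>lborel) = log_coth_integral" for C
    using nn_integral_real_affine[of "\<lambda>x. ennreal (h x)" 1 C] by (simp add: log_coth_integral_def h_def)
  have "2 * (\<integral>\<^sup>+a. ennreal (F a) * indicator {0<..} a \<partial>lborel) = (\<integral>\<^sup>+a. ennreal (F a) \<partial>lborel)"
    by (rule nn_integral_even[symmetric]) (auto simp: F_def)
  also have "\<dots> = (\<integral>\<^sup>+a. ennreal (1 / 2) * (ennreal (h (B + a)) + ennreal (h (- B + a))) \<partial>lborel)"
  proof -
    have "ennreal ((x + y) / 2) = ennreal (1 / 2) * (ennreal x + ennreal y)" if "x \<ge> 0" "y \<ge> 0" for x y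
      using that by (subst ennreal_plus[symmetric], simp, simp, subst ennreal_mult[symmetric]) simp_all
    then show ?thesis
      by (intro nn_integral_cong_AE eventually_mono[OF eventually_conj[OF AE_lborel_singleton[of B] AE_lborel_singleton[of "- B"]]])
         (simp add: F h_nonneg del: ennreal_plus)
  qed
  also have "\<dots> = ennreal (1 / 2) * (log_coth_integral + log_coth_integral)"
    using shift[of B] shift[of "- B"] by (simp add: nn_integral_cmult nn_integral_add del: minus_add_distrib add_uminus_conv_diff uminus_add_conv_diff)
  also have "\<dots> = ennreal (1 / 2) * (ennreal 2 * log_coth_integral)"
    by (simp add: mult_2)
  also have "\<dots> = ennreal (1 / 2 * 2) * log_coth_integral"
    by (subst ennreal_mult) (simp_all add: mult.assoc)
  finally have eq: "ennreal 2 * (\<integral>\<^sup>+a. ennreal (F a) * indicator {0<..} a \<partial>lborel) = log_coth_integral"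
    by simp
  show ?thesis using ennreal_mult_cancel_const[OF _ eq] by (simp add: F_def)
qed

text \<open>For \<open>w \<le> 1\<close> the logarithm is written as an integral over
  \<open>b\<close> and the resolvent integral is applied. For \<open>w > 1\<close> write
  \<open>w = cosh B\<close>: the integral does not depend on \<open>B\<close> and keeps its value at
  \<open>w = 1\<close>. This saturation is the origin of \<open>min w 1\<close>, and hence of the
  interval \<open>(0, 1)\<close> that matches the formula for
  \<open>I\<^sub>0 * K\<^sub>0\<close>.\<close>

lemma nn_integral_hilbert_kernel_cosh:
  assumes w: "w > 0"
  shows "(\<integral>\<^sup>+a. (\<integral>\<^sup>+v. ennreal (hilbert_kernel v (cosh a) w) * indicator {0<..} v \<partial>lborel) * indicator {0<..} a \<partial>lborel) =
    (\<integral>\<^sup>+b. ennreal (pi / 2 / sqrt (1 - b\<^sup>2)) * indicator {0<..<min w 1} b \<partial>lborel)"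
proof -
  have 0: "(\<integral>\<^sup>+a. (\<integral>\<^sup>+v. ennreal (hilbert_kernel v (cosh a) w) * indicator {0<..} v \<partial>lborel) * indicator {0<..} a \<partial>lborel) =
    (\<integral>\<^sup>+a. ennreal (ln \<bar>(cosh a + w) / (cosh a - w)\<bar> / 2) * indicator {0<..} a \<partial>lborel)" if w: "w > 0" for w
  proof (intro nn_integral_cong_AE eventually_mono[OF AE_lborel_singleton[of "arcosh w"]])
    fix a :: real assume a: "a \<noteq> arcosh w"
    show "(\<integral>\<^sup>+v. ennreal (hilbert_kernel v (cosh a) w) * indicator {0<..} v \<partial>lborel) * indicator {0<..} a =
      ennreal (ln \<bar>(cosh a + w) / (cosh a - w)\<bar> / 2) * indicator {0<..} a"
    proof (cases "a > 0")
      case True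
      then have "w \<noteq> cosh a" using a arcosh_cosh_real[of a] by auto
      then show ?thesis using w by (simp add: nn_integral_hilbert_kernel)
    qed simp
  qed
  have 1: "(\<integral>\<^sup>+a. ennreal (ln \<bar>(cosh a + w) / (cosh a - w)\<bar> / 2) * indicator {0<..} a \<partial>lborel) =
     (\<integral>\<^sup>+b. ennreal (pi / 2 / sqrt (1 - b\<^sup>2)) * indicator {0<..<w} b \<partial>lborel)" if w: "0 < w" "w \<le> 1" for w
  proof -
    have "(\<integral>\<^sup>+a. ennreal (ln \<bar>(cosh a + w) / (cosh a - w)\<bar> / 2) * indicator {0<..} a \<partial>lborel) =
      (\<integral>\<^sup>+a. (\<integral>\<^sup>+b. ennreal (cosh a / ((cosh a)\<^sup>2 - b\<^sup>2)) * indicator {0<..<w} b * indicator {0<..} a \<partial>lborel) \<partial>lborel)"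
    proof (rule nn_integral_cong)
      fix a :: real
      show "ennreal (ln \<bar>(cosh a + w) / (cosh a - w)\<bar> / 2) * indicator {0<..} a =
        (\<integral>\<^sup>+b. ennreal (cosh a / ((cosh a)\<^sup>2 - b\<^sup>2)) * indicator {0<..<w} b * indicator {0<..} a \<partial>lborel)"
        by (cases "a > 0") (simp_all only: ln_cosh_quotient_le_1[OF w] indicator_simps greaterThan_iff mult_1_right mult_zero_right nn_integral_0_iff_AE if_True, simp_all?)
    qed
    also have "\<dots> = (\<integral>\<^sup>+b. (\<integral>\<^sup>+a. ennreal (cosh a / ((cosh a)\<^sup>2 - b\<^sup>2)) * indicator {0<..<w} b * indicator {0<..} a \<partial>lborel) \<partial>lborel)"
      by (rule lborel_pair.Fubini') measurable
    also have "\<dots> = (\<integral>\<^sup>+b. ennreal (pi / 2 / sqrt (1 - b\<^sup>2)) * indicator {0<..<w} b \<partial>lborel)"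
      using w by (intro nn_integral_cong) (auto simp: nn_integral_cosh_resolvent split: split_indicator)
    finally show ?thesis .
  qed
  show ?thesis
  proof (cases "w \<le> 1")
    case True
    then show ?thesis using 0[OF w] 1[OF w] by simp
  next
    case False
    define B where "B = arcosh w"
    have B: "cosh B = w" using False by (simp add: B_def)
    show ?thesis
      using 0[OF w] nn_integral_ln_cosh_quotient[of B] nn_integral_ln_cosh_quotient[of 0] 1[of 1] False B by simp
  qed
qed

text \<open>Once the quotient is expressed by the kernel and \<open>v\<close>, \<open>a\<close> are
  integrated out, the exponential in \<open>w\<close> enters only through its tail over
  \<open>w > b\<close>, which is \<open>exp (- l * b)\<close>.\<close>

lemma nn_integral_hilbert_exp_cosh:
  assumes l: "l > 0"
  shows "(\<integral>\<^sup>+v. (\<integral>\<^sup>+a. ennreal ((exp (- l * (v * cosh a)) - exp (- l * cosh a)) / (1 - v\<^sup>2)) * indicator {0<..} a \<partial>lborel) * indicator {0<..} v \<partial>lborel) =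
    (\<integral>\<^sup>+s. ennreal (pi / 2 * exp (- l * s) / sqrt (1 - s\<^sup>2)) * indicator {0<..<1} s \<partial>lborel)" (is "?L = ?R")
proof -
  define e where "e w = ennreal (l * exp (- l * w)) * indicator {0<..} w" for w
  have [measurable]: "e \<in> borel_measurable borel" unfolding e_def by measurable
  have "?L = (\<integral>\<^sup>+v. (\<integral>\<^sup>+a. (\<integral>\<^sup>+w. e w * ennreal (hilbert_kernel v (cosh a) w) * indicator {0<..} a * indicator {0<..} v \<partial>lborel) \<partial>lborel) \<partial>lborel)"
  proof (intro nn_integral_cong_AE eventually_mono[OF AE_lborel_singleton[of 1]])
    fix v :: real assume v: "v \<noteq> 1"
    have *: "(\<integral>\<^sup>+w. e w * ennreal (hilbert_kernel v (cosh a) w) \<partial>lborel) =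
      ennreal ((exp (- l * (v * cosh a)) - exp (- l * cosh a)) / (1 - v\<^sup>2))" if "v > 0" for a
    proof -
      have "(\<integral>\<^sup>+w. e w * ennreal (hilbert_kernel v (cosh a) w) \<partial>lborel) =
        (\<integral>\<^sup>+w. ennreal (l * exp (- l * w)) * ennreal (hilbert_kernel v (cosh a) w) \<partial>lborel)"
      proof (rule nn_integral_cong)
        fix w :: real
        have "v * cosh a > 0" "cosh a > 0" using that by simp_all
        then have "w \<le> 0 \<Longrightarrow> hilbert_kernel v (cosh a) w = 0"
          unfolding hilbert_kernel_def by (smt (verit))
        then show "e w * ennreal (hilbert_kernel v (cosh a) w) = ennreal (l * exp (- l * w)) * ennreal (hilbert_kernel v (cosh a) w)"
          by (cases "w > 0") (simp_all add: e_def)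
      qed
      then show ?thesis using nn_integral_hilbert_kernel_exp[OF l that v, of "cosh a"] by simp
    qed
    show "(\<integral>\<^sup>+a. ennreal ((exp (- l * (v * cosh a)) - exp (- l * cosh a)) / (1 - v\<^sup>2)) * indicator {0<..} a \<partial>lborel) * indicator {0<..} v =
      (\<integral>\<^sup>+a. (\<integral>\<^sup>+w. e w * ennreal (hilbert_kernel v (cosh a) w) * indicator {0<..} a * indicator {0<..} v \<partial>lborel) \<partial>lborel)"
    proof (cases "v > 0")
      case True
      then show ?thesis by (simp add: nn_integral_multc *)
    qed simp
  qed
  also have "\<dots> = (\<integral>\<^sup>+a. (\<integral>\<^sup>+v. (\<integral>\<^sup>+w. e w * ennreal (hilbert_kernel v (cosh a) w) * indicator {0<..} a * indicator {0<..} v \<partial>lborel) \<partial>lborel) \<partial>lborel)"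
    by (rule lborel_pair.Fubini') measurable
  also have "\<dots> = (\<integral>\<^sup>+a. (\<integral>\<^sup>+w. (\<integral>\<^sup>+v. e w * ennreal (hilbert_kernel v (cosh a) w) * indicator {0<..} a * indicator {0<..} v \<partial>lborel) \<partial>lborel) \<partial>lborel)"
    by (rule nn_integral_cong, rule lborel_pair.Fubini') measurable
  also have "\<dots> = (\<integral>\<^sup>+w. (\<integral>\<^sup>+a. (\<integral>\<^sup>+v. e w * ennreal (hilbert_kernel v (cosh a) w) * indicator {0<..} a * indicator {0<..} v \<partial>lborel) \<partial>lborel) \<partial>lborel)"
    by (rule lborel_pair.Fubini') measurable
  also have "\<dots> = (\<integral>\<^sup>+w. e w * (\<integral>\<^sup>+a. (\<integral>\<^sup>+v. ennreal (hilbert_kernel v (cosh a) w) * indicator {0<..} v \<partial>lborel) * indicator {0<..} a \<partial>lborel) \<partial>lborel)"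
    by (intro nn_integral_cong) (simp add: nn_integral_cmult[symmetric] nn_integral_multc[symmetric] mult_ac)
  also have "\<dots> = (\<integral>\<^sup>+w. e w * (\<integral>\<^sup>+b. ennreal (pi / 2 / sqrt (1 - b\<^sup>2)) * indicator {0<..<min w 1} b \<partial>lborel) \<partial>lborel)"
  proof (intro nn_integral_cong)
    fix w :: real
    show "e w * (\<integral>\<^sup>+a. (\<integral>\<^sup>+v. ennreal (hilbert_kernel v (cosh a) w) * indicator {0<..} v \<partial>lborel) * indicator {0<..} a \<partial>lborel) =
      e w * (\<integral>\<^sup>+b. ennreal (pi / 2 / sqrt (1 - b\<^sup>2)) * indicator {0<..<min w 1} b \<partial>lborel)"
      using nn_integral_hilbert_kernel_cosh[of w] by (cases "w > 0") (simp_all add: e_def)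
  qed
  also have "\<dots> = (\<integral>\<^sup>+w. (\<integral>\<^sup>+b. (ennreal (l * exp (- l * w)) * indicator {b<..} w) * (ennreal (pi / 2 / sqrt (1 - b\<^sup>2)) * indicator {0<..<1} b) \<partial>lborel) \<partial>lborel)"
  proof (rule nn_integral_cong)
    fix w :: real
    have "e w * (\<integral>\<^sup>+b. ennreal (pi / 2 / sqrt (1 - b\<^sup>2)) * indicator {0<..<min w 1} b \<partial>lborel) =
      (\<integral>\<^sup>+b. e w * (ennreal (pi / 2 / sqrt (1 - b\<^sup>2)) * indicator {0<..<min w 1} b) \<partial>lborel)"
      by (simp add: nn_integral_cmult)
    also have "\<dots> = (\<integral>\<^sup>+b. (ennreal (l * exp (- l * w)) * indicator {b<..} w) * (ennreal (pi / 2 / sqrt (1 - b\<^sup>2)) * indicator {0<..<1} b) \<partial>lborel)"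
      by (intro nn_integral_cong) (auto simp: e_def split: split_indicator)
    finally show "e w * (\<integral>\<^sup>+b. ennreal (pi / 2 / sqrt (1 - b\<^sup>2)) * indicator {0<..<min w 1} b \<partial>lborel) = \<dots>" .
  qed
  also have "\<dots> = (\<integral>\<^sup>+b. (\<integral>\<^sup>+w. (ennreal (l * exp (- l * w)) * indicator {b<..} w) * (ennreal (pi / 2 / sqrt (1 - b\<^sup>2)) * indicator {0<..<1} b) \<partial>lborel) \<partial>lborel)"
  proof (rule lborel_pair.Fubini')
    have *: "indicator {b<..} w = (if b < w then 1 else 0 :: ennreal)" for b w :: real
      by (auto split: split_indicator)
    show "(\<lambda>(b, w). (ennreal (l * exp (- l * w)) * indicator {b<..} w) * (ennreal (pi / 2 / sqrt (1 - b\<^sup>2)) * indicator {0<..<1} b)) \<in> borel_measurable (lborel \<Otimes>\<^sub>M lborel)"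
      unfolding * by measurable
  qed
  also have "\<dots> = (\<integral>\<^sup>+b. ennreal (exp (- l * b)) * (ennreal (pi / 2 / sqrt (1 - b\<^sup>2)) * indicator {0<..<1} b) \<partial>lborel)"
    by (intro nn_integral_cong) (subst nn_integral_multc, simp_all add: nn_integral_exp_tail[OF l, simplified])
  also have "\<dots> = ?R"
    by (intro nn_integral_cong) (auto simp: ennreal_mult'[symmetric] mult_ac split: split_indicator)
  finally show ?thesis .
qed


lemma bessel_K0_antimono:
  assumes "0 < p" "p \<le> q"
  shows "bessel_K0 q \<le> bessel_K0 p"
proof -
  have "ennreal (bessel_K0 q) \<le> ennreal (bessel_K0 p)"
    unfolding nn_integral_bessel_K0[OF assms(1), symmetric] nn_integral_bessel_K0[OF less_le_trans[OF assms], symmetric]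
    using assms by (intro nn_integral_mono) (auto intro!: ennreal_leI mult_right_mono split: split_indicator)
  then show ?thesis using bessel_K0_nonneg by (simp add: ennreal_le_iff)
qed

lemma bessel_K0_square_double_integral:
  assumes u: "u > 0"
  shows "(\<integral>\<^sup>+b. (\<integral>\<^sup>+a. ennreal (exp (- (2 * u * cosh b) * cosh a)) * indicator {0<..} a \<partial>lborel) * indicator {0<..} b \<partial>lborel) =
    ennreal ((bessel_K0 u)\<^sup>2 / 2)"
  unfolding bessel_K0_square[OF u, symmetric]
  by (intro nn_integral_cong arg_cong2[where f = "(*)"] refl nn_integral_bessel_K0) (use u in simp)

text \<open>The sign condition makes the integrand nonnegative, so that the quotient by
  \<open>1 - v\<^sup>2\<close> can be treated on both sides of \<open>v = 1\<close>. The subtraction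
  in \<open>ennreal\<close> is sound because the double integrals of both squares are
  finite.\<close>

lemma bessel_K0_square_diff_double_integral:
  assumes p: "p > 0" and q: "q > 0" and c: "(q - p) * c \<ge> 0"
  shows "(\<integral>\<^sup>+b. (\<integral>\<^sup>+a. ennreal ((exp (- (2 * p * cosh b) * cosh a) - exp (- (2 * q * cosh b) * cosh a)) * c) * indicator {0<..} a \<partial>lborel) * indicator {0<..} b \<partial>lborel) =
    ennreal (((bessel_K0 p)\<^sup>2 - (bessel_K0 q)\<^sup>2) / 2 * c)"
proof -
  have main: "(\<integral>\<^sup>+b. (\<integral>\<^sup>+a. ennreal ((exp (- (2 * p * cosh b) * cosh a) - exp (- (2 * q * cosh b) * cosh a)) * c) * indicator {0<..} a \<partial>lborel) * indicator {0<..} b \<partial>lborel) =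
    ennreal (((bessel_K0 p)\<^sup>2 - (bessel_K0 q)\<^sup>2) / 2 * c)"
    if p: "p > 0" and pq: "p \<le> q" and c: "c \<ge> 0" for p q c
  proof -
    define e where "e u b a = ennreal (exp (- (2 * u * cosh b) * cosh a))" for u b a :: real
    define d where "d b a = ennreal (exp (- (2 * p * cosh b) * cosh a) - exp (- (2 * q * cosh b) * cosh a))" for b a :: real
    define D where "D = (\<integral>\<^sup>+b. (\<integral>\<^sup>+a. d b a * indicator {0<..} a \<partial>lborel) * indicator {0<..} b \<partial>lborel)"
    have [measurable]: "(\<lambda>x. d (f x) (g x)) \<in> borel_measurable M" if [measurable]: "f \<in> borel_measurable M" "g \<in> borel_measurable M" for f g M
      unfolding d_def by measurable
    have [measurable]: "(\<lambda>x. e u (f x) (g x)) \<in> borel_measurable M" if [measurable]: "f \<in> borel_measurable M" "g \<in> borel_measurable M" for f g M u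
      unfolding e_def by measurable
    have q: "q > 0" using p pq by simp
    have le: "exp (- (2 * q * cosh b) * cosh a) \<le> exp (- (2 * p * cosh b) * cosh a)" for a b :: real
      using pq by (auto intro!: mult_right_mono)
    have ed: "e p b a = e q b a + d b a" for b a
      unfolding e_def d_def using le by (subst ennreal_plus[symmetric]) auto
    have "ennreal ((bessel_K0 p)\<^sup>2 / 2) = (\<integral>\<^sup>+b. (\<integral>\<^sup>+a. e p b a * indicator {0<..} a \<partial>lborel) * indicator {0<..} b \<partial>lborel)"
      using bessel_K0_square_double_integral[OF p] by (simp add: e_def)
    also have "\<dots> = (\<integral>\<^sup>+b. (\<integral>\<^sup>+a. e q b a * indicator {0<..} a \<partial>lborel) * indicator {0<..} b \<partial>lborel) + D"
      unfolding ed distrib_right D_def by (simp add: nn_integral_add distrib_right)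
    also have "(\<integral>\<^sup>+b. (\<integral>\<^sup>+a. e q b a * indicator {0<..} a \<partial>lborel) * indicator {0<..} b \<partial>lborel) = ennreal ((bessel_K0 q)\<^sup>2 / 2)"
      using bessel_K0_square_double_integral[OF q] by (simp add: e_def)
    finally have "D = ennreal ((bessel_K0 p)\<^sup>2 / 2) - ennreal ((bessel_K0 q)\<^sup>2 / 2)"
      by simp
    then have D: "D = ennreal (((bessel_K0 p)\<^sup>2 - (bessel_K0 q)\<^sup>2) / 2)"
      by (simp add: ennreal_minus diff_divide_distrib)
    have "(\<integral>\<^sup>+b. (\<integral>\<^sup>+a. ennreal ((exp (- (2 * p * cosh b) * cosh a) - exp (- (2 * q * cosh b) * cosh a)) * c) * indicator {0<..} a \<partial>lborel) * indicator {0<..} b \<partial>lborel) =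
      (\<integral>\<^sup>+b. (\<integral>\<^sup>+a. ennreal c * (d b a * indicator {0<..} a) \<partial>lborel) * indicator {0<..} b \<partial>lborel)"
      unfolding d_def using c le by (simp add: ennreal_mult mult_ac)
    also have "\<dots> = (\<integral>\<^sup>+b. ennreal c * ((\<integral>\<^sup>+a. d b a * indicator {0<..} a \<partial>lborel) * indicator {0<..} b) \<partial>lborel)"
      by (simp add: nn_integral_cmult mult.assoc)
    also have "\<dots> = ennreal c * D"
      by (simp add: nn_integral_cmult D_def)
    also have "\<dots> = ennreal (((bessel_K0 p)\<^sup>2 - (bessel_K0 q)\<^sup>2) / 2 * c)"
    proof -
      have "(bessel_K0 q)\<^sup>2 \<le> (bessel_K0 p)\<^sup>2"
        using bessel_K0_antimono[OF p pq] bessel_K0_nonneg by (intro power_mono)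
      then show ?thesis using c unfolding D by (subst ennreal_mult[symmetric]) (auto simp: mult_ac)
    qed
    finally show ?thesis .
  qed
  consider "p = q" | "p < q" "c \<ge> 0" | "q < p" "c \<le> 0"
    using c by (smt (verit) zero_le_mult_iff)
  then show ?thesis
  proof cases
    case 1
    then show ?thesis by simp
  next
    case 2
    then show ?thesis using main[of p q c] p by simp
  next
    case 3
    have *: "(x - y) * c = (y - x) * (- c)" "(x - y) / 2 * c = (y - x) / 2 * (- c)" for x y :: real
      by (simp_all add: algebra_simps)
    show ?thesis
      unfolding *[of "exp _" "exp _"] *(2)[of "(bessel_K0 p)\<^sup>2"] using 3 q by (intro main) auto
  qed
qed

text \<open>For fixed \<open>b\<close> the inner integrals are the exponential identity with
  \<open>l = 2 * z * cosh b\<close>. Integrating over \<open>b\<close> turns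
  \<open>exp (- 2 * z * s * cosh b)\<close> into \<open>K\<^sub>0(2 z s)\<close>, whose integral
  against \<open>1 / sqrt (1 - s\<^sup>2)\<close> is the product formula.\<close>

lemma nn_integral_hilbert_bessel_K0_square:
  assumes z: "z > 0"
  shows "(\<integral>\<^sup>+v. ennreal (((bessel_K0 (z * v))\<^sup>2 - (bessel_K0 z)\<^sup>2) / (1 - v\<^sup>2)) * indicator {0<..} v \<partial>lborel) =
    ennreal (pi\<^sup>2 / 2 * (bessel_I0 z * bessel_K0 z))"
proof -
  define g where "g v b a = ennreal ((exp (- (2 * z * cosh b) * (v * cosh a)) - exp (- (2 * z * cosh b) * cosh a)) / (1 - v\<^sup>2))" for v b a :: real
  have [measurable]: "(\<lambda>x. g (h x) (f x) (k x)) \<in> borel_measurable M"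
    if [measurable]: "f \<in> borel_measurable M" "h \<in> borel_measurable M" "k \<in> borel_measurable M" for f h k M
    unfolding g_def by measurable
  have "ennreal (1 / 2) * (\<integral>\<^sup>+v. ennreal (((bessel_K0 (z * v))\<^sup>2 - (bessel_K0 z)\<^sup>2) / (1 - v\<^sup>2)) * indicator {0<..} v \<partial>lborel) =
    (\<integral>\<^sup>+v. ennreal (1 / 2) * (ennreal (((bessel_K0 (z * v))\<^sup>2 - (bessel_K0 z)\<^sup>2) / (1 - v\<^sup>2)) * indicator {0<..} v) \<partial>lborel)"
    by (rule nn_integral_cmult[symmetric]) measurable
  also have "\<dots> = (\<integral>\<^sup>+v. (\<integral>\<^sup>+b. (\<integral>\<^sup>+a. g v b a * indicator {0<..} a \<partial>lborel) * indicator {0<..} b * indicator {0<..} v \<partial>lborel) \<partial>lborel)"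
  proof (rule nn_integral_cong)
    fix v :: real
    show "ennreal (1 / 2) * (ennreal (((bessel_K0 (z * v))\<^sup>2 - (bessel_K0 z)\<^sup>2) / (1 - v\<^sup>2)) * indicator {0<..} v) =
      (\<integral>\<^sup>+b. (\<integral>\<^sup>+a. g v b a * indicator {0<..} a \<partial>lborel) * indicator {0<..} b * indicator {0<..} v \<partial>lborel)"
    proof (cases "v > 0")
      case True
      have "0 \<le> (1 - v) * (1 / (1 - v\<^sup>2))"
        using True power_le_one[of v 2] one_le_power[of v 2]
        by (cases "v \<le> 1") (auto intro: divide_nonneg_nonneg divide_nonpos_nonpos)
      then have "0 \<le> z * ((1 - v) * (1 / (1 - v\<^sup>2)))" by (rule mult_nonneg_nonneg[OF less_imp_le[OF z]])
      then have "(z - z * v) * (1 / (1 - v\<^sup>2)) \<ge> 0"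
        by (simp only: mult.assoc[symmetric] right_diff_distrib mult_1_right)
      from bessel_K0_square_diff_double_integral[OF _ z this] True z
      have *: "(\<integral>\<^sup>+b. (\<integral>\<^sup>+a. g v b a * indicator {0<..} a \<partial>lborel) * indicator {0<..} b \<partial>lborel) =
         ennreal (((bessel_K0 (z * v))\<^sup>2 - (bessel_K0 z)\<^sup>2) / 2 * (1 / (1 - v\<^sup>2)))"
        by (simp add: g_def mult_ac)
      have "((bessel_K0 (z * v))\<^sup>2 - (bessel_K0 z)\<^sup>2) / 2 * (1 / (1 - v\<^sup>2)) =
          1 / 2 * (((bessel_K0 (z * v))\<^sup>2 - (bessel_K0 z)\<^sup>2) / (1 - v\<^sup>2))" by simp
      then show ?thesis using True * by (simp only: ennreal_mult'[of "1/2"]) simp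
    qed simp
  qed
  also have "\<dots> = (\<integral>\<^sup>+b. (\<integral>\<^sup>+v. (\<integral>\<^sup>+a. g v b a * indicator {0<..} a \<partial>lborel) * indicator {0<..} b * indicator {0<..} v \<partial>lborel) \<partial>lborel)"
    by (rule lborel_pair.Fubini') measurable
  also have "\<dots> = (\<integral>\<^sup>+b. (\<integral>\<^sup>+s. ennreal (pi / 2 * exp (- (2 * z * cosh b) * s) / sqrt (1 - s\<^sup>2)) * indicator {0<..<1} s * indicator {0<..} b \<partial>lborel) \<partial>lborel)"
  proof (rule nn_integral_cong)
    fix b :: real
    have "(\<integral>\<^sup>+v. (\<integral>\<^sup>+a. g v b a * indicator {0<..} a \<partial>lborel) * indicator {0<..} v \<partial>lborel) =
      (\<integral>\<^sup>+s. ennreal (pi / 2 * exp (- (2 * z * cosh b) * s) / sqrt (1 - s\<^sup>2)) * indicator {0<..<1} s \<partial>lborel)"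
      unfolding g_def by (rule nn_integral_hilbert_exp_cosh) (use z in simp)
    then show "(\<integral>\<^sup>+v. (\<integral>\<^sup>+a. g v b a * indicator {0<..} a \<partial>lborel) * indicator {0<..} b * indicator {0<..} v \<partial>lborel) =
      (\<integral>\<^sup>+s. ennreal (pi / 2 * exp (- (2 * z * cosh b) * s) / sqrt (1 - s\<^sup>2)) * indicator {0<..<1} s * indicator {0<..} b \<partial>lborel)"
      by (cases "b > 0") simp_all
  qed
  also have "\<dots> = (\<integral>\<^sup>+s. (\<integral>\<^sup>+b. ennreal (pi / 2 * exp (- (2 * z * cosh b) * s) / sqrt (1 - s\<^sup>2)) * indicator {0<..<1} s * indicator {0<..} b \<partial>lborel) \<partial>lborel)"
    by (rule lborel_pair.Fubini') measurable
  also have "\<dots> = (\<integral>\<^sup>+s. ennreal (pi / 2) * (ennreal (bessel_K0 (2 * z * s) / sqrt (1 - s\<^sup>2)) * indicator {0<..<1} s) \<partial>lborel)"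
  proof (rule nn_integral_cong)
    fix s :: real
    show "(\<integral>\<^sup>+b. ennreal (pi / 2 * exp (- (2 * z * cosh b) * s) / sqrt (1 - s\<^sup>2)) * indicator {0<..<1} s * indicator {0<..} b \<partial>lborel) =
      ennreal (pi / 2) * (ennreal (bessel_K0 (2 * z * s) / sqrt (1 - s\<^sup>2)) * indicator {0<..<1} s)"
    proof (cases "0 < s \<and> s < 1")
      case True
      then have s2: "s\<^sup>2 < 1" using abs_square_less_1[of s] by auto
      have "(\<integral>\<^sup>+b. ennreal (pi / 2 * exp (- (2 * z * cosh b) * s) / sqrt (1 - s\<^sup>2)) * indicator {0<..<1} s * indicator {0<..} b \<partial>lborel) =
        (\<integral>\<^sup>+b. ennreal (pi / 2 / sqrt (1 - s\<^sup>2)) * (ennreal (exp (- (2 * z * s) * cosh b)) * indicator {0<..} b) \<partial>lborel)"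
        using True s2 by (intro nn_integral_cong) (simp add: ennreal_mult[symmetric] mult_ac split: split_indicator)
      also have "\<dots> = ennreal (pi / 2 / sqrt (1 - s\<^sup>2)) * ennreal (bessel_K0 (2 * z * s))"
        by (subst nn_integral_cmult, measurable) (subst nn_integral_bessel_K0, use True z in simp_all)
      also have "\<dots> = ennreal (pi / 2) * (ennreal (bessel_K0 (2 * z * s) / sqrt (1 - s\<^sup>2)))"
        using s2 by (simp add: ennreal_mult[symmetric] bessel_K0_nonneg)
      finally show ?thesis using True by simp
    qed auto
  qed
  also have "\<dots> = ennreal (pi / 2) * ennreal (pi / 2 * (bessel_I0 z * bessel_K0 z))"
    by (subst nn_integral_cmult) (simp_all add: bessel_I0_times_K0[OF z])
  also have "\<dots> = ennreal (pi\<^sup>2 / 4 * (bessel_I0 z * bessel_K0 z))"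
    by (subst ennreal_mult[symmetric]) (simp_all add: bessel_I0_nonneg bessel_K0_nonneg power2_eq_square)
  finally have eq: "ennreal (1 / 2) * (\<integral>\<^sup>+v. ennreal (((bessel_K0 (z * v))\<^sup>2 - (bessel_K0 z)\<^sup>2) / (1 - v\<^sup>2)) * indicator {0<..} v \<partial>lborel) =
     ennreal (pi\<^sup>2 / 4 * (bessel_I0 z * bessel_K0 z))" .
  have "(\<integral>\<^sup>+v. ennreal (((bessel_K0 (z * v))\<^sup>2 - (bessel_K0 z)\<^sup>2) / (1 - v\<^sup>2)) * indicator {0<..} v \<partial>lborel) =
    ennreal (1 / (1 / 2)) * ennreal (pi\<^sup>2 / 4 * (bessel_I0 z * bessel_K0 z))"
    by (rule ennreal_mult_cancel_const[OF _ eq]) simp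
  also have "\<dots> = ennreal (1 / (1 / 2) * (pi\<^sup>2 / 4 * (bessel_I0 z * bessel_K0 z)))"
    by (rule ennreal_mult[symmetric]) (simp_all add: bessel_I0_nonneg bessel_K0_nonneg)
  finally show ?thesis by (simp add: mult_ac)
qed

section \<open>Moments of K_0^2 and the remainder for every truncation order\<close>

lemma nn_integral_power_exp:
  assumes l: "l > 0"
  shows "(\<integral>\<^sup>+v. ennreal (v ^ k * exp (- l * v)) * indicator {0<..} v \<partial>lborel) = ennreal (fact k / l ^ Suc k)"
proof -
  define G where "G t = ennreal (t powr (real (Suc k) - 1) / exp t) * indicator {0..} t" for t :: real
  have [measurable]: "G \<in> borel_measurable borel" unfolding G_def by measurable
  have "(\<lambda>t. t powr (real (Suc k) - 1) / exp t) absolutely_integrable_on {0..}"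
    using Gamma_integral_real[of "real (Suc k)"]
    by (intro nonnegative_absolutely_integrable_1) (auto simp: has_integral_iff)
  then have "(\<integral>\<^sup>+t. G t \<partial>lborel) = ennreal (Gamma (real (Suc k)))"
    using Gamma_integral_real[of "real (Suc k)"] unfolding G_def
    by (subst nn_integral_set_absolutely_integrable) (auto simp: has_integral_iff)
  then have G: "(\<integral>\<^sup>+t. G t \<partial>lborel) = ennreal (fact k)"
    using Gamma_fact[of k, where 'a = real] by (simp add: add.commute)
  have "ennreal (1 / l ^ Suc k) * ennreal (fact k) = ennreal (1 / l ^ Suc k) * (ennreal l * (\<integral>\<^sup>+v. G (l * v) \<partial>lborel))"
    unfolding G[symmetric] using l nn_integral_real_affine[of G l 0] by simp
  also have "\<dots> = ennreal (1 / l ^ k) * (\<integral>\<^sup>+v. G (l * v) \<partial>lborel)"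
    using l by (simp add: mult.assoc[symmetric] ennreal_mult[symmetric])
  also have "\<dots> = (\<integral>\<^sup>+v. ennreal (1 / l ^ k) * G (l * v) \<partial>lborel)"
    by (simp add: nn_integral_cmult)
  also have "\<dots> = (\<integral>\<^sup>+v. ennreal (v ^ k * exp (- l * v)) * indicator {0<..} v \<partial>lborel)"
  proof (intro nn_integral_cong_AE eventually_mono[OF AE_lborel_singleton[of 0]])
    fix v :: real assume "v \<noteq> 0"
    moreover have "1 / l ^ k * ((l * v) powr real k / exp (l * v)) = v ^ k * exp (- l * v)" if "v > 0"
      using that l by (simp add: powr_realpow power_mult_distrib exp_minus field_simps)
    ultimately show "ennreal (1 / l ^ k) * G (l * v) = ennreal (v ^ k * exp (- l * v)) * indicator {0<..} v"
      using l by (cases "v > 0") (auto simp: G_def ennreal_mult[symmetric] zero_le_mult_iff)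
  qed
  finally show ?thesis
    using l by (simp add: ennreal_mult[symmetric])
qed

text \<open>Under the double integral for the square, the \<open>v\<close>-integral is a Gamma
  integral whose value is a product in \<open>a\<close> and \<open>b\<close>; what remains is the
  square of one Wallis integral.\<close>

lemma nn_integral_bessel_K0_square_moment:
  assumes z: "z > 0"
  shows "(\<integral>\<^sup>+v. ennreal (v ^ (2 * k) * (bessel_K0 (z * v))\<^sup>2) * indicator {0<..} v \<partial>lborel) =
    ennreal (pi\<^sup>2 / 4 * (fact (2 * k) * (central_coeff k)\<^sup>2) / (4 ^ k * z ^ (2 * k + 1)))"
proof -
  define e where "e v b a = ennreal (v ^ (2 * k) * exp (- (2 * z * cosh b * cosh a) * v)) * indicator {0<..} a * indicator {0<..} b * indicator {0<..} v" for v b a :: real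
  have [measurable]: "(\<lambda>x. e (h x) (f x) (g x)) \<in> borel_measurable M"
    if [measurable]: "f \<in> borel_measurable M" "h \<in> borel_measurable M" "g \<in> borel_measurable M" for f h g M
    unfolding e_def by measurable
  have "(\<integral>\<^sup>+v. ennreal (v ^ (2 * k) * (bessel_K0 (z * v))\<^sup>2) * indicator {0<..} v \<partial>lborel) =
    (\<integral>\<^sup>+v. 2 * (\<integral>\<^sup>+b. (\<integral>\<^sup>+a. e v b a \<partial>lborel) \<partial>lborel) \<partial>lborel)"
  proof (rule nn_integral_cong)
    fix v :: real
    show "ennreal (v ^ (2 * k) * (bessel_K0 (z * v))\<^sup>2) * indicator {0<..} v = 2 * (\<integral>\<^sup>+b. (\<integral>\<^sup>+a. e v b a \<partial>lborel) \<partial>lborel)"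
    proof (cases "v > 0")
      case True
      have "(\<integral>\<^sup>+b. (\<integral>\<^sup>+a. e v b a \<partial>lborel) \<partial>lborel) =
        (\<integral>\<^sup>+b. (\<integral>\<^sup>+a. ennreal (v ^ (2 * k)) * (ennreal (exp (- (2 * (z * v) * cosh b) * cosh a)) * indicator {0<..} a * indicator {0<..} b) \<partial>lborel) \<partial>lborel)"
        using True by (simp add: e_def ennreal_mult mult_ac)
      also have "\<dots> = ennreal (v ^ (2 * k)) * (\<integral>\<^sup>+b. (\<integral>\<^sup>+a. ennreal (exp (- (2 * (z * v) * cosh b) * cosh a)) * indicator {0<..} a \<partial>lborel) * indicator {0<..} b \<partial>lborel)"
        by (simp add: nn_integral_cmult nn_integral_multc)
      also have "\<dots> = ennreal (v ^ (2 * k)) * ennreal ((bessel_K0 (z * v))\<^sup>2 / 2)"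
        by (subst bessel_K0_square_double_integral) (use True z in simp_all)
      finally have *: "(\<integral>\<^sup>+b. (\<integral>\<^sup>+a. e v b a \<partial>lborel) \<partial>lborel) = ennreal (v ^ (2 * k)) * ennreal ((bessel_K0 (z * v))\<^sup>2 / 2)" .
      have "ennreal 2 * (ennreal (v ^ (2 * k)) * ennreal ((bessel_K0 (z * v))\<^sup>2 / 2)) = ennreal (v ^ (2 * k) * (bessel_K0 (z * v))\<^sup>2)"
        using True by (simp add: ennreal_mult[symmetric] del: ennreal_numeral)
      then show ?thesis using True * by simp
    qed (simp add: e_def)
  qed
  also have "\<dots> = 2 * (\<integral>\<^sup>+v. (\<integral>\<^sup>+b. (\<integral>\<^sup>+a. e v b a \<partial>lborel) \<partial>lborel) \<partial>lborel)"
    by (rule nn_integral_cmult) measurable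
  also have "(\<integral>\<^sup>+v. (\<integral>\<^sup>+b. (\<integral>\<^sup>+a. e v b a \<partial>lborel) \<partial>lborel) \<partial>lborel) = (\<integral>\<^sup>+b. (\<integral>\<^sup>+v. (\<integral>\<^sup>+a. e v b a \<partial>lborel) \<partial>lborel) \<partial>lborel)"
    by (rule lborel_pair.Fubini') measurable
  also have "\<dots> = (\<integral>\<^sup>+b. (\<integral>\<^sup>+a. (\<integral>\<^sup>+v. e v b a \<partial>lborel) \<partial>lborel) \<partial>lborel)"
    by (rule nn_integral_cong, rule lborel_pair.Fubini') measurable
  also have "\<dots> = (\<integral>\<^sup>+b. (\<integral>\<^sup>+a. (ennreal (fact (2 * k) / (2 * z) ^ (2 * k + 1)) * (ennreal (1 / cosh b ^ (2 * k + 1)) * indicator {0<..} b)) *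
      (ennreal (1 / cosh a ^ (2 * k + 1)) * indicator {0<..} a) \<partial>lborel) \<partial>lborel)"
  proof (rule nn_integral_cong, rule nn_integral_cong)
    fix a b :: real
    have l: "2 * z * cosh b * cosh a > 0" using z by simp
    have "(\<integral>\<^sup>+v. e v b a \<partial>lborel) = (\<integral>\<^sup>+v. (ennreal (v ^ (2 * k) * exp (- (2 * z * cosh b * cosh a) * v)) * indicator {0<..} v) * (indicator {0<..} a * indicator {0<..} b) \<partial>lborel)"
      by (simp add: e_def mult_ac)
    also have "\<dots> = ennreal (fact (2 * k) / (2 * z * cosh b * cosh a) ^ Suc (2 * k)) * (indicator {0<..} a * indicator {0<..} b)"
      by (subst nn_integral_multc) (simp_all only: nn_integral_power_exp[OF l], measurable)
    also have "fact (2 * k) / (2 * z * cosh b * cosh a) ^ Suc (2 * k) =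
       fact (2 * k) / (2 * z) ^ (2 * k + 1) * (1 / cosh b ^ (2 * k + 1)) * (1 / cosh a ^ (2 * k + 1))"
      by (simp add: power_mult_distrib)
    also have "ennreal (fact (2 * k) / (2 * z) ^ (2 * k + 1) * (1 / cosh b ^ (2 * k + 1)) * (1 / cosh a ^ (2 * k + 1))) * (indicator {0<..} a * indicator {0<..} b) =
      (ennreal (fact (2 * k) / (2 * z) ^ (2 * k + 1)) * (ennreal (1 / cosh b ^ (2 * k + 1)) * indicator {0<..} b)) *
      (ennreal (1 / cosh a ^ (2 * k + 1)) * indicator {0<..} a)"
    proof -
      have H: "ennreal (C * B * A) * (i * j) = ennreal C * (ennreal B * j) * (ennreal A * i)"
        if "A \<ge> 0" "B \<ge> 0" "C \<ge> 0" for A B C and i j :: ennreal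
        using that by (simp add: ennreal_mult mult_ac)
      show ?thesis by (rule H) (use z in simp_all)
    qed
    finally show "(\<integral>\<^sup>+v. e v b a \<partial>lborel) = (ennreal (fact (2 * k) / (2 * z) ^ (2 * k + 1)) * (ennreal (1 / cosh b ^ (2 * k + 1)) * indicator {0<..} b)) *
      (ennreal (1 / cosh a ^ (2 * k + 1)) * indicator {0<..} a)" .
  qed
  also have "\<dots> = ennreal (fact (2 * k) / (2 * z) ^ (2 * k + 1)) * ennreal (pi / 2 * central_coeff k) * ennreal (pi / 2 * central_coeff k)"
    by (subst nn_integral_cmult, measurable, subst nn_integral_multc, measurable, subst nn_integral_cmult, measurable)
       (simp only: nn_integral_cosh_power)
  also have "2 * \<dots> = ennreal (2 * (fact (2 * k) / (2 * z) ^ (2 * k + 1) * (pi / 2 * central_coeff k) * (pi / 2 * central_coeff k)))"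
  proof -
    have H: "2 * (ennreal A * ennreal B * ennreal C) = ennreal (2 * (A * B * C))"
      if "A \<ge> 0" "B \<ge> 0" "C \<ge> 0" for A B C
      using that by (simp add: ennreal_mult)
    show ?thesis by (rule H) (use z less_imp_le[OF central_coeff_pos[of k]] in simp_all)
  qed
  also have "2 * (fact (2 * k) / (2 * z) ^ (2 * k + 1) * (pi / 2 * central_coeff k) * (pi / 2 * central_coeff k)) =
     pi\<^sup>2 / 4 * (fact (2 * k) * (central_coeff k)\<^sup>2) / (4 ^ k * z ^ (2 * k + 1))"
    by (simp add: power_mult_distrib power2_eq_square power_mult mult_ac) (simp flip: power_mult_distrib)
  finally show ?thesis .
qed

lemma I0K0_remainder_integral:
  assumes z: "z > 0"
  shows "has_bochner_integral lborel (\<lambda>v. indicator {0<..} v *\<^sub>R ((v ^ (2 * M) * (bessel_K0 (z * v))\<^sup>2 - (bessel_K0 z)\<^sup>2) / (1 - v\<^sup>2)))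
    (pi\<^sup>2 / 2 * I0K0_remainder M z)"
proof (induction M)
  case 0
  have nonneg: "0 \<le> ((bessel_K0 (z * v))\<^sup>2 - (bessel_K0 z)\<^sup>2) / (1 - v\<^sup>2)" if v: "v > 0" for v
  proof (cases "v \<le> 1")
    case True
    then have "(bessel_K0 z)\<^sup>2 \<le> (bessel_K0 (z * v))\<^sup>2"
      using v z by (intro power_mono bessel_K0_antimono bessel_K0_nonneg) auto
    then show ?thesis using True v by (simp add: power_le_one)
  next
    case False
    then have "(bessel_K0 (z * v))\<^sup>2 \<le> (bessel_K0 z)\<^sup>2"
      using v z by (intro power_mono bessel_K0_antimono bessel_K0_nonneg) auto
    moreover have "1 \<le> v\<^sup>2" using False by simp
    ultimately show ?thesis by (intro divide_nonpos_nonpos) auto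
  qed
  show ?case
  proof (rule has_bochner_integral_nn_integral)
    show "(\<integral>\<^sup>+v. ennreal (indicator {0<..} v *\<^sub>R ((v ^ (2 * 0) * (bessel_K0 (z * v))\<^sup>2 - (bessel_K0 z)\<^sup>2) / (1 - v\<^sup>2))) \<partial>lborel) =
      ennreal (pi\<^sup>2 / 2 * I0K0_remainder 0 z)"
      unfolding I0K0_remainder_def I0K0_trunc_def
      by (simp add: nn_integral_hilbert_bessel_K0_square[OF z, symmetric] del: times_divide_eq_left times_divide_eq_right)
         (intro nn_integral_cong, auto split: split_indicator)
  qed (use nonneg in \<open>auto split: split_indicator simp: I0K0_remainder_def I0K0_trunc_def bessel_I0_nonneg bessel_K0_nonneg\<close>)
next
  case (Suc M)
  define c where "c = pi\<^sup>2 / 4 * (fact (2 * M) * (central_coeff M)\<^sup>2) / (4 ^ M * z ^ (2 * M + 1))"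
  have "has_bochner_integral lborel (\<lambda>v. indicator {0<..} v *\<^sub>R (v ^ (2 * M) * (bessel_K0 (z * v))\<^sup>2)) c"
  proof (rule has_bochner_integral_nn_integral)
    show "(\<integral>\<^sup>+v. ennreal (indicator {0<..} v *\<^sub>R (v ^ (2 * M) * (bessel_K0 (z * v))\<^sup>2)) \<partial>lborel) = ennreal c"
      unfolding c_def nn_integral_bessel_K0_square_moment[OF z, symmetric]
      by (intro nn_integral_cong) (auto split: split_indicator)
  qed (use z in \<open>auto split: split_indicator simp: c_def\<close>)
  from has_bochner_integral_diff[OF Suc this]
  have "has_bochner_integral lborel (\<lambda>v. indicator {0<..} v *\<^sub>R ((v ^ (2 * M) * (bessel_K0 (z * v))\<^sup>2 - (bessel_K0 z)\<^sup>2) / (1 - v\<^sup>2)) -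
      indicator {0<..} v *\<^sub>R (v ^ (2 * M) * (bessel_K0 (z * v))\<^sup>2)) (pi\<^sup>2 / 2 * I0K0_remainder M z - c)" .
  also have "pi\<^sup>2 / 2 * I0K0_remainder M z - c = pi\<^sup>2 / 2 * I0K0_remainder (Suc M) z"
  proof -
    have "c = pi\<^sup>2 / 2 * (1 / (2 * z) * ((fact (2 * M)) ^ 3 / ((fact M) ^ 4 * (8 * z) ^ (2 * M))))"
    proof -
      have "(4::real) ^ M * (4 ^ M * 4 ^ M) = 8 ^ (M + M)" by (simp add: power_add flip: power_mult_distrib)
      then show ?thesis using z
        by (simp add: c_def central_coeff_def power_mult_distrib power_mult power_divide field_simps eval_nat_numeral)
    qed
    then show ?thesis by (simp add: I0K0_remainder_def I0K0_trunc_def algebra_simps)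
  qed
  finally show ?case
  proof (rule has_bochner_integral_cong_AE[THEN iffD1, rotated -1])
    show "AE v in lborel. indicator {0<..} v *\<^sub>R ((v ^ (2 * M) * (bessel_K0 (z * v))\<^sup>2 - (bessel_K0 z)\<^sup>2) / (1 - v\<^sup>2)) -
      indicator {0<..} v *\<^sub>R (v ^ (2 * M) * (bessel_K0 (z * v))\<^sup>2) =
      indicator {0<..} v *\<^sub>R ((v ^ (2 * Suc M) * (bessel_K0 (z * v))\<^sup>2 - (bessel_K0 z)\<^sup>2) / (1 - v\<^sup>2))"
    proof (rule eventually_mono[OF AE_lborel_singleton[of 1]])
      fix v :: real assume v: "v \<noteq> 1"
      \<comment> \<open>The geometric series identity \<open>v ^ (2 * M) / (1 - v\<^sup>2) - v ^ (2
        * M) = v ^ (2 * Suc M) / (1 - v\<^sup>2)\<close>, which holds off the null set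
        \<open>v = 1\<close>.\<close>
      have "((v ^ (2 * M) * K - L) / (1 - v\<^sup>2)) - v ^ (2 * M) * K = (v ^ (2 * Suc M) * K - L) / (1 - v\<^sup>2)" if "v > 0" for K L
      proof -
        have "1 - v\<^sup>2 \<noteq> 0" using v that by (simp add: power2_eq_1_iff)
        then show ?thesis by (simp add: field_simps power2_eq_square)
      qed
      then show "indicator {0<..} v *\<^sub>R ((v ^ (2 * M) * (bessel_K0 (z * v))\<^sup>2 - (bessel_K0 z)\<^sup>2) / (1 - v\<^sup>2)) -
        indicator {0<..} v *\<^sub>R (v ^ (2 * M) * (bessel_K0 (z * v))\<^sup>2) =
        indicator {0<..} v *\<^sub>R ((v ^ (2 * Suc M) * (bessel_K0 (z * v))\<^sup>2 - (bessel_K0 z)\<^sup>2) / (1 - v\<^sup>2))"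
        by (auto split: split_indicator)
    qed
  qed auto
qed

section \<open>Asymptotic power series\<close>

text \<open>A Poincare expansion along an arbitrary filter in powers of a scale \<open>h\<close>.
  With the coefficients kept as a formal power series, products, inverses and compositions of
  expansions become arithmetic in \<open>real fps\<close>. The case \<open>n = 0\<close> states
  boundedness.\<close>

definition asymp_series :: "'a filter \<Rightarrow> ('a \<Rightarrow> real) \<Rightarrow> ('a \<Rightarrow> real) \<Rightarrow> real fps \<Rightarrow> bool" where
  "asymp_series F h f P \<longleftrightarrow> (\<forall>n. (\<lambda>x. f x - (\<Sum>k<n. fps_nth P k * h x ^ k)) \<in> O[F](\<lambda>x. h x ^ n))"

lemma asymp_seriesD:
  "asymp_series F h f P \<Longrightarrow> (\<lambda>x. f x - (\<Sum>k<n. fps_nth P k * h x ^ k)) \<in> O[F](\<lambda>x. h x ^ n)"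
  by (simp add: asymp_series_def)

lemma asymp_series_bounded: "asymp_series F h f P \<Longrightarrow> f \<in> O[F](\<lambda>_. 1)"
  using asymp_seriesD[of F h f P 0] by simp

lemma asymp_series_cong:
  assumes "asymp_series F h f P" "eventually (\<lambda>x. f x = g x) F"
  shows "asymp_series F h g P"
  unfolding asymp_series_def
proof
  fix n
  have "eventually (\<lambda>x. f x - (\<Sum>k<n. fps_nth P k * h x ^ k) = g x - (\<Sum>k<n. fps_nth P k * h x ^ k)) F"
    using assms(2) by eventually_elim simp
  from landau_o.big.in_cong[OF this] asymp_seriesD[OF assms(1), of n]
  show "(\<lambda>x. g x - (\<Sum>k<n. fps_nth P k * h x ^ k)) \<in> O[F](\<lambda>x. h x ^ n)" by simp
qed

lemma bigo_power_mono:
  fixes h :: "'a \<Rightarrow> real"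
  assumes h: "h \<in> O[F](\<lambda>_. 1)" and mn: "m \<le> n"
  shows "(\<lambda>x. h x ^ n) \<in> O[F](\<lambda>x. h x ^ m)"
proof -
  have "(\<lambda>x. h x ^ m * h x ^ (n - m)) \<in> O[F](\<lambda>x. h x ^ m * 1 ^ (n - m))"
    by (intro landau_o.big.mult landau_o.big_power h) auto
  then show ?thesis using mn by (simp add: power_add[symmetric])
qed

lemma bigo_partial_sum:
  fixes h :: "'a \<Rightarrow> real"
  assumes h: "h \<in> O[F](\<lambda>_. 1)"
  shows "(\<lambda>x. \<Sum>k<n. c k * h x ^ k) \<in> O[F](\<lambda>_. 1)"
  using bigo_power_mono[OF h, of 0] by (intro big_sum_in_bigo) (auto intro: landau_o.big.cmult_in_iff[THEN iffD2])

text \<open>For bounded \<open>h\<close> the surplus terms of a higher order are themselves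
  \<open>O(h ^ n)\<close>, so an expansion has to be verified only for large
  \<open>n\<close>.\<close>

lemma asymp_seriesI_ge:
  assumes h: "h \<in> O[F](\<lambda>_. 1)"
    and "\<And>n. n \<ge> N \<Longrightarrow> (\<lambda>x. f x - (\<Sum>k<n. fps_nth P k * h x ^ k)) \<in> O[F](\<lambda>x. h x ^ n)"
  shows "asymp_series F h f P"
  unfolding asymp_series_def
proof
  fix n
  show "(\<lambda>x. f x - (\<Sum>k<n. fps_nth P k * h x ^ k)) \<in> O[F](\<lambda>x. h x ^ n)"
  proof (cases "n \<ge> N")
    case False
    then have nN: "n \<le> N" by simp
    have "(\<lambda>x. (f x - (\<Sum>k<N. fps_nth P k * h x ^ k)) + (\<Sum>k=n..<N. fps_nth P k * h x ^ k)) \<in> O[F](\<lambda>x. h x ^ n)"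
    proof (rule sum_in_bigo(1))
      show "(\<lambda>x. f x - (\<Sum>k<N. fps_nth P k * h x ^ k)) \<in> O[F](\<lambda>x. h x ^ n)"
        using assms(2)[of N] bigo_power_mono[OF h nN] by (blast intro: landau_o.big_trans)
      show "(\<lambda>x. \<Sum>k=n..<N. fps_nth P k * h x ^ k) \<in> O[F](\<lambda>x. h x ^ n)"
        using bigo_power_mono[OF h] by (intro big_sum_in_bigo) auto
    qed
    also have "(\<lambda>x. (f x - (\<Sum>k<N. fps_nth P k * h x ^ k)) + (\<Sum>k=n..<N. fps_nth P k * h x ^ k)) =
        (\<lambda>x. f x - (\<Sum>k<n. fps_nth P k * h x ^ k))"
    proof
      fix x
      have "(\<Sum>k<N. fps_nth P k * h x ^ k) = (\<Sum>k<n. fps_nth P k * h x ^ k) + (\<Sum>k=n..<N. fps_nth P k * h x ^ k)"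
        using nN by (simp add: sum.atLeastLessThan_concat lessThan_atLeast0)
      then show "(f x - (\<Sum>k<N. fps_nth P k * h x ^ k)) + (\<Sum>k=n..<N. fps_nth P k * h x ^ k) =
        f x - (\<Sum>k<n. fps_nth P k * h x ^ k)" by simp
    qed
    finally show ?thesis .
  qed (use assms(2) in simp)
qed

lemma asymp_series_const: "h \<in> O[F](\<lambda>_. 1) \<Longrightarrow> asymp_series F h (\<lambda>_. c) (fps_const c)"
proof (rule asymp_seriesI_ge[of _ _ 1])
  fix n :: nat assume "n \<ge> 1"
  have "(\<Sum>k<n. fps_nth (fps_const c) k * h x ^ k) = c" for x
    using \<open>n \<ge> 1\<close> by (subst sum.remove[of _ 0]) auto
  then show "(\<lambda>x. c - (\<Sum>k<n. fps_nth (fps_const c) k * h x ^ k)) \<in> O[F](\<lambda>x. h x ^ n)" by simp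
qed

lemma asymp_series_ident: "h \<in> O[F](\<lambda>_. 1) \<Longrightarrow> asymp_series F h h fps_X"
proof (rule asymp_seriesI_ge[of _ _ 2])
  fix n :: nat assume "n \<ge> 2"
  have "(\<Sum>k<n. fps_nth fps_X k * h x ^ k) = h x" for x
    using \<open>n \<ge> 2\<close> by (subst sum.remove[of _ 1]) auto
  then show "(\<lambda>x. h x - (\<Sum>k<n. fps_nth fps_X k * h x ^ k)) \<in> O[F](\<lambda>x. h x ^ n)" by simp
qed

lemma asymp_series_add:
  assumes "asymp_series F h f P" "asymp_series F h g Q"
  shows "asymp_series F h (\<lambda>x. f x + g x) (P + Q)"
  unfolding asymp_series_def
proof
  fix n
  show "(\<lambda>x. f x + g x - (\<Sum>k<n. fps_nth (P + Q) k * h x ^ k)) \<in> O[F](\<lambda>x. h x ^ n)"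
    using sum_in_bigo(1)[OF asymp_seriesD[OF assms(1), of n] asymp_seriesD[OF assms(2), of n]]
    by (simp add: algebra_simps sum.distrib)
qed

lemma asymp_series_sum:
  assumes "h \<in> O[F](\<lambda>_. 1)" "\<And>i. i \<in> A \<Longrightarrow> asymp_series F h (f i) (P i)"
  shows "asymp_series F h (\<lambda>x. \<Sum>i\<in>A. f i x) (\<Sum>i\<in>A. P i)"
  using assms(2)
proof (induction A rule: infinite_finite_induct)
  case (insert i A)
  then show ?case by (simp add: asymp_series_add)
qed (use asymp_series_const[OF assms(1), of 0] in simp_all)

lemma fps_partial_sum_mult:
  fixes P Q :: "real fps"
  shows "(\<Sum>k<n. fps_nth P k * x ^ k) * (\<Sum>k<n. fps_nth Q k * x ^ k) = (\<Sum>k<n. fps_nth (P * Q) k * x ^ k) +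
    (\<Sum>(i, j)\<in>{(i, j). i < n \<and> j < n \<and> i + j \<ge> n}. fps_nth P i * fps_nth Q j * x ^ (i + j))"
proof -
  let ?s = "\<lambda>P x. \<Sum>k<n. fps_nth P k * x ^ k"
  let ?I = "{(i, j). i < n \<and> j < n \<and> i + j \<ge> n}"
  have fin: "finite ?I" by (rule finite_subset[of _ "{..<n} \<times> {..<n}"]) auto
  have "?s P x * ?s Q x = (\<Sum>(i, j)\<in>{..<n} \<times> {..<n}. fps_nth P i * fps_nth Q j * x ^ (i + j))"
    by (simp add: sum_product sum.cartesian_product power_add mult_ac)
  also have "{..<n} \<times> {..<n} = {(i, j). i + j < n} \<union> ?I" by auto
  also have "(\<Sum>(i, j)\<in>{(i, j). i + j < n} \<union> ?I. fps_nth P i * fps_nth Q j * x ^ (i + j)) =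
    (\<Sum>(i, j)\<in>{(i, j). i + j < n}. fps_nth P i * fps_nth Q j * x ^ (i + j)) +
    (\<Sum>(i, j)\<in>?I. fps_nth P i * fps_nth Q j * x ^ (i + j))"
    by (intro sum.union_disjoint fin finite_subset[of "{(i, j). i + j < n}" "{..<n} \<times> {..<n}"]) auto
  also have "(\<Sum>(i, j)\<in>{(i, j). i + j < n}. fps_nth P i * fps_nth Q j * x ^ (i + j)) =
    (\<Sum>k<n. \<Sum>i\<le>k. fps_nth P i * fps_nth Q (k - i) * x ^ (i + (k - i)))"
    by (rule sum.triangle_reindex)
  also have "\<dots> = ?s (P * Q) x"
    by (intro sum.cong) (auto simp: fps_mult_nth sum_distrib_right atLeast0AtMost intro!: sum.cong)
  finally show ?thesis .
qed

lemma asymp_series_mult: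
  assumes h: "h \<in> O[F](\<lambda>_. 1)" and f: "asymp_series F h f P" and g: "asymp_series F h g Q"
  shows "asymp_series F h (\<lambda>x. f x * g x) (P * Q)"
  unfolding asymp_series_def
proof
  fix n
  let ?s = "\<lambda>P x. \<Sum>k<n. fps_nth P k * h x ^ k"
  let ?I = "{(i, j). i < n \<and> j < n \<and> i + j \<ge> n}"
  have prod: "?s P x * ?s Q x = ?s (P * Q) x + (\<Sum>(i, j)\<in>?I. fps_nth P i * fps_nth Q j * h x ^ (i + j))" for x
    by (rule fps_partial_sum_mult)
  have "(\<lambda>x. (f x - ?s P x) * g x + ?s P x * (g x - ?s Q x) + (\<Sum>(i, j)\<in>?I. fps_nth P i * fps_nth Q j * h x ^ (i + j))) \<in> O[F](\<lambda>x. h x ^ n)"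
  proof (intro sum_in_bigo)
    show "(\<lambda>x. (f x - ?s P x) * g x) \<in> O[F](\<lambda>x. h x ^ n)"
      using landau_o.big.mult[OF asymp_seriesD[OF f, of n] asymp_series_bounded[OF g]] by simp
    show "(\<lambda>x. ?s P x * (g x - ?s Q x)) \<in> O[F](\<lambda>x. h x ^ n)"
      using landau_o.big.mult[OF bigo_partial_sum[OF h] asymp_seriesD[OF g, of n]] by simp
    show "(\<lambda>x. \<Sum>(i, j)\<in>?I. fps_nth P i * fps_nth Q j * h x ^ (i + j)) \<in> O[F](\<lambda>x. h x ^ n)"
    proof (rule big_sum_in_bigo)
      fix p assume "p \<in> ?I"
      then show "(\<lambda>x. case p of (i, j) \<Rightarrow> fps_nth P i * fps_nth Q j * h x ^ (i + j)) \<in> O[F](\<lambda>x. h x ^ n)"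
        using bigo_power_mono[OF h] by (auto intro: landau_o.big.cmult_in_iff[THEN iffD2])
    qed
  qed
  also have "(\<lambda>x. (f x - ?s P x) * g x + ?s P x * (g x - ?s Q x) + (\<Sum>(i, j)\<in>?I. fps_nth P i * fps_nth Q j * h x ^ (i + j))) =
      (\<lambda>x. f x * g x - ?s (P * Q) x)"
  proof
    fix x
    have "(\<Sum>(i, j)\<in>?I. fps_nth P i * fps_nth Q j * h x ^ (i + j)) = ?s P x * ?s Q x - ?s (P * Q) x"
      using prod[of x] by simp
    then show "(f x - ?s P x) * g x + ?s P x * (g x - ?s Q x) + (\<Sum>(i, j)\<in>?I. fps_nth P i * fps_nth Q j * h x ^ (i + j)) =
      f x * g x - ?s (P * Q) x"
      by (simp add: algebra_simps)
  qed
  finally show "(\<lambda>x. f x * g x - ?s (P * Q) x) \<in> O[F](\<lambda>x. h x ^ n)" .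
qed

lemma asymp_series_cmult:
  assumes h: "h \<in> O[F](\<lambda>_. 1)" and f: "asymp_series F h f P"
  shows "asymp_series F h (\<lambda>x. c * f x) (fps_const c * P)"
  by (rule asymp_series_mult[OF h asymp_series_const[OF h] f])

lemma asymp_series_diff:
  assumes h: "h \<in> O[F](\<lambda>_. 1)" and f: "asymp_series F h f P" and g: "asymp_series F h g Q"
  shows "asymp_series F h (\<lambda>x. f x - g x) (P - Q)"
proof -
  have eq: "P - Q = P + fps_const (- 1) * Q"
    by (simp add: fps_eq_iff)
  show ?thesis
    using asymp_series_add[OF f asymp_series_cmult[OF h g, of "-1"]] unfolding eq by simp
qed

lemma asymp_series_power:
  assumes h: "h \<in> O[F](\<lambda>_. 1)" and f: "asymp_series F h f P"
  shows "asymp_series F h (\<lambda>x. f x ^ n) (P ^ n)"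
  by (induction n) (auto simp: fps_const_1_eq_1[symmetric] asymp_series_const h f intro!: asymp_series_mult simp del: fps_const_1_eq_1)

lemma asymp_series_imp_tendsto:
  assumes h: "(h \<longlongrightarrow> 0) F" and f: "asymp_series F h f P"
  shows "(f \<longlongrightarrow> fps_nth P 0) F"
proof -
  have "(\<lambda>x. f x - fps_nth P 0) \<in> O[F](h)"
    using asymp_seriesD[OF f, of 1] by simp
  moreover have "h \<in> o[F](\<lambda>_. 1)" using h by (intro smalloI_tendsto) auto
  ultimately have "(\<lambda>x. f x - fps_nth P 0) \<in> o[F](\<lambda>_. 1)"
    by (rule landau_o.big_small_trans)
  from smalloD_tendsto[OF this] have "((\<lambda>x. f x - fps_nth P 0) \<longlongrightarrow> 0) F" by simp
  then show ?thesis by (simp add: LIM_zero_iff)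
qed

lemma tendsto_imp_bigo_1: "(h \<longlongrightarrow> (c::real)) F \<Longrightarrow> h \<in> O[F](\<lambda>_. 1)"
  by (rule bigoI_tendsto) auto

text \<open>Past its first \<open>n\<close> terms the series is \<open>y ^ n\<close> times a power
  series of positive radius, which is bounded near \<open>0\<close> by continuity.\<close>

lemma has_fps_expansion_bigo:
  fixes G :: "real \<Rightarrow> real"
  assumes "G has_fps_expansion Q"
  shows "(\<lambda>y. G y - (\<Sum>k<n. fps_nth Q k * y ^ k)) \<in> O[nhds 0](\<lambda>y. y ^ n)"
proof -
  define R where "R = fps_shift n Q"
  have "fps_conv_radius Q > 0" using assms by (simp add: has_fps_expansion_def)
  then have R: "fps_conv_radius R > 0" by (simp add: R_def)
  have "isCont (eval_fps R) 0"
    using R by (intro continuous_eval_fps) (auto simp: zero_ereal_def)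
  then have "(eval_fps R \<longlongrightarrow> eval_fps R 0) (nhds 0)"
    by (simp add: isCont_def tendsto_at_iff_tendsto_nhds)
  then have "eval_fps R \<in> O[nhds 0](\<lambda>_. 1)" by (rule tendsto_imp_bigo_1)
  then have "(\<lambda>y. y ^ n * eval_fps R y) \<in> O[nhds 0](\<lambda>y. y ^ n * 1)"
    by (intro landau_o.big.mult) auto
  moreover have "eventually (\<lambda>y. y ^ n * eval_fps R y = G y - (\<Sum>k<n. fps_nth Q k * y ^ k)) (nhds 0)"
  proof -
    have "eventually (\<lambda>y. eval_fps Q y = G y) (nhds 0)" using assms by (simp add: has_fps_expansion_def)
    moreover have "eventually (\<lambda>y. y \<in> eball 0 (fps_conv_radius Q)) (nhds (0::real))"
      using \<open>fps_conv_radius Q > 0\<close> by (intro eventually_nhds_in_open) (auto simp: zero_ereal_def)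
    ultimately show ?thesis
    proof eventually_elim
      case (elim y)
      then have sm: "summable (\<lambda>k. fps_nth Q k * y ^ k)"
        by (intro summable_fps) (simp add: in_eball_iff)
      have "G y = (\<Sum>k. fps_nth Q k * y ^ k)" using elim by (simp add: eval_fps_def)
      also have "\<dots> = (\<Sum>k. fps_nth Q (k + n) * y ^ (k + n)) + (\<Sum>k<n. fps_nth Q k * y ^ k)"
        by (rule suminf_split_initial_segment[OF sm])
      also have "(\<Sum>k. fps_nth Q (k + n) * y ^ (k + n)) = y ^ n * eval_fps R y"
      proof -
        have "summable (\<lambda>k. fps_nth R k * y ^ k)"
          using elim by (intro summable_fps) (simp add: R_def in_eball_iff)
        then show ?thesis unfolding eval_fps_def
          by (subst suminf_mult[symmetric]) (auto simp: R_def power_add mult_ac)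
      qed
      finally show ?case by simp
    qed
  qed
  ultimately show ?thesis by (simp add: landau_o.big.in_cong)
qed

text \<open>Since \<open>P\<close> has no constant term, \<open>P ^ k\<close> contributes nothing
  below order \<open>k\<close>; hence the Taylor polynomial of \<open>G\<close> of degree below
  \<open>n\<close> already yields all coefficients below \<open>n\<close>.\<close>

lemma asymp_series_compose:
  fixes G :: "real \<Rightarrow> real"
  assumes h: "(h \<longlongrightarrow> 0) F" and f: "asymp_series F h f P" and P0: "fps_nth P 0 = 0"
    and G: "G has_fps_expansion Q"
  shows "asymp_series F h (\<lambda>x. G (f x)) (Q oo P)"
  unfolding asymp_series_def
proof
  fix n
  note h1 = tendsto_imp_bigo_1[OF h]
  have f0: "(f \<longlongrightarrow> 0) F" using asymp_series_imp_tendsto[OF h f] P0 by simp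
  have "f \<in> O[F](h)" using asymp_seriesD[OF f, of 1] P0 by simp
  then have fn: "(\<lambda>x. f x ^ n) \<in> O[F](\<lambda>x. h x ^ n)" by (rule landau_o.big_power)
  have 1: "(\<lambda>x. G (f x) - (\<Sum>k<n. fps_nth Q k * f x ^ k)) \<in> O[F](\<lambda>x. h x ^ n)"
    using landau_o.big_trans[OF landau_o.big.compose[OF has_fps_expansion_bigo[OF G, of n] f0] fn] .
  have "asymp_series F h (\<lambda>x. \<Sum>k<n. fps_nth Q k * f x ^ k) (\<Sum>k<n. fps_const (fps_nth Q k) * P ^ k)"
    by (intro asymp_series_sum asymp_series_cmult asymp_series_power h1 f)
  from asymp_seriesD[OF this, of n]
  have 2: "(\<lambda>x. (\<Sum>k<n. fps_nth Q k * f x ^ k) - (\<Sum>j<n. fps_nth (\<Sum>k<n. fps_const (fps_nth Q k) * P ^ k) j * h x ^ j)) \<in> O[F](\<lambda>x. h x ^ n)" .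
  have "fps_nth (\<Sum>k<n. fps_const (fps_nth Q k) * P ^ k) j = fps_nth (Q oo P) j" if "j < n" for j
  proof -
    have "fps_nth (\<Sum>k<n. fps_const (fps_nth Q k) * P ^ k) j = (\<Sum>k<n. fps_nth Q k * fps_nth (P ^ k) j)"
      by (simp add: fps_sum_nth)
    also have "\<dots> = (\<Sum>k\<in>{0..j}. fps_nth Q k * fps_nth (P ^ k) j)"
      using that P0 by (intro sum.mono_neutral_right) (auto simp: startsby_zero_power_prefix)
    finally show ?thesis by (simp add: fps_compose_nth)
  qed
  then have "(\<Sum>j<n. fps_nth (\<Sum>k<n. fps_const (fps_nth Q k) * P ^ k) j * h x ^ j) = (\<Sum>j<n. fps_nth (Q oo P) j * h x ^ j)" for x
    by (intro sum.cong) auto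
  with sum_in_bigo(1)[OF 1 2] show "(\<lambda>x. G (f x) - (\<Sum>k<n. fps_nth (Q oo P) k * h x ^ k)) \<in> O[F](\<lambda>x. h x ^ n)"
    by simp
qed

lemma asymp_series_inverse:
  assumes h: "(h \<longlongrightarrow> 0) F" and f: "asymp_series F h f P" and P0: "fps_nth P 0 \<noteq> 0"
  shows "asymp_series F h (\<lambda>x. inverse (f x)) (inverse P)"
proof -
  define c where "c = fps_nth P 0"
  note h1 = tendsto_imp_bigo_1[OF h]
  have "(\<lambda>y. inverse (c + y)) has_fps_expansion inverse (fps_const c + fps_X)"
    using P0 by (intro fps_expansion_intros) (auto simp: c_def)
  from asymp_series_compose[OF h asymp_series_diff[OF h1 f asymp_series_const[OF h1, of c]] _ this]
  have "asymp_series F h (\<lambda>x. inverse (f x)) (inverse (fps_const c + fps_X) oo (P - fps_const c))"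
    by (simp add: c_def)
  also have "inverse (fps_const c + fps_X) oo (P - fps_const c) = inverse P"
    using P0 by (subst fps_inverse_compose) (auto simp: c_def fps_compose_add_distrib)
  finally show ?thesis .
qed

lemma asymp_series_filter:
  assumes "asymp_series F h f P" "filterlim g F G"
  shows "asymp_series G (\<lambda>x. h (g x)) (\<lambda>x. f (g x)) P"
  unfolding asymp_series_def using landau_o.big.compose[OF asymp_seriesD[OF assms(1)] assms(2)] by blast

lemma asymp_series_rescale:
  assumes "asymp_series F (\<lambda>x. c * h x) f P"
  shows "asymp_series F h f (Abs_fps (\<lambda>k. fps_nth P k * c ^ k))"
  unfolding asymp_series_def
proof
  fix n
  have "(\<lambda>x. (c * h x) ^ n) \<in> O[F](\<lambda>x. h x ^ n)" by (simp add: power_mult_distrib)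
  from landau_o.big_trans[OF asymp_seriesD[OF assms, of n] this]
  show "(\<lambda>x. f x - (\<Sum>k<n. fps_nth (Abs_fps (\<lambda>k. fps_nth P k * c ^ k)) k * h x ^ k)) \<in> O[F](\<lambda>x. h x ^ n)"
    by (simp add: power_mult_distrib mult_ac)
qed

text \<open>Here the coefficients \<open>g j\<close> depend on \<open>x\<close> and have expansions
  of their own; collecting equal powers of \<open>h\<close> sums along diagonals. The situation
  arises when integrand and weight both vary with the large parameter.\<close>

lemma asymp_series_family:
  assumes h: "h \<in> O[F](\<lambda>_. 1)"
    and f: "\<And>J. J \<ge> 1 \<Longrightarrow> (\<lambda>x. f x - (\<Sum>j<J. h x ^ j * g j x)) \<in> O[F](\<lambda>x. h x ^ J)"
    and g: "\<And>j. asymp_series F h (g j) (P j)"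
  shows "asymp_series F h f (Abs_fps (\<lambda>k. \<Sum>j\<le>k. fps_nth (P j) (k - j)))"
proof (rule asymp_seriesI_ge[OF h, of 1])
  fix n :: nat assume n: "n \<ge> 1"
  have "asymp_series F h (\<lambda>x. \<Sum>j<n. h x ^ j * g j x) (\<Sum>j<n. fps_X ^ j * P j)"
    by (intro asymp_series_sum asymp_series_mult asymp_series_power asymp_series_ident h g)
  from sum_in_bigo(1)[OF f[OF n] asymp_seriesD[OF this, of n]]
  have "(\<lambda>x. f x - (\<Sum>k<n. fps_nth (\<Sum>j<n. fps_X ^ j * P j) k * h x ^ k)) \<in> O[F](\<lambda>x. h x ^ n)"
    by simp
  moreover have "fps_nth (\<Sum>j<n. fps_X ^ j * P j) k = (\<Sum>j\<le>k. fps_nth (P j) (k - j))" if "k < n" for k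
  proof -
    have "fps_nth (\<Sum>j<n. fps_X ^ j * P j) k = (\<Sum>j<n. if k < j then 0 else fps_nth (P j) (k - j))"
      by (simp add: fps_sum_nth fps_X_power_mult_nth)
    also have "\<dots> = (\<Sum>j\<le>k. if k < j then 0 else fps_nth (P j) (k - j))"
      using that by (intro sum.mono_neutral_right) auto
    finally show ?thesis by simp
  qed
  ultimately show "(\<lambda>x. f x - (\<Sum>k<n. fps_nth (Abs_fps (\<lambda>k. \<Sum>j\<le>k. fps_nth (P j) (k - j))) k * h x ^ k)) \<in> O[F](\<lambda>x. h x ^ n)"
    by simp
qed


section \<open>First-order recursions: formal and actual solutions\<close>

definition fps_shift_inv :: "real fps" where
  "fps_shift_inv = fps_X * inverse (1 + fps_X)"

text \<open>With \<open>h = 1 / m\<close> one has \<open>1 / (m + 1) = h / (1 + h)\<close>, so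
  composition with \<open>fps_shift_inv\<close> is the shift from \<open>m\<close> to
  \<open>m + 1\<close> on the level of expansions.\<close>

lemma inverse_Suc_asymp_series:
  "asymp_series sequentially (\<lambda>m. 1 / real m) (\<lambda>m. 1 / real (Suc m)) fps_shift_inv"
proof -
  have h: "((\<lambda>m. 1 / real m) \<longlongrightarrow> 0) sequentially" by real_asymp
  note h1 = tendsto_imp_bigo_1[OF h]
  have "asymp_series sequentially (\<lambda>m. 1 / real m) (\<lambda>m. 1 / real m * inverse (1 + 1 / real m)) fps_shift_inv"
    unfolding fps_shift_inv_def
    using asymp_series_const[OF h1, of 1]
    by (intro asymp_series_mult asymp_series_inverse asymp_series_add asymp_series_ident h h1) simp_all
  then show ?thesis
    by (rule asymp_series_cong) (auto simp: field_simps intro!: eventually_mono[OF eventually_gt_at_top[of 0]])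
qed

lemma fps_shift_inv_nth_0 [simp]: "fps_nth fps_shift_inv 0 = 0"
  by (simp add: fps_shift_inv_def)

lemma fps_shift_inv_power: "fps_shift_inv ^ k = fps_X ^ k * inverse (1 + fps_X) ^ k"
  by (simp add: fps_shift_inv_def power_mult_distrib)

text \<open>The matrix of the operator \<open>S \<mapsto> Q * (S oo fps_shift_inv) - S\<close>. If
  \<open>Q\<close> begins with \<open>1\<close>, even the diagonal vanishes, because the shift
  alters a power of \<open>1 / m\<close> only at the next order.\<close>

definition rec_coeff :: "real fps \<Rightarrow> nat \<Rightarrow> nat \<Rightarrow> real" where
  "rec_coeff Q j n = fps_nth (Q * fps_shift_inv ^ j - fps_X ^ j) n"

lemma rec_coeff_eq_0:
  assumes "fps_nth Q 0 = 1" "n \<le> j"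
  shows "rec_coeff Q j n = 0"
proof (cases "n = j")
  case True
  have "fps_nth (inverse (1 + fps_X :: real fps) ^ j) 0 = 1" by (induction j) simp_all
  then show ?thesis using True assms
    by (simp add: rec_coeff_def fps_shift_inv_power mult.left_commute[of Q] fps_X_power_mult_nth)
next
  case False
  then show ?thesis using assms
    by (simp add: rec_coeff_def fps_shift_inv_power mult.left_commute[of Q] fps_X_power_mult_nth)
qed

lemma rec_coeff_Suc:
  assumes "fps_nth Q 0 = 1"
  shows "rec_coeff Q j (Suc j) = fps_nth Q 1 - real j"
proof -
  have i1: "fps_nth (inverse (1 + fps_X :: real fps) ^ j) 1 = - real j"
  proof (induction j)
    case (Suc j)
    have "fps_nth (inverse (1 + fps_X :: real fps)) 1 = -1"
    proof -
      have "fps_nth ((1 + fps_X) * inverse (1 + fps_X :: real fps)) 1 = 0"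
        by (subst inverse_mult_eq_1') auto
      then show ?thesis by (simp add: fps_mult_nth_1)
    qed
    moreover have "fps_nth (inverse (1 + fps_X :: real fps) ^ j) 0 = 1" by (induction j) simp_all
    ultimately show ?case using Suc by (simp add: fps_mult_nth_1)
  qed simp
  have "fps_nth (inverse (1 + fps_X :: real fps) ^ j) 0 = 1" by (induction j) simp_all
  then show ?thesis using assms i1
    by (simp add: rec_coeff_def fps_shift_inv_power mult.left_commute[of Q] fps_X_power_mult_nth fps_mult_nth_1)
qed

lemma rec_operator_nth:
  "fps_nth (Q * (S oo fps_shift_inv) - S) n = (\<Sum>j\<le>n. fps_nth S j * rec_coeff Q j n)"
proof -
  have "fps_nth (Q * (S oo fps_shift_inv)) n = (\<Sum>i\<le>n. fps_nth Q i * (\<Sum>j\<le>n. fps_nth S j * fps_nth (fps_shift_inv ^ j) (n - i)))"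
    unfolding fps_mult_nth fps_compose_nth atLeast0AtMost
    by (intro sum.cong refl arg_cong2[where f = "(*)"] sum.mono_neutral_left)
       (auto simp: startsby_zero_power_prefix)
  also have "\<dots> = (\<Sum>i\<le>n. \<Sum>j\<le>n. fps_nth S j * (fps_nth Q i * fps_nth (fps_shift_inv ^ j) (n - i)))"
    by (simp add: sum_distrib_left mult_ac)
  also have "\<dots> = (\<Sum>j\<le>n. \<Sum>i\<le>n. fps_nth S j * (fps_nth Q i * fps_nth (fps_shift_inv ^ j) (n - i)))"
    by (rule sum.swap)
  also have "\<dots> = (\<Sum>j\<le>n. fps_nth S j * fps_nth (Q * fps_shift_inv ^ j) n)"
    by (simp add: fps_mult_nth atLeast0AtMost sum_distrib_left)
  finally have 1: "fps_nth (Q * (S oo fps_shift_inv)) n = \<dots>" .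
  have "fps_nth S n = (\<Sum>j\<le>n. fps_nth S j * fps_nth (fps_X ^ j) n)"
    by (subst sum.remove[of _ n]) (auto simp: fps_X_power_nth)
  then show ?thesis using 1
    by (simp add: rec_coeff_def right_diff_distrib sum_subtractf)
qed

text \<open>Forward substitution: the equation at order \<open>k + 1\<close> determines the
  coefficient of index \<open>k\<close> through the subdiagonal entry
  \<open>fps_nth Q 1 - real k\<close>. The start \<open>s0\<close> is a parameter because this entry
  may vanish at \<open>k = 0\<close>, as it does for Stirling's series.\<close>

fun rec_solution :: "real fps \<Rightarrow> real fps \<Rightarrow> real \<Rightarrow> nat \<Rightarrow> real" where
  "rec_solution Q B s0 k = (if k = 0 then s0 else
    (fps_nth B (Suc k) - (\<Sum>j<k. rec_solution Q B s0 j * rec_coeff Q j (Suc k))) / (fps_nth Q 1 - real k))"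

declare rec_solution.simps [simp del]

lemma rec_solution_correct:
  assumes Q0: "fps_nth Q 0 = 1" and B0: "fps_nth B 0 = 0" and B1: "fps_nth Q 1 * s0 = fps_nth B 1"
    and Q1: "\<And>k. k \<ge> 1 \<Longrightarrow> fps_nth Q 1 \<noteq> real k"
  defines "S \<equiv> Abs_fps (rec_solution Q B s0)"
  shows "Q * (S oo fps_shift_inv) - S = B"
proof (rule fps_ext)
  fix n
  show "fps_nth (Q * (S oo fps_shift_inv) - S) n = fps_nth B n"
  proof (cases n)
    case 0
    then show ?thesis using B0 Q0 by (simp add: rec_operator_nth rec_coeff_eq_0)
  next
    case (Suc k)
    have "fps_nth (Q * (S oo fps_shift_inv) - S) n =
        (\<Sum>j<k. fps_nth S j * rec_coeff Q j (Suc k)) + fps_nth S k * (fps_nth Q 1 - real k)"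
      unfolding rec_operator_nth Suc
      by (simp add: rec_coeff_eq_0[OF Q0] rec_coeff_Suc[OF Q0] lessThan_Suc_atMost[symmetric])
    also have "\<dots> = fps_nth B n"
    proof (cases "k = 0")
      case True
      then show ?thesis using B1 Suc by (simp add: S_def rec_solution.simps[of _ _ _ 0] mult.commute)
    next
      case False
      then have "fps_nth S k * (fps_nth Q 1 - real k) = fps_nth B (Suc k) - (\<Sum>j<k. fps_nth S j * rec_coeff Q j (Suc k))"
        using Q1[of k] by (simp add: S_def rec_solution.simps[of _ _ _ k])
      then show ?thesis using Suc by simp
    qed
    finally show ?thesis .
  qed
qed

text \<open>
  Telescoping: \<open>g * (y - S\<^sub>K)\<close> tends to \<open>0\<close> and has increments of size \<open>g m / m ^ K\<close>.
\<close>

lemma asymp_series_recursion: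
  fixes y q b g :: "nat \<Rightarrow> real"
  assumes q: "asymp_series sequentially (\<lambda>m. 1 / real m) q Q"
    and b: "asymp_series sequentially (\<lambda>m. 1 / real m) b B"
    and rec: "eventually (\<lambda>m. y (Suc m) * q m - y m = b m) sequentially"
    and S: "Q * (S oo fps_shift_inv) - S = B"
    and g: "eventually (\<lambda>m. g m > 0 \<and> g (Suc m) = g m * q m \<and> g (Suc m) \<le> g m) sequentially"
    and lim: "(\<lambda>m. g m * (y m - fps_nth S 0)) \<longlonglongrightarrow> 0"
  shows "asymp_series sequentially (\<lambda>m. 1 / real m) y S"
proof -
  let ?h = "\<lambda>m. 1 / real m"
  have h: "(?h \<longlongrightarrow> 0) sequentially" by real_asymp
  note h1 = tendsto_imp_bigo_1[OF h]
  define e where "e K m = y m - (\<Sum>k<K. fps_nth S k * ?h m ^ k)" for K m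
  have main: "e K \<in> O(\<lambda>m. ?h m ^ (K - 1))" if K: "K \<ge> 2" for K
  proof -
    define r where "r m = e K (Suc m) * q m - e K m" for m
    define T where "T = (\<Sum>k<K. fps_const (fps_nth S k) * fps_X ^ k)"
    have T_nth: "fps_nth T k = (if k < K then fps_nth S k else 0)" for k
      by (simp add: T_def fps_sum_nth fps_X_power_nth if_distrib cong: if_cong)
    have sum_asymp: "asymp_series sequentially ?h (\<lambda>m. \<Sum>k<K. fps_nth S k * ?h m ^ k) T"
      unfolding T_def by (intro asymp_series_sum asymp_series_cmult asymp_series_power asymp_series_ident h1)
    have sum_asymp': "asymp_series sequentially ?h (\<lambda>m. \<Sum>k<K. fps_nth S k * ?h (Suc m) ^ k) (T oo fps_shift_inv)"
    proof -
      have eq: "T oo fps_shift_inv = (\<Sum>k<K. fps_const (fps_nth S k) * fps_shift_inv ^ k)"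
        unfolding T_def by (simp add: fps_compose_sum_distrib fps_compose_mult_distrib fps_compose_power[symmetric])
      show ?thesis
        unfolding eq by (intro asymp_series_sum asymp_series_cmult asymp_series_power inverse_Suc_asymp_series h1)
    qed
    have 1: "asymp_series sequentially ?h (\<lambda>m. b m - ((\<Sum>k<K. fps_nth S k * ?h (Suc m) ^ k) * q m - (\<Sum>k<K. fps_nth S k * ?h m ^ k)))
        (B - ((T oo fps_shift_inv) * Q - T))"
      by (intro asymp_series_diff asymp_series_mult b q sum_asymp sum_asymp' h1)
    \<comment> \<open>At order \<open>k\<close> the operator sees only coefficients of index at most
      \<open>k\<close>, so the truncation satisfies the formal equation below order
      \<open>K\<close>.\<close>
    have 2: "fps_nth (B - ((T oo fps_shift_inv) * Q - T)) k = 0" if "k < K" for k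
    proof -
      have "fps_nth (Q * (T oo fps_shift_inv) - T) k = fps_nth (Q * (S oo fps_shift_inv) - S) k"
        unfolding rec_operator_nth using that by (intro sum.cong) (auto simp: T_nth)
      then show ?thesis unfolding S by (simp add: mult.commute)
    qed
    have "(\<Sum>k<K. fps_nth (B - ((T oo fps_shift_inv) * Q - T)) k * ?h m ^ k) = 0" for m
      by (intro sum.neutral) (use 2 in auto)
    with asymp_seriesD[OF 1, of K]
    have "(\<lambda>m. b m - ((\<Sum>k<K. fps_nth S k * ?h (Suc m) ^ k) * q m - (\<Sum>k<K. fps_nth S k * ?h m ^ k))) \<in> O(\<lambda>m. ?h m ^ K)"
      by (simp only: diff_zero)
    moreover have "eventually (\<lambda>m. b m - ((\<Sum>k<K. fps_nth S k * ?h (Suc m) ^ k) * q m - (\<Sum>k<K. fps_nth S k * ?h m ^ k)) = r m) sequentially"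
      using rec by eventually_elim (simp add: r_def e_def algebra_simps)
    ultimately have "r \<in> O(\<lambda>m. ?h m ^ K)" by (simp add: landau_o.big.in_cong)
    then obtain C where C: "C > 0" "eventually (\<lambda>m. norm (r m) \<le> C * norm (?h m ^ K)) sequentially"
      by (auto elim: landau_o.bigE)
    from eventually_conj[OF C(2) eventually_conj[OF g eventually_gt_at_top[of 0]]]
    obtain m0 where m0: "\<And>m. m \<ge> m0 \<Longrightarrow> norm (r m) \<le> C * norm (?h m ^ K) \<and> (g m > 0 \<and> g (Suc m) = g m * q m \<and> g (Suc m) \<le> g m) \<and> m > 0"
      unfolding eventually_sequentially by blast
    have g_anti: "g n \<le> g m" if "m \<ge> m0" "n \<ge> m" for m n
      using that(2)
    proof (induction n rule: dec_induct)
      case (step n)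
      then have "m0 \<le> n" using that(1) by simp
      then have "g (Suc n) \<le> g n" using m0 by blast
      from order_trans[OF this step.IH] show ?case .
    qed simp
    \<comment> \<open>\<open>g\<close> is an integrating factor: because of
      \<open>g (Suc m) = g m * q m\<close> the increments of \<open>u\<close> are
      \<open>g m * r m\<close>.\<close>
    define u where "u m = g m * e K m" for m
    have u_diff: "u (Suc m) - u m = g m * r m" if "m \<ge> m0" for m
      using m0[OF that] by (simp add: u_def r_def algebra_simps)
    \<comment> \<open>Solutions of the recursion differ by multiples of \<open>1 / g\<close>; the
      limit hypothesis singles out the right one. The remaining terms of \<open>e\<close> tend to
      \<open>0\<close> and \<open>g\<close> is bounded.\<close>
    have u_lim: "u \<longlonglongrightarrow> 0"
    proof -
      have "(\<lambda>m. \<Sum>k\<in>{1..<K}. fps_nth S k * ?h m ^ k) \<longlonglongrightarrow> (\<Sum>k\<in>{1..<K}. fps_nth S k * 0 ^ k)"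
        by (intro tendsto_intros h)
      then have l1: "(\<lambda>m. \<Sum>k\<in>{1..<K}. fps_nth S k * ?h m ^ k) \<longlonglongrightarrow> 0" by simp
      have "(\<lambda>m. g m * (\<Sum>k\<in>{1..<K}. fps_nth S k * ?h m ^ k)) \<longlonglongrightarrow> 0"
      proof (rule Lim_null_comparison)
        show "eventually (\<lambda>m. norm (g m * (\<Sum>k\<in>{1..<K}. fps_nth S k * ?h m ^ k)) \<le> g m0 * \<bar>\<Sum>k\<in>{1..<K}. fps_nth S k * ?h m ^ k\<bar>) sequentially"
        proof (rule eventually_mono[OF eventually_ge_at_top[of m0]])
          fix m assume "m \<ge> m0"
          then have "g m > 0" "g m \<le> g m0" using m0[of m] g_anti[of m0 m] by auto
          then show "norm (g m * (\<Sum>k\<in>{1..<K}. fps_nth S k * ?h m ^ k)) \<le> g m0 * \<bar>\<Sum>k\<in>{1..<K}. fps_nth S k * ?h m ^ k\<bar>"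
            by (simp add: abs_mult mult_right_mono)
        qed
        show "(\<lambda>m. g m0 * \<bar>\<Sum>k\<in>{1..<K}. fps_nth S k * ?h m ^ k\<bar>) \<longlonglongrightarrow> 0"
          using tendsto_mult_right_zero[OF tendsto_rabs_zero[OF l1]] by simp
      qed
      from tendsto_diff[OF lim this]
      have "(\<lambda>m. g m * (y m - fps_nth S 0) - g m * (\<Sum>k\<in>{1..<K}. fps_nth S k * ?h m ^ k)) \<longlonglongrightarrow> 0" by simp
      moreover have "g m * (y m - fps_nth S 0) - g m * (\<Sum>k\<in>{1..<K}. fps_nth S k * ?h m ^ k) = u m" for m
      proof -
        have "{..<K} = insert 0 {1..<K}" using K by auto
        then show ?thesis by (simp add: u_def e_def algebra_simps)
      qed
      ultimately show ?thesis by simp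
    qed
    have bound: "\<bar>u m\<bar> \<le> g m * (2 * C * ?h m ^ (K - 1))" if m: "m \<ge> m0" for m
    proof -
      have *: "\<bar>u m\<bar> \<le> \<bar>u n\<bar> + g m * (2 * C * ?h m ^ (K - 2)) * (?h m - ?h n)" if "n \<ge> m" for n
        using that
      proof (induction n rule: dec_induct)
        case (step n)
        have n: "n \<ge> m0" "n > 0" "m > 0" using step m m0 by auto
        have "\<bar>u (Suc n) - u n\<bar> = g n * \<bar>r n\<bar>" using u_diff[OF n(1)] m0[OF n(1)] by (simp add: abs_mult)
        also have "\<dots> \<le> g m * (C * ?h n ^ K)"
          using m0[OF n(1)] m0[OF m] g_anti[OF m step(1)] C(1) by (intro mult_mono) auto
        also have "?h n ^ K = ?h n ^ (K - 2) * ?h n ^ 2"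
          using power_add[of "?h n" "K - 2" 2] K by (simp only: le_add_diff_inverse2)
        also have "g m * (C * (?h n ^ (K - 2) * ?h n ^ 2)) \<le> g m * (C * (?h m ^ (K - 2) * (2 * (?h n - ?h (Suc n)))))"
        proof -
          \<comment> \<open>A telescoping majorant of \<open>1 / n\<^sup>2\<close>, so that summing
            the increments costs one power of \<open>1 / m\<close>.\<close>
          have "?h n ^ 2 \<le> 2 * (?h n - ?h (Suc n))"
          proof -
            have "?h n - ?h (Suc n) = 1 / (real n * (real n + 1))"
              using n by (simp add: diff_frac_eq add.commute)
            moreover have "real n * (real n + 1) \<le> 2 * real n ^ 2"
              using n mult_left_mono[of 1 "real n" "real n"] by (simp add: power2_eq_square distrib_left)
            then have "1 / real n ^ 2 \<le> 2 * (1 / (real n * (real n + 1)))"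
              using n by (simp add: divide_simps)
            ultimately show ?thesis by (simp add: power_divide)
          qed
          moreover have "?h n ^ (K - 2) \<le> ?h m ^ (K - 2)"
            using n step(1) by (intro power_mono) (auto simp: divide_simps)
          ultimately show ?thesis using C(1) m0[OF m] by (intro mult_left_mono mult_mono) auto
        qed
        finally have "\<bar>u (Suc n) - u n\<bar> \<le> g m * (2 * C * ?h m ^ (K - 2)) * (?h n - ?h (Suc n))"
          by (simp add: algebra_simps)
        with step.IH show ?case unfolding right_diff_distrib by linarith
      qed simp
      have "(\<lambda>n. \<bar>u n\<bar> + g m * (2 * C * ?h m ^ (K - 2)) * (?h m - ?h n)) \<longlonglongrightarrow> \<bar>0\<bar> + g m * (2 * C * ?h m ^ (K - 2)) * (?h m - 0)"
        by (intro tendsto_intros u_lim h)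
      from tendsto_lowerbound[OF this, of "\<bar>u m\<bar>"] *
      have "\<bar>u m\<bar> \<le> \<bar>0\<bar> + g m * (2 * C * ?h m ^ (K - 2)) * (?h m - 0)"
        by (auto simp: eventually_sequentially)
      also have "\<dots> = g m * (2 * C * ?h m ^ (K - 1))"
      proof -
        have "K - 1 = Suc (K - 2)" using K by simp
        then show ?thesis by simp
      qed
      finally show ?thesis .
    qed
    have "\<bar>e K m\<bar> \<le> 2 * C * ?h m ^ (K - 1)" if "m \<ge> m0" for m
      using bound[OF that] m0[OF that] by (simp add: u_def abs_mult)
    then show ?thesis
      by (intro landau_o.bigI[of "2 * C"]) (use C(1) in \<open>auto simp: eventually_sequentially\<close>)
  qed
  show ?thesis
  proof (rule asymp_seriesI_ge[OF h1, of 1])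
    fix n :: nat assume n: "n \<ge> 1"
    \<comment> \<open>The summation lost one order; the estimate is therefore used at
      \<open>Suc n\<close> and the last term, itself of order \<open>n\<close>, is put back.\<close>
    have "(\<lambda>m. e (Suc n) m + fps_nth S n * ?h m ^ n) \<in> O(\<lambda>m. ?h m ^ n)"
      using main[of "Suc n"] n by (intro sum_in_bigo) auto
    then show "(\<lambda>m. y m - (\<Sum>k<n. fps_nth S k * ?h m ^ k)) \<in> O(\<lambda>m. ?h m ^ n)"
      by (simp add: e_def)
  qed
qed

section \<open>Laplace integrals with saddle point 1\<close>

text \<open>\<open>v ^ m * exp (- m * v)\<close> divided by its maximum, which it attains at
  \<open>v = 1\<close>.\<close>

definition wt :: "nat \<Rightarrow> real \<Rightarrow> real" where
  "wt m v = (v * exp (1 - v)) ^ m"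

text \<open>The weight stays generic because the same linearity and domination rules serve two
  weights: \<open>wt m\<close> for the integrals at the saddle and \<open>gauss_wt\<close> for the
  Bessel functions.\<close>

definition wint :: "(real \<Rightarrow> real) \<Rightarrow> (real \<Rightarrow> real) \<Rightarrow> real" where
  "wint w f = (LINT v:{0<..}|lborel. w v * f v)"

abbreviation wint_integrable :: "(real \<Rightarrow> real) \<Rightarrow> (real \<Rightarrow> real) \<Rightarrow> bool" where
  "wint_integrable w f \<equiv> set_integrable lborel {0<..} (\<lambda>v. w v * f v)"

abbreviation bracket :: "nat \<Rightarrow> (real \<Rightarrow> real) \<Rightarrow> real" where
  "bracket m \<equiv> wint (wt m)"

abbreviation bracket_integrable :: "nat \<Rightarrow> (real \<Rightarrow> real) \<Rightarrow> bool" where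
  "bracket_integrable m \<equiv> wint_integrable (wt m)"

lemma wt_nonneg: "v > 0 \<Longrightarrow> 0 \<le> wt m v"
  by (simp add: wt_def)

lemma wt_measurable [measurable]: "wt m \<in> borel_measurable borel"
  unfolding wt_def by measurable

text \<open>Positive and negative powers in one statement; \<open>i \<le> m + n\<close> says that
  the weight compensates the singularity at \<open>0\<close>.\<close>

lemma bracket_power_aux:
  assumes m: "m > 0" and n: "i \<le> m + n"
  shows "bracket_integrable m (\<lambda>v. v ^ n / v ^ i)"
    and "bracket m (\<lambda>v. v ^ n / v ^ i) = exp (real m) * fact (m + n - i) / real m ^ (m + n - i + 1)"
proof -
  define k where "k = m + n - i"
  have "has_bochner_integral lborel (\<lambda>v. indicator {0<..} v *\<^sub>R (v ^ k * exp (- real m * v))) (fact k / real m ^ Suc k)"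
  proof (rule has_bochner_integral_nn_integral)
    show "(\<integral>\<^sup>+v. ennreal (indicator {0<..} v *\<^sub>R (v ^ k * exp (- real m * v))) \<partial>lborel) = ennreal (fact k / real m ^ Suc k)"
    proof -
      have "real m > 0" using m by simp
      from nn_integral_power_exp[OF this, of k, symmetric] show ?thesis
        by (simp only:) (intro nn_integral_cong, auto split: split_indicator)
    qed
  qed (auto split: split_indicator)
  from has_bochner_integral_mult_right[OF this, of "exp (real m)"]
  have *: "has_bochner_integral lborel (\<lambda>v. exp (real m) * (indicator {0<..} v *\<^sub>R (v ^ k * exp (- real m * v)))) (exp (real m) * (fact k / real m ^ Suc k))" by simp
  have eq: "exp (real m) * (indicator {0<..} v *\<^sub>R (v ^ k * exp (- real m * v))) = indicator {0<..} v *\<^sub>R (wt m v * (v ^ n / v ^ i))" for v :: real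
  proof (cases "v > 0")
    case True
    have "wt m v = v ^ m * exp (real m * (1 - v))"
      unfolding wt_def by (simp only: power_mult_distrib exp_of_nat_mult)
    also have "real m * (1 - v) = real m + (- real m * v)" by (simp add: algebra_simps)
    also have "exp \<dots> = exp (real m) * exp (- real m * v)" by (rule exp_add)
    finally have "wt m v * (v ^ n / v ^ i) = v ^ (m + n) / v ^ i * (exp (real m) * exp (- real m * v))"
      by (simp add: power_add)
    also have "v ^ (m + n) / v ^ i = v ^ k" using True n by (simp add: k_def power_diff)
    finally show ?thesis by (simp add: mult_ac)
  qed simp
  have "has_bochner_integral lborel (\<lambda>v. indicator {0<..} v *\<^sub>R (wt m v * (v ^ n / v ^ i))) (exp (real m) * (fact k / real m ^ Suc k))"
    using * unfolding eq .
  then show "bracket_integrable m (\<lambda>v. v ^ n / v ^ i)" "bracket m (\<lambda>v. v ^ n / v ^ i) = exp (real m) * fact (m + n - i) / real m ^ (m + n - i + 1)"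
    unfolding set_integrable_def wint_def set_lebesgue_integral_def has_bochner_integral_iff k_def by simp_all
qed

lemma bracket_power:
  assumes "m > 0"
  shows "bracket_integrable m (\<lambda>v. v ^ n)"
    and "bracket m (\<lambda>v. v ^ n) = exp (real m) * fact (m + n) / real m ^ (m + n + 1)"
  using bracket_power_aux[OF assms, of 0 n] by simp_all

lemma bracket_inverse_power:
  assumes "m > 0" "i \<le> m"
  shows "bracket_integrable m (\<lambda>v. 1 / v ^ i)"
    and "bracket m (\<lambda>v. 1 / v ^ i) = exp (real m) * fact (m - i) / real m ^ (m - i + 1)"
  using bracket_power_aux[OF assms(1), of i 0] assms(2) by simp_all

lemma bracket_one:
  assumes "m > 0"
  shows "bracket_integrable m (\<lambda>v. 1)" "bracket m (\<lambda>v. 1) = exp (real m) * fact m / real m ^ (m + 1)" "bracket m (\<lambda>v. 1) > 0"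
  using bracket_power[OF assms, of 0] assms by simp_all

lemma wint_add:
  assumes "wint_integrable w f" "wint_integrable w g"
  shows "wint_integrable w (\<lambda>v. f v + g v)" "wint w (\<lambda>v. f v + g v) = wint w f + wint w g"
  using set_integral_add[OF assms] by (simp_all add: wint_def distrib_left)

lemma wint_diff:
  assumes "wint_integrable w f" "wint_integrable w g"
  shows "wint_integrable w (\<lambda>v. f v - g v)" "wint w (\<lambda>v. f v - g v) = wint w f - wint w g"
  using set_integral_diff[OF assms] by (simp_all add: wint_def right_diff_distrib)

lemma wint_cmult:
  assumes "wint_integrable w f"
  shows "wint_integrable w (\<lambda>v. c * f v)" "wint w (\<lambda>v. c * f v) = c * wint w f"
proof -
  have eq: "w v * (c * f v) = c * (w v * f v)" for v by simp
  show "wint_integrable w (\<lambda>v. c * f v)" unfolding eq by (intro set_integrable_mult_right assms)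
  show "wint w (\<lambda>v. c * f v) = c * wint w f"
    unfolding wint_def eq by (simp add: set_integral_mult_right)
qed

lemma wint_sum:
  assumes "\<And>i. i \<in> A \<Longrightarrow> wint_integrable w (f i)"
  shows "wint_integrable w (\<lambda>v. \<Sum>i\<in>A. f i v) \<and> wint w (\<lambda>v. \<Sum>i\<in>A. f i v) = (\<Sum>i\<in>A. wint w (f i))"
  using assms
proof (induction A rule: infinite_finite_induct)
  case (insert i A)
  then show ?case by (simp add: wint_add)
qed (simp_all add: set_integrable_def wint_def)

lemma wint_bound:
  assumes w: "w \<in> borel_measurable borel" "\<And>v. v > 0 \<Longrightarrow> 0 \<le> w v"
    and f: "f \<in> borel_measurable borel" and g: "wint_integrable w g"
    and le: "\<And>v. v > 0 \<Longrightarrow> \<bar>f v\<bar> \<le> g v"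
  shows "wint_integrable w f" "\<bar>wint w f\<bar> \<le> wint w g"
proof -
  have *: "\<bar>w v * f v\<bar> \<le> w v * g v" if "v > 0" for v
    using mult_left_mono[OF le[OF that] w(2)[OF that]] w(2)[OF that] by (simp add: abs_mult)
  show int: "wint_integrable w f"
    unfolding set_integrable_def
  proof (rule Bochner_Integration.integrable_bound[OF g[unfolded set_integrable_def]])
    show "AE v in lborel. norm (indicator {0<..} v *\<^sub>R (w v * f v)) \<le> norm (indicator {0<..} v *\<^sub>R (w v * g v))"
      using * by (intro AE_I2) (fastforce split: split_indicator)
  qed (use f w(1) in measurable)
  have "\<bar>wint w f\<bar> \<le> (LINT v:{0<..}|lborel. \<bar>w v * f v\<bar>)"
    unfolding wint_def using set_integral_norm_bound[OF int] by simp
  also have "\<dots> \<le> wint w g"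
    unfolding wint_def
    by (rule set_integral_mono[OF set_integrable_abs[OF int] g]) (use * in auto)
  finally show "\<bar>wint w f\<bar> \<le> wint w g" .
qed

section \<open>Moments about the saddle\<close>

lemma bracket_integrable_central:
  assumes m: "m > 0"
  shows "bracket_integrable m (\<lambda>v. v ^ n * (v - 1) ^ i)"
proof (induction i arbitrary: n)
  case 0
  show ?case using bracket_power[OF m] by simp
next
  case (Suc i)
  have eq: "v ^ n * (v - 1) ^ Suc i = v ^ Suc n * (v - 1) ^ i - v ^ n * (v - 1) ^ i" for v :: real
    by (simp add: algebra_simps)
  show ?case unfolding eq by (intro wint_diff Suc)
qed

lemma bracket_central_Suc:
  assumes m: "m > 0"
  shows "bracket m (\<lambda>v. v ^ n * (v - 1) ^ Suc i) = bracket m (\<lambda>v. v ^ Suc n * (v - 1) ^ i) - bracket m (\<lambda>v. v ^ n * (v - 1) ^ i)"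
proof -
  have eq: "v ^ n * (v - 1) ^ Suc i = v ^ Suc n * (v - 1) ^ i - v ^ n * (v - 1) ^ i" for v :: real
    by (simp add: algebra_simps)
  show ?thesis unfolding eq by (intro wint_diff bracket_integrable_central m)
qed

text \<open>This is integration by parts of \<open>v ^ Suc n * (v - 1) ^ i\<close> against the
  weight, whose logarithmic derivative is \<open>m * (1 - v) / v\<close>. The induction obtains it
  from the ratio of consecutive factorial moments instead. For \<open>i = 0\<close> the factor
  \<open>real i\<close> removes the term with exponent \<open>i - 1\<close>.\<close>

lemma bracket_central_by_parts:
  assumes m: "m > 0"
  shows "real m * bracket m (\<lambda>v. v ^ n * (v - 1) ^ Suc i) =
    (real n + 1) * bracket m (\<lambda>v. v ^ n * (v - 1) ^ i) + real i * bracket m (\<lambda>v. v ^ Suc n * (v - 1) ^ (i - 1))"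
proof (induction i arbitrary: n)
  case 0
  have "bracket m (\<lambda>v. v ^ Suc n) = (real m + real n + 1) / real m * bracket m (\<lambda>v. v ^ n)"
    using m by (simp add: bracket_power[OF m] field_simps del: power_Suc) simp
  then have "real m * (bracket m (\<lambda>v. v ^ Suc n) - bracket m (\<lambda>v. v ^ n)) = (real n + 1) * bracket m (\<lambda>v. v ^ n)"
    using m by (simp add: field_simps del: power_Suc)
  then show ?case
    using bracket_central_Suc[OF m, of n 0] by (simp only: power_0 mult_1_right)
next
  case (Suc i)
  have "real m * bracket m (\<lambda>v. v ^ n * (v - 1) ^ Suc (Suc i)) =
    real m * bracket m (\<lambda>v. v ^ Suc n * (v - 1) ^ Suc i) - real m * bracket m (\<lambda>v. v ^ n * (v - 1) ^ Suc i)"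
    by (subst bracket_central_Suc[OF m]) (simp add: right_diff_distrib)
  also have "\<dots> = (real (Suc n) + 1) * bracket m (\<lambda>v. v ^ Suc n * (v - 1) ^ i) + real i * bracket m (\<lambda>v. v ^ Suc (Suc n) * (v - 1) ^ (i - 1))
     - ((real n + 1) * bracket m (\<lambda>v. v ^ n * (v - 1) ^ i) + real i * bracket m (\<lambda>v. v ^ Suc n * (v - 1) ^ (i - 1)))"
    unfolding Suc.IH ..
  also have "real i * bracket m (\<lambda>v. v ^ Suc (Suc n) * (v - 1) ^ (i - 1)) =
      real i * bracket m (\<lambda>v. v ^ Suc n * (v - 1) ^ (i - 1)) + real i * bracket m (\<lambda>v. v ^ Suc n * (v - 1) ^ i)"
    using arg_cong[OF bracket_central_Suc[OF m, of "Suc n" "i - 1"], of "\<lambda>t. real i * t"]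
    by (cases i) (simp_all add: right_diff_distrib del: power_Suc of_nat_Suc)
  finally show ?case
    using bracket_central_Suc[OF m, of n i] arg_cong[OF bracket_central_Suc[OF m, of n i], of "\<lambda>t. real n * t"]
    by (simp add: algebra_simps del: power_Suc)
qed

lemma bracket_central_recursion:
  assumes m: "m > 0"
  shows "bracket m (\<lambda>v. (v - 1) ^ Suc i) =
    ((real i + 1) * bracket m (\<lambda>v. (v - 1) ^ i) + real i * bracket m (\<lambda>v. (v - 1) ^ (i - 1))) / real m"
proof -
  have "real i * bracket m (\<lambda>v. v ^ Suc 0 * (v - 1) ^ (i - 1)) =
      real i * (bracket m (\<lambda>v. (v - 1) ^ i) + bracket m (\<lambda>v. (v - 1) ^ (i - 1)))"
    using bracket_central_Suc[OF m, of 0 "i - 1"] by (cases i) (simp_all del: power_Suc add: power_Suc[of _ 0])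
  then have "real m * bracket m (\<lambda>v. (v - 1) ^ Suc i) =
      (real i + 1) * bracket m (\<lambda>v. (v - 1) ^ i) + real i * bracket m (\<lambda>v. (v - 1) ^ (i - 1))"
    using bracket_central_by_parts[OF m, of 0 i]
    by (simp add: algebra_simps del: power_Suc)
  then show ?thesis using m by (simp add: field_simps del: power_Suc)
qed

text \<open>Moments about \<open>1\<close> of the Gamma density proportional to \<open>wt m\<close>,
  as polynomials in \<open>X = 1 / m\<close>; the recursion is exact and not only
  asymptotic.\<close>

fun central_moment :: "nat \<Rightarrow> real fps" where
  "central_moment 0 = 1"
| "central_moment (Suc 0) = fps_X"
| "central_moment (Suc (Suc i)) = fps_X * (fps_const (real i + 2) * central_moment (Suc i) + fps_const (real i + 1) * central_moment i)"

lemma inverse_nat_tendsto_0: "((\<lambda>m. 1 / real m) \<longlongrightarrow> 0) sequentially"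
  by real_asymp

lemmas inverse_nat_bigo_1 = tendsto_imp_bigo_1[OF inverse_nat_tendsto_0]

lemma central_moment_asymp_series:
  "asymp_series sequentially (\<lambda>m. 1 / real m) (\<lambda>m. bracket m (\<lambda>v. (v - 1) ^ i) / bracket m (\<lambda>v. 1)) (central_moment i)"
proof (induction i rule: central_moment.induct)
  case 1
  have "asymp_series sequentially (\<lambda>m. 1 / real m) (\<lambda>m. bracket m (\<lambda>v. 1) / bracket m (\<lambda>v. 1)) (fps_const 1)"
  proof (rule asymp_series_cong[OF asymp_series_const[OF inverse_nat_bigo_1]], rule eventually_mono[OF eventually_gt_at_top[of 0]])
    fix m :: nat assume "m > 0"
    then show "1 = bracket m (\<lambda>v. 1) / bracket m (\<lambda>v. 1)" using bracket_one(3)[of m] by simp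
  qed
  then show ?case by simp
next
  case 2
  show ?case
    unfolding central_moment.simps
    by (rule asymp_series_cong[OF asymp_series_ident[OF inverse_nat_bigo_1]], rule eventually_mono[OF eventually_gt_at_top[of 0]])
       (use bracket_central_recursion[of _ 0] bracket_one(3) in \<open>simp add: less_imp_neq[OF bracket_one(3), symmetric]\<close>)
next
  case (3 i)
  have "asymp_series sequentially (\<lambda>m. 1 / real m) (\<lambda>m. 1 / real m *
      ((real i + 2) * (bracket m (\<lambda>v. (v - 1) ^ Suc i) / bracket m (\<lambda>v. 1)) + (real i + 1) * (bracket m (\<lambda>v. (v - 1) ^ i) / bracket m (\<lambda>v. 1)))) (central_moment (Suc (Suc i)))"
    unfolding central_moment.simps
    by (intro asymp_series_mult asymp_series_add asymp_series_cmult asymp_series_ident inverse_nat_bigo_1 3)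
  then show ?case
  proof (rule asymp_series_cong, intro eventually_mono[OF eventually_gt_at_top[of 0]])
    fix m :: nat assume m: "m > 0"
    show "1 / real m * ((real i + 2) * (bracket m (\<lambda>v. (v - 1) ^ Suc i) / bracket m (\<lambda>v. 1)) + (real i + 1) * (bracket m (\<lambda>v. (v - 1) ^ i) / bracket m (\<lambda>v. 1))) =
      bracket m (\<lambda>v. (v - 1) ^ Suc (Suc i)) / bracket m (\<lambda>v. 1)"
      by (subst bracket_central_recursion[OF m, of "Suc i"]) (simp add: field_simps add_divide_distrib del: power_Suc)
  qed
qed

text \<open>The saddle has width of order \<open>m ^ (- 1 / 2)\<close>, so the moment of index
  \<open>i\<close> has order at least \<open>i / 2\<close> in \<open>1 / m\<close>. Each coefficient
  of a Laplace expansion thus involves finitely many Taylor coefficients, those with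
  \<open>i \<le> 2 * k\<close>.\<close>

lemma central_moment_nth_eq_0:
  "2 * k < i \<Longrightarrow> fps_nth (central_moment i) k = 0"
proof (induction i arbitrary: k rule: central_moment.induct)
  case (3 i)
  show ?case
  proof (cases k)
    case (Suc l)
    then show ?thesis using 3 by simp
  qed simp
qed (auto simp: fps_X_nth)

definition moment_series :: "real fps \<Rightarrow> real fps" where
  "moment_series P = Abs_fps (\<lambda>k. \<Sum>i\<le>2 * k. fps_nth P i * fps_nth (central_moment i) k)"

text \<open>Near \<open>1\<close> the expansion itself gives order \<open>n\<close>; at distance at
  least \<open>d\<close> the function is bounded and every lower power of
  \<open>\<bar>v - 1\<bar>\<close> is dominated by the power \<open>n\<close>. This admits functions
  that are cut off away from \<open>1\<close>.\<close>

lemma taylor_global_bound: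
  fixes f :: "real \<Rightarrow> real"
  assumes P: "(\<lambda>h. f (1 + h)) has_fps_expansion P" and S: "1 \<in> S" and C: "\<And>v. v \<in> S \<Longrightarrow> \<bar>f v\<bar> \<le> C"
  shows "\<exists>D. \<forall>v\<in>S. \<bar>f v - (\<Sum>i<n. fps_nth P i * (v - 1) ^ i)\<bar> \<le> D * \<bar>v - 1\<bar> ^ n"
proof -
  obtain c where c: "c > 0" "eventually (\<lambda>h. norm (f (1 + h) - (\<Sum>i<n. fps_nth P i * h ^ i)) \<le> c * norm (h ^ n)) (nhds 0)"
    using has_fps_expansion_bigo[OF P, of n] by (auto elim: landau_o.bigE)
  then obtain d where d: "d > 0" "\<And>h. \<bar>h\<bar> < d \<Longrightarrow> \<bar>f (1 + h) - (\<Sum>i<n. fps_nth P i * h ^ i)\<bar> \<le> c * \<bar>h\<bar> ^ n"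
    by (auto simp: eventually_nhds_metric dist_real_def power_abs)
  \<comment> \<open>One summand for each source: the local remainder, the function at distance at
    least \<open>d\<close>, and the Taylor polynomial there.\<close>
  define D where "D = c + C / d ^ n + (\<Sum>i<n. \<bar>fps_nth P i\<bar> / d ^ (n - i))"
  have C0: "C \<ge> 0" using C[OF S] by simp
  have sum0: "0 \<le> (\<Sum>i<n. \<bar>fps_nth P i\<bar> / d ^ (n - i))" using d(1) by (intro sum_nonneg) simp
  have "\<bar>f v - (\<Sum>i<n. fps_nth P i * (v - 1) ^ i)\<bar> \<le> D * \<bar>v - 1\<bar> ^ n" if v: "v \<in> S" for v
  proof (cases "\<bar>v - 1\<bar> < d")
    case True
    have "\<bar>f v - (\<Sum>i<n. fps_nth P i * (v - 1) ^ i)\<bar> \<le> c * \<bar>v - 1\<bar> ^ n"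
      using d(2)[OF True] by simp
    also have "c \<le> D" using C0 d(1) sum0 by (simp add: D_def)
    finally show ?thesis by (simp add: mult_right_mono)
  next
    case False
    define w where "w = \<bar>v - 1\<bar>"
    have w: "w \<ge> d" "w > 0" using False d(1) by (auto simp: w_def)
    have pw: "w ^ i \<le> w ^ n / d ^ (n - i)" if "i \<le> n" for i
    proof -
      have "w ^ i * d ^ (n - i) \<le> w ^ i * w ^ (n - i)"
        using w d(1) by (intro mult_left_mono power_mono) auto
      also have "\<dots> = w ^ n" using that by (simp add: power_add[symmetric])
      finally show ?thesis using d(1) by (simp add: pos_le_divide_eq)
    qed
    have "\<bar>f v - (\<Sum>i<n. fps_nth P i * (v - 1) ^ i)\<bar> \<le> \<bar>f v\<bar> + \<bar>\<Sum>i<n. fps_nth P i * (v - 1) ^ i\<bar>"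
      by (rule abs_triangle_ineq4)
    also have "\<bar>\<Sum>i<n. fps_nth P i * (v - 1) ^ i\<bar> \<le> (\<Sum>i<n. \<bar>fps_nth P i\<bar> * w ^ i)"
      by (rule order_trans[OF sum_abs]) (simp add: abs_mult power_abs w_def)
    also have "\<dots> \<le> (\<Sum>i<n. \<bar>fps_nth P i\<bar> * (w ^ n / d ^ (n - i)))"
      by (intro sum_mono mult_left_mono pw) auto
    also have "\<dots> = (\<Sum>i<n. \<bar>fps_nth P i\<bar> / d ^ (n - i)) * w ^ n"
      by (simp add: sum_distrib_right)
    also have "\<bar>f v\<bar> \<le> C * (w ^ n / d ^ n)"
      using C[OF v] pw[of 0] C0 mult_left_mono[of 1 "w ^ n / d ^ n" C] by simp
    finally have "\<bar>f v - (\<Sum>i<n. fps_nth P i * (v - 1) ^ i)\<bar> \<le> (C / d ^ n + (\<Sum>i<n. \<bar>fps_nth P i\<bar> / d ^ (n - i))) * w ^ n"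
      by (simp add: distrib_right)
    also have "\<dots> \<le> D * w ^ n"
      using c(1) w(2) by (intro mult_right_mono) (auto simp: D_def)
    finally show ?thesis by (simp add: w_def)
  qed
  then show ?thesis by blast
qed

text \<open>Laplace's method at an interior saddle. Precision \<open>m ^ (- n)\<close> takes a
  Taylor polynomial with \<open>2 * n\<close> terms, and the even exponent bounds the remainder by
  an ordinary moment without absolute values.\<close>

lemma bracket_asymp_series:
  fixes f :: "real \<Rightarrow> real"
  assumes [measurable]: "f \<in> borel_measurable borel"
    and P: "(\<lambda>h. f (1 + h)) has_fps_expansion P" and C: "\<And>v. v > 0 \<Longrightarrow> \<bar>f v\<bar> \<le> C"
  shows "asymp_series sequentially (\<lambda>m. 1 / real m) (\<lambda>m. bracket m f / bracket m (\<lambda>v. 1)) (moment_series P)"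
  unfolding asymp_series_def
proof
  fix n
  let ?h = "\<lambda>m. 1 / real m"
  let ?p = "\<lambda>v. \<Sum>i<2 * n. fps_nth P i * (v - 1) ^ i"
  let ?r = "\<lambda>i m. bracket m (\<lambda>v. (v - 1) ^ i) / bracket m (\<lambda>v. 1)"
  obtain D where D: "\<And>v. v > 0 \<Longrightarrow> \<bar>f v - ?p v\<bar> \<le> D * \<bar>v - 1\<bar> ^ (2 * n)"
    using taylor_global_bound[OF P, of "{0<..}" C "2 * n"] C by auto
  have 1: "(\<lambda>m. bracket m f / bracket m (\<lambda>v. 1) - (\<Sum>i<2 * n. fps_nth P i * ?r i m)) \<in> O(\<lambda>m. ?h m ^ n)"
  proof (rule landau_o.big_trans)
    show "(\<lambda>m. bracket m f / bracket m (\<lambda>v. 1) - (\<Sum>i<2 * n. fps_nth P i * ?r i m)) \<in> O(?r (2 * n))"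
    proof (rule landau_o.bigI[of "\<bar>D\<bar> + 1"], simp, rule eventually_mono[OF eventually_gt_at_top[of 0]])
      fix m :: nat assume m: "m > 0"
      have int: "bracket_integrable m (\<lambda>v. (v - 1) ^ i)" for i
        using bracket_integrable_central[OF m, of 0 i] by simp
      have intf: "bracket_integrable m f"
      proof (rule wint_bound(1)[OF wt_measurable wt_nonneg, where g = "\<lambda>v. C * 1"])
        show "bracket_integrable m (\<lambda>v. C * 1)" by (rule wint_cmult[OF bracket_one(1)[OF m]])
      qed (use C in auto)
      have sum: "bracket_integrable m ?p \<and> bracket m ?p = (\<Sum>i<2 * n. bracket m (\<lambda>v. fps_nth P i * (v - 1) ^ i))"
        by (intro wint_sum wint_cmult int)
      have "bracket m (\<lambda>v. f v - ?p v) = bracket m f - (\<Sum>i<2 * n. fps_nth P i * bracket m (\<lambda>v. (v - 1) ^ i))"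
        using wint_diff[OF intf conjunct1[OF sum]] sum by (simp add: wint_cmult int)
      then have "bracket m f / bracket m (\<lambda>v. 1) - (\<Sum>i<2 * n. fps_nth P i * ?r i m) = bracket m (\<lambda>v. f v - ?p v) / bracket m (\<lambda>v. 1)"
        by (simp add: diff_divide_distrib sum_divide_distrib)
      moreover have "\<bar>bracket m (\<lambda>v. f v - ?p v)\<bar> \<le> bracket m (\<lambda>v. D * (v - 1) ^ (2 * n))"
        by (rule wint_bound(2)[OF wt_measurable wt_nonneg]) (use D wint_cmult[OF int] in \<open>auto simp: power_even_abs\<close>)
      moreover have "bracket m (\<lambda>v. D * (v - 1) ^ (2 * n)) = D * bracket m (\<lambda>v. (v - 1) ^ (2 * n))"
        by (rule wint_cmult[OF int])
      moreover have "0 \<le> bracket m (\<lambda>v. (v - 1) ^ (2 * n))"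
        using wint_bound(2)[OF wt_measurable wt_nonneg _ int[of "2 * n"], of "\<lambda>_. 0"] by simp
      then have "D * bracket m (\<lambda>v. (v - 1) ^ (2 * n)) \<le> (\<bar>D\<bar> + 1) * bracket m (\<lambda>v. (v - 1) ^ (2 * n))"
        by (intro mult_right_mono) auto
      ultimately show "norm (bracket m f / bracket m (\<lambda>v. 1) - (\<Sum>i<2 * n. fps_nth P i * ?r i m)) \<le> (\<bar>D\<bar> + 1) * norm (?r (2 * n) m)"
        using bracket_one(3)[OF m] \<open>0 \<le> bracket m (\<lambda>v. (v - 1) ^ (2 * n))\<close>
        by (simp add: abs_divide divide_right_mono)
    qed
    have "(\<Sum>k<n. fps_nth (central_moment (2 * n)) k * ?h m ^ k) = 0" for m
      by (intro sum.neutral) (simp add: central_moment_nth_eq_0)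
    with asymp_seriesD[OF central_moment_asymp_series[of "2 * n"], of n]
    show "?r (2 * n) \<in> O(\<lambda>m. ?h m ^ n)" by simp
  qed
  have "asymp_series sequentially ?h (\<lambda>m. \<Sum>i<2 * n. fps_nth P i * ?r i m) (\<Sum>i<2 * n. fps_const (fps_nth P i) * central_moment i)"
    by (intro asymp_series_sum asymp_series_cmult central_moment_asymp_series inverse_nat_bigo_1)
  from asymp_seriesD[OF this, of n]
  have 2: "(\<lambda>m. (\<Sum>i<2 * n. fps_nth P i * ?r i m) - (\<Sum>k<n. fps_nth (\<Sum>i<2 * n. fps_const (fps_nth P i) * central_moment i) k * ?h m ^ k)) \<in> O(\<lambda>m. ?h m ^ n)" .
  have "fps_nth (\<Sum>i<2 * n. fps_const (fps_nth P i) * central_moment i) k = fps_nth (moment_series P) k" if "k < n" for k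
  proof -
    have "(\<Sum>i<2 * n. fps_nth P i * fps_nth (central_moment i) k) = (\<Sum>i\<le>2 * k. fps_nth P i * fps_nth (central_moment i) k)"
      using that by (intro sum.mono_neutral_right) (auto simp: central_moment_nth_eq_0)
    then show ?thesis by (simp add: moment_series_def fps_sum_nth)
  qed
  then have "(\<Sum>k<n. fps_nth (\<Sum>i<2 * n. fps_const (fps_nth P i) * central_moment i) k * ?h m ^ k) = (\<Sum>k<n. fps_nth (moment_series P) k * ?h m ^ k)" for m
    by (intro sum.cong) auto
  with sum_in_bigo(1)[OF 1 2]
  show "(\<lambda>m. bracket m f / bracket m (\<lambda>v. 1) - (\<Sum>k<n. fps_nth (moment_series P) k * ?h m ^ k)) \<in> O(\<lambda>m. ?h m ^ n)"
    by simp
qed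

section \<open>The principal value integral\<close>

lemma wt_1_bounds:
  assumes v: "v > 0"
  shows "0 < wt 1 v" "wt 1 v \<le> 1" "1 - wt 1 v \<le> (1 - v)\<^sup>2"
proof -
  show "0 < wt 1 v" using v by (simp add: wt_def)
  have "v \<le> exp (v - 1)" using exp_ge_add_one_self[of "v - 1"] by simp
  then have "v * exp (1 - v) \<le> exp (v - 1) * exp (1 - v)" by (rule mult_right_mono) simp
  also have "\<dots> = 1" by (simp flip: exp_add)
  finally show "wt 1 v \<le> 1" by (simp add: wt_def)
  have "v * (2 - v) \<le> v * exp (1 - v)"
    using v exp_ge_add_one_self[of "1 - v"] by (intro mult_left_mono) auto
  then show "1 - wt 1 v \<le> (1 - v)\<^sup>2" by (simp add: wt_def power2_eq_square algebra_simps)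
qed

lemma wt_eq_power: "wt m v = wt 1 v ^ m"
  by (simp add: wt_def)

lemma wt_le_1: "v > 0 \<Longrightarrow> wt m v \<le> 1"
  using wt_1_bounds[of v] by (subst wt_eq_power) (simp add: power_le_one)

text \<open>The numerator has a double zero at \<open>1\<close>, so the value \<open>0\<close>
  produced by division by zero at \<open>v = 1\<close> is the continuous extension.\<close>

definition gap :: "real \<Rightarrow> real" where
  "gap v = (wt 1 v - 1) / (1 - v\<^sup>2)"

text \<open>Subtracting \<open>1\<close> amounts to taking the principal value, as that of \<open>\<integral> 1 / (1 - v\<^sup>2) dv\<close> is \<open>0\<close>.\<close>

definition pv :: "nat \<Rightarrow> real" where
  "pv m = (LINT v:{0<..}|lborel. (wt m v - 1) / (1 - v\<^sup>2))"

lemma gap_measurable [measurable]: "gap \<in> borel_measurable borel"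
  unfolding gap_def by measurable

lemma gap_bound:
  assumes v: "v > 0"
  shows "\<bar>gap v\<bar> \<le> 1" "\<bar>gap v\<bar> \<le> 5 / (1 + v\<^sup>2)"
proof -
  have abs: "\<bar>gap v\<bar> = (1 - wt 1 v) / \<bar>1 - v\<^sup>2\<bar>"
    using wt_1_bounds[OF v] by (simp add: gap_def abs_divide)
  have fac: "\<bar>1 - v\<^sup>2\<bar> = \<bar>1 - v\<bar> * (1 + v)"
  proof -
    have "1 - v\<^sup>2 = (1 - v) * (1 + v)" by (simp add: power2_eq_square algebra_simps)
    then show ?thesis using v by (simp add: abs_mult)
  qed
  have "\<bar>gap v\<bar> \<le> (1 - v)\<^sup>2 / (\<bar>1 - v\<bar> * (1 + v))"
    unfolding abs fac using wt_1_bounds[OF v] v by (intro divide_right_mono) auto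
  also have "\<dots> = \<bar>1 - v\<bar> / (1 + v)"
  proof -
    have "(1 - v)\<^sup>2 = \<bar>1 - v\<bar> * \<bar>1 - v\<bar>" by (simp add: power2_eq_square)
    moreover have "t * t / (t * w) = t / w" for t w :: real by simp
    ultimately show ?thesis by metis
  qed
  also have "\<dots> \<le> 1" using v by (simp add: divide_le_eq abs_le_iff)
  finally show 1: "\<bar>gap v\<bar> \<le> 1" .
  \<comment> \<open>\<open>5 = 1 + 2\<^sup>2\<close>: up to \<open>v = 2\<close> the bound
    \<open>1\<close> is enough, and beyond it the bound \<open>1 / (v\<^sup>2 - 1)\<close>
    is.\<close>
  show "\<bar>gap v\<bar> \<le> 5 / (1 + v\<^sup>2)"
  proof (cases "v \<le> 2")
    case True
    then have "v\<^sup>2 \<le> 2\<^sup>2" using v by (intro power_mono) auto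
    then have "1 \<le> 5 / (1 + v\<^sup>2)" by (simp add: le_divide_eq add_pos_nonneg)
    with 1 show ?thesis by linarith
  next
    case False
    then have "2\<^sup>2 \<le> v\<^sup>2" by (intro power_mono) auto
    then have v2: "v\<^sup>2 \<ge> 4" by simp
    have "\<bar>gap v\<bar> \<le> 1 / \<bar>1 - v\<^sup>2\<bar>"
      unfolding abs using wt_1_bounds[OF v] by (intro divide_right_mono) auto
    also have "\<dots> \<le> 5 / (1 + v\<^sup>2)" using v2 by (simp add: divide_simps)
    finally show ?thesis .
  qed
qed

lemma set_integrable_inverse_one_plus_square:
  "set_integrable lborel {0<..} (\<lambda>v::real. c / (1 + v\<^sup>2))"
proof -
  have "(\<integral>\<^sup>+v. ennreal (1 / (1 + v\<^sup>2)) * indicator {0..} v \<partial>lborel) = ennreal (pi / 2 - arctan 0)"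
    by (intro nn_integral_FTC_atLeast tendsto_arctan_at_top)
       (auto intro!: derivative_eq_intros simp: inverse_eq_divide add_pos_nonneg)
  then have "integrable lborel (\<lambda>v::real. indicator {0..} v *\<^sub>R (1 / (1 + v\<^sup>2)))"
    by (intro integrableI_nonneg)
       (auto split: split_indicator simp: indicator_mult_ennreal[symmetric] ennreal_mult'[symmetric] mult.commute ennreal_indicator[symmetric])
  then have "set_integrable lborel {0..} (\<lambda>v::real. 1 / (1 + v\<^sup>2))" by (simp add: set_integrable_def)
  then have "set_integrable lborel {0<..} (\<lambda>v::real. 1 / (1 + v\<^sup>2))"
    by (rule set_integrable_subset) auto
  with set_integrable_mult_right[of c lborel "{0<..}" "\<lambda>v. 1 / (1 + v\<^sup>2)"] show ?thesis by simp
qed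

text \<open>Bernoulli's inequality \<open>1 - x ^ m \<le> m * (1 - x)\<close> at
  \<open>x = wt 1 v\<close> dominates the integrand by \<open>m * \<bar>gap v\<bar>\<close>.\<close>

lemma pv_integrable: "set_integrable lborel {0<..} (\<lambda>v. (wt m v - 1) / (1 - v\<^sup>2))"
proof -
  have bern: "1 - x ^ m \<le> real m * (1 - x)" if "0 \<le> x" "x \<le> 1" for x :: real
    using Bernoulli_inequality[of "x - 1" m] that by (simp add: algebra_simps)
  have *: "\<bar>(wt m v - 1) / (1 - v\<^sup>2)\<bar> \<le> real m * 5 / (1 + v\<^sup>2)" if v: "v > 0" for v
  proof -
    have "\<bar>wt m v - 1\<bar> \<le> real m * \<bar>wt 1 v - 1\<bar>"
      using bern[of "wt 1 v"] wt_1_bounds[OF v] wt_le_1[OF v, of m] by (simp add: wt_eq_power[of m])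
    then have "\<bar>(wt m v - 1) / (1 - v\<^sup>2)\<bar> \<le> real m * \<bar>gap v\<bar>"
      unfolding gap_def abs_divide times_divide_eq_right by (rule divide_right_mono) simp
    also have "\<dots> \<le> real m * (5 / (1 + v\<^sup>2))" by (intro mult_left_mono gap_bound v) simp
    finally show ?thesis by simp
  qed
  show ?thesis
    unfolding set_integrable_def
  proof (rule Bochner_Integration.integrable_bound[OF set_integrable_inverse_one_plus_square[of "real m * 5", unfolded set_integrable_def]])
    show "AE v in lborel. norm (indicator {0<..} v *\<^sub>R ((wt m v - 1) / (1 - v\<^sup>2))) \<le> norm (indicator {0<..} v *\<^sub>R (real m * 5 / (1 + v\<^sup>2)))"
      using * by (intro AE_I2) (fastforce split: split_indicator)
  qed measurable
qed

text \<open>\<open>wt (Suc m) v - wt m v = wt m v * (wt 1 v - 1)\<close>: the difference recovers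
  the Laplace weight, and the factor left over cancels the pole.\<close>

lemma pv_Suc: "pv (Suc m) - pv m = bracket m gap"
proof -
  have "pv (Suc m) - pv m = (LINT v:{0<..}|lborel. (wt (Suc m) v - 1) / (1 - v\<^sup>2) - (wt m v - 1) / (1 - v\<^sup>2))"
    unfolding pv_def by (rule set_integral_diff(2)[symmetric]) (rule pv_integrable)+
  also have "\<dots> = bracket m gap"
    unfolding wint_def by (intro set_lebesgue_integral_cong) (auto simp: gap_def wt_def algebra_simps diff_divide_distrib)
  finally show ?thesis .
qed

section \<open>The limit of the principal value\<close>

lemma ln_quadratic_bound:
  fixes v :: real
  assumes "0 < v" "v \<le> 1"
  shows "(1 - v)\<^sup>2 / 2 \<le> v - 1 - ln v"
proof -
  have "(\<lambda>v. v - 1 - ln v - (1 - v)\<^sup>2 / 2) 1 \<le> (\<lambda>v. v - 1 - ln v - (1 - v)\<^sup>2 / 2) v"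
  proof (rule DERIV_nonpos_imp_nonincreasing[OF assms(2)])
    fix x :: real assume x: "v \<le> x" "x \<le> 1"
    have "((\<lambda>v. v - 1 - ln v - (1 - v)\<^sup>2 / 2) has_real_derivative (1 - 1 / x + (1 - x))) (at x)"
      using x assms by (auto intro!: derivative_eq_intros) (simp add: field_simps)
    moreover have "1 - 1 / x + (1 - x) = - ((1 - x)\<^sup>2 / x)"
      using x assms by (simp add: field_simps power2_eq_square)
    moreover have "(1 - x)\<^sup>2 / x \<ge> 0" using x assms by simp
    ultimately show "\<exists>y. ((\<lambda>v. v - 1 - ln v - (1 - v)\<^sup>2 / 2) has_real_derivative y) (at x) \<and> y \<le> 0"
      by (intro exI[of _ "1 - 1 / x + (1 - x)"]) simp
  qed
  then show ?thesis by simp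
qed

text \<open>Apart from the factor \<open>- m\<close>, the left side is the difference of the
  exponents of \<open>wt m\<close> at \<open>1 / v\<close> and at \<open>v\<close>. Reflection
  preserves the exponent to second order at \<open>1\<close>, whence the cube. The constant
  \<open>4\<close> gives the derivative a sign, since \<open>1 / x\<^sup>2 \<le> 12\<close> for
  \<open>x \<ge> 1 / 2\<close>.\<close>

lemma ln_cubic_bound:
  fixes v :: real
  assumes "1 / 2 \<le> v" "v \<le> 1"
  shows "1 / v - v + 2 * ln v \<le> 4 * (1 - v) ^ 3"
proof -
  have "(\<lambda>v. 4 * (1 - v) ^ 3 - (1 / v - v + 2 * ln v)) 1 \<le> (\<lambda>v. 4 * (1 - v) ^ 3 - (1 / v - v + 2 * ln v)) v"
  proof (rule DERIV_nonpos_imp_nonincreasing[OF assms(2)])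
    fix x :: real assume x: "v \<le> x" "x \<le> 1"
    then have x0: "x > 0" using assms by simp
    have "((\<lambda>v. 4 * (1 - v) ^ 3 - (1 / v - v + 2 * ln v)) has_real_derivative (- 12 * (1 - x)\<^sup>2 - (- 1 / x\<^sup>2 - 1 + 2 / x))) (at x)"
      using x0 by (auto intro!: derivative_eq_intros simp: power2_eq_square)
    moreover have "- 12 * (1 - x)\<^sup>2 - (- 1 / x\<^sup>2 - 1 + 2 / x) = (1 - x)\<^sup>2 * (1 / x\<^sup>2 - 12)"
      using x0 by (simp add: field_simps power2_eq_square)
    moreover have "1 / x\<^sup>2 - 12 \<le> 0"
    proof -
      have "(1/2)\<^sup>2 \<le> x\<^sup>2" using x assms by (intro power_mono) auto
      then show ?thesis using x0 by (simp add: divide_simps power2_eq_square)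
    qed
    then have "(1 - x)\<^sup>2 * (1 / x\<^sup>2 - 12) \<le> 0" by (intro mult_nonneg_nonpos) auto
    ultimately show "\<exists>y. ((\<lambda>v. 4 * (1 - v) ^ 3 - (1 / v - v + 2 * ln v)) has_real_derivative y) (at x) \<and> y \<le> 0"
      by (intro exI[of _ "- 12 * (1 - x)\<^sup>2 - (- 1 / x\<^sup>2 - 1 + 2 / x)"]) (simp only: simp_thms)
  qed
  then show ?thesis by simp
qed

lemma ln_reflection_nonneg:
  fixes v :: real
  assumes "0 < v" "v \<le> 1"
  shows "0 \<le> 1 / v - v + 2 * ln v"
proof -
  have "(\<lambda>v. 1 / v - v + 2 * ln v) 1 \<le> (\<lambda>v. 1 / v - v + 2 * ln v) v"
  proof (rule DERIV_nonpos_imp_nonincreasing[OF assms(2)])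
    fix x :: real assume x: "v \<le> x" "x \<le> 1"
    then have x0: "x > 0" using assms by simp
    have "((\<lambda>v. 1 / v - v + 2 * ln v) has_real_derivative (- 1 / x\<^sup>2 - 1 + 2 / x)) (at x)"
      using x0 by (auto intro!: derivative_eq_intros simp: power2_eq_square)
    moreover have "- 1 / x\<^sup>2 - 1 + 2 / x = - (1 / x - 1)\<^sup>2"
      using x0 by (simp add: field_simps power2_eq_square)
    ultimately show "\<exists>y. ((\<lambda>v. 1 / v - v + 2 * ln v) has_real_derivative y) (at x) \<and> y \<le> 0"
      by (intro exI[of _ "- 1 / x\<^sup>2 - 1 + 2 / x"]) simp
  qed
  then show ?thesis by simp
qed

text \<open>The point is uniformity in \<open>m\<close>. The exponents \<open>a\<close> at
  \<open>v\<close> and \<open>b\<close> at \<open>1 / v\<close> differ by at most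
  \<open>8 * (1 - v) * a\<close>; with \<open>t = m * a\<close> the numerator is at most
  \<open>8 * (1 - v) * (t * exp (- t))\<close>, and \<open>t * exp (- t) \<le> 1\<close>. The factor
  \<open>1 - v\<close> cancels the pole. For \<open>v < 1 / 2\<close> the denominator is bounded
  away from \<open>0\<close>.\<close>

lemma wt_reflection_bound:
  assumes v: "0 < v" "v < 1"
  shows "\<bar>(wt m v - wt m (1 / v)) / (1 - v\<^sup>2)\<bar> \<le> 8"
proof (cases "v \<ge> 1 / 2")
  case False
  then have v2: "v\<^sup>2 \<le> (1/2)\<^sup>2" using v by (intro power_mono) auto
  have "\<bar>wt m v - wt m (1 / v)\<bar> \<le> 1"
    using wt_nonneg[of v m] wt_nonneg[of "1/v" m] wt_le_1[of v m] wt_le_1[of "1/v" m] v by (simp add: abs_le_iff)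
  then have "\<bar>(wt m v - wt m (1 / v)) / (1 - v\<^sup>2)\<bar> \<le> 1 / (1 - v\<^sup>2)"
    using v2 by (simp add: abs_divide divide_right_mono power_divide)
  also have "\<dots> \<le> 8" using v2 by (simp add: divide_simps power2_eq_square)
  finally show ?thesis .
next
  case True
  define a b where "a = v - 1 - ln v" and "b = 1 / v - 1 + ln v"
  have e: "wt m v = exp (- (real m * a))" "wt m (1 / v) = exp (- (real m * b))"
  proof -
    have "- a = ln v + (1 - v)" by (simp add: a_def)
    then have "v * exp (1 - v) = exp (- a)" using v by (simp only: exp_add) simp
    then show "wt m v = exp (- (real m * a))" by (simp add: wt_def exp_of_nat_mult[symmetric])
    have "- b = - ln v + (1 - 1 / v)" by (simp add: b_def)
    then have "1 / v * exp (1 - 1 / v) = exp (- b)" using v by (simp only: exp_add) (simp add: exp_minus inverse_eq_divide)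
    then show "wt m (1 / v) = exp (- (real m * b))" by (simp add: wt_def exp_of_nat_mult[symmetric])
  qed
  have a: "a \<ge> (1 - v)\<^sup>2 / 2" using ln_quadratic_bound[of v] v by (simp add: a_def)
  then have a0: "a > 0" using v by (smt (verit) zero_less_power2 divide_pos_pos)
  have ba: "b - a \<le> 4 * (1 - v) ^ 3" using ln_cubic_bound[of v] True v by (simp add: a_def b_def)
  have ba0: "b - a \<ge> 0" using ln_reflection_nonneg[of v] v by (simp add: a_def b_def)
  have ba8: "\<bar>b - a\<bar> \<le> 8 * (1 - v) * a"
  proof -
    have "\<bar>b - a\<bar> \<le> 4 * (1 - v) ^ 3" using ba ba0 by simp
    also have "4 * (1 - v) ^ 3 = 8 * (1 - v) * ((1 - v)\<^sup>2 / 2)" by (simp add: power2_eq_square power3_eq_cube)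
    also have "\<dots> \<le> 8 * (1 - v) * a" using a v by (intro mult_left_mono) auto
    finally show ?thesis .
  qed
  have le8: "\<bar>wt m v - wt m (1 / v)\<bar> \<le> 8 * (1 - v)"
  proof -
    have "wt m (1 / v) = wt m v * exp (- (real m * (b - a)))"
      unfolding e by (simp flip: exp_add add: algebra_simps)
    then have "wt m v - wt m (1 / v) = exp (- (real m * a)) * (1 - exp (- (real m * (b - a))))"
      using e by (simp add: algebra_simps)
    moreover have "1 - exp (- (real m * (b - a))) \<le> real m * \<bar>b - a\<bar>"
      using exp_ge_add_one_self[of "- (real m * (b - a))"] ba0 by simp
    moreover have "0 \<le> 1 - exp (- (real m * (b - a)))" using ba0 by simp
    ultimately have "\<bar>wt m v - wt m (1 / v)\<bar> \<le> exp (- (real m * a)) * (real m * \<bar>b - a\<bar>)"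
      by (auto simp: abs_mult intro!: mult_left_mono)
    also have "\<dots> \<le> exp (- (real m * a)) * (real m * (8 * (1 - v) * a))"
      using ba8 by (intro mult_left_mono) auto
    also have "\<dots> = 8 * (1 - v) * (real m * a * exp (- (real m * a)))" by (simp add: mult_ac)
    also have "\<dots> \<le> 8 * (1 - v) * 1"
    proof (intro mult_left_mono)
      have "real m * a \<le> exp (real m * a)" using exp_ge_add_one_self[of "real m * a"] by linarith
      then have "real m * a * exp (- (real m * a)) \<le> exp (real m * a) * exp (- (real m * a))" by (rule mult_right_mono) simp
      then show "real m * a * exp (- (real m * a)) \<le> 1" by (simp flip: exp_add)
    qed (use v in auto)
    finally show ?thesis by simp
  qed
  have le: "1 - v \<le> 1 - v\<^sup>2" using v by (simp add: power2_eq_square mult_left_le)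
  then have "8 * (1 - v) \<le> 8 * (1 - v\<^sup>2)" by simp
  with le8 have "\<bar>wt m v - wt m (1 / v)\<bar> \<le> 8 * (1 - v\<^sup>2)" by (rule order_trans)
  moreover have "1 - v\<^sup>2 > 0" using le v by auto
  ultimately show ?thesis by (simp add: abs_divide divide_le_eq)
qed

text \<open>Under \<open>v \<mapsto> 1 / v\<close> the density \<open>1 / (1 - v\<^sup>2)\<close> on
  \<open>(1, \<infinity>)\<close> turns into its negative on \<open>(0, 1)\<close>. The
  contributions of the subtracted \<open>1\<close> cancel, which is where the vanishing of the
  principal value enters.\<close>

lemma pv_eq_reflected:
  "pv m = (LINT v:{0<..<1}|lborel. (wt m v - wt m (1 / v)) / (1 - v\<^sup>2))"
proof -
  define A where "A v = (wt m v - 1) / (1 - v\<^sup>2)" for v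
  have [measurable]: "A \<in> borel_measurable borel" unfolding A_def by measurable
  have int: "set_integrable lborel {0<..} A" using pv_integrable[of m] by (simp add: A_def[abs_def])
  have int1: "set_integrable lborel {0<..<1} A" by (rule set_integrable_subset[OF int]) auto
  have int2: "set_integrable lborel {1<..} A" by (rule set_integrable_subset[OF int]) auto
  have lebint: "f absolutely_integrable_on S \<longleftrightarrow> set_integrable lborel S f"
    if [measurable]: "f \<in> borel_measurable borel" "S \<in> sets borel" for f :: "real \<Rightarrow> real" and S
    unfolding set_integrable_def by (subst integrable_completion) auto
  have img: "(\<lambda>v::real. 1 / v) ` {0<..<1} = {1<..}"
  proof (intro equalityI subsetI)
    fix u :: real assume "u \<in> {1<..}"
    then have "u = 1 / (1 / u)" "1 / u \<in> {0<..<1}" by auto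
    then show "u \<in> (\<lambda>v. 1 / v) ` {0<..<1}" by blast
  qed auto
  have "((\<lambda>v. \<bar>- (1 / v\<^sup>2)\<bar> * A (1 / v)) absolutely_integrable_on {0<..<1} \<and>
      integral {0<..<1} (\<lambda>v. \<bar>- (1 / v\<^sup>2)\<bar> * A (1 / v)) = integral {1<..} A) \<longleftrightarrow>
      (A absolutely_integrable_on (\<lambda>v. 1 / v) ` {0<..<1} \<and> integral ((\<lambda>v. 1 / v) ` {0<..<1}) A = integral {1<..} A)"
    by (rule has_absolute_integral_change_of_variables_1')
       (auto intro!: derivative_eq_intros inj_onI simp: power2_eq_square)
  then have cov: "(\<lambda>v. \<bar>- (1 / v\<^sup>2)\<bar> * A (1 / v)) absolutely_integrable_on {0<..<1}"
      "integral {0<..<1} (\<lambda>v. \<bar>- (1 / v\<^sup>2)\<bar> * A (1 / v)) = integral {1<..} A"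
    using int2 by (simp_all add: img lebint)
  define B where "B v = \<bar>- (1 / v\<^sup>2)\<bar> * A (1 / v)" for v
  have [measurable]: "B \<in> borel_measurable borel" unfolding B_def by measurable
  have intB: "set_integrable lborel {0<..<1} B" using cov(1) by (simp add: B_def[abs_def] lebint)
  have "integral {0<..<1} B = integral {1<..} A" using cov(2) by (simp only: B_def[abs_def])
  then have eqB: "(LINT v:{1<..}|lborel. A v) = (LINT v:{0<..<1}|lborel. B v)"
    using set_borel_integral_eq_integral(2)[OF int2] set_borel_integral_eq_integral(2)[OF intB] by simp
  have "pv m = (LINT v:{0<..<1} \<union> {1<..}|lborel. A v)"
    unfolding pv_def A_def[symmetric] set_lebesgue_integral_def
    by (rule integral_cong_AE, measurable, rule eventually_mono[OF AE_lborel_singleton[of 1]])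
       (auto split: split_indicator)
  also have "\<dots> = (LINT v:{0<..<1}|lborel. A v) + (LINT v:{1<..}|lborel. A v)"
    by (rule set_integral_Un) (use int1 int2 in auto)
  also have "\<dots> = (LINT v:{0<..<1}|lborel. A v + B v)"
    unfolding eqB by (rule set_integral_add(2)[symmetric, OF int1 intB])
  also have "\<dots> = (LINT v:{0<..<1}|lborel. (wt m v - wt m (1 / v)) / (1 - v\<^sup>2))"
  proof (intro set_lebesgue_integral_cong allI impI)
    fix v :: real assume v: "v \<in> {0<..<1}"
    have "v\<^sup>2 < 1" using v abs_square_less_1[of v] by auto
    have "B v = (wt m (1 / v) - 1) / (v\<^sup>2 * (1 - 1 / v\<^sup>2))"
      by (simp add: B_def A_def power_divide)
    also have "v\<^sup>2 * (1 - 1 / v\<^sup>2) = - (1 - v\<^sup>2)" using v by (simp add: field_simps)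
    finally have "B v = - ((wt m (1 / v) - 1) / (1 - v\<^sup>2))" by (metis divide_minus_right)
    then show "A v + B v = (wt m v - wt m (1 / v)) / (1 - v\<^sup>2)"
      by (simp add: A_def diff_divide_distrib)
  qed simp
  finally show ?thesis .
qed

text \<open>Dominated convergence in the folded form: \<open>wt m\<close> tends to \<open>0\<close>
  pointwise off \<open>1\<close>. This limit is the boundary condition at infinity for the recursion
  of \<open>pv\<close>.\<close>

lemma pv_tendsto_0: "pv \<longlonglongrightarrow> 0"
proof -
  have "(\<lambda>m. LINT v|lborel. indicator {0<..<1} v *\<^sub>R ((wt m v - wt m (1 / v)) / (1 - v\<^sup>2))) \<longlonglongrightarrow> (LINT v::real|lborel. (0::real))"
  proof (rule integral_dominated_convergence[where w = "\<lambda>v::real. indicator {0<..<1} v *\<^sub>R (8::real)"])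
    show "integrable lborel (\<lambda>v::real. indicator {0<..<1} v *\<^sub>R (8::real))"
      by (intro integrable_scaleR_left integrable_real_indicator) auto
    show "AE v in lborel. (\<lambda>m. indicator {0<..<1} v *\<^sub>R ((wt m v - wt m (1 / v)) / (1 - v\<^sup>2))) \<longlonglongrightarrow> (0::real)"
    proof (intro AE_I2)
      fix v :: real
      show "(\<lambda>m. indicator {0<..<1} v *\<^sub>R ((wt m v - wt m (1 / v)) / (1 - v\<^sup>2))) \<longlonglongrightarrow> (0::real)"
      proof (cases "v \<in> {0<..<1}")
        case True
        have lt: "wt 1 w < 1" if "w > 0" "w \<noteq> 1" for w
        proof -
          have "ln w \<noteq> w - 1" using ln_eq_minus_one[of w] that by auto
          then have "ln w + (1 - w) < 0" using ln_le_minus_one[of w] that by linarith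
          then have "exp (ln w + (1 - w)) < 1" by simp
          then show ?thesis using that by (simp only: exp_add exp_ln wt_def power_one_right)
        qed
        have l: "(\<lambda>m. wt m w) \<longlonglongrightarrow> 0" if "w > 0" "w \<noteq> 1" for w
        proof -
          have "(\<lambda>m. wt 1 w ^ m) \<longlonglongrightarrow> 0"
            using lt[OF that] wt_1_bounds(1)[OF that(1)] by (intro LIMSEQ_realpow_zero) auto
          then show ?thesis by (simp add: wt_def)
        qed
        have "(\<lambda>m. (wt m v - wt m (1 / v)) / (1 - v\<^sup>2)) \<longlonglongrightarrow> (0 - 0) / (1 - v\<^sup>2)"
          using True by (intro tendsto_intros l) (auto simp: power2_eq_1_iff)
        then show ?thesis using True by simp
      qed simp
    qed
    show "AE v in lborel. norm (indicator {0<..<1} v *\<^sub>R ((wt m v - wt m (1 / v)) / (1 - v\<^sup>2))) \<le> indicator {0<..<1} v *\<^sub>R 8" for m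
      using wt_reflection_bound[of _ m] by (intro AE_I2) (auto split: split_indicator)
  qed measurable
  then show ?thesis unfolding pv_eq_reflected[abs_def] set_lebesgue_integral_def by simp
qed

section \<open>Stirling's series and the expansion of the principal value\<close>

text \<open>At \<open>v = 1 + h\<close> the denominator is \<open>- h * (2 + h)\<close>, and the
  \<open>h\<close> is absorbed by the numerator. Stating the product with \<open>2 + fps_X\<close>
  rather than the quotient yields a two-term recursion for the coefficients.\<close>

lemma gap_fps_expansion:
  "\<exists>P. (\<lambda>h. gap (1 + h)) has_fps_expansion P \<and>
     P * (2 + fps_X) = Abs_fps (\<lambda>n. (- 1) ^ Suc n * (real n / fact (n + 1)))"
proof -
  define F :: "real fps" where "F = (1 + fps_X) * fps_exp (- 1) - 1"
  have F_nth: "fps_nth F (Suc n) = (- 1) ^ n * (real n / fact (n + 1))" for n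
  proof -
    have "fps_nth F (Suc n) = (- 1) ^ Suc n / fact (Suc n) + (- 1) ^ n / fact n"
      by (simp add: F_def distrib_right)
    also have "(- 1) ^ n / fact n = (- 1) ^ n * (real n + 1) / (fact (Suc n) :: real)"
      by (simp add: divide_simps) (simp add: algebra_simps)?
    also have "(- 1) ^ Suc n / fact (Suc n) + (- 1) ^ n * (real n + 1) / fact (Suc n) = (- 1) ^ n * (real n / (fact (Suc n) :: real))"
      by (simp only: add_divide_distrib[symmetric]) (simp add: distrib_left del: fact_Suc)
    finally show ?thesis by simp
  qed
  have "(\<lambda>h. (1 + h) * exp (- 1 * h) - 1) has_fps_expansion F"
    unfolding F_def by (intro fps_expansion_intros)
  then have exF: "(\<lambda>h. (1 + h) * exp (- h) - 1) has_fps_expansion F" by simp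
  have "fps_nth F 2 \<noteq> 0" using F_nth[of 1] by (simp add: numeral_2_eq_2)
  then have F1: "1 \<le> subdegree F" by (intro subdegree_geI) (auto simp: F_def)
  have N: "(\<lambda>h. if h = 0 then 0 else ((1 + h) * exp (- h) - 1) / h) has_fps_expansion fps_shift 1 F"
    using has_fps_expansion_shift[OF exF F1, of 0] F_nth[of 0] unfolding power_one_right by simp
  have "(\<lambda>h. - ((if h = 0 then 0 else ((1 + h) * exp (- h) - 1) / h) * inverse (2 + h))) has_fps_expansion - (fps_shift 1 F * inverse (2 + fps_X))"
    by (intro fps_expansion_intros N) auto
  also have "(\<lambda>h. - ((if h = 0 then 0 else ((1 + h) * exp (- h) - 1) / h) * inverse (2 + h))) = (\<lambda>h. gap (1 + h))"
  proof
    fix h :: real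
    have "1 - (1 + h)\<^sup>2 = - (h * (2 + h))" by (simp add: power2_eq_square algebra_simps)
    then show "- ((if h = 0 then 0 else ((1 + h) * exp (- h) - 1) / h) * inverse (2 + h)) = gap (1 + h)"
      by (simp add: gap_def wt_def divide_inverse mult_ac)
  qed
  finally have "(\<lambda>h. gap (1 + h)) has_fps_expansion - (fps_shift 1 F * inverse (2 + fps_X))" .
  moreover have "- (fps_shift 1 F * inverse (2 + fps_X)) * (2 + fps_X) = Abs_fps (\<lambda>n. (- 1) ^ Suc n * (real n / fact (n + 1)))"
  proof -
    have "- (fps_shift 1 F * inverse (2 + fps_X)) * (2 + fps_X) = - fps_shift 1 F * (inverse (2 + fps_X) * (2 + fps_X))"
      by (simp add: mult.assoc)
    also have "inverse (2 + fps_X :: real fps) * (2 + fps_X) = 1" by (rule inverse_mult_eq_1) simp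
    finally show ?thesis by (simp add: fps_eq_iff F_nth)
  qed
  ultimately show ?thesis by blast
qed

definition gap_fps :: "real fps" where
  "gap_fps = (SOME P. (\<lambda>h. gap (1 + h)) has_fps_expansion P \<and>
     P * (2 + fps_X) = Abs_fps (\<lambda>n. (- 1) ^ Suc n * (real n / fact (n + 1))))"

lemma gap_fps:
  "(\<lambda>h. gap (1 + h)) has_fps_expansion gap_fps"
  "gap_fps * (2 + fps_X) = Abs_fps (\<lambda>n. (- 1) ^ Suc n * (real n / fact (n + 1)))"
  using someI_ex[OF gap_fps_expansion] unfolding gap_fps_def by simp_all

lemma gap_fps_nth_0: "fps_nth gap_fps 0 = 0"
  using arg_cong[OF gap_fps(2), of "\<lambda>P. fps_nth P 0"] by simp

lemma gap_fps_nth_Suc: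
  "fps_nth gap_fps (Suc n) = ((- 1) ^ n * (real (Suc n) / fact (n + 2)) - fps_nth gap_fps n) / 2"
proof -
  have "fps_nth (gap_fps * (2 + fps_X)) (Suc n) = 2 * fps_nth gap_fps (Suc n) + fps_nth gap_fps n"
    by (simp add: distrib_left numeral_fps_const)
  also have "fps_nth (gap_fps * (2 + fps_X)) (Suc n) = (- 1) ^ n * (real (Suc n) / fact (n + 2))"
    unfolding gap_fps(2) by (simp del: fact_Suc)
  finally have eq: "(- 1) ^ n * (real (Suc n) / fact (n + 2)) = 2 * fps_nth gap_fps (Suc n) + fps_nth gap_fps n" .
  show ?thesis unfolding eq by simp
qed

text \<open>The coefficient at \<open>n = 0\<close> is \<open>0\<close> by division by zero, as the
  logarithm requires.\<close>

lemma ln_fps_expansion: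
  "(\<lambda>x::real. ln (1 + x)) has_fps_expansion Abs_fps (\<lambda>n. - ((- 1) ^ n) / real n)"
proof (rule has_fps_expansionI)
  have "eventually (\<lambda>u::real. u \<in> {-1<..<1}) (nhds 0)" by (rule eventually_nhds_in_open) auto
  then show "eventually (\<lambda>u. (\<lambda>n. fps_nth (Abs_fps (\<lambda>n. - ((- 1) ^ n) / real n)) n * u ^ n) sums ln (1 + u)) (nhds (0::real))"
  proof eventually_elim
    case (elim u)
    then have "(\<lambda>n. - ((- u) ^ n) / real n) sums ln (1 + u)"
      by (intro ln_series') (auto simp: abs_less_iff)
    then show ?case by (simp add: power_minus[of u])
  qed
qed

lemma powr_fps_expansion:
  "(\<lambda>x::real. (1 + x) powr a) has_fps_expansion fps_binomial a"
proof (rule has_fps_expansionI)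
  have "eventually (\<lambda>u::real. u \<in> {-1<..<1}) (nhds 0)" by (rule eventually_nhds_in_open) auto
  then show "eventually (\<lambda>u. (\<lambda>n. fps_nth (fps_binomial a) n * u ^ n) sums (1 + u) powr a) (nhds (0::real))"
    by eventually_elim (use gen_binomial_real in \<open>auto simp: abs_less_iff\<close>)
qed

section \<open>Stirling's series, with the constant from Wallis' product\<close>

definition stirling_ratio :: "nat \<Rightarrow> real" where
  "stirling_ratio m = bracket m (\<lambda>v. 1) * sqrt (real m) / sqrt (2 * pi)"

text \<open>The total mass of the Laplace weight is a factorial in disguise; its expansion converts
  normalised brackets back into integrals.\<close>

lemma stirling_ratio_eq: "m > 0 \<Longrightarrow> stirling_ratio m = exp (real m) * fact m / (real m ^ m * sqrt (2 * pi * real m))"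
  by (simp add: stirling_ratio_def bracket_one real_sqrt_mult field_simps)

lemma stirling_ratio_pos: "m > 0 \<Longrightarrow> stirling_ratio m > 0"
  by (simp add: stirling_ratio_eq)

text \<open>Wallis' product in terms of the central binomial coefficient, which in turn is a
  quotient of values of \<open>stirling_ratio\<close>; this is how the limit of the latter gets
  identified.\<close>

lemma central_coeff_wallis: "(\<Prod>k=1..n. (4 * real k^2) / (4 * real k^2 - 1)) = 1 / ((2 * real n + 1) * (central_coeff n)\<^sup>2)"
proof (induction n)
  case (Suc n)
  have "4 * (real (Suc n))\<^sup>2 - 1 = (2 * real n + 1) * (2 * real n + 3)" by (simp add: power2_eq_square algebra_simps)
  moreover have "real (Suc n) = real n + 1" by simp
  moreover have "(\<Prod>k=1..Suc n. (4 * real k^2) / (4 * real k^2 - 1)) =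
    (\<Prod>k=1..n. (4 * real k^2) / (4 * real k^2 - 1)) * ((4 * real (Suc n)^2) / (4 * real (Suc n)^2 - 1))"
    by simp
  ultimately have "(\<Prod>k=1..Suc n. (4 * real k^2) / (4 * real k^2 - 1)) =
     1 / ((2 * real n + 1) * (central_coeff n)\<^sup>2) * (4 * (real n + 1)\<^sup>2 / ((2 * real n + 1) * (2 * real n + 3)))"
    by (simp only: Suc)
  also have "\<dots> = 1 / ((2 * real n + 3) * (central_coeff (Suc n))\<^sup>2)"
    using central_coeff_pos[of n]
    by (simp add: central_coeff_Suc power_mult_distrib power_divide divide_simps) (simp add: power2_eq_square algebra_simps)
  finally show ?case by (simp add: algebra_simps)
qed simp

lemma stirling_ratio_log_diff:
  assumes m: "m > 0"
  shows "ln (stirling_ratio (Suc m)) - ln (stirling_ratio m) = 1 - (real m + 1 / 2) * ln (1 + 1 / real m)"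
proof -
  have l: "ln (stirling_ratio k) = real k + ln (fact k) - real k * ln (real k) - ln (2 * pi) / 2 - ln (real k) / 2" if "k > 0" for k
    using that by (simp add: stirling_ratio_eq ln_mult ln_div ln_realpow ln_sqrt add_divide_distrib)
  have eq: "ln (1 + 1 / real m) = ln (real (Suc m)) - ln (real m)"
  proof -
    have "1 + 1 / real m = real (Suc m) / real m" using m by (simp add: field_simps)
    then show ?thesis using m by (simp only: ln_div) simp
  qed
  have lf: "ln (fact (Suc m) :: real) = ln (real (Suc m)) + ln (fact m)"
    by (simp add: ln_mult del: of_nat_Suc)
  show ?thesis
    unfolding l[OF m] l[OF zero_less_Suc] eq lf by (simp add: algebra_simps add_divide_distrib del: fact_Suc)
qed


definition stirling_log_rhs :: "real fps" where
  "stirling_log_rhs = 1 - (fps_shift 1 (Abs_fps (\<lambda>n. - ((- 1) ^ n) / real n)) + fps_const (1 / 2) * Abs_fps (\<lambda>n. - ((- 1) ^ n) / real n))"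

lemma stirling_log_rhs_nth: "fps_nth stirling_log_rhs n =
   (if n = 0 then 0 else (- 1) ^ n * (1 / (2 * real n) - 1 / (real n + 1)))"
  by (cases "n = 0") (simp_all add: stirling_log_rhs_def right_diff_distrib)

lemma stirling_log_diff_asymp_series:
  "asymp_series sequentially (\<lambda>m. 1 / real m) (\<lambda>m. ln (stirling_ratio (Suc m)) - ln (stirling_ratio m)) stirling_log_rhs"
proof -
  note h = inverse_nat_tendsto_0 and h1 = inverse_nat_bigo_1
  define L where "L = Abs_fps (\<lambda>n. - ((- 1) ^ n) / real n)"
  have "fps_nth L 1 \<noteq> 0" by (simp add: L_def)
  then have "L \<noteq> 0" by (rule fps_nonzeroI)
  then have L1: "1 \<le> subdegree L" by (intro subdegree_geI) (auto simp: L_def)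
  have "(\<lambda>x. 1 - ((if x = 0 then 1 else ln (1 + x) / x ^ 1) + 1 / 2 * ln (1 + x))) has_fps_expansion 1 - (fps_shift 1 L + fps_const (1 / 2) * L)"
    by (intro fps_expansion_intros ln_fps_expansion[folded L_def] L1) (simp add: L_def)
  then have "(\<lambda>x. 1 - ((if x = 0 then 1 else ln (1 + x) / x ^ 1) + 1 / 2 * ln (1 + x))) has_fps_expansion stirling_log_rhs"
    by (simp add: L_def stirling_log_rhs_def)
  from asymp_series_compose[OF h asymp_series_ident[OF h1] _ this]
  have "asymp_series sequentially (\<lambda>m. 1 / real m) (\<lambda>m. 1 - ((if 1 / real m = 0 then 1 else ln (1 + 1 / real m) / (1 / real m) ^ 1) + 1 / 2 * ln (1 + 1 / real m))) stirling_log_rhs"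
    by simp
  then show ?thesis
    by (rule asymp_series_cong, intro eventually_mono[OF eventually_gt_at_top[of 0]])
       (simp add: stirling_ratio_log_diff algebra_simps)
qed

text \<open>The logarithmic differences are \<open>O(1 / m\<^sup>2)\<close>, so a limit
  \<open>c > 0\<close> exists. Wallis' product involves
  \<open>stirling_ratio (2 * n) / (stirling_ratio n)\<^sup>2\<close>, which tends to
  \<open>1 / c\<close>, and so forces \<open>c = 1\<close>.\<close>

lemma stirling_ratio_tendsto: "stirling_ratio \<longlonglongrightarrow> 1"
proof -
  define d where "d m = ln (stirling_ratio (Suc m)) - ln (stirling_ratio m)" for m
  have "(\<Sum>k<2. fps_nth stirling_log_rhs k * (1 / real m) ^ k) = 0" for m
    by (simp add: stirling_log_rhs_nth numeral_2_eq_2)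
  then have "d \<in> O(\<lambda>m. (1 / real m) ^ 2)"
    using asymp_seriesD[OF stirling_log_diff_asymp_series, of 2] by (simp add: d_def[abs_def])
  moreover have "summable (\<lambda>m. norm ((1 / real m) ^ 2))"
    using inverse_power_summable[of 2, where 'a = real] by (simp add: power_divide divide_inverse power_inverse)
  ultimately have "summable d" by (rule summable_comparison_test_bigo[rotated])
  then have "(\<lambda>n. (\<Sum>m<n. d m)) \<longlonglongrightarrow> suminf d" by (rule summable_LIMSEQ)
  moreover have "(\<Sum>m<n. d m) = ln (stirling_ratio n) - ln (stirling_ratio 0)" for n
    unfolding d_def by (rule sum_lessThan_telescope)
  ultimately have "(\<lambda>n. ln (stirling_ratio n) - ln (stirling_ratio 0)) \<longlonglongrightarrow> suminf d" by simp
  from tendsto_add[OF this tendsto_const[of "ln (stirling_ratio 0)"]]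
  have "(\<lambda>n. ln (stirling_ratio n)) \<longlonglongrightarrow> suminf d + ln (stirling_ratio 0)" by simp
  define c where "c = exp (suminf d + ln (stirling_ratio 0))"
  have c: "c > 0" "(\<lambda>n. exp (ln (stirling_ratio n))) \<longlonglongrightarrow> c"
    using tendsto_exp[OF \<open>(\<lambda>n. ln (stirling_ratio n)) \<longlonglongrightarrow> suminf d + ln (stirling_ratio 0)\<close>] by (simp_all add: c_def)
  have ev: "eventually (\<lambda>n. exp (ln (stirling_ratio n)) = stirling_ratio n) sequentially"
    by (intro eventually_mono[OF eventually_gt_at_top[of 0]]) (simp add: stirling_ratio_pos)
  have lim: "stirling_ratio \<longlonglongrightarrow> c" using c(2) tendsto_cong[OF ev] by simp
  have cc: "central_coeff n = stirling_ratio (2 * n) / (stirling_ratio n)\<^sup>2 / sqrt (pi * real n)" if n: "n > 0" for n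
  proof -
    have s4: "sqrt (2 * pi * real (2 * n)) = 2 * sqrt (pi * real n)"
    proof -
      have "2 * pi * real (2 * n) = 2\<^sup>2 * (pi * real n)" by simp
      then show ?thesis by (simp add: real_sqrt_mult)
    qed
    have s2: "(sqrt (2 * pi * real n))\<^sup>2 = 2 * (sqrt (pi * real n))\<^sup>2" by simp
    have p: "real (2 * n) ^ (2 * n) = 4 ^ n * (real n ^ n)\<^sup>2"
      by (simp add: power_mult_distrib power_mult power2_eq_square)
    have e: "exp (real (2 * n)) = (exp (real n))\<^sup>2" by (simp add: exp_double)
    have "stirling_ratio (2 * n) / (stirling_ratio n)\<^sup>2 =
       fact (2 * n) / (4 ^ n * (fact n)\<^sup>2) * ((sqrt (2 * pi * real n))\<^sup>2 / sqrt (2 * pi * real (2 * n)))"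
    proof -
      have 1: "stirling_ratio (2 * n) = (exp (real n))\<^sup>2 * fact (2 * n) / (4 ^ n * (real n ^ n)\<^sup>2 * sqrt (2 * pi * real (2 * n)))"
        using n by (simp only: stirling_ratio_eq p e)
      have 2: "(stirling_ratio n)\<^sup>2 = (exp (real n))\<^sup>2 * (fact n)\<^sup>2 / ((real n ^ n)\<^sup>2 * (sqrt (2 * pi * real n))\<^sup>2)"
        using n by (simp only: stirling_ratio_eq power_divide power_mult_distrib)
      have "E * A / (q * P * t) / (E * B / (P * w)) = A / (q * B) * (w / t)" if "E > 0" "P > 0" "B > 0" "w > 0" "t > 0" "q > 0" for E A q P t B w :: real
        using that by (simp add: field_simps)
      then show ?thesis unfolding 1 2 using n by (simp add: mult_ac)
    qed
    also have "(sqrt (2 * pi * real n))\<^sup>2 / sqrt (2 * pi * real (2 * n)) = sqrt (pi * real n)"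
      unfolding s2 s4 by (simp add: real_div_sqrt)
    finally show ?thesis using n by (simp add: central_coeff_def)
  qed
  have "(\<lambda>n. 1 / ((2 * real n + 1) / real n / pi * (stirling_ratio (2 * n) / (stirling_ratio n)\<^sup>2)\<^sup>2)) \<longlonglongrightarrow> 1 / (2 / pi * (c / c\<^sup>2)\<^sup>2)"
  proof (intro tendsto_intros lim)
    show "(\<lambda>n. (2 * real n + 1) / real n) \<longlonglongrightarrow> 2" by real_asymp
    show "(\<lambda>n. stirling_ratio (2 * n)) \<longlonglongrightarrow> c"
      using LIMSEQ_subseq_LIMSEQ[OF lim, of "\<lambda>n. 2 * n"] by (simp add: strict_mono_def o_def)
  qed (use c(1) in auto)
  moreover have "eventually (\<lambda>n. 1 / ((2 * real n + 1) / real n / pi * (stirling_ratio (2 * n) / (stirling_ratio n)\<^sup>2)\<^sup>2) =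
      (\<Prod>k=1..n. (4 * real k^2) / (4 * real k^2 - 1))) sequentially"
  proof (intro eventually_mono[OF eventually_gt_at_top[of 0]])
    fix n :: nat assume n: "n > 0"
    have sq: "(A / sqrt (pi * real n))\<^sup>2 = A\<^sup>2 / (pi * real n)" for A
      by (simp add: power_divide)
    have "1 / ((2 * real n + 1) / real n / pi * (stirling_ratio (2 * n) / (stirling_ratio n)\<^sup>2)\<^sup>2) =
        1 / ((2 * real n + 1) * (central_coeff n)\<^sup>2)"
      unfolding cc[OF n] sq by (simp add: mult.commute)
    then show "1 / ((2 * real n + 1) / real n / pi * (stirling_ratio (2 * n) / (stirling_ratio n)\<^sup>2)\<^sup>2) =
        (\<Prod>k=1..n. (4 * real k^2) / (4 * real k^2 - 1))"
      unfolding central_coeff_wallis .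
  qed
  ultimately have "(\<lambda>n. \<Prod>k=1..n. (4 * real k^2) / (4 * real k^2 - 1)) \<longlonglongrightarrow> 1 / (2 / pi * (c / c\<^sup>2)\<^sup>2)"
    by (simp add: tendsto_cong)
  from LIMSEQ_unique[OF this wallis] have "1 / (2 / pi * (c / c\<^sup>2)\<^sup>2) = pi / 2" .
  then have "c\<^sup>2 = 1" using c(1) by (simp add: field_simps power2_eq_square)
  then have "c = 1" using c(1) by (simp add: power2_eq_1_iff)
  then show ?thesis using lim by simp
qed

text \<open>With \<open>Q = 1\<close> the recursion leaves the constant term free; \<open>0\<close>
  is the logarithm of the limit of \<open>stirling_ratio\<close>.\<close>

definition stirling_log_fps :: "real fps" where
  "stirling_log_fps = Abs_fps (rec_solution 1 stirling_log_rhs 0)"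

lemma stirling_log_asymp_series:
  "asymp_series sequentially (\<lambda>m. 1 / real m) (\<lambda>m. ln (stirling_ratio m)) stirling_log_fps"
proof (rule asymp_series_recursion[where q = "\<lambda>_. 1" and Q = 1 and g = "\<lambda>_. 1" and B = stirling_log_rhs])
  note h = inverse_nat_tendsto_0 and h1 = inverse_nat_bigo_1
  show "asymp_series sequentially (\<lambda>m. 1 / real m) (\<lambda>_. 1) 1"
    using asymp_series_const[OF h1, of 1] by simp
  show "asymp_series sequentially (\<lambda>m. 1 / real m) (\<lambda>m. ln (stirling_ratio (Suc m)) - ln (stirling_ratio m)) stirling_log_rhs"
    by (rule stirling_log_diff_asymp_series)
  show "1 * (stirling_log_fps oo fps_shift_inv) - stirling_log_fps = stirling_log_rhs"
    unfolding stirling_log_fps_def by (rule rec_solution_correct) (auto simp: stirling_log_rhs_nth)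
  have "(\<lambda>m. ln (stirling_ratio m)) \<longlonglongrightarrow> ln 1" by (intro tendsto_ln stirling_ratio_tendsto) simp
  then show "(\<lambda>m. 1 * (ln (stirling_ratio m) - fps_nth stirling_log_fps 0)) \<longlonglongrightarrow> 0"
    by (simp add: stirling_log_fps_def rec_solution.simps)
qed simp_all

definition stirling_fps :: "real fps" where
  "stirling_fps = fps_exp 1 oo stirling_log_fps"

lemma stirling_asymp_series:
  "asymp_series sequentially (\<lambda>m. 1 / real m) stirling_ratio stirling_fps"
proof -
  have "fps_nth stirling_log_fps 0 = 0" by (simp add: stirling_log_fps_def rec_solution.simps)
  from asymp_series_compose[OF inverse_nat_tendsto_0 stirling_log_asymp_series this has_fps_expansion_exp1]
  have "asymp_series sequentially (\<lambda>m. 1 / real m) (\<lambda>m. exp (ln (stirling_ratio m))) stirling_fps"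
    by (simp add: stirling_fps_def)
  then show ?thesis
    by (rule asymp_series_cong, intro eventually_mono[OF eventually_gt_at_top[of 0]])
       (simp add: stirling_ratio_pos)
qed

section \<open>The expansion of the principal value\<close>

definition pv_rhs :: "real fps" where
  "pv_rhs = stirling_fps * moment_series gap_fps"

definition pv_fps :: "real fps" where
  "pv_fps = Abs_fps (rec_solution (fps_binomial (- 1 / 2)) pv_rhs (- 2 * fps_nth pv_rhs 1))"

text \<open>The factor \<open>sqrt m\<close> removes the half-integer power and brings in
  \<open>q = sqrt (m / (m + 1))\<close>, whose linear coefficient is \<open>- 1 / 2\<close>; the
  equation at order \<open>1\<close> then gives the start \<open>- 2 * fps_nth pv_rhs 1\<close>.
  With \<open>g = 1 / sqrt m\<close> the limit condition of the recursion reduces to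
  \<open>pv_tendsto_0\<close>.\<close>

lemma pv_asymp_series:
  "asymp_series sequentially (\<lambda>m. 1 / real m) (\<lambda>m. sqrt (real m) * pv m / sqrt (2 * pi)) pv_fps"
proof (rule asymp_series_recursion[where q = "\<lambda>m. (1 + 1 / real m) powr (- 1 / 2)" and Q = "fps_binomial (- 1 / 2)"
    and g = "\<lambda>m. 1 / sqrt (real m)" and B = pv_rhs])
  note h = inverse_nat_tendsto_0 and h1 = inverse_nat_bigo_1
  have powr: "(1 + 1 / real m) powr (- 1 / 2) = sqrt (real m) / sqrt (real (Suc m))" if "m > 0" for m
  proof -
    have a: "1 + 1 / real m = real (Suc m) / real m" using that by (simp add: field_simps)
    have "(1 + 1 / real m) powr (- 1 / 2) = inverse ((1 + 1 / real m) powr (1 / 2))"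
      by (simp add: powr_minus[symmetric])
    also have "\<dots> = inverse (sqrt (1 + 1 / real m))" by (subst powr_half_sqrt) auto
    also have "\<dots> = sqrt (real m) / sqrt (real (Suc m))" unfolding a by (simp add: real_sqrt_divide)
    finally show ?thesis .
  qed
  show "asymp_series sequentially (\<lambda>m. 1 / real m) (\<lambda>m. (1 + 1 / real m) powr (- 1 / 2)) (fps_binomial (- 1 / 2))"
    using asymp_series_compose[OF h asymp_series_ident[OF h1] _ powr_fps_expansion[of "- 1 / 2"]] by simp
  have "asymp_series sequentially (\<lambda>m. 1 / real m) (\<lambda>m. bracket m gap / bracket m (\<lambda>v. 1)) (moment_series gap_fps)"
    by (rule bracket_asymp_series[OF _ gap_fps(1) gap_bound(1)]) auto
  then show "asymp_series sequentially (\<lambda>m. 1 / real m) (\<lambda>m. stirling_ratio m * (bracket m gap / bracket m (\<lambda>v. 1))) pv_rhs"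
    unfolding pv_rhs_def by (intro asymp_series_mult h1 stirling_asymp_series)
  show "eventually (\<lambda>m. sqrt (real (Suc m)) * pv (Suc m) / sqrt (2 * pi) * (1 + 1 / real m) powr (- 1 / 2) - sqrt (real m) * pv m / sqrt (2 * pi) =
     stirling_ratio m * (bracket m gap / bracket m (\<lambda>v. 1))) sequentially"
  proof (intro eventually_mono[OF eventually_gt_at_top[of 0]])
    fix m :: nat assume m: "m > 0"
    have "sqrt (real (Suc m)) * pv (Suc m) / sqrt (2 * pi) * (1 + 1 / real m) powr (- 1 / 2) - sqrt (real m) * pv m / sqrt (2 * pi) =
        sqrt (real m) * (pv (Suc m) - pv m) / sqrt (2 * pi)"
      unfolding powr[OF m] by (simp add: field_simps)
    also have "\<dots> = stirling_ratio m * (bracket m gap / bracket m (\<lambda>v. 1))"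
      using bracket_one(3)[OF m] unfolding pv_Suc by (simp add: stirling_ratio_def)
    finally show "sqrt (real (Suc m)) * pv (Suc m) / sqrt (2 * pi) * (1 + 1 / real m) powr (- 1 / 2) - sqrt (real m) * pv m / sqrt (2 * pi) =
      stirling_ratio m * (bracket m gap / bracket m (\<lambda>v. 1))" .
  qed
  show "fps_binomial (- 1 / 2) * (pv_fps oo fps_shift_inv) - pv_fps = pv_rhs"
    unfolding pv_fps_def
    by (rule rec_solution_correct) (auto simp: pv_rhs_def moment_series_def gap_fps_nth_0)
  show "eventually (\<lambda>m. 1 / sqrt (real m) > 0 \<and> 1 / sqrt (real (Suc m)) = 1 / sqrt (real m) * (1 + 1 / real m) powr (- 1 / 2) \<and>
      1 / sqrt (real (Suc m)) \<le> 1 / sqrt (real m)) sequentially"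
  proof (intro eventually_mono[OF eventually_gt_at_top[of 0]])
    fix m :: nat assume m: "m > 0"
    show "1 / sqrt (real m) > 0 \<and> 1 / sqrt (real (Suc m)) = 1 / sqrt (real m) * (1 + 1 / real m) powr (- 1 / 2) \<and>
      1 / sqrt (real (Suc m)) \<le> 1 / sqrt (real m)"
      unfolding powr[OF m] using m by (simp add: divide_simps)
  qed
  have "(\<lambda>m. pv m / sqrt (2 * pi) - fps_nth pv_fps 0 * (1 / sqrt (real m))) \<longlonglongrightarrow> 0 / sqrt (2 * pi) - fps_nth pv_fps 0 * 0"
    by (intro tendsto_intros pv_tendsto_0) (auto, real_asymp)
  moreover have "eventually (\<lambda>m. pv m / sqrt (2 * pi) - fps_nth pv_fps 0 * (1 / sqrt (real m)) =
      1 / sqrt (real m) * (sqrt (real m) * pv m / sqrt (2 * pi) - fps_nth pv_fps 0)) sequentially"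
    by (intro eventually_mono[OF eventually_gt_at_top[of 0]]) (simp add: field_simps)
  ultimately show "(\<lambda>m. 1 / sqrt (real m) * (sqrt (real m) * pv m / sqrt (2 * pi) - fps_nth pv_fps 0)) \<longlonglongrightarrow> 0"
    by (simp add: tendsto_cong)
qed

section \<open>The large-argument expansion of the Bessel functions\<close>

definition lip_bound :: "nat \<Rightarrow> (real \<Rightarrow> real) \<Rightarrow> bool" where
  "lip_bound k f \<longleftrightarrow> (\<exists>C\<ge>0. \<exists>q. \<forall>x y. 0 \<le> x \<longrightarrow> x \<le> y \<longrightarrow> \<bar>f y - f x\<bar> \<le> C * y ^ k * (1 + y) ^ q * (y - x))"

lemma lip_boundE:
  assumes "lip_bound k f"
  obtains C q where "C \<ge> 0" "\<And>x y. 0 \<le> x \<Longrightarrow> x \<le> y \<Longrightarrow> \<bar>f y - f x\<bar> \<le> C * y ^ k * (1 + y) ^ q * (y - x)"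
  using assms unfolding lip_bound_def by blast

lemma lip_boundI:
  assumes "C \<ge> 0" "\<And>x y. 0 \<le> x \<Longrightarrow> x \<le> y \<Longrightarrow> \<bar>f y - f x\<bar> \<le> C * y ^ k * (1 + y) ^ q * (y - x)"
  shows "lip_bound k f"
  using assms unfolding lip_bound_def by blast

lemma lip_bound_const: "lip_bound k (\<lambda>_. c)"
  by (rule lip_boundI[of 0]) auto

lemma lip_bound_cmult:
  assumes "lip_bound k f"
  shows "lip_bound k (\<lambda>x. c * f x)"
proof -
  obtain C q where C: "C \<ge> 0" "\<And>x y. 0 \<le> x \<Longrightarrow> x \<le> y \<Longrightarrow> \<bar>f y - f x\<bar> \<le> C * y ^ k * (1 + y) ^ q * (y - x)"
    using lip_boundE[OF assms] by blast
  show ?thesis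
  proof (rule lip_boundI[of "\<bar>c\<bar> * C" _ _ q])
    fix x y :: real assume xy: "0 \<le> x" "x \<le> y"
    have "\<bar>c * f y - c * f x\<bar> = \<bar>c\<bar> * \<bar>f y - f x\<bar>" by (simp add: abs_mult[symmetric] right_diff_distrib)
    also have "\<dots> \<le> \<bar>c\<bar> * (C * y ^ k * (1 + y) ^ q * (y - x))" by (intro mult_left_mono C xy) auto
    finally show "\<bar>c * f y - c * f x\<bar> \<le> \<bar>c\<bar> * C * y ^ k * (1 + y) ^ q * (y - x)" by (simp add: mult_ac)
  qed (use C(1) in simp)
qed

lemma lip_bound_add:
  assumes "lip_bound k f" "lip_bound k g"
  shows "lip_bound k (\<lambda>x. f x + g x)"
proof -
  obtain C q where C: "C \<ge> 0" "\<And>x y. 0 \<le> x \<Longrightarrow> x \<le> y \<Longrightarrow> \<bar>f y - f x\<bar> \<le> C * y ^ k * (1 + y) ^ q * (y - x)"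
    using lip_boundE[OF assms(1)] by blast
  obtain D r where D: "D \<ge> 0" "\<And>x y. 0 \<le> x \<Longrightarrow> x \<le> y \<Longrightarrow> \<bar>g y - g x\<bar> \<le> D * y ^ k * (1 + y) ^ r * (y - x)"
    using lip_boundE[OF assms(2)] by blast
  show ?thesis
  proof (rule lip_boundI[of "C + D" _ _ "q + r"])
    fix x y :: real assume xy: "0 \<le> x" "x \<le> y"
    have "\<bar>(f y + g y) - (f x + g x)\<bar> \<le> \<bar>f y - f x\<bar> + \<bar>g y - g x\<bar>" by linarith
    also have "\<bar>f y - f x\<bar> \<le> C * y ^ k * (1 + y) ^ q * (y - x)" by (rule C(2)[OF xy])
    also have "\<dots> \<le> C * y ^ k * (1 + y) ^ (q + r) * (y - x)"
      using C(1) xy by (intro mult_right_mono mult_left_mono power_increasing) auto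
    also have "\<bar>g y - g x\<bar> \<le> D * y ^ k * (1 + y) ^ r * (y - x)" by (rule D(2)[OF xy])
    also have "\<dots> \<le> D * y ^ k * (1 + y) ^ (q + r) * (y - x)"
      using D(1) xy by (intro mult_right_mono mult_left_mono power_increasing) auto
    finally show "\<bar>(f y + g y) - (f x + g x)\<bar> \<le> (C + D) * y ^ k * (1 + y) ^ (q + r) * (y - x)"
      by (simp add: distrib_right)
  qed (use C(1) D(1) in simp)
qed

lemma lip_bound_sum: "(\<And>i. i \<in> A \<Longrightarrow> lip_bound k (f i)) \<Longrightarrow> lip_bound k (\<lambda>x. \<Sum>i\<in>A. f i x)"
  by (induction A rule: infinite_finite_induct) (auto intro: lip_bound_const lip_bound_add)

lemma lip_bound_power:
  assumes "j \<ge> Suc k"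
  shows "lip_bound k (\<lambda>x. x ^ j)"
proof (rule lip_boundI[of "real j" _ _ "j - Suc k"])
  fix x y :: real assume xy: "0 \<le> x" "x \<le> y"
  have "y ^ j - x ^ j = (y - x) * (\<Sum>i<j. x ^ (j - Suc i) * y ^ i)" by (rule power_diff_sumr2)
  moreover have "(\<Sum>i<j. x ^ (j - Suc i) * y ^ i) \<le> (\<Sum>i<j. y ^ (j - 1))"
  proof (intro sum_mono)
    fix i assume "i \<in> {..<j}"
    then have "y ^ (j - Suc i) * y ^ i = y ^ (j - 1)" by (simp flip: power_add)
    moreover have "x ^ (j - Suc i) * y ^ i \<le> y ^ (j - Suc i) * y ^ i"
      using xy by (intro mult_right_mono power_mono) auto
    ultimately show "x ^ (j - Suc i) * y ^ i \<le> y ^ (j - 1)" by simp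
  qed
  moreover have "(\<Sum>i<j. x ^ (j - Suc i) * y ^ i) \<ge> 0" using xy by (intro sum_nonneg) auto
  ultimately have "\<bar>y ^ j - x ^ j\<bar> \<le> (y - x) * (real j * y ^ (j - 1))"
    using xy by (simp add: abs_mult mult_left_mono)
  also have "y ^ (j - 1) = y ^ k * y ^ (j - Suc k)" using assms by (simp flip: power_add)
  also have "(y - x) * (real j * (y ^ k * y ^ (j - Suc k))) \<le> (y - x) * (real j * (y ^ k * (1 + y) ^ (j - Suc k)))"
    using xy by (intro mult_left_mono power_mono) auto
  finally show "\<bar>y ^ j - x ^ j\<bar> \<le> real j * y ^ k * (1 + y) ^ (j - Suc k) * (y - x)" by (simp add: mult_ac)
qed simp

lemma lip_bound_polynomial: "lip_bound 0 (\<lambda>x. \<Sum>j<n. c j * x ^ j)"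
proof (intro lip_bound_sum lip_bound_cmult)
  fix j show "lip_bound 0 (\<lambda>x. x ^ j)"
    by (cases "j = 0") (auto intro: lip_bound_const lip_bound_power)
qed

text \<open>One factor carries the order \<open>k\<close>. Its vanishing at \<open>0\<close>
  converts the Lipschitz bound into a bound on its size, and the other factor adds only polynomial
  growth.\<close>

lemma lip_bound_mult:
  assumes "lip_bound k f" "f 0 = 0" "lip_bound 0 g"
  shows "lip_bound k (\<lambda>x. f x * g x)"
proof -
  obtain C q where C: "C \<ge> 0" "\<And>x y. 0 \<le> x \<Longrightarrow> x \<le> y \<Longrightarrow> \<bar>f y - f x\<bar> \<le> C * y ^ k * (1 + y) ^ q * (y - x)"
    using lip_boundE[OF assms(1)] by blast
  obtain D r where D: "D \<ge> 0" "\<And>x y. 0 \<le> x \<Longrightarrow> x \<le> y \<Longrightarrow> \<bar>g y - g x\<bar> \<le> D * y ^ 0 * (1 + y) ^ r * (y - x)"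
    using lip_boundE[OF assms(3)] by blast
  show ?thesis
  proof (rule lip_boundI[of "C * (\<bar>g 0\<bar> + D) + C * D" _ _ "q + r + 1"])
    fix x y :: real assume xy: "0 \<le> x" "x \<le> y"
    then have y: "y \<ge> 0" by simp
    have gy: "\<bar>g y\<bar> \<le> (\<bar>g 0\<bar> + D) * (1 + y) ^ (r + 1)"
    proof -
      have "\<bar>g y\<bar> \<le> \<bar>g 0\<bar> + D * (1 + y) ^ r * y" using D(2)[of 0 y] y by simp
      also have "\<dots> \<le> \<bar>g 0\<bar> * (1 + y) ^ (r + 1) + D * (1 + y) ^ r * (1 + y)"
        using D(1) y one_le_power[of "1 + y" "r + 1"] mult_left_mono[of 1 "(1 + y) ^ (r + 1)" "\<bar>g 0\<bar>"]
        by (intro add_mono mult_left_mono) auto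
      finally show ?thesis by (simp add: algebra_simps)
    qed
    have fx: "\<bar>f x\<bar> \<le> C * y ^ k * (1 + y) ^ (q + 1)"
    proof -
      have "\<bar>f x\<bar> \<le> C * x ^ k * (1 + x) ^ q * x" using C(2)[of 0 x] xy assms(2) by simp
      also have "\<dots> \<le> C * y ^ k * (1 + y) ^ q * (1 + y)"
        using C(1) xy by (intro mult_mono power_mono) auto
      finally show ?thesis by (simp add: mult_ac)
    qed
    have "\<bar>f y * g y - f x * g x\<bar> = \<bar>(f y - f x) * g y + f x * (g y - g x)\<bar>" by (simp add: algebra_simps)
    also have "\<dots> \<le> \<bar>f y - f x\<bar> * \<bar>g y\<bar> + \<bar>f x\<bar> * \<bar>g y - g x\<bar>"
      by (rule order_trans[OF abs_triangle_ineq]) (simp add: abs_mult)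
    also have "\<dots> \<le> (C * y ^ k * (1 + y) ^ q * (y - x)) * ((\<bar>g 0\<bar> + D) * (1 + y) ^ (r + 1)) +
        (C * y ^ k * (1 + y) ^ (q + 1)) * (D * y ^ 0 * (1 + y) ^ r * (y - x))"
      using C D xy y by (intro add_mono mult_mono gy fx) auto
    also have "\<dots> = (C * (\<bar>g 0\<bar> + D) + C * D) * y ^ k * (1 + y) ^ (q + r + 1) * (y - x)"
      by (simp add: power_add algebra_simps)
    finally show "\<bar>f y * g y - f x * g x\<bar> \<le> \<dots>" .
  qed (use C(1) D(1) in simp)
qed

text \<open>
  Remainders of order \<open>J\<close> are required to have Lipschitz constant \<open>O(\<eta> ^ (J - 1))\<close> on \<open>[0, \<eta>]\<close>, up to
  polynomial growth at infinity: this survives the singular factor \<open>1 / (1 - v\<^sup>2)\<close>.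
\<close>

definition lip_series :: "(real \<Rightarrow> real) \<Rightarrow> real fps \<Rightarrow> bool" where
  "lip_series f P \<longleftrightarrow> f 0 = fps_nth P 0 \<and> (\<forall>J\<ge>1. lip_bound (J - 1) (\<lambda>x. f x - (\<Sum>j<J. fps_nth P j * x ^ j)))"

lemma lip_series_remainder_0:
  assumes "lip_series f P" "J \<ge> 1"
  shows "f 0 - (\<Sum>j<J. fps_nth P j * 0 ^ j) = 0"
  using assms by (subst sum.remove[of _ 0]) (auto simp: lip_series_def intro!: sum.neutral)

lemma lip_seriesE:
  assumes "lip_series f P" "J \<ge> 1"
  obtains C q where "C \<ge> 0" and "\<And>x y. 0 \<le> x \<Longrightarrow> x \<le> y \<Longrightarrow>
     \<bar>(f y - (\<Sum>j<J. fps_nth P j * y ^ j)) - (f x - (\<Sum>j<J. fps_nth P j * x ^ j))\<bar> \<le> C * y ^ (J - 1) * (1 + y) ^ q * (y - x)"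
    and "\<And>y. 0 \<le> y \<Longrightarrow> \<bar>f y - (\<Sum>j<J. fps_nth P j * y ^ j)\<bar> \<le> C * y ^ J * (1 + y) ^ q"
proof -
  have "lip_bound (J - 1) (\<lambda>x. f x - (\<Sum>j<J. fps_nth P j * x ^ j))"
    using assms by (simp add: lip_series_def)
  then show thesis
  proof (rule lip_boundE)
    fix C q
    assume C: "C \<ge> 0" "\<And>x y. 0 \<le> x \<Longrightarrow> x \<le> y \<Longrightarrow>
      \<bar>(f y - (\<Sum>j<J. fps_nth P j * y ^ j)) - (f x - (\<Sum>j<J. fps_nth P j * x ^ j))\<bar> \<le> C * y ^ (J - 1) * (1 + y) ^ q * (y - x)"
    have "y ^ J = y ^ (J - 1) * y" for y :: real using assms(2) by (simp add: power_eq_if)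
    then have "\<bar>f y - (\<Sum>j<J. fps_nth P j * y ^ j)\<bar> \<le> C * y ^ J * (1 + y) ^ q" if "0 \<le> y" for y
      using C(2)[of 0 y] that lip_series_remainder_0[OF assms] by (simp add: mult_ac)
    with C show thesis by (rule that)
  qed
qed

lemma lip_series_mult:
  assumes f: "lip_series f P" and g: "lip_series g Q"
  shows "lip_series (\<lambda>x. f x * g x) (P * Q)"
  unfolding lip_series_def
proof (intro conjI allI impI)
  show "f 0 * g 0 = fps_nth (P * Q) 0" using f g by (simp add: lip_series_def)
next
  fix J :: nat assume J: "J \<ge> 1"
  let ?s = "\<lambda>P x. \<Sum>j<J. fps_nth P j * x ^ j"
  let ?I = "{(i, j). i < J \<and> j < J \<and> i + j \<ge> J}"
  have "lip_bound 0 (\<lambda>x. (g x - (\<Sum>j<1. fps_nth Q j * x ^ j)) + fps_nth Q 0)"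
    using g by (intro lip_bound_add lip_bound_const) (auto simp: lip_series_def dest: spec[of _ 1])
  then have g0: "lip_bound 0 g" by simp
  have "lip_bound (J - 1) (\<lambda>x. ((f x - ?s P x) * g x + (g x - ?s Q x) * ?s P x) +
      (\<Sum>(i, j)\<in>?I. fps_nth P i * fps_nth Q j * x ^ (i + j)))"
  proof (intro lip_bound_add lip_bound_mult lip_bound_polynomial g0)
    show "lip_bound (J - 1) (\<lambda>x. f x - ?s P x)" "lip_bound (J - 1) (\<lambda>x. g x - ?s Q x)"
      using f g J by (auto simp: lip_series_def)
    show "f 0 - ?s P 0 = 0" "g 0 - ?s Q 0 = 0"
      using lip_series_remainder_0[OF f J] lip_series_remainder_0[OF g J] by simp_all
    show "lip_bound (J - 1) (\<lambda>x. \<Sum>(i, j)\<in>?I. fps_nth P i * fps_nth Q j * x ^ (i + j))"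
    proof (rule lip_bound_sum)
      fix p assume "p \<in> ?I"
      then show "lip_bound (J - 1) (\<lambda>x. case p of (i, j) \<Rightarrow> fps_nth P i * fps_nth Q j * x ^ (i + j))"
        using J by (auto intro!: lip_bound_cmult lip_bound_power)
    qed
  qed
  also have "(\<lambda>x. ((f x - ?s P x) * g x + (g x - ?s Q x) * ?s P x) + (\<Sum>(i, j)\<in>?I. fps_nth P i * fps_nth Q j * x ^ (i + j))) =
      (\<lambda>x. f x * g x - ?s (P * Q) x)"
  proof
    fix x
    have "(\<Sum>(i, j)\<in>?I. fps_nth P i * fps_nth Q j * x ^ (i + j)) = ?s P x * ?s Q x - ?s (P * Q) x"
      using fps_partial_sum_mult[where n = J and P = P and Q = Q and x = x] by simp
    then show "((f x - ?s P x) * g x + (g x - ?s Q x) * ?s P x) + (\<Sum>(i, j)\<in>?I. fps_nth P i * fps_nth Q j * x ^ (i + j)) =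
      f x * g x - ?s (P * Q) x"
      by (simp add: algebra_simps)
  qed
  finally show "lip_bound (J - 1) (\<lambda>x. f x * g x - ?s (P * Q) x)" .
qed

lemma lip_series_imp_asymp_series:
  assumes f: "lip_series f P" and h: "(h \<longlongrightarrow> 0) F" and pos: "eventually (\<lambda>x. h x \<ge> 0) F"
  shows "asymp_series F h (\<lambda>x. f (h x)) P"
proof (rule asymp_seriesI_ge[OF tendsto_imp_bigo_1[OF h], of 1])
  fix n :: nat assume n: "n \<ge> 1"
  obtain C q where C: "C \<ge> 0"
      "\<And>y. 0 \<le> y \<Longrightarrow> \<bar>f y - (\<Sum>j<n. fps_nth P j * y ^ j)\<bar> \<le> C * y ^ n * (1 + y) ^ q"
    by (rule lip_seriesE[OF f n]) (rule that)
  have "eventually (\<lambda>x. h x < 1) F" using h by (rule order_tendstoD) simp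
  with pos have "eventually (\<lambda>x. norm (f (h x) - (\<Sum>j<n. fps_nth P j * h x ^ j)) \<le> (C * 2 ^ q) * norm (h x ^ n)) F"
  proof eventually_elim
    case (elim x)
    have "\<bar>f (h x) - (\<Sum>j<n. fps_nth P j * h x ^ j)\<bar> \<le> C * h x ^ n * (1 + h x) ^ q"
      by (rule C(2)) (use elim in simp)
    also have "\<dots> \<le> C * h x ^ n * 2 ^ q"
      using C(1) elim by (intro mult_left_mono power_mono) auto
    finally show ?case using elim by (simp add: mult_ac abs_mult power_abs)
  qed
  then show "(\<lambda>x. f (h x) - (\<Sum>k<n. fps_nth P k * h x ^ k)) \<in> O[F](\<lambda>x. h x ^ n)"
    by (rule bigoI)
qed

text \<open>Absorption of binomial coefficients keeps the Taylor remainders of the functions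
  \<open>(1 + x) powr a\<close> closed under differentiation, with \<open>a\<close> and the order
  each lowered by one.\<close>

lemma powr_remainder_deriv:
  fixes a x :: real
  assumes "x \<ge> 0"
  shows "((\<lambda>x. (1 + x) powr a - (\<Sum>j<Suc J. (a gchoose j) * x ^ j)) has_real_derivative
    a * ((1 + x) powr (a - 1) - (\<Sum>j<J. (a - 1 gchoose j) * x ^ j))) (at x)"
proof -
  have "((\<lambda>x. (1 + x) powr a - (1 + (\<Sum>j<J. (a gchoose Suc j) * x ^ Suc j))) has_real_derivative
      (a * (1 + x) powr (a - 1) - (\<Sum>j<J. (a gchoose Suc j) * (real (Suc j) * x ^ j)))) (at x)"
    using assms by (auto intro!: derivative_eq_intros sum.cong simp: mult_ac simp del: power_Suc of_nat_Suc)
  also have "(\<Sum>j<J. (a gchoose Suc j) * (real (Suc j) * x ^ j)) = a * (\<Sum>j<J. (a - 1 gchoose j) * x ^ j)"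
    unfolding sum_distrib_left
  proof (intro sum.cong refl)
    fix j
    have "(a gchoose Suc j) * real (Suc j) = a * (a - 1 gchoose j)"
      using gbinomial_absorption[of j a] by (simp add: mult.commute)
    then show "(a gchoose Suc j) * (real (Suc j) * x ^ j) = a * ((a - 1 gchoose j) * x ^ j)"
      by (simp only: mult.assoc[symmetric])
  qed
  also have "(\<lambda>x. (1 + x) powr a - (1 + (\<Sum>j<J. (a gchoose Suc j) * x ^ Suc j))) =
      (\<lambda>x. (1 + x) powr a - (\<Sum>j<Suc J. (a gchoose j) * x ^ j))"
    by (auto simp: fun_eq_iff sum.lessThan_Suc_shift simp del: power_Suc sum.lessThan_Suc)
  finally show ?thesis by (simp add: right_diff_distrib)
qed

text \<open>The mean value theorem raises the order by one, and \<open>a \<le> 0\<close> is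
  inherited by \<open>a - 1\<close>. The bound has to be global on the half-line because arguments
  \<open>s * x / 2\<close> with unbounded \<open>s\<close> will be inserted.\<close>

lemma powr_remainder_bound:
  fixes a :: real
  assumes "a \<le> 0"
  shows "\<exists>C\<ge>0. \<forall>x\<ge>0. \<bar>(1 + x) powr a - (\<Sum>j<J. (a gchoose j) * x ^ j)\<bar> \<le> C * x ^ J"
  using assms
proof (induction J arbitrary: a)
  case 0
  have "(1 + x) powr a \<le> 1" if "x \<ge> 0" for x
    using powr_mono2'[of a 1 "1 + x"] that 0 by simp
  then show ?case by (intro exI[of _ 1]) auto
next
  case (Suc J)
  have "\<exists>C\<ge>0. \<forall>x\<ge>0. \<bar>(1 + x) powr (a - 1) - (\<Sum>j<J. (a - 1 gchoose j) * x ^ j)\<bar> \<le> C * x ^ J"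
    by (rule Suc.IH) (use Suc.prems in simp)
  then obtain C where C: "C \<ge> 0" "\<And>x. x \<ge> 0 \<Longrightarrow> \<bar>(1 + x) powr (a - 1) - (\<Sum>j<J. (a - 1 gchoose j) * x ^ j)\<bar> \<le> C * x ^ J"
    by blast
  define r where "r x = (1 + x) powr a - (\<Sum>j<Suc J. (a gchoose j) * x ^ j)" for x
  have der: "(r has_real_derivative a * ((1 + x) powr (a - 1) - (\<Sum>j<J. (a - 1 gchoose j) * x ^ j))) (at x)" if "x \<ge> 0" for x
    unfolding r_def by (rule powr_remainder_deriv[OF that])
  have "\<bar>r x\<bar> \<le> (\<bar>a\<bar> * C) * x ^ Suc J" if x: "x \<ge> 0" for x
  proof (cases "x = 0")
    case True
    then show ?thesis by (simp add: r_def sum.lessThan_Suc_shift)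
  next
    case False
    with x have "x > 0" by simp
    from MVT2[OF this der] obtain t where t: "0 < t" "t < x"
      "r x - r 0 = (x - 0) * (a * ((1 + t) powr (a - 1) - (\<Sum>j<J. (a - 1 gchoose j) * t ^ j)))" by auto
    have "r 0 = 0" by (simp add: r_def sum.lessThan_Suc_shift)
    then have "\<bar>r x\<bar> = x * (\<bar>a\<bar> * \<bar>(1 + t) powr (a - 1) - (\<Sum>j<J. (a - 1 gchoose j) * t ^ j)\<bar>)"
      using t x by (simp add: abs_mult)
    also have "\<dots> \<le> x * (\<bar>a\<bar> * (C * t ^ J))" using C(2)[of t] t x by (intro mult_left_mono) auto
    also have "\<dots> \<le> x * (\<bar>a\<bar> * (C * x ^ J))" using C(1) t x by (intro mult_left_mono power_mono) auto
    finally show ?thesis by (simp add: mult_ac)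
  qed
  then show ?case unfolding r_def using C(1) by (intro exI[of _ "\<bar>a\<bar> * C"]) auto
qed


lemma powr_remainder_lipschitz:
  fixes a :: real
  assumes "a \<le> 0" "J \<ge> 1"
  shows "\<exists>C\<ge>0. \<forall>x y. 0 \<le> x \<longrightarrow> x \<le> y \<longrightarrow>
    \<bar>((1 + y) powr a - (\<Sum>j<J. (a gchoose j) * y ^ j)) - ((1 + x) powr a - (\<Sum>j<J. (a gchoose j) * x ^ j))\<bar> \<le> C * y ^ (J - 1) * (y - x)"
proof -
  obtain K where K: "J = Suc K" using assms(2) by (cases J) auto
  obtain C where C: "C \<ge> 0" "\<And>x. x \<ge> 0 \<Longrightarrow> \<bar>(1 + x) powr (a - 1) - (\<Sum>j<K. (a - 1 gchoose j) * x ^ j)\<bar> \<le> C * x ^ K"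
    using powr_remainder_bound[of "a - 1" K] assms(1) by auto
  define r where "r x = (1 + x) powr a - (\<Sum>j<J. (a gchoose j) * x ^ j)" for x
  have der: "(r has_real_derivative a * ((1 + x) powr (a - 1) - (\<Sum>j<K. (a - 1 gchoose j) * x ^ j))) (at x)" if "x \<ge> 0" for x
    unfolding r_def K by (rule powr_remainder_deriv[OF that])
  have "\<bar>r y - r x\<bar> \<le> (\<bar>a\<bar> * C) * y ^ K * (y - x)" if xy: "0 \<le> x" "x \<le> y" for x y
  proof (cases "x = y")
    case False
    with xy have "x < y" by simp
    from MVT2[OF this der] xy obtain t where t: "x < t" "t < y"
      "r y - r x = (y - x) * (a * ((1 + t) powr (a - 1) - (\<Sum>j<K. (a - 1 gchoose j) * t ^ j)))" by auto
    then have "\<bar>r y - r x\<bar> = (y - x) * (\<bar>a\<bar> * \<bar>(1 + t) powr (a - 1) - (\<Sum>j<K. (a - 1 gchoose j) * t ^ j)\<bar>)"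
      using xy by (simp add: abs_mult)
    also have "\<dots> \<le> (y - x) * (\<bar>a\<bar> * (C * t ^ K))" using C(2)[of t] t xy by (intro mult_left_mono) auto
    also have "\<dots> \<le> (y - x) * (\<bar>a\<bar> * (C * y ^ K))" using C(1) t xy by (intro mult_left_mono power_mono) auto
    finally show ?thesis by (simp add: mult_ac)
  qed simp
  then show ?thesis unfolding r_def using C(1) K by (intro exI[of _ "\<bar>a\<bar> * C"]) auto
qed

section \<open>K_0 at large argument, as an average over a Gamma density\<close>

definition gauss_wt :: "real \<Rightarrow> real" where
  "gauss_wt s = exp (- s) / (sqrt s * sqrt pi)"

lemma gauss_wt_measurable [measurable]: "gauss_wt \<in> borel_measurable borel"
  unfolding gauss_wt_def by measurable

lemma gauss_wt_nonneg: "s > 0 \<Longrightarrow> 0 \<le> gauss_wt s"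
  by (simp add: gauss_wt_def)

text \<open>\<open>gauss_wt\<close> is the Gamma density with parameter \<open>1 / 2\<close>, the
  image of a Gaussian under squaring; its moments are
  \<open>Gamma (1 / 2 + j) / Gamma (1 / 2)\<close>.\<close>

lemma gauss_wt_moment:
  "wint_integrable gauss_wt (\<lambda>s. s ^ j)" "wint gauss_wt (\<lambda>s. s ^ j) = pochhammer (1 / 2) j"
proof -
  define G where "G t = t powr (1 / 2 + real j - 1) / exp t" for t :: real
  have [measurable]: "G \<in> borel_measurable borel" unfolding G_def by measurable
  have hi: "(G has_integral Gamma (1 / 2 + real j)) {0..}"
    unfolding G_def by (rule Gamma_integral_real) simp
  then have "G absolutely_integrable_on {0..}"
    by (intro nonnegative_absolutely_integrable_1) (auto simp: has_integral_iff G_def)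
  then have int0: "set_integrable lborel {0..} G"
    unfolding set_integrable_def by (subst (asm) integrable_completion) auto
  have int: "set_integrable lborel {0<..} G" by (rule set_integrable_subset[OF int0]) auto
  have "(LINT t:{0<..}|lborel. G t) = (LINT t:{0..}|lborel. G t)"
    unfolding set_lebesgue_integral_def
    by (rule integral_cong_AE, measurable, rule eventually_mono[OF AE_lborel_singleton[of 0]])
       (auto split: split_indicator)
  also have "\<dots> = Gamma (1 / 2 + real j)"
    using set_borel_integral_eq_integral(2)[OF int0] hi by (simp add: has_integral_iff)
  finally have G: "(LINT t:{0<..}|lborel. G t) = Gamma (1 / 2 + real j)" .
  have eq: "gauss_wt t * t ^ j = 1 / sqrt pi * G t" if "t > 0" for t
  proof -
    have "t powr (1 / 2 + real j - 1) = t powr (real j - 1 / 2)" by simp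
    also have "\<dots> = t ^ j / sqrt t" using that by (simp add: powr_diff powr_realpow powr_half_sqrt)
    finally show ?thesis by (simp add: gauss_wt_def G_def exp_minus field_simps)
  qed
  have "set_integrable lborel {0<..} (\<lambda>t. 1 / sqrt pi * G t)" by (rule set_integrable_mult_right[OF int])
  then show "wint_integrable gauss_wt (\<lambda>s. s ^ j)"
    by (rule set_integrable_cong[THEN iffD1, rotated -1]) (simp_all add: eq)
  have "wint gauss_wt (\<lambda>s. s ^ j) = (LINT t:{0<..}|lborel. 1 / sqrt pi * G t)"
    unfolding wint_def by (intro set_lebesgue_integral_cong) (auto simp: eq)
  also have "\<dots> = 1 / sqrt pi * Gamma (1 / 2 + real j)" by (subst set_integral_mult_right) (simp add: G)
  also have "\<dots> = pochhammer (1 / 2) j"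
    by (subst pochhammer_Gamma) (auto simp: Gamma_one_half_real elim!: nonpos_Ints_cases)
  finally show "wint gauss_wt (\<lambda>s. s ^ j) = pochhammer (1 / 2) j" .
qed

text \<open>\<open>K\<^sub>0(u)\<close> at \<open>u = 1 / x\<close> without the factor
  \<open>sqrt (pi / (2 * u)) * exp (- u)\<close>. In the reciprocal variable, dilating the argument
  of \<open>K\<^sub>0\<close> by \<open>v\<close> replaces \<open>x\<close> by \<open>x / v\<close>,
  and the expansion at infinity becomes one at \<open>0\<close>.\<close>

definition macdonald :: "real \<Rightarrow> real" where
  "macdonald x = wint gauss_wt (\<lambda>s. (1 + s * x / 2) powr (- 1 / 2))"

definition macdonald_fps :: "real fps" where
  "macdonald_fps = Abs_fps (\<lambda>j. ((- 1 / 2) gchoose j) / 2 ^ j * pochhammer (1 / 2) j)"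

lemma macdonald_integrable:
  assumes "x \<ge> 0"
  shows "wint_integrable gauss_wt (\<lambda>s. (1 + s * x / 2) powr (- 1 / 2))"
proof (rule wint_bound(1)[OF gauss_wt_measurable gauss_wt_nonneg, where g = "\<lambda>s. s ^ 0"])
  show "wint_integrable gauss_wt (\<lambda>s. s ^ 0)" by (rule gauss_wt_moment)
  fix s :: real assume "s > 0"
  then have "1 \<le> 1 + s * x / 2" using assms by simp
  then have "(1 + s * x / 2) powr (- 1 / 2) \<le> 1 powr (- 1 / 2)" by (intro powr_mono2') auto
  then show "\<bar>(1 + s * x / 2) powr (- 1 / 2)\<bar> \<le> s ^ 0" by simp
qed auto

text \<open>The Lipschitz bound for the Taylor remainder of \<open>(1 + x) powr (- 1 / 2)\<close> is
  integrated against the weight; scaling its arguments by \<open>s / 2\<close> brings out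
  \<open>s ^ J\<close>, whose moment is finite.\<close>

lemma macdonald_lip_series: "lip_series macdonald macdonald_fps"
  unfolding lip_series_def
proof (intro conjI allI impI)
  show "macdonald 0 = fps_nth macdonald_fps 0"
    using gauss_wt_moment(2)[of 0] by (simp add: macdonald_def macdonald_fps_def)
next
  fix J :: nat assume J: "J \<ge> 1"
  define T where "T x = (1 + x) powr (- 1 / 2) - (\<Sum>j<J. ((- 1 / 2) gchoose j) * x ^ j)" for x :: real
  have [measurable]: "T \<in> borel_measurable borel" unfolding T_def by measurable
  obtain C where C: "C \<ge> 0" "\<And>x y. 0 \<le> x \<Longrightarrow> x \<le> y \<Longrightarrow> \<bar>T y - T x\<bar> \<le> C * y ^ (J - 1) * (y - x)"
    using powr_remainder_lipschitz[of "- 1 / 2" J] J unfolding T_def by auto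
  have pint: "wint_integrable gauss_wt (\<lambda>s. \<Sum>j<J. ((- 1 / 2) gchoose j) * (s * x / 2) ^ j) \<and>
     wint gauss_wt (\<lambda>s. \<Sum>j<J. ((- 1 / 2) gchoose j) * (s * x / 2) ^ j) = (\<Sum>j<J. fps_nth macdonald_fps j * x ^ j)" for x
  proof -
    define c where "c j = ((- 1 / 2) gchoose j) / 2 ^ j * x ^ j" for j
    have e: "((- 1 / 2) gchoose j) * (s * x / 2) ^ j = c j * s ^ j" for s :: real and j
      by (simp add: c_def power_mult_distrib power_divide)
    have ci: "wint_integrable gauss_wt (\<lambda>s. c j * s ^ j)" and cv: "wint gauss_wt (\<lambda>s. c j * s ^ j) = c j * pochhammer (1 / 2) j" for j
      using wint_cmult[OF gauss_wt_moment(1), of "c j" j] by (simp_all add: gauss_wt_moment(2))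
    have "(\<Sum>j<J. c j * pochhammer (1 / 2) j) = (\<Sum>j<J. fps_nth macdonald_fps j * x ^ j)"
      by (simp add: c_def macdonald_fps_def mult_ac)
    then show ?thesis
      using wint_sum[of "{..<J}" gauss_wt "\<lambda>j s. c j * s ^ j", OF ci] unfolding e cv by simp
  qed
  have rem: "wint_integrable gauss_wt (\<lambda>s. T (s * x / 2)) \<and> wint gauss_wt (\<lambda>s. T (s * x / 2)) = macdonald x - (\<Sum>j<J. fps_nth macdonald_fps j * x ^ j)" if "x \<ge> 0" for x
    using wint_diff[OF macdonald_integrable[OF that] conjunct1[OF pint[of x]]] pint[of x]
    unfolding T_def macdonald_def by simp
  have "\<bar>(macdonald y - (\<Sum>j<J. fps_nth macdonald_fps j * y ^ j)) - (macdonald x - (\<Sum>j<J. fps_nth macdonald_fps j * x ^ j))\<bar>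
      \<le> (C / 2 ^ J * pochhammer (1 / 2) J) * y ^ (J - 1) * (1 + y) ^ 0 * (y - x)" if xy: "0 \<le> x" "x \<le> y" for x y
  proof -
    have y: "y \<ge> 0" using xy by simp
    have "\<bar>wint gauss_wt (\<lambda>s. T (s * y / 2) - T (s * x / 2))\<bar> \<le> wint gauss_wt (\<lambda>s. (C / 2 ^ J * y ^ (J - 1) * (y - x)) * s ^ J)"
    proof (rule wint_bound(2)[OF gauss_wt_measurable gauss_wt_nonneg])
      show "wint_integrable gauss_wt (\<lambda>s. (C / 2 ^ J * y ^ (J - 1) * (y - x)) * s ^ J)"
        by (intro wint_cmult gauss_wt_moment)
      fix s :: real assume s: "s > 0"
      have "\<bar>T (s * y / 2) - T (s * x / 2)\<bar> \<le> C * (s * y / 2) ^ (J - 1) * (s * y / 2 - s * x / 2)"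
        using s xy by (intro C(2)) (auto intro: mult_left_mono)
      also have "s * y / 2 - s * x / 2 = s / 2 * (y - x)" by (simp add: algebra_simps diff_divide_distrib)
      also have "C * (s * y / 2) ^ (J - 1) * (s / 2 * (y - x)) = C * y ^ (J - 1) * (y - x) * ((s / 2) ^ (J - 1) * (s / 2))"
        by (simp add: power_mult_distrib power_divide mult_ac)
      also have "(s / 2) ^ (J - 1) * (s / 2) = (s / 2) ^ J" using J by (simp add: power_eq_if[of _ J])
      finally show "\<bar>T (s * y / 2) - T (s * x / 2)\<bar> \<le> (C / 2 ^ J * y ^ (J - 1) * (y - x)) * s ^ J"
        by (simp add: power_divide mult_ac)
    qed measurable
    moreover have "wint gauss_wt (\<lambda>s. c * s ^ J) = c * pochhammer (1 / 2) J" for c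
      using wint_cmult(2)[OF gauss_wt_moment(1), of c J] by (simp add: gauss_wt_moment(2))
    moreover have "wint gauss_wt (\<lambda>s. T (s * y / 2) - T (s * x / 2)) =
        (macdonald y - (\<Sum>j<J. fps_nth macdonald_fps j * y ^ j)) - (macdonald x - (\<Sum>j<J. fps_nth macdonald_fps j * x ^ j))"
      using wint_diff(2)[OF conjunct1[OF rem[OF y]] conjunct1[OF rem[OF xy(1)]]] rem[OF y] rem[OF xy(1)] by simp
    ultimately have "\<bar>(macdonald y - (\<Sum>j<J. fps_nth macdonald_fps j * y ^ j)) - (macdonald x - (\<Sum>j<J. fps_nth macdonald_fps j * x ^ j))\<bar>
      \<le> C / 2 ^ J * y ^ (J - 1) * (y - x) * pochhammer (1 / 2) J" by (simp only:)
    then show ?thesis by (simp add: mult_ac)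
  qed
  moreover have "C / 2 ^ J * pochhammer (1 / 2) J \<ge> 0"
    using C(1) pochhammer_pos[of "1/2 :: real" J] by simp
  ultimately show "lip_bound (J - 1) (\<lambda>x. macdonald x - (\<Sum>j<J. fps_nth macdonald_fps j * x ^ j))"
    by (intro lip_boundI[where q = 0]) auto
qed

text \<open>The substitution \<open>w = 1 + s / u\<close> factors \<open>w\<^sup>2 - 1\<close> into
  \<open>2 * s / u\<close> and \<open>1 + s / (2 * u)\<close>, which separates the weight from the
  slowly varying part.\<close>

lemma bessel_K0_macdonald:
  assumes u: "u > 0"
  shows "bessel_K0 u = sqrt (pi / (2 * u)) * exp (- u) * macdonald (1 / u)"
proof -
  define B where "B w = ennreal (exp (- u * w) / sqrt (w\<^sup>2 - 1)) * indicator {1<..} w" for w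
  have [measurable]: "B \<in> borel_measurable borel" unfolding B_def by measurable
  define c where "c = sqrt (pi / (2 * u)) * exp (- u)"
  have c: "c \<ge> 0" using u by (simp add: c_def)
  have int: "wint_integrable gauss_wt (\<lambda>s. (1 + s * (1 / u) / 2) powr (- 1 / 2))"
    using macdonald_integrable[of "1 / u"] u by simp
  have "ennreal (bessel_K0 u) = (\<integral>\<^sup>+w. B w \<partial>lborel)"
    using nn_integral_bessel_K0_algebraic[OF u] by (simp add: B_def)
  also have "\<dots> = ennreal (1 / u) * (\<integral>\<^sup>+s. B (1 + 1 / u * s) \<partial>lborel)"
    using nn_integral_real_affine[of B "1 / u" 1] u by simp
  also have "\<dots> = (\<integral>\<^sup>+s. ennreal (1 / u) * B (1 + 1 / u * s) \<partial>lborel)"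
    by (simp add: nn_integral_cmult)
  also have "\<dots> = (\<integral>\<^sup>+s. ennreal (c * (indicator {0<..} s *\<^sub>R (gauss_wt s * (1 + s * (1 / u) / 2) powr (- 1 / 2)))) \<partial>lborel)"
  proof (intro nn_integral_cong)
    fix s :: real
    have "1 / u * (exp (- u * (1 + 1 / u * s)) / sqrt ((1 + 1 / u * s)\<^sup>2 - 1)) = c * (gauss_wt s * (1 + s * (1 / u) / 2) powr (- 1 / 2))"
      if s: "s > 0"
    proof -
      have "- u * (1 + 1 / u * s) = - u + - s" using u by (simp add: field_simps)
      then have e: "exp (- u * (1 + 1 / u * s)) = exp (- u) * exp (- s)" by (simp only: exp_add)
      have "(1 + 1 / u * s)\<^sup>2 - 1 = (2 * s / u) * (1 + s * (1 / u) / 2)"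
        using u by (simp add: field_simps power2_eq_square)
      then have sq: "sqrt ((1 + 1 / u * s)\<^sup>2 - 1) = sqrt (2 * s / u) * sqrt (1 + s * (1 / u) / 2)"
        by (simp only: real_sqrt_mult)
      have p: "(1 + s * (1 / u) / 2) powr (- 1 / 2) = 1 / sqrt (1 + s * (1 / u) / 2)"
      proof -
        have "(1 + s * (1 / u) / 2) powr (- 1 / 2) = 1 / (1 + s * (1 / u) / 2) powr (1 / 2)"
          by (simp add: powr_minus_divide[symmetric])
        also have "(1 + s * (1 / u) / 2) powr (1 / 2) = sqrt (1 + s * (1 / u) / 2)"
          using s u by (intro powr_half_sqrt) simp
        finally show ?thesis .
      qed
      have k: "1 / u / sqrt (2 * s / u) = sqrt (pi / (2 * u)) / (sqrt s * sqrt pi)"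
      proof -
        have "1 / u / sqrt (2 * s / u) = 1 / (sqrt u * sqrt u) / (sqrt (2 * s) / sqrt u)"
          using u by (simp add: real_sqrt_divide)
        also have "\<dots> = sqrt (pi / (2 * u)) / (sqrt s * sqrt pi)"
          using u s by (simp add: real_sqrt_divide real_sqrt_mult field_simps)
        finally show ?thesis .
      qed
      have "1 / u * (exp (- u * (1 + 1 / u * s)) / sqrt ((1 + 1 / u * s)\<^sup>2 - 1)) =
        (1 / u / sqrt (2 * s / u)) * (exp (- u) * exp (- s) / sqrt (1 + s * (1 / u) / 2))"
        unfolding e sq by simp
      then show ?thesis unfolding k p c_def gauss_wt_def by (simp add: mult_ac)
    qed
    then show "ennreal (1 / u) * B (1 + 1 / u * s) = ennreal (c * (indicator {0<..} s *\<^sub>R (gauss_wt s * (1 + s * (1 / u) / 2) powr (- 1 / 2))))"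
      using u by (cases "s > 0") (auto simp: B_def ennreal_mult'[symmetric] zero_less_divide_iff)
  qed
  also have "\<dots> = ennreal (c * macdonald (1 / u))"
  proof -
    have "(\<integral>\<^sup>+s. ennreal (c * (indicator {0<..} s *\<^sub>R (gauss_wt s * (1 + s * (1 / u) / 2) powr (- 1 / 2)))) \<partial>lborel) =
      ennreal (\<integral>s. c * (indicator {0<..} s *\<^sub>R (gauss_wt s * (1 + s * (1 / u) / 2) powr (- 1 / 2))) \<partial>lborel)"
      using int c gauss_wt_nonneg unfolding set_integrable_def
      by (intro nn_integral_eq_integral integrable_mult_right AE_I2) (auto split: split_indicator)
    also have "(\<integral>s. c * (indicator {0<..} s *\<^sub>R (gauss_wt s * (1 + s * (1 / u) / 2) powr (- 1 / 2))) \<partial>lborel) = c * macdonald (1 / u)"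
      unfolding macdonald_def wint_def set_lebesgue_integral_def by (rule integral_mult_right_zero)
    finally show ?thesis .
  qed
  finally have "ennreal (bessel_K0 u) = ennreal (c * macdonald (1 / u))" .
  moreover have "0 \<le> macdonald (1 / u)"
    unfolding macdonald_def wint_def set_lebesgue_integral_def
    using gauss_wt_nonneg by (intro integral_nonneg_AE AE_I2) (auto split: split_indicator)
  ultimately show ?thesis using c bessel_K0_nonneg by (simp add: c_def ennreal_inj)
qed

text \<open>The cutoff acts twice. For \<open>v = 1 - s / (2 * u)\<close> it means
  \<open>s < u\<close>, which is the half \<open>(0, 1)\<close> of the interval in the integral for
  \<open>I\<^sub>0\<close>; and it makes the power bounded, as the global Taylor bound
  requires.\<close>

definition bessel_wt_fn :: "real \<Rightarrow> real" where
  "bessel_wt_fn v = (if v > 1 / 2 then v powr (- 1 / 2) else 0)"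

lemma bessel_wt_fn_measurable [measurable]: "bessel_wt_fn \<in> borel_measurable borel"
  unfolding bessel_wt_fn_def by measurable

lemma bessel_wt_fn_bounds: "0 \<le> bessel_wt_fn v" "bessel_wt_fn v \<le> 2"
proof -
  show "0 \<le> bessel_wt_fn v" by (simp add: bessel_wt_fn_def)
  show "bessel_wt_fn v \<le> 2"
  proof (cases "v > 1 / 2")
    case True
    then have "v powr (- 1 / 2) \<le> (1 / 4) powr (- 1 / 2)" by (intro powr_mono2') auto
    also have "(1 / 4 :: real) powr (- 1 / 2) = inverse (sqrt (1 / 4))"
      by (simp add: powr_minus powr_half_sqrt[symmetric])
    also have "\<dots> = 2" by (simp add: real_sqrt_divide)
    finally show ?thesis using True by (simp add: bessel_wt_fn_def)
  qed (simp add: bessel_wt_fn_def)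
qed

lemma bessel_wt_fn_expansion: "(\<lambda>h. bessel_wt_fn (1 + h)) has_fps_expansion fps_binomial (- 1 / 2)"
proof -
  have ev: "eventually (\<lambda>h::real. h \<in> {-1/2<..<1}) (nhds 0)" by (rule eventually_nhds_in_open) auto
  have "eventually (\<lambda>h. bessel_wt_fn (1 + h) = (1 + h) powr (- 1 / 2)) (nhds 0)"
    using ev by eventually_elim (simp add: bessel_wt_fn_def)
  with powr_fps_expansion[of "- 1 / 2"] show ?thesis
    unfolding has_fps_expansion_def by (auto elim: eventually_elim2)
qed

definition bessel_I0_scaled :: "real \<Rightarrow> real" where
  "bessel_I0_scaled u = sqrt (2 * pi * u) * exp (- u) * bessel_I0 u"

definition bessel_I0_fps :: "real fps" where
  "bessel_I0_fps = Abs_fps (\<lambda>j. ((- 1 / 2) gchoose j) * (- 1 / 2) ^ j * pochhammer (1 / 2) j)"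

text \<open>On the half \<open>(-1, 0)\<close> of the integral for \<open>I\<^sub>0\<close> the
  exponential is at most \<open>1\<close>, so this half contributes at most \<open>pi / 2\<close>
  and becomes exponentially small after scaling. The half \<open>(0, 1)\<close> is exactly the
  weighted integral.\<close>

lemma bessel_I0_scaled_approx:
  assumes u: "u > 0"
  shows "\<bar>bessel_I0_scaled u - wint gauss_wt (\<lambda>s. bessel_wt_fn (1 - s / (2 * u)))\<bar> \<le> sqrt (2 * pi * u) * exp (- u)"
proof -
  define f where "f v = exp (u * v) / sqrt (1 - v\<^sup>2)" for v
  have [measurable]: "f \<in> borel_measurable borel" unfolding f_def by measurable
  define k where "k = sqrt (2 * pi * u) * exp (- u) / pi"
  have k: "k > 0" using u by (simp add: k_def)
  define W where "W = wint gauss_wt (\<lambda>s. bessel_wt_fn (1 - s / (2 * u)))"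
  have intW: "wint_integrable gauss_wt (\<lambda>s. bessel_wt_fn (1 - s / (2 * u)))"
  proof (rule wint_bound(1)[OF gauss_wt_measurable gauss_wt_nonneg, where g = "\<lambda>s. 2 * s ^ 0"])
    show "wint_integrable gauss_wt (\<lambda>s. 2 * s ^ 0)" by (intro wint_cmult gauss_wt_moment)
  qed (use bessel_wt_fn_bounds in \<open>auto simp: abs_of_nonneg\<close>)
  have W0: "W \<ge> 0"
    unfolding W_def wint_def set_lebesgue_integral_def
    using gauss_wt_nonneg bessel_wt_fn_bounds by (intro integral_nonneg_AE AE_I2) (auto split: split_indicator)
  define A where "A = (\<integral>\<^sup>+v. ennreal (f v) * indicator {0<..<1} v \<partial>lborel)"
  define B where "B = (\<integral>\<^sup>+v. ennreal (f v) * indicator {-1<..<0} v \<partial>lborel)"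
  have "ennreal (pi * bessel_I0 u) = (\<integral>\<^sup>+v. ennreal (f v) * indicator {-1<..<1} v \<partial>lborel)"
    using nn_integral_bessel_I0[of u] by (simp add: f_def)
  also have "\<dots> = (\<integral>\<^sup>+v. ennreal (f v) * indicator {-1<..<0} v + ennreal (f v) * indicator {0<..<1} v \<partial>lborel)"
    by (intro nn_integral_cong_AE eventually_mono[OF AE_lborel_singleton[of 0]])
       (auto split: split_indicator)
  also have "\<dots> = B + A" by (simp add: nn_integral_add A_def B_def)
  finally have AB: "ennreal (pi * bessel_I0 u) = B + A" .
  have "B \<le> ennreal (pi / 2)"
  proof -
    have "B = (\<integral>\<^sup>+v. ennreal (f (- v)) * indicator {0<..<1} v \<partial>lborel)"
      unfolding B_def by (subst nn_integral_real_affine[where c = "-1" and t = 0])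
        (auto intro!: nn_integral_cong split: split_indicator)
    also have "\<dots> \<le> (\<integral>\<^sup>+v. ennreal (v ^ (2 * 0) / sqrt (1 - v\<^sup>2)) * indicator {0<..<1} v \<partial>lborel)"
    proof (rule nn_integral_mono)
      fix v :: real
      have "v\<^sup>2 < 1" if "0 < v" "v < 1" using that abs_square_less_1[of v] by auto
      then have "f (- v) \<le> v ^ (2 * 0) / sqrt (1 - v\<^sup>2)" if "0 < v" "v < 1"
        using that u unfolding f_def by (auto intro!: divide_right_mono)
      then show "ennreal (f (- v)) * indicator {0<..<1} v \<le> ennreal (v ^ (2 * 0) / sqrt (1 - v\<^sup>2)) * indicator {0<..<1} v"
        by (auto split: split_indicator intro: ennreal_leI)
    qed
    also have "\<dots> = ennreal (pi / 2)" by (subst nn_integral_power_sqrt) simp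
    finally show ?thesis .
  qed
  then obtain b where b: "B = ennreal b" "b \<ge> 0" "b \<le> pi / 2"
    by (cases B) (auto simp: ennreal_le_iff top_unique)
  have "ennreal k * A = ennreal W"
  proof -
    define F where "F v = ennreal (f v) * indicator {0<..<1} v" for v
    have [measurable]: "F \<in> borel_measurable borel" unfolding F_def by measurable
    have "A = ennreal (1 / u) * (\<integral>\<^sup>+s. F (1 + (- 1 / u) * s) \<partial>lborel)"
      using nn_integral_real_affine[of F "- 1 / u" 1] u by (simp add: A_def F_def)
    then have "ennreal k * A = (\<integral>\<^sup>+s. ennreal (k / u) * F (1 + (- 1 / u) * s) \<partial>lborel)"
      using k u by (simp add: nn_integral_cmult mult.assoc[symmetric] ennreal_mult[symmetric])
    also have "\<dots> = (\<integral>\<^sup>+s. ennreal (indicator {0<..} s *\<^sub>R (gauss_wt s * bessel_wt_fn (1 - s / (2 * u)))) \<partial>lborel)"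
    proof (rule nn_integral_cong)
      fix s :: real
      have "k / u * f (1 + (- 1 / u) * s) = gauss_wt s * bessel_wt_fn (1 - s / (2 * u))" if s: "0 < s" "s < u"
      proof -
        have w: "1 - s / (2 * u) > 1 / 2" using s u by (simp add: field_simps)
        have "u * (1 + (- 1 / u) * s) = u + - s" using u by (simp add: field_simps)
        then have e: "exp (u * (1 + (- 1 / u) * s)) = exp u * exp (- s)" by (simp only: exp_add)
        have "1 - (1 + (- 1 / u) * s)\<^sup>2 = (2 * s / u) * (1 - s / (2 * u))"
          using u by (simp add: field_simps power2_eq_square)
        then have sq: "sqrt (1 - (1 + (- 1 / u) * s)\<^sup>2) = sqrt (2 * s / u) * sqrt (1 - s / (2 * u))"
          by (simp only: real_sqrt_mult)
        have "(1 - s / (2 * u)) powr (- 1 / 2) = 1 / (1 - s / (2 * u)) powr (1 / 2)"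
          by (simp add: powr_minus_divide[symmetric])
        also have "(1 - s / (2 * u)) powr (1 / 2) = sqrt (1 - s / (2 * u))"
          using w by (intro powr_half_sqrt) simp
        finally have p: "bessel_wt_fn (1 - s / (2 * u)) = 1 / sqrt (1 - s / (2 * u))"
          using w by (simp add: bessel_wt_fn_def)
        have kk: "k / u / sqrt (2 * s / u) = exp (- u) / (sqrt s * sqrt pi)"
        proof -
          have "k / u / sqrt (2 * s / u) = (sqrt 2 * sqrt pi * sqrt u) * exp (- u) / (sqrt pi * sqrt pi) / (sqrt u * sqrt u) / (sqrt 2 * sqrt s / sqrt u)"
            using u by (simp add: k_def real_sqrt_divide real_sqrt_mult)
          also have "\<dots> = exp (- u) / (sqrt s * sqrt pi)"
          proof -
            have "sqrt pi * (sqrt u * (sqrt u * sqrt pi)) = (sqrt pi * sqrt pi) * (sqrt u * sqrt u)" by (simp only: mult_ac)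
            then show ?thesis using u s by (simp add: divide_simps)
          qed
          finally show ?thesis .
        qed
        have "k / u * f (1 + (- 1 / u) * s) = (k / u / sqrt (2 * s / u)) * exp u * exp (- s) * (1 / sqrt (1 - s / (2 * u)))"
          unfolding f_def e sq by simp
        also have "\<dots> = (exp (- u) * exp u) * (exp (- s) / (sqrt s * sqrt pi)) * (1 / sqrt (1 - s / (2 * u)))"
          unfolding kk by (simp add: mult_ac)
        also have "exp (- u) * exp u = 1" by (simp flip: exp_add)
        finally show ?thesis unfolding p gauss_wt_def by simp
      qed
      moreover have "bessel_wt_fn (1 - s / (2 * u)) = 0" if "\<not> s < u"
        using that u by (simp add: bessel_wt_fn_def field_simps)
      moreover have "1 + (- 1 / u) * s \<in> {0<..<1} \<longleftrightarrow> 0 < s \<and> s < u"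
        using u by (auto simp: field_simps)
      ultimately show "ennreal (k / u) * F (1 + (- 1 / u) * s) = ennreal (indicator {0<..} s *\<^sub>R (gauss_wt s * bessel_wt_fn (1 - s / (2 * u))))"
        using k u by (cases "0 < s \<and> s < u") (auto simp: F_def ennreal_mult'[symmetric] simp del: greaterThanLessThan_iff split: split_indicator)
    qed
    also have "\<dots> = ennreal W"
      unfolding W_def wint_def set_lebesgue_integral_def
      using intW gauss_wt_nonneg bessel_wt_fn_bounds unfolding set_integrable_def
      by (intro nn_integral_eq_integral AE_I2) (auto split: split_indicator)
    finally show ?thesis .
  qed
  then have "A = ennreal (1 / k) * ennreal W" by (rule ennreal_mult_cancel_const[OF k])
  then have A: "A = ennreal (W / k)" using k W0 by (simp add: ennreal_mult[symmetric])
  have "ennreal (pi * bessel_I0 u) = ennreal (b + W / k)"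
    using AB b A k W0 by (simp add: ennreal_plus[symmetric] del: ennreal_plus)
  then have "pi * bessel_I0 u = b + W / k"
    using b k W0 bessel_I0_nonneg[of u] by (subst (asm) ennreal_inj) auto
  moreover have "bessel_I0_scaled u = k * (pi * bessel_I0 u)" by (simp add: bessel_I0_scaled_def k_def)
  ultimately have "bessel_I0_scaled u - W = k * b" using k by (simp add: field_simps)
  moreover have "k * b \<le> k * (pi / 2)" using k b by (intro mult_left_mono) auto
  moreover have "k * (pi / 2) \<le> sqrt (2 * pi * u) * exp (- u)" using u by (simp add: k_def)
  moreover have "k * b \<ge> 0" using k b by simp
  ultimately show ?thesis unfolding W_def by linarith
qed

text \<open>The global Taylor bound for the cut-off function is integrated term by term with the
  moments of the weight; the neglected half of the integral is smaller than every power of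
  \<open>1 / u\<close>.\<close>

lemma bessel_I0_asymp_series:
  "asymp_series at_top (\<lambda>u. 1 / u) bessel_I0_scaled bessel_I0_fps"
proof -
  have h: "((\<lambda>u::real. 1 / u) \<longlongrightarrow> 0) at_top" by real_asymp
  show ?thesis
  proof (rule asymp_seriesI_ge[OF tendsto_imp_bigo_1[OF h], of 0])
    fix n :: nat
    define b where "b = fps_nth (fps_binomial (- 1 / 2 :: real))"
    obtain D where D: "\<And>v. \<bar>bessel_wt_fn v - (\<Sum>j<n. b j * (v - 1) ^ j)\<bar> \<le> D * \<bar>v - 1\<bar> ^ n"
      using taylor_global_bound[OF bessel_wt_fn_expansion, of UNIV 2 n] bessel_wt_fn_bounds unfolding b_def by auto
    have bound: "\<bar>wint gauss_wt (\<lambda>s. bessel_wt_fn (1 - s / (2 * u))) - (\<Sum>j<n. fps_nth bessel_I0_fps j * (1 / u) ^ j)\<bar>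
        \<le> (D / 2 ^ n * pochhammer (1 / 2) n) * (1 / u) ^ n" if u: "u > 0" for u
    proof -
      define c where "c j = b j * (- 1 / 2) ^ j * (1 / u) ^ j" for j
      have e: "b j * ((1 - s / (2 * u)) - 1) ^ j = c j * s ^ j" for s j
      proof -
        have "(1 - s / (2 * u)) - 1 = (- 1 / 2) * (1 / u) * s" by simp
        then show ?thesis by (simp only: power_mult_distrib c_def mult.assoc)
      qed
      have ci: "wint_integrable gauss_wt (\<lambda>s. c j * s ^ j)" and cv: "wint gauss_wt (\<lambda>s. c j * s ^ j) = c j * pochhammer (1 / 2) j" for j
        using wint_cmult[OF gauss_wt_moment(1), of "c j" j] by (simp_all add: gauss_wt_moment(2))
      have sum: "wint_integrable gauss_wt (\<lambda>s. \<Sum>j<n. c j * s ^ j)" "wint gauss_wt (\<lambda>s. \<Sum>j<n. c j * s ^ j) = (\<Sum>j<n. fps_nth bessel_I0_fps j * (1 / u) ^ j)"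
        using wint_sum[of "{..<n}" gauss_wt "\<lambda>j s. c j * s ^ j", OF ci]
        unfolding cv by (simp_all add: c_def b_def bessel_I0_fps_def mult_ac)
      have intW: "wint_integrable gauss_wt (\<lambda>s. bessel_wt_fn (1 - s / (2 * u)))"
      proof (rule wint_bound(1)[OF gauss_wt_measurable gauss_wt_nonneg, where g = "\<lambda>s. 2 * s ^ 0"])
        show "wint_integrable gauss_wt (\<lambda>s. 2 * s ^ 0)" by (intro wint_cmult gauss_wt_moment)
      qed (use bessel_wt_fn_bounds in \<open>auto simp: abs_of_nonneg\<close>)
      define d where "d = D / 2 ^ n * (1 / u) ^ n"
      have "\<bar>wint gauss_wt (\<lambda>s. bessel_wt_fn (1 - s / (2 * u)) - (\<Sum>j<n. c j * s ^ j))\<bar> \<le> wint gauss_wt (\<lambda>s. d * s ^ n)"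
      proof (rule wint_bound(2)[OF gauss_wt_measurable gauss_wt_nonneg])
        show "wint_integrable gauss_wt (\<lambda>s. d * s ^ n)" by (intro wint_cmult gauss_wt_moment)
        fix s :: real assume s: "s > 0"
        have "\<bar>(1 - s / (2 * u)) - 1\<bar> ^ n = s ^ n / (2 ^ n * u ^ n)"
          using s u by (simp add: power_divide power_mult_distrib)
        then show "\<bar>bessel_wt_fn (1 - s / (2 * u)) - (\<Sum>j<n. c j * s ^ j)\<bar> \<le> d * s ^ n"
          using D[of "1 - s / (2 * u)"] unfolding e by (simp add: d_def power_divide)
      qed measurable
      also have "wint gauss_wt (\<lambda>s. d * s ^ n) = d * pochhammer (1 / 2) n"
        using wint_cmult(2)[OF gauss_wt_moment(1), of d n] by (simp add: gauss_wt_moment(2))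
      finally show ?thesis
        using wint_diff(2)[OF intW sum(1)] sum(2) by (simp add: d_def mult_ac)
    qed
    have 1: "(\<lambda>u. wint gauss_wt (\<lambda>s. bessel_wt_fn (1 - s / (2 * u))) - (\<Sum>j<n. fps_nth bessel_I0_fps j * (1 / u) ^ j)) \<in> O(\<lambda>u. (1 / u) ^ n)"
      by (rule bigoI[of _ "D / 2 ^ n * pochhammer (1 / 2) n"], rule eventually_mono[OF eventually_gt_at_top[of 0]])
         (use bound in \<open>simp add: power_divide\<close>)
    have "(\<lambda>u. bessel_I0_scaled u - wint gauss_wt (\<lambda>s. bessel_wt_fn (1 - s / (2 * u)))) \<in> O(\<lambda>u. sqrt (2 * pi * u) * exp (- u))"
      by (rule bigoI[of _ 1], rule eventually_mono[OF eventually_gt_at_top[of 0]])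
         (use bessel_I0_scaled_approx in simp)
    also have "(\<lambda>u. sqrt (2 * pi * u) * exp (- u)) \<in> O(\<lambda>u::real. (1 / u) ^ n)"
      by real_asymp
    finally have 2: "(\<lambda>u. bessel_I0_scaled u - wint gauss_wt (\<lambda>s. bessel_wt_fn (1 - s / (2 * u)))) \<in> O(\<lambda>u. (1 / u) ^ n)" .
    from sum_in_bigo(1)[OF 2 1]
    show "(\<lambda>u. bessel_I0_scaled u - (\<Sum>k<n. fps_nth bessel_I0_fps k * (1 / u) ^ k)) \<in> O(\<lambda>u. (1 / u) ^ n)"
      by simp
  qed
qed

section \<open>The remainder at optimal truncation\<close>

definition macdonald_sq :: "real \<Rightarrow> real" where
  "macdonald_sq x = macdonald x * macdonald x"

lemma macdonald_sq_lip_series: "lip_series macdonald_sq (macdonald_fps * macdonald_fps)"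
  unfolding macdonald_sq_def[abs_def] by (intro lip_series_mult macdonald_lip_series)

lemma macdonald_measurable [measurable]: "macdonald \<in> borel_measurable borel"
  unfolding macdonald_def[abs_def] wint_def set_lebesgue_integral_def by measurable

lemma macdonald_sq_measurable [measurable]: "macdonald_sq \<in> borel_measurable borel"
  unfolding macdonald_sq_def[abs_def] by measurable

text \<open>The part of the integrand whose numerator vanishes at \<open>v = 1\<close>. Its factor
  \<open>1 / v\<close> stems from the prefactor \<open>pi / (2 * u)\<close> of
  \<open>K\<^sub>0\<^sup>2\<close> at \<open>u = z * v\<close>.\<close>

definition dilation_gap :: "(real \<Rightarrow> real) \<Rightarrow> real \<Rightarrow> real \<Rightarrow> real" where
  "dilation_gap D x v = (D (x / v) / v - D x) / (1 - v\<^sup>2)"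

text \<open>With \<open>m = 2 * M\<close> and \<open>z = m / 2\<close> the product of
  \<open>v ^ (2 * M)\<close> and the exponential part of \<open>K\<^sub>0(z v)\<^sup>2\<close> is a
  multiple of \<open>wt m v\<close>. Writing \<open>D\<close> for \<open>macdonald_sq\<close>, the
  numerator \<open>wt m v * D (x / v) / v - D x\<close> is split by the intermediate term
  \<open>wt m v * D x\<close>: one half is the dilation gap under the weight, the other is
  \<open>D x * (wt m v - 1)\<close> and gives \<open>pv m\<close>.\<close>

lemma I0K0_remainder_decomposition:
  assumes m: "m > 0" "m = 2 * M"
  shows "I0K0_remainder M (real m / 2) = 2 * exp (- real m) / (pi * real m) *
    (macdonald_sq (2 / real m) * pv m + bracket m (dilation_gap macdonald_sq (2 / real m)))"
proof -
  define z where "z = real m / 2"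
  define k where "k = pi / (2 * z) * exp (- real m)"
  define x where "x = 2 / real m"
  have z: "z > 0" and k: "k > 0" and xz: "1 / z = x" using m by (simp_all add: z_def k_def x_def)
  define T where "T v = (v ^ (2 * M) * (bessel_K0 (z * v))\<^sup>2 - (bessel_K0 z)\<^sup>2) / (1 - v\<^sup>2)" for v
  have Tint: "set_integrable lborel {0<..} T" and TI: "(LINT v:{0<..}|lborel. T v) = pi\<^sup>2 / 2 * I0K0_remainder M z"
    using I0K0_remainder_integral[OF z, of M]
    by (simp_all add: has_bochner_integral_iff set_integrable_def set_lebesgue_integral_def T_def)
  have Ksq: "(bessel_K0 (z * v))\<^sup>2 = pi / (2 * z * v) * exp (- (real m * v)) * macdonald_sq (x / v)" if v: "v > 0" for v
  proof -
    have "bessel_K0 (z * v) = sqrt (pi / (2 * (z * v))) * exp (- (z * v)) * macdonald (1 / (z * v))"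
      using z v by (intro bessel_K0_macdonald) simp
    also have "1 / (z * v) = x / v" using xz by (metis divide_divide_eq_left)
    finally have "(bessel_K0 (z * v))\<^sup>2 = (sqrt (pi / (2 * (z * v))))\<^sup>2 * (exp (- (z * v)))\<^sup>2 * (macdonald (x / v))\<^sup>2"
      by (simp only: power_mult_distrib)
    also have "(sqrt (pi / (2 * (z * v))))\<^sup>2 = pi / (2 * z * v)" using z v by (simp add: mult.assoc)
    also have "(exp (- (z * v)))\<^sup>2 = exp (- (real m * v))" by (simp add: z_def exp_double[symmetric] mult.commute)
    finally show ?thesis by (simp add: macdonald_sq_def power2_eq_square)
  qed
  have wt: "wt m v * dilation_gap macdonald_sq x v = 1 / k * T v - macdonald_sq x * ((wt m v - 1) / (1 - v\<^sup>2))" if v: "v > 0" for v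
  proof -
    have "wt m v = v ^ m * exp (real m * (1 - v))"
      unfolding wt_def by (simp only: power_mult_distrib exp_of_nat_mult)
    also have "real m * (1 - v) = real m + - (real m * v)" by (simp add: algebra_simps)
    finally have w: "wt m v = v ^ m * (exp (real m) * exp (- (real m * v)))" by (simp only: exp_add)
    have e1: "exp (- real m) * exp (real m) = 1" by (simp flip: exp_add)
    have "v ^ (2 * M) * (bessel_K0 (z * v))\<^sup>2 = k * (wt m v * (macdonald_sq (x / v) / v))"
    proof -
      have "k * (wt m v * (macdonald_sq (x / v) / v)) = (exp (- real m) * exp (real m)) * (v ^ m * (pi / (2 * z * v) * exp (- (real m * v)) * macdonald_sq (x / v)))"
        unfolding w k_def by simp
      then show ?thesis unfolding e1 Ksq[OF v] using m(2) by simp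
    qed
    moreover have "(bessel_K0 z)\<^sup>2 = k * macdonald_sq x"
      using Ksq[of 1] by (simp add: k_def)
    ultimately have "T v = k * ((wt m v * (macdonald_sq (x / v) / v) - macdonald_sq x) / (1 - v\<^sup>2))"
      by (simp add: T_def right_diff_distrib)
    then have "1 / k * T v = (wt m v * (macdonald_sq (x / v) / v) - macdonald_sq x) / (1 - v\<^sup>2)"
      using k by simp
    then show ?thesis by (simp add: dilation_gap_def diff_divide_distrib right_diff_distrib)
  qed
  have "bracket m (dilation_gap macdonald_sq x) = (LINT v:{0<..}|lborel. 1 / k * T v - macdonald_sq x * ((wt m v - 1) / (1 - v\<^sup>2)))"
    unfolding wint_def by (intro set_lebesgue_integral_cong) (auto simp: wt)
  also have "\<dots> = (LINT v:{0<..}|lborel. 1 / k * T v) - (LINT v:{0<..}|lborel. macdonald_sq x * ((wt m v - 1) / (1 - v\<^sup>2)))"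
    by (intro set_integral_diff(2) set_integrable_mult_right Tint pv_integrable)
  also have "\<dots> = 1 / k * (LINT v:{0<..}|lborel. T v) - macdonald_sq x * pv m"
    unfolding pv_def by (subst (1 2) set_integral_mult_right) (rule refl)
  finally have "bracket m (dilation_gap macdonald_sq x) = 1 / k * (pi\<^sup>2 / 2 * I0K0_remainder M z) - macdonald_sq x * pv m"
    by (simp only: TI)
  then have "I0K0_remainder M z = 2 * k / pi\<^sup>2 * (macdonald_sq x * pv m + bracket m (dilation_gap macdonald_sq x))"
    using k by simp
  also have "2 * k / pi\<^sup>2 = 2 * exp (- real m) / (pi * real m)"
    using m by (simp add: k_def z_def power2_eq_square)
  finally show ?thesis by (simp add: z_def x_def)
qed

section \<open>Laplace integrals of negative powers and of dilated series\<close>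

fun inverse_power_fps :: "nat \<Rightarrow> real fps" where
  "inverse_power_fps 0 = 1"
| "inverse_power_fps (Suc i) = inverse_power_fps i * inverse (1 - fps_const (real i) * fps_X)"

text \<open>Negative powers are unbounded at \<open>0\<close>, outside the scope of
  \<open>bracket_asymp_series\<close>; but the moment with exponent \<open>i\<close> is
  \<open>1 - i / m\<close> times the next one, once \<open>m > i\<close>, and this can be
  iterated.\<close>

lemma inverse_power_asymp_series:
  "asymp_series sequentially (\<lambda>m. 1 / real m) (\<lambda>m. bracket m (\<lambda>v. 1 / v ^ i) / bracket m (\<lambda>v. 1)) (inverse_power_fps i)"
proof (induction i)
  case 0
  have "asymp_series sequentially (\<lambda>m. 1 / real m) (\<lambda>m. bracket m (\<lambda>v. (v - 1) ^ 0) / bracket m (\<lambda>v. 1)) (central_moment 0)"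
    by (rule central_moment_asymp_series)
  then show ?case by simp
next
  case (Suc i)
  note h = inverse_nat_tendsto_0 and h1 = inverse_nat_bigo_1
  have "asymp_series sequentially (\<lambda>m. 1 / real m) (\<lambda>m. bracket m (\<lambda>v. 1 / v ^ i) / bracket m (\<lambda>v. 1) * inverse (1 - real i * (1 / real m)))
     (inverse_power_fps (Suc i))"
    unfolding inverse_power_fps.simps
    using asymp_series_const[OF h1, of 1]
    by (intro asymp_series_mult Suc asymp_series_inverse asymp_series_diff asymp_series_cmult asymp_series_ident h h1) simp_all
  then show ?case
  proof (rule asymp_series_cong, intro eventually_mono[OF eventually_gt_at_top[of "Suc i"]])
    fix m assume m: "m > Suc i"
    define n where "n = m - Suc i"
    have n: "m - i = Suc n" "m - Suc i = n" using m by (simp_all add: n_def)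
    have "bracket m (\<lambda>v. 1 / v ^ i) = exp (real m) * fact (Suc n) / real m ^ (Suc n + 1)"
      using bracket_inverse_power(2)[of m i] m n by simp
    moreover have "bracket m (\<lambda>v. 1 / v ^ Suc i) = exp (real m) * fact n / real m ^ (n + 1)"
      using bracket_inverse_power(2)[of m "Suc i"] m n by simp
    ultimately have "bracket m (\<lambda>v. 1 / v ^ i) = bracket m (\<lambda>v. 1 / v ^ Suc i) * (real (Suc n) / real m)"
      by (simp add: field_simps)
    also have s: "real (Suc n) / real m = 1 - real i * (1 / real m)"
      using m by (simp add: n_def field_simps of_nat_diff)
    finally have "bracket m (\<lambda>v. 1 / v ^ i) / bracket m (\<lambda>v. 1) * inverse (1 - real i * (1 / real m)) =
        bracket m (\<lambda>v. 1 / v ^ Suc i) / bracket m (\<lambda>v. 1) * ((1 - real i * (1 / real m)) * inverse (1 - real i * (1 / real m)))"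
      by simp
    also have "(1 - real i * (1 / real m)) * inverse (1 - real i * (1 / real m)) = 1"
      using m by (intro right_inverse) (simp flip: s)
    finally show "bracket m (\<lambda>v. 1 / v ^ i) / bracket m (\<lambda>v. 1) * inverse (1 - real i * (1 / real m)) = bracket m (\<lambda>v. 1 / v ^ Suc i) / bracket m (\<lambda>v. 1)"
      by (simp only: mult_1_right)
  qed
qed

text \<open>For \<open>i \<ge> 1\<close> this is the dilation gap of the monomial
  \<open>x ^ (i - 1)\<close>, with that monomial divided out.\<close>

definition power_gap :: "nat \<Rightarrow> real \<Rightarrow> real" where
  "power_gap i v = (1 / v ^ i - 1) / (1 - v\<^sup>2)"

lemma power_gap_measurable [measurable]: "power_gap i \<in> borel_measurable borel"
  unfolding power_gap_def by measurable

text \<open>At \<open>v = 1\<close> division by zero makes \<open>power_gap\<close> vanish while its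
  rational continuation need not, so the recursions that follow hold off this point only.\<close>

lemma wint_cong_AE:
  assumes [measurable]: "w \<in> borel_measurable borel" "f \<in> borel_measurable borel" "g \<in> borel_measurable borel"
    and eq: "\<And>v. v > 0 \<Longrightarrow> v \<noteq> 1 \<Longrightarrow> f v = g v" and int: "wint_integrable w g"
  shows "wint_integrable w f" "wint w f = wint w g"
proof -
  have ae: "AE v in lborel. indicator {0<..} v *\<^sub>R (w v * g v) = indicator {0<..} v *\<^sub>R (w v * f v)"
    by (rule eventually_mono[OF AE_lborel_singleton[of 1]]) (auto simp: eq split: split_indicator)
  show "wint_integrable w f"
    using int unfolding set_integrable_def by (rule integrable_cong_AE_imp) (use ae in auto)
  show "wint w f = wint w g"
    unfolding wint_def set_lebesgue_integral_def using ae by (intro integral_cong_AE) (auto elim: eventually_mono)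
qed

lemma one_minus_square_nz: "v > 0 \<Longrightarrow> v \<noteq> 1 \<Longrightarrow> 1 - v\<^sup>2 \<noteq> (0::real)"
  by (simp add: power2_eq_1_iff)

lemma power_gap_1: "v > 0 \<Longrightarrow> v \<noteq> 1 \<Longrightarrow> power_gap 1 v = 1 / v ^ 1 - 1 / (1 + v)"
  using one_minus_square_nz[of v] by (simp add: power_gap_def divide_simps) (simp add: power2_eq_square algebra_simps)

text \<open>Raising the exponent by two adds a pure negative power. Exponents thus reduce to
  \<open>0\<close> and \<open>1\<close>, and only the latter introduces a further function,
  \<open>1 / (1 + v)\<close>.\<close>

lemma power_gap_Suc_Suc: "v > 0 \<Longrightarrow> v \<noteq> 1 \<Longrightarrow> power_gap (Suc (Suc i)) v = power_gap i v + 1 / v ^ Suc (Suc i)"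
  using one_minus_square_nz[of v] by (simp add: power_gap_def divide_simps) (simp add: power2_eq_square algebra_simps)

lemma inverse_1_plus_bracket:
  "m > 0 \<Longrightarrow> bracket_integrable m (\<lambda>v. 1 / (1 + v))"
  "asymp_series sequentially (\<lambda>m. 1 / real m) (\<lambda>m. bracket m (\<lambda>v. 1 / (1 + v)) / bracket m (\<lambda>v. 1)) (moment_series (inverse (2 + fps_X)))"
proof -
  show "bracket_integrable m (\<lambda>v. 1 / (1 + v))" if "m > 0"
    by (rule wint_bound(1)[OF wt_measurable wt_nonneg _ bracket_one(1)[OF that]]) auto
  have "(\<lambda>h::real. inverse (2 + h)) has_fps_expansion inverse (2 + fps_X)"
    by (intro fps_expansion_intros) auto
  also have "(\<lambda>h::real. inverse (2 + h)) = (\<lambda>h. 1 / (1 + (1 + h)))"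
    by (auto simp: fun_eq_iff divide_inverse)
  finally show "asymp_series sequentially (\<lambda>m. 1 / real m) (\<lambda>m. bracket m (\<lambda>v. 1 / (1 + v)) / bracket m (\<lambda>v. 1)) (moment_series (inverse (2 + fps_X)))"
    by (rule bracket_asymp_series[where C = 1, rotated]) auto
qed

lemma power_gap_integrable: "m > 0 \<Longrightarrow> i \<le> m \<Longrightarrow> bracket_integrable m (power_gap i)"
\<comment> \<open>Only the scheme with the cases \<open>0\<close>, \<open>1\<close> and
  \<open>i + 2\<close> is taken over.\<close>
proof (induction i rule: central_moment.induct)
  case 1
  then show ?case by (simp add: power_gap_def[abs_def] set_integrable_def)
next
  case 2
  show ?case
    by (rule wint_cong_AE(1)[where g = "\<lambda>v. 1 / v ^ 1 - 1 / (1 + v)"])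
       (use power_gap_1 2 in \<open>auto intro!: wint_diff(1) inverse_1_plus_bracket bracket_inverse_power(1)[of _ 1, simplified]\<close>)
next
  case (3 i)
  show ?case
    by (rule wint_cong_AE(1)[where g = "\<lambda>v. power_gap i v + 1 / v ^ Suc (Suc i)"])
       (use power_gap_Suc_Suc 3 in \<open>auto intro!: wint_add(1) bracket_inverse_power(1) simp del: power_Suc\<close>)
qed

fun power_gap_fps :: "nat \<Rightarrow> real fps" where
  "power_gap_fps 0 = 0"
| "power_gap_fps (Suc 0) = inverse_power_fps 1 - moment_series (inverse (2 + fps_X))"
| "power_gap_fps (Suc (Suc i)) = power_gap_fps i + inverse_power_fps (Suc (Suc i))"

lemma power_gap_asymp_series:
  "asymp_series sequentially (\<lambda>m. 1 / real m) (\<lambda>m. bracket m (power_gap i) / bracket m (\<lambda>v. 1)) (power_gap_fps i)"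
proof (induction i rule: power_gap_fps.induct)
  case 1
  have "bracket m (power_gap 0) = 0" for m by (simp add: wint_def power_gap_def[abs_def])
  then show ?case using asymp_series_const[OF inverse_nat_bigo_1, of 0] by simp
next
  case 2
  have "asymp_series sequentially (\<lambda>m. 1 / real m) (\<lambda>m. bracket m (\<lambda>v. 1 / v ^ 1) / bracket m (\<lambda>v. 1) - bracket m (\<lambda>v. 1 / (1 + v)) / bracket m (\<lambda>v. 1)) (power_gap_fps (Suc 0))"
    unfolding power_gap_fps.simps
    by (intro asymp_series_diff inverse_power_asymp_series inverse_1_plus_bracket(2) inverse_nat_bigo_1)
  then show ?case
  proof (rule asymp_series_cong, intro eventually_mono[OF eventually_gt_at_top[of 0]])
    fix m :: nat assume m: "m > 0"
    have i: "bracket_integrable m (\<lambda>v. 1 / v ^ 1)" using bracket_inverse_power(1)[of m 1] m by simp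
    have "bracket m (power_gap 1) = bracket m (\<lambda>v. 1 / v ^ 1 - 1 / (1 + v))"
      by (rule wint_cong_AE(2)) (use power_gap_1 wint_diff(1)[OF i inverse_1_plus_bracket(1)[OF m]] in auto)
    also have "\<dots> = bracket m (\<lambda>v. 1 / v ^ 1) - bracket m (\<lambda>v. 1 / (1 + v))"
      by (rule wint_diff(2)[OF i inverse_1_plus_bracket(1)[OF m]])
    finally show "bracket m (\<lambda>v. 1 / v ^ 1) / bracket m (\<lambda>v. 1) - bracket m (\<lambda>v. 1 / (1 + v)) / bracket m (\<lambda>v. 1) = bracket m (power_gap (Suc 0)) / bracket m (\<lambda>v. 1)"
      by (simp add: diff_divide_distrib)
  qed
next
  case (3 i)
  have "asymp_series sequentially (\<lambda>m. 1 / real m) (\<lambda>m. bracket m (power_gap i) / bracket m (\<lambda>v. 1) + bracket m (\<lambda>v. 1 / v ^ Suc (Suc i)) / bracket m (\<lambda>v. 1)) (power_gap_fps (Suc (Suc i)))"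
    unfolding power_gap_fps.simps by (intro asymp_series_add 3 inverse_power_asymp_series)
  then show ?case
  proof (rule asymp_series_cong, intro eventually_mono[OF eventually_gt_at_top[of "Suc (Suc i)"]])
    fix m :: nat assume m: "m > Suc (Suc i)"
    have i1: "bracket_integrable m (power_gap i)" and i2: "bracket_integrable m (\<lambda>v. 1 / v ^ Suc (Suc i))"
      using power_gap_integrable[of m i] bracket_inverse_power(1)[of m "Suc (Suc i)"] m by simp_all
    have "bracket m (power_gap (Suc (Suc i))) = bracket m (\<lambda>v. power_gap i v + 1 / v ^ Suc (Suc i))"
      by (rule wint_cong_AE(2)) (use power_gap_Suc_Suc wint_add(1)[OF i1 i2] in \<open>auto simp del: power_Suc\<close>)
    also have "\<dots> = bracket m (power_gap i) + bracket m (\<lambda>v. 1 / v ^ Suc (Suc i))"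
      by (rule wint_add(2)[OF i1 i2])
    finally show "bracket m (power_gap i) / bracket m (\<lambda>v. 1) + bracket m (\<lambda>v. 1 / v ^ Suc (Suc i)) / bracket m (\<lambda>v. 1) = bracket m (power_gap (Suc (Suc i))) / bracket m (\<lambda>v. 1)"
      by (simp add: add_divide_distrib)
  qed
qed

text \<open>The dominating function for remainders of a dilated series: powers of
  \<open>1 + 1 / v\<close> absorb the polynomial growth of \<open>D (x / v)\<close> as
  \<open>v\<close> tends to \<open>0\<close>.\<close>

lemma one_plus_inverse_power_bigo:
  "(\<lambda>m. bracket m (\<lambda>v. (1 + 1 / v) ^ p) / bracket m (\<lambda>v. 1)) \<in> O(\<lambda>_. 1)"
  "m \<ge> p \<Longrightarrow> m > 0 \<Longrightarrow> bracket_integrable m (\<lambda>v. (1 + 1 / v) ^ p)"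
proof -
  have e: "(1 + 1 / v) ^ p = (\<Sum>i\<le>p. real (p choose i) * (1 / v ^ i))" for v :: real
    using binomial_ring[of "1 / v" 1 p] by (simp add: add.commute power_one_over)
  have ii: "bracket_integrable m (\<lambda>v. real (p choose i) * (1 / v ^ i))" if "m \<ge> p" "m > 0" "i \<le> p" for m i
    using that by (intro wint_cmult bracket_inverse_power) auto
  have s: "bracket_integrable m (\<lambda>v. \<Sum>i\<le>p. real (p choose i) * (1 / v ^ i)) \<and>
     bracket m (\<lambda>v. \<Sum>i\<le>p. real (p choose i) * (1 / v ^ i)) = (\<Sum>i\<le>p. bracket m (\<lambda>v. real (p choose i) * (1 / v ^ i)))"
    if "m \<ge> p" "m > 0" for m
    by (rule wint_sum) (use ii that in auto)
  show "m \<ge> p \<Longrightarrow> m > 0 \<Longrightarrow> bracket_integrable m (\<lambda>v. (1 + 1 / v) ^ p)" unfolding e using s by blast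
  have "asymp_series sequentially (\<lambda>m. 1 / real m) (\<lambda>m. \<Sum>i\<le>p. real (p choose i) * (bracket m (\<lambda>v. 1 / v ^ i) / bracket m (\<lambda>v. 1)))
     (\<Sum>i\<le>p. fps_const (real (p choose i)) * inverse_power_fps i)"
    by (intro asymp_series_sum asymp_series_cmult inverse_power_asymp_series inverse_nat_bigo_1)
  then have "asymp_series sequentially (\<lambda>m. 1 / real m) (\<lambda>m. bracket m (\<lambda>v. (1 + 1 / v) ^ p) / bracket m (\<lambda>v. 1))
     (\<Sum>i\<le>p. fps_const (real (p choose i)) * inverse_power_fps i)"
  proof (rule asymp_series_cong, intro eventually_mono[OF eventually_gt_at_top[of p]])
    fix m assume m: "m > p"
    have "bracket m (\<lambda>v. (1 + 1 / v) ^ p) = (\<Sum>i\<le>p. bracket m (\<lambda>v. real (p choose i) * (1 / v ^ i)))"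
      unfolding e using s[of m] m by simp
    also have "\<dots> = (\<Sum>i\<le>p. real (p choose i) * bracket m (\<lambda>v. 1 / v ^ i))"
      using m by (intro sum.cong refl wint_cmult(2) bracket_inverse_power(1)) auto
    finally show "(\<Sum>i\<le>p. real (p choose i) * (bracket m (\<lambda>v. 1 / v ^ i) / bracket m (\<lambda>v. 1))) = bracket m (\<lambda>v. (1 + 1 / v) ^ p) / bracket m (\<lambda>v. 1)"
      by (simp add: sum_divide_distrib)
  qed
  then show "(\<lambda>m. bracket m (\<lambda>v. (1 + 1 / v) ^ p) / bracket m (\<lambda>v. 1)) \<in> O(\<lambda>_. 1)"
    by (rule asymp_series_bounded)
qed

text \<open>The factor \<open>2 ^ j\<close> belongs to \<open>x ^ j = (2 / m) ^ j\<close>; the sum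
  over \<open>j\<close> combines the powers of \<open>1 / m\<close> from the series with those from
  the integrals.\<close>

definition dilation_gap_fps :: "real fps \<Rightarrow> real fps" where
  "dilation_gap_fps P = Abs_fps (\<lambda>k. \<Sum>j\<le>k. fps_nth (fps_const (fps_nth P j * 2 ^ j) * power_gap_fps (Suc j)) (k - j))"

text \<open>Each monomial of \<open>D\<close> contributes an integral of \<open>power_gap\<close>
  with its own expansion. For the remainder \<open>E\<close> the Lipschitz form is decisive: a bound
  on its size alone would not survive division by \<open>1 - v\<^sup>2\<close>.\<close>

lemma dilation_gap_asymp_series:
  assumes D: "lip_series D P" and [measurable]: "D \<in> borel_measurable borel"
  shows "asymp_series sequentially (\<lambda>m. 1 / real m) (\<lambda>m. bracket m (dilation_gap D (2 / real m)) / bracket m (\<lambda>v. 1)) (dilation_gap_fps P)"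
  unfolding dilation_gap_fps_def
proof (rule asymp_series_family[OF inverse_nat_bigo_1])
  fix j
  show "asymp_series sequentially (\<lambda>m. 1 / real m) (\<lambda>m. (fps_nth P j * 2 ^ j) * (bracket m (power_gap (Suc j)) / bracket m (\<lambda>v. 1))) (fps_const (fps_nth P j * 2 ^ j) * power_gap_fps (Suc j))"
    by (intro asymp_series_cmult power_gap_asymp_series inverse_nat_bigo_1)
next
  fix J :: nat assume J: "J \<ge> 1"
  define E where "E x = D x - (\<Sum>j<J. fps_nth P j * x ^ j)" for x
  have [measurable]: "E \<in> borel_measurable borel" unfolding E_def by measurable
  obtain C q where C: "C \<ge> 0"
    and CL': "\<And>x y. 0 \<le> x \<Longrightarrow> x \<le> y \<Longrightarrow> \<bar>(D y - (\<Sum>j<J. fps_nth P j * y ^ j)) - (D x - (\<Sum>j<J. fps_nth P j * x ^ j))\<bar> \<le> C * y ^ (J - 1) * (1 + y) ^ q * (y - x)"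
    and CB': "\<And>y. 0 \<le> y \<Longrightarrow> \<bar>D y - (\<Sum>j<J. fps_nth P j * y ^ j)\<bar> \<le> C * y ^ J * (1 + y) ^ q"
    by (rule lip_seriesE[OF D J]) (rule that)
  note CL = CL'[folded E_def] and CB = CB'[folded E_def]
  \<comment> \<open>The Lipschitz bound with its growth factor accounts for \<open>J + q\<close>
    powers of \<open>1 + 1 / v\<close>, and the division of \<open>E (x / v)\<close> by
    \<open>v\<close> for one more.\<close>
  define p where "p = Suc (J + q)"
  \<comment> \<open>Two contributions with constant \<open>C\<close> each, and
    \<open>1 + y \<le> 2 * t\<close> raised to the power \<open>q\<close>.\<close>
  define K where "K = 2 * C * 2 ^ q"
  have K: "K \<ge> 0" using C by (simp add: K_def)
  have Ebound: "\<bar>dilation_gap E x v\<bar> \<le> (K * x ^ J) * (1 + 1 / v) ^ p" if x: "0 < x" "x \<le> 1" and v: "v > 0" for x v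
  proof (cases "v = 1")
    case True
    then show ?thesis using K x by (simp add: dilation_gap_def)
  next
    case False
    define t where "t = 1 + 1 / v"
    have t1: "t \<ge> 1" and tv: "1 / v \<le> t" using v by (simp_all add: t_def)
    have xv: "x / v \<le> x * t" "x \<le> x * t" using x v by (simp_all add: t_def field_simps)
    have xt: "x * t \<le> t" using x t1 by (simp add: mult_left_le_one_le)
    define y where "y = max x (x / v)"
    have y: "0 \<le> y" "y \<le> x * t" "1 + y \<le> 2 * t" using x xv xt t1 order_trans[OF xv(1) xt] by (auto simp: y_def)
    have xJ: "(x * t) ^ (J - 1) * (x * t) = (x * t) ^ J" using J by (simp add: power_eq_if)
    have dist: "\<bar>x / v - x\<bar> \<le> x * t * \<bar>1 - v\<bar>"
    proof -
      have "\<bar>x / v - x\<bar> = x * (1 / v) * \<bar>1 - v\<bar>"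
      proof -
        have "x / v - x = x * (1 / v) * (1 - v)" using v by (simp add: field_simps)
        then show ?thesis using x v by (simp add: abs_mult)
      qed
      also have "\<dots> \<le> x * t * \<bar>1 - v\<bar>" using x tv by (intro mult_right_mono mult_left_mono) auto
      finally show ?thesis .
    qed
    have "\<bar>E (x / v) - E x\<bar> \<le> C * y ^ (J - 1) * (1 + y) ^ q * \<bar>x / v - x\<bar>"
      using CL[of x "x / v"] CL[of "x / v" x] x v by (cases "x \<le> x / v") (auto simp: y_def abs_minus_commute max_def)
    also have "\<dots> \<le> C * (x * t) ^ (J - 1) * (2 * t) ^ q * (x * t * \<bar>1 - v\<bar>)"
      using y x t1 C dist by (intro mult_mono power_mono) auto
    also have "\<dots> = C * 2 ^ q * x ^ J * \<bar>1 - v\<bar> * t ^ (J + q)"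
      using xJ by (simp add: power_mult_distrib power_add algebra_simps)
    finally have A: "\<bar>E (x / v) - E x\<bar> \<le> C * 2 ^ q * x ^ J * \<bar>1 - v\<bar> * t ^ (J + q)" .
    have B: "\<bar>E x\<bar> \<le> C * 2 ^ q * x ^ J * t ^ (J + q)"
    proof -
      have "\<bar>E x\<bar> \<le> C * x ^ J * (1 + x) ^ q" using CB[of x] x by simp
      also have "\<dots> \<le> C * x ^ J * 2 ^ q * 1" using x C by (simp add: mult_left_mono power_mono)
      also have "\<dots> \<le> C * x ^ J * 2 ^ q * t ^ (J + q)" using x C t1 by (intro mult_left_mono) auto
      finally show ?thesis by (simp add: mult_ac)
    qed
    \<comment> \<open>Both summands now carry a factor \<open>1 - v\<close>: the first through the
      Lipschitz bound, the second explicitly.\<close>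
    have "E (x / v) / v - E x = (1 / v) * ((E (x / v) - E x) + (1 - v) * E x)"
      using v by (simp add: field_simps)
    then have "\<bar>E (x / v) / v - E x\<bar> = (1 / v) * \<bar>(E (x / v) - E x) + (1 - v) * E x\<bar>"
      using v by (simp add: abs_mult)
    also have "\<dots> \<le> t * (\<bar>E (x / v) - E x\<bar> + \<bar>1 - v\<bar> * \<bar>E x\<bar>)"
      using tv v t1 by (intro mult_mono) (auto simp flip: abs_mult)
    also have "\<dots> \<le> t * (C * 2 ^ q * x ^ J * \<bar>1 - v\<bar> * t ^ (J + q) + \<bar>1 - v\<bar> * (C * 2 ^ q * x ^ J * t ^ (J + q)))"
      using A B t1 by (intro mult_left_mono add_mono) auto
    also have "\<dots> = (K * x ^ J) * t ^ p * \<bar>1 - v\<bar>"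
      by (simp add: K_def p_def algebra_simps)
    finally have num: "\<bar>E (x / v) / v - E x\<bar> \<le> (K * x ^ J) * t ^ p * \<bar>1 - v\<bar>" .
    have "1 - v\<^sup>2 = (1 - v) * (1 + v)" by (simp add: power2_eq_square algebra_simps)
    then have "\<bar>1 - v\<^sup>2\<bar> = \<bar>1 - v\<bar> * (1 + v)" using v by (simp add: abs_mult)
    then have "\<bar>dilation_gap E x v\<bar> = \<bar>E (x / v) / v - E x\<bar> / (\<bar>1 - v\<bar> * (1 + v))"
      by (simp add: dilation_gap_def abs_divide)
    also have "\<dots> \<le> ((K * x ^ J) * t ^ p * \<bar>1 - v\<bar>) / (\<bar>1 - v\<bar> * 1)"
      using num v False by (intro frac_le mult_left_mono) auto
    also have "\<dots> = (K * x ^ J) * t ^ p" using False by simp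
    finally show ?thesis by (simp add: t_def)
  qed
  have split: "dilation_gap D x v = (\<Sum>j<J. (fps_nth P j * x ^ j) * power_gap (Suc j) v) + dilation_gap E x v" if v: "v > 0" for x v
  proof -
    have p1: "fps_nth P j * (x / v) ^ j / v - fps_nth P j * x ^ j = fps_nth P j * x ^ j * (1 / v ^ Suc j - 1)" for j
      using v by (simp add: power_divide field_simps)
    have "D (x / v) / v - D x = (\<Sum>j<J. fps_nth P j * (x / v) ^ j / v - fps_nth P j * x ^ j) + (E (x / v) / v - E x)"
      by (simp add: E_def sum_subtractf sum_divide_distrib diff_divide_distrib)
    then show ?thesis
      unfolding p1 by (simp add: dilation_gap_def power_gap_def add_divide_distrib sum_divide_distrib)
  qed
  show "(\<lambda>m. bracket m (dilation_gap D (2 / real m)) / bracket m (\<lambda>v. 1) -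
     (\<Sum>j<J. (1 / real m) ^ j * ((fps_nth P j * 2 ^ j) * (bracket m (power_gap (Suc j)) / bracket m (\<lambda>v. 1))))) \<in> O(\<lambda>m. (1 / real m) ^ J)"
  proof -
    have "(\<lambda>m. (K * 2 ^ J) * (1 / real m) ^ J * (bracket m (\<lambda>v. (1 + 1 / v) ^ p) / bracket m (\<lambda>v. 1))) \<in> O(\<lambda>m. (1 / real m) ^ J * 1)"
      by (intro landau_o.big.mult one_plus_inverse_power_bigo(1)) simp
    moreover have "eventually (\<lambda>m. norm (bracket m (dilation_gap D (2 / real m)) / bracket m (\<lambda>v. 1) -
     (\<Sum>j<J. (1 / real m) ^ j * ((fps_nth P j * 2 ^ j) * (bracket m (power_gap (Suc j)) / bracket m (\<lambda>v. 1))))) \<le>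
      norm ((K * 2 ^ J) * (1 / real m) ^ J * (bracket m (\<lambda>v. (1 + 1 / v) ^ p) / bracket m (\<lambda>v. 1)))) sequentially"
    \<comment> \<open>The \<open>2\<close> yields \<open>x \<le> 1\<close>; the \<open>p\<close>
      makes \<open>(1 + 1 / v) ^ p\<close> and the gaps up to index \<open>J\<close>
      integrable.\<close>
    proof (intro eventually_mono[OF eventually_ge_at_top[of "2 + p"]])
      fix m :: nat assume m: "m \<ge> 2 + p"
      define x where "x = 2 / real m"
      have x: "0 < x" "x \<le> 1" using m by (simp_all add: x_def)
      have b1: "bracket m (\<lambda>v. 1) > 0" using bracket_one(2)[of m] m by simp
      have Eint: "bracket_integrable m (dilation_gap E x)"
        and Ebd: "\<bar>bracket m (dilation_gap E x)\<bar> \<le> K * x ^ J * bracket m (\<lambda>v. (1 + 1 / v) ^ p)"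
      proof -
        have i: "bracket_integrable m (\<lambda>v. (1 + 1 / v) ^ p)" using one_plus_inverse_power_bigo(2)[of p m] m by simp
        have [measurable]: "dilation_gap E x \<in> borel_measurable borel" unfolding dilation_gap_def by measurable
        note w = wint_bound[OF wt_measurable wt_nonneg _ wint_cmult(1)[OF i, of "K * x ^ J"], of "dilation_gap E x"]
        show "bracket_integrable m (dilation_gap E x)" by (rule w(1)) (use Ebound[OF x] in auto)
        have "\<bar>bracket m (dilation_gap E x)\<bar> \<le> bracket m (\<lambda>v. K * x ^ J * (1 + 1 / v) ^ p)" by (rule w(2)) (use Ebound[OF x] in auto)
        also have "\<dots> = K * x ^ J * bracket m (\<lambda>v. (1 + 1 / v) ^ p)" by (rule wint_cmult(2)[OF i])
        finally show "\<bar>bracket m (dilation_gap E x)\<bar> \<le> K * x ^ J * bracket m (\<lambda>v. (1 + 1 / v) ^ p)" .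
      qed
      have pint: "bracket_integrable m (power_gap (Suc j))" if "j < J" for j
        using that m by (intro power_gap_integrable) (auto simp: p_def)
      have sint: "bracket_integrable m (\<lambda>v. \<Sum>j<J. (fps_nth P j * x ^ j) * power_gap (Suc j) v) \<and>
        bracket m (\<lambda>v. \<Sum>j<J. (fps_nth P j * x ^ j) * power_gap (Suc j) v) = (\<Sum>j<J. bracket m (\<lambda>v. (fps_nth P j * x ^ j) * power_gap (Suc j) v))"
        by (rule wint_sum) (auto intro!: wint_cmult(1) pint)
      have "bracket m (dilation_gap D x) = bracket m (\<lambda>v. (\<Sum>j<J. (fps_nth P j * x ^ j) * power_gap (Suc j) v) + dilation_gap E x v)"
        unfolding wint_def by (intro set_lebesgue_integral_cong) (auto simp: split)
      also have "\<dots> = (\<Sum>j<J. bracket m (\<lambda>v. (fps_nth P j * x ^ j) * power_gap (Suc j) v)) + bracket m (dilation_gap E x)"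
        using wint_add(2)[OF conjunct1[OF sint] Eint] sint by simp
      also have "(\<Sum>j<J. bracket m (\<lambda>v. (fps_nth P j * x ^ j) * power_gap (Suc j) v)) = (\<Sum>j<J. (fps_nth P j * x ^ j) * bracket m (power_gap (Suc j)))"
        by (intro sum.cong refl wint_cmult(2) pint) auto
      finally have "bracket m (dilation_gap D x) / bracket m (\<lambda>v. 1) -
        (\<Sum>j<J. (1 / real m) ^ j * ((fps_nth P j * 2 ^ j) * (bracket m (power_gap (Suc j)) / bracket m (\<lambda>v. 1)))) = bracket m (dilation_gap E x) / bracket m (\<lambda>v. 1)"
        by (simp add: add_divide_distrib sum_divide_distrib x_def power_divide mult_ac)
      also have "norm \<dots> \<le> K * x ^ J * bracket m (\<lambda>v. (1 + 1 / v) ^ p) / bracket m (\<lambda>v. 1)"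
        using Ebd b1 by (simp add: abs_divide divide_right_mono)
      also have "\<dots> = (K * 2 ^ J) * (1 / real m) ^ J * (bracket m (\<lambda>v. (1 + 1 / v) ^ p) / bracket m (\<lambda>v. 1))"
        by (simp add: x_def power_divide)
      also have "\<dots> \<le> norm \<dots>" unfolding real_norm_def by (rule abs_ge_self)
      finally show "norm (bracket m (dilation_gap D (2 / real m)) / bracket m (\<lambda>v. 1) -
     (\<Sum>j<J. (1 / real m) ^ j * ((fps_nth P j * 2 ^ j) * (bracket m (power_gap (Suc j)) / bracket m (\<lambda>v. 1))))) \<le>
      norm ((K * 2 ^ J) * (1 / real m) ^ J * (bracket m (\<lambda>v. (1 + 1 / v) ^ p) / bracket m (\<lambda>v. 1)))" by (simp only: x_def)
    qed
    ultimately show ?thesis by (simp del: norm_mult real_norm_def) (rule landau_o.big_trans[OF landau_o.big_mono])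
  qed
qed

text \<open>In terms of the paper, \<open>m = 4 x\<close>; the Bessel functions are taken at \<open>m / 2\<close>.\<close>

definition scaled_error :: "nat \<Rightarrow> real" where
  "scaled_error m = (macdonald_sq (2 / real m) * (sqrt (real m) * pv m / sqrt (2 * pi)) +
     stirling_ratio m * (bracket m (dilation_gap macdonald_sq (2 / real m)) / bracket m (\<lambda>v. 1))) *
     inverse (bessel_I0_scaled (real m / 2) * bessel_I0_scaled (real m / 2))"

definition fps_scale :: "real \<Rightarrow> real fps \<Rightarrow> real fps" where
  "fps_scale c P = Abs_fps (\<lambda>k. fps_nth P k * c ^ k)"

definition scaled_error_numerator :: "real fps" where
  "scaled_error_numerator = fps_scale 2 (macdonald_fps * macdonald_fps) * pv_fps +
     stirling_fps * dilation_gap_fps (macdonald_fps * macdonald_fps)"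

definition scaled_error_fps :: "real fps" where
  "scaled_error_fps = scaled_error_numerator * inverse (fps_scale 2 bessel_I0_fps * fps_scale 2 bessel_I0_fps)"

lemma scaled_error_asymp_series:
  "asymp_series sequentially (\<lambda>m. 1 / real m) scaled_error scaled_error_fps"
proof -
  note h = inverse_nat_tendsto_0 and h1 = inverse_nat_bigo_1
  have K: "asymp_series sequentially (\<lambda>m. 1 / real m) (\<lambda>m. macdonald_sq (2 / real m)) (fps_scale 2 (macdonald_fps * macdonald_fps))"
  proof -
    have "asymp_series sequentially (\<lambda>m. 2 * (1 / real m)) (\<lambda>m. macdonald_sq (2 * (1 / real m))) (macdonald_fps * macdonald_fps)"
      by (rule lip_series_imp_asymp_series[OF macdonald_sq_lip_series]) (real_asymp, simp)
    from asymp_series_rescale[OF this] show ?thesis by (simp add: fps_scale_def)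
  qed
  have I: "asymp_series sequentially (\<lambda>m. 1 / real m) (\<lambda>m. bessel_I0_scaled (real m / 2)) (fps_scale 2 bessel_I0_fps)"
  proof -
    have "filterlim (\<lambda>m. real m / 2) at_top sequentially" by real_asymp
    from asymp_series_filter[OF bessel_I0_asymp_series this]
    have "asymp_series sequentially (\<lambda>m. 2 * (1 / real m)) (\<lambda>m. bessel_I0_scaled (real m / 2)) bessel_I0_fps"
      by simp
    from asymp_series_rescale[OF this] show ?thesis by (simp add: fps_scale_def)
  qed
  have I0: "fps_nth (fps_scale 2 bessel_I0_fps) 0 = 1" by (simp add: fps_scale_def bessel_I0_fps_def)
  show ?thesis
    unfolding scaled_error_def[abs_def] scaled_error_fps_def scaled_error_numerator_def
    by (intro asymp_series_mult asymp_series_add asymp_series_inverse K I pv_asymp_series stirling_asymp_series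
          dilation_gap_asymp_series macdonald_sq_lip_series macdonald_sq_measurable h h1)
       (simp add: I0)
qed

text \<open>The factor \<open>exp (- m)\<close> of the remainder is doubled in the exponent by
  \<open>I\<^sub>0(m / 2)\<^sup>2\<close>, which is of size \<open>exp m / (pi * m)\<close>. In
  \<open>scaled_error\<close> the factor \<open>stirling_ratio m\<close> undoes the normalisation of
  the bracket up to \<open>sqrt (m / (2 * pi))\<close>, the same factor that accompanies
  \<open>pv m\<close>.\<close>

lemma I0K0_remainder_over_I0_square:
  assumes m: "m > 0" "m = 2 * M"
  shows "I0K0_remainder M (real m / 2) / (bessel_I0 (real m / 2))\<^sup>2 =
    2 * sqrt (2 * pi) * exp (- 2 * real m) / sqrt (real m) * scaled_error m"
proof -
  define a b e where "a = sqrt (2 * pi)" and "b = sqrt (real m)" and "e = exp (real m)"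
  define L where "L = bracket m (\<lambda>v. 1)"
  define H where "H = bracket m (dilation_gap macdonald_sq (2 / real m))"
  define D where "D = macdonald_sq (2 / real m)"
  define I where "I = bessel_I0 (real m / 2)"
  have pos: "a > 0" "b > 0" "e > 0" and L: "L > 0" using m bracket_one(2)[of m] by (simp_all add: a_def b_def e_def L_def)
  have bb: "real m = b\<^sup>2" and aa: "pi = a\<^sup>2 / 2" by (simp_all add: a_def b_def)
  have R: "I0K0_remainder M (real m / 2) = 2 / e / (pi * real m) * (D * pv m + H)"
    unfolding I0K0_remainder_decomposition[OF m] by (simp add: D_def H_def e_def exp_minus divide_inverse)
  have "(bessel_I0_scaled (real m / 2))\<^sup>2 = (2 * pi * (real m / 2)) * (exp (- (real m / 2)))\<^sup>2 * I\<^sup>2"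
    by (simp add: bessel_I0_scaled_def power_mult_distrib I_def)
  also have "(exp (- (real m / 2)))\<^sup>2 = 1 / e"
    by (simp add: e_def exp_minus field_simps flip: exp_double)
  finally have I2: "bessel_I0_scaled (real m / 2) * bessel_I0_scaled (real m / 2) = pi * real m / e * I\<^sup>2"
    by (simp add: power2_eq_square)
  have ex: "exp (- 2 * real m) = 1 / e\<^sup>2"
    by (simp add: e_def exp_minus field_simps flip: exp_double)
  have S: "scaled_error m = (D * (b * pv m / a) + L * b / a * (H / L)) * inverse (pi * real m / e * I\<^sup>2)"
    unfolding scaled_error_def I2 stirling_ratio_def by (simp add: D_def H_def L_def a_def b_def)
  also have "\<dots> = (b / a) * (D * pv m + H) * inverse (pi * real m / e * I\<^sup>2)"
    using L pos by (simp add: field_simps)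
  finally have "scaled_error m = (b / a) * (D * pv m + H) * inverse (pi * real m / e * I\<^sup>2)" .
  moreover have "2 * a * (1 / e\<^sup>2) / b * ((b / a) * N * inverse (p / e * J)) = 2 / e / p * N / J" for N p J
    using pos by (simp add: power2_eq_square divide_simps)
  ultimately have "2 * a * (1 / e\<^sup>2) / b * scaled_error m = 2 / e / (pi * real m) * (D * pv m + H) / I\<^sup>2"
    by simp
  then show ?thesis by (simp only: R I_def a_def b_def ex)
qed

lemma bessel_I0_pos: "bessel_I0 z > 0"
proof -
  have "0 < (\<Sum>n. (z / 2) ^ (2 * n) / (fact n)\<^sup>2)"
    by (rule suminf_pos2[OF bessel_I0_summable, of _ 0]) auto
  then show ?thesis by (simp add: bessel_I0_def)
qed

text \<open>For \<open>m = 4 * x\<close> the rescaling by \<open>1 / 4\<close> passes to powers of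
  \<open>1 / x\<close>; the factor \<open>12 / 7\<close> normalises the leading coefficient to
  \<open>1\<close>.\<close>

definition error_fps :: "real fps" where
  "error_fps = fps_const (12 / 7) * fps_scale (1 / 4) scaled_error_fps"

lemma error_expansion:
  "(\<lambda>x::nat. I0K0_remainder (2 * x) (2 * real x) / (bessel_I0 (2 * real x))\<^sup>2
      - 7 * sqrt (2 * pi) * exp (- 8 * real x) / (12 * sqrt (real x)) * (\<Sum>k<M. fps_nth error_fps k / real x ^ k))
    \<in> O(\<lambda>x. 7 * sqrt (2 * pi) * exp (- 8 * real x) / (12 * sqrt (real x)) / real x ^ M)"
proof -
  define lead where "lead x = 7 * sqrt (2 * pi) * exp (- 8 * real x) / (12 * sqrt (real x))" for x :: nat
  have "filterlim (\<lambda>x::nat. 4 * x) at_top sequentially" by real_asymp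
  from asymp_series_filter[OF scaled_error_asymp_series this]
  have "asymp_series sequentially (\<lambda>x. (1 / 4) * (1 / real x)) (\<lambda>x. scaled_error (4 * x)) scaled_error_fps"
    by simp
  from asymp_series_cmult[OF inverse_nat_bigo_1 asymp_series_rescale[OF this], of "12 / 7"]
  have "asymp_series sequentially (\<lambda>x. 1 / real x) (\<lambda>x. 12 / 7 * scaled_error (4 * x)) error_fps"
    by (simp add: error_fps_def fps_scale_def)
  from asymp_seriesD[OF this, of M]
  have "(\<lambda>x. lead x * (12 / 7 * scaled_error (4 * x) - (\<Sum>k<M. fps_nth error_fps k * (1 / real x) ^ k))) \<in> O(\<lambda>x. lead x * (1 / real x) ^ M)"
    by (intro landau_o.big.mult landau_o.big_refl)
  also have "(\<lambda>x. lead x * (1 / real x) ^ M) = (\<lambda>x. lead x / real x ^ M)"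
    by (simp add: power_one_over)
  finally have "(\<lambda>x. lead x * (12 / 7 * scaled_error (4 * x) - (\<Sum>k<M. fps_nth error_fps k * (1 / real x) ^ k))) \<in> O(\<lambda>x. lead x / real x ^ M)" .
  also have "?this \<longleftrightarrow> (\<lambda>x. I0K0_remainder (2 * x) (2 * real x) / (bessel_I0 (2 * real x))\<^sup>2 - lead x * (\<Sum>k<M. fps_nth error_fps k / real x ^ k)) \<in> O(\<lambda>x. lead x / real x ^ M)"
  proof (rule landau_o.big.in_cong, intro eventually_mono[OF eventually_gt_at_top[of 0]])
    fix x :: nat assume x: "x > 0"
    have z: "real (4 * x) / 2 = 2 * real x" "- 2 * real (4 * x) = - 8 * real x" by simp_all
    have q: "sqrt (real (4 * x)) = 2 * sqrt (real x)" by (simp add: real_sqrt_mult)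
    have m: "4 * x > 0" "4 * x = 2 * (2 * x)" using x by simp_all
    have "I0K0_remainder (2 * x) (2 * real x) / (bessel_I0 (2 * real x))\<^sup>2 =
        2 * sqrt (2 * pi) * exp (- 8 * real x) / (2 * sqrt (real x)) * scaled_error (4 * x)"
      by (rule I0K0_remainder_over_I0_square[OF m, unfolded z q])
    moreover have "2 * p * e / (2 * r) * s = 7 * p * e / (12 * r) * (12 / 7 * s)" for p e r s :: real
      by simp
    ultimately have "I0K0_remainder (2 * x) (2 * real x) / (bessel_I0 (2 * real x))\<^sup>2 = lead x * (12 / 7 * scaled_error (4 * x))"
      by (simp only: lead_def)
    then show "lead x * (12 / 7 * scaled_error (4 * x) - (\<Sum>k<M. fps_nth error_fps k * (1 / real x) ^ k)) =
      I0K0_remainder (2 * x) (2 * real x) / (bessel_I0 (2 * real x))\<^sup>2 - lead x * (\<Sum>k<M. fps_nth error_fps k / real x ^ k)"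
      by (simp add: right_diff_distrib power_one_over)
  qed
  finally show ?thesis by (simp only: lead_def)
qed

section \<open>The first five coefficients\<close>

text \<open>Finite lists of coefficients turn the arithmetic of the series into rational
  computations by rewriting, while the series themselves remain folded.\<close>

definition fps_coeffs :: "nat \<Rightarrow> 'a::zero fps \<Rightarrow> 'a list" where
  "fps_coeffs n P = map (fps_nth P) [0..<n]"

lemma upt_0_numeral: "[0..<numeral k] = [0..<pred_numeral k] @ [pred_numeral k]"
  by (simp add: numeral_eq_Suc)

lemma fps_coeffs_nth: "fps_coeffs n P = xs \<Longrightarrow> k < n \<Longrightarrow> fps_nth P k = xs ! k"
  by (auto simp: fps_coeffs_def)

lemma fps_coeffs_mult:
  fixes P Q :: "real fps"
  shows "fps_coeffs n P = xs \<Longrightarrow> fps_coeffs n Q = ys \<Longrightarrow>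
     fps_coeffs n (P * Q) = map (\<lambda>k. \<Sum>i\<leftarrow>[0..<Suc k]. xs ! i * ys ! (k - i)) [0..<n]"
  by (auto simp: fps_coeffs_def fps_mult_nth interv_sum_list_conv_sum_set_nat atLeastLessThanSuc_atLeastAtMost
      simp del: upt_Suc intro!: sum.cong)

lemma fps_coeffs_add:
  fixes P Q :: "real fps"
  shows "fps_coeffs n P = xs \<Longrightarrow> fps_coeffs n Q = ys \<Longrightarrow> fps_coeffs n (P + Q) = map2 (+) xs ys"
  by (auto simp: fps_coeffs_def zip_map_map zip_same_conv_map intro!: nth_equalityI)

lemma fps_coeffs_diff:
  fixes P Q :: "real fps"
  shows "fps_coeffs n P = xs \<Longrightarrow> fps_coeffs n Q = ys \<Longrightarrow> fps_coeffs n (P - Q) = map2 (-) xs ys"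
  by (auto simp: fps_coeffs_def intro!: nth_equalityI)

lemma fps_coeffs_scale: "fps_coeffs n P = xs \<Longrightarrow> fps_coeffs n (fps_scale c P) = map (\<lambda>k. xs ! k * c ^ k) [0..<n]"
  by (auto simp: fps_coeffs_def fps_scale_def)

lemma gbinomial_numeral:
  fixes a :: real
  shows "a gchoose numeral k = (a gchoose pred_numeral k) * (a - real (pred_numeral k)) / numeral k"
proof -
  have "a * (a gchoose pred_numeral k) = real (pred_numeral k) * (a gchoose pred_numeral k) + real (Suc (pred_numeral k)) * (a gchoose Suc (pred_numeral k))"
    by (rule gbinomial_mult_1)
  then have "real (numeral k) * (a gchoose numeral k) = (a gchoose pred_numeral k) * (a - real (pred_numeral k))"
    by (simp only: numeral_eq_Suc[symmetric]) (simp add: algebra_simps)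
  then show ?thesis by (simp add: field_simps)
qed

text \<open>\<open>fps_binomial a\<close> times \<open>fps_shift_inv ^ j\<close> is
  \<open>fps_X ^ j\<close> times \<open>fps_binomial (a - real j)\<close>. Both recursions are of
  this form, with \<open>a = 0\<close> for Stirling's series and \<open>a = - 1 / 2\<close> for the
  principal value.\<close>

lemma rec_coeff_binomial:
  "rec_coeff (fps_binomial a) j n = (if n \<le> j then 0 else (a - real j) gchoose (n - j))"
proof (cases "n \<le> j")
  case True
  then show ?thesis by (simp add: rec_coeff_eq_0)
next
  case False
  have "fps_binomial a * fps_shift_inv ^ j = fps_X ^ j * (fps_binomial a * fps_binomial (real j * - 1))"
    by (simp only: fps_shift_inv_power fps_binomial_minus_one[symmetric] fps_binomial_power mult.left_commute)
  also have "\<dots> = fps_X ^ j * fps_binomial (a - real j)"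
    by (simp flip: fps_binomial_add_mult)
  finally show ?thesis using False by (simp add: rec_coeff_def fps_X_power_mult_nth fps_X_power_nth)
qed

lemma sum_lessThan_list: "(\<Sum>j<n. f j) = (\<Sum>j\<leftarrow>[0..<n]. f j :: real)"
  by (simp add: interv_sum_list_conv_sum_set_nat lessThan_atLeast0)

lemma sum_atMost_list: "(\<Sum>j\<le>n. f j) = (\<Sum>j\<leftarrow>[0..<Suc n]. f j :: real)"
  by (simp add: interv_sum_list_conv_sum_set_nat atLeastLessThanSuc_atLeastAtMost atLeast0AtMost del: upt_Suc)

lemma rec_solution_list:
  assumes "fps_coeffs k (Abs_fps (rec_solution (fps_binomial a) B s0)) = xs" "k > 0"
  shows "rec_solution (fps_binomial a) B s0 k =
    (fps_nth B (Suc k) - (\<Sum>j\<leftarrow>[0..<k]. xs ! j * ((a - real j) gchoose (Suc k - j)))) / (a - real k)"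
proof -
  have "(\<Sum>j<k. rec_solution (fps_binomial a) B s0 j * rec_coeff (fps_binomial a) j (Suc k)) = (\<Sum>j<k. xs ! j * ((a - real j) gchoose (Suc k - j)))"
    using assms(1) by (intro sum.cong) (auto simp: fps_coeffs_def rec_coeff_binomial)
  then show ?thesis using assms(2)
    by (simp add: rec_solution.simps[of _ _ _ k] sum_lessThan_list)
qed

lemma fps_coeffs_Suc: "fps_coeffs (Suc k) P = fps_coeffs k P @ [fps_nth P k]"
  by (simp add: fps_coeffs_def)

lemma fps_coeffs_Abs_Suc: "fps_coeffs (Suc k) (Abs_fps f) = fps_coeffs k (Abs_fps f) @ [f k]"
  by (simp add: fps_coeffs_def)

section \<open>Coefficients of the Laplace, Stirling and principal value series\<close>

lemma gap_fps_nth_numeral: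
  "fps_nth gap_fps (numeral k) = ((- 1) ^ pred_numeral k * (numeral k / fact (pred_numeral k + 2)) - fps_nth gap_fps (pred_numeral k)) / 2"
  using gap_fps_nth_Suc[of "pred_numeral k"] by (simp add: numeral_eq_Suc[symmetric] del: fact_Suc)

lemma fact_numeral_real: "(fact (numeral k) :: real) = numeral k * fact (pred_numeral k)"
  by (simp add: fact_numeral)

text \<open>The length is \<open>2 * 5 + 1\<close>: order \<open>4\<close> of \<open>pv_fps\<close>
  depends on order \<open>5\<close> of its right side, and order \<open>5\<close> of a moment series
  uses Taylor coefficients up to index \<open>10\<close>.\<close>

lemma gap_fps_coeffs:
  "fps_coeffs 11 gap_fps = [0, 1/4, -7/24, 5/24, -29/240, 23/360, -41/1260, 1319/80640, -11887/1451520, 59453/14515200, -654023/319334400]"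
proof -
  have g: "fps_nth gap_fps (Suc 0) = 1 / 4" using gap_fps_nth_Suc[of 0] by (simp add: gap_fps_nth_0)
  show ?thesis by (simp add: g upt_0_numeral fps_coeffs_def gap_fps_nth_0 gap_fps_nth_numeral fact_numeral_real)
qed

lemma inverse_2_plus_X_nth: "fps_nth (inverse (2 + fps_X :: real fps)) k = (- 1) ^ k / 2 ^ Suc k"
proof -
  have "inverse (2 + fps_X :: real fps) = Abs_fps (\<lambda>k. (- 1) ^ k / 2 ^ Suc k)"
  proof (rule fps_inverse_unique, rule fps_ext)
    fix n
    show "fps_nth ((2 + fps_X) * Abs_fps (\<lambda>k. (- 1 :: real) ^ k / 2 ^ Suc k)) n = fps_nth 1 n"
      by (cases n) (simp_all add: distrib_right numeral_fps_const field_simps)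
  qed
  then show ?thesis by simp
qed

lemma inverse_2_plus_X_coeffs:
  "fps_coeffs 9 (inverse (2 + fps_X :: real fps)) = [1/2, -1/4, 1/8, -1/16, 1/32, -1/64, 1/128, -1/256, 1/512]"
  by (simp add: upt_0_numeral fps_coeffs_def inverse_2_plus_X_nth)

lemma central_moment_coeffs_step:
  assumes "fps_coeffs (Suc n) (central_moment i) = xs" "fps_coeffs (Suc n) (central_moment j) = ys" "j = Suc i" "k = Suc j"
  shows "fps_coeffs (Suc n) (central_moment k) = 0 # map (\<lambda>l. (real i + 2) * ys ! l + (real i + 1) * xs ! l) [0..<n]"
proof -
  have e: "fps_nth (central_moment i) l = xs ! l" "fps_nth (central_moment (Suc i)) l = ys ! l" if "l < n" for l
    using assms(1-3) that by (auto simp: fps_coeffs_def nth_append)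
  have "fps_coeffs (Suc n) (central_moment k) = 0 # map (\<lambda>l. fps_nth (central_moment k) (Suc l)) [0..<n]"
    unfolding fps_coeffs_def map_upt_Suc using assms(3,4) by simp
  also have "map (\<lambda>l. fps_nth (central_moment k) (Suc l)) [0..<n] = map (\<lambda>l. (real i + 2) * ys ! l + (real i + 1) * xs ! l) [0..<n]"
    using assms(3,4) by (intro map_cong refl) (simp add: e)
  finally show ?thesis .
qed

lemma central_moment_coeffs:
  "fps_coeffs 6 (central_moment 0) = [1, 0, 0, 0, 0, 0]"
  "fps_coeffs 6 (central_moment 1) = [0, 1, 0, 0, 0, 0]"
  "fps_coeffs 6 (central_moment 2) = [0, 1, 2, 0, 0, 0]"
  "fps_coeffs 6 (central_moment 3) = [0, 0, 5, 6, 0, 0]"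
  "fps_coeffs 6 (central_moment 4) = [0, 0, 3, 26, 24, 0]"
  "fps_coeffs 6 (central_moment 5) = [0, 0, 0, 35, 154, 120]"
  "fps_coeffs 6 (central_moment 6) = [0, 0, 0, 15, 340, 1044]"
  "fps_coeffs 6 (central_moment 7) = [0, 0, 0, 0, 315, 3304]"
  "fps_coeffs 6 (central_moment 8) = [0, 0, 0, 0, 105, 4900]"
  "fps_coeffs 6 (central_moment 9) = [0, 0, 0, 0, 0, 3465]"
  "fps_coeffs 6 (central_moment 10) = [0, 0, 0, 0, 0, 945]"
proof -
  have s: "fps_coeffs 6 (central_moment k) = 0 # map (\<lambda>l. (real i + 2) * ys ! l + (real i + 1) * xs ! l) [0..<5]"
    if "fps_coeffs 6 (central_moment i) = xs" "fps_coeffs 6 (central_moment j) = ys" "j = Suc i" "k = Suc j" for i j k xs ys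
    using central_moment_coeffs_step[of 5 i xs j ys k] that by simp
  show 0: "fps_coeffs 6 (central_moment 0) = [1, 0, 0, 0, 0, 0]" by (simp add: upt_0_numeral fps_coeffs_def)
  show 1: "fps_coeffs 6 (central_moment 1) = [0, 1, 0, 0, 0, 0]" by (simp add: upt_0_numeral fps_coeffs_def)
  show 2: "fps_coeffs 6 (central_moment 2) = [0, 1, 2, 0, 0, 0]" using s[OF 0 1, of 2] by (simp add: upt_0_numeral)
  show 3: "fps_coeffs 6 (central_moment 3) = [0, 0, 5, 6, 0, 0]" using s[OF 1 2, of 3] by (simp add: upt_0_numeral)
  show 4: "fps_coeffs 6 (central_moment 4) = [0, 0, 3, 26, 24, 0]" using s[OF 2 3, of 4] by (simp add: upt_0_numeral)
  show 5: "fps_coeffs 6 (central_moment 5) = [0, 0, 0, 35, 154, 120]" using s[OF 3 4, of 5] by (simp add: upt_0_numeral)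
  show 6: "fps_coeffs 6 (central_moment 6) = [0, 0, 0, 15, 340, 1044]" using s[OF 4 5, of 6] by (simp add: upt_0_numeral)
  show 7: "fps_coeffs 6 (central_moment 7) = [0, 0, 0, 0, 315, 3304]" using s[OF 5 6, of 7] by (simp add: upt_0_numeral)
  show 8: "fps_coeffs 6 (central_moment 8) = [0, 0, 0, 0, 105, 4900]" using s[OF 6 7, of 8] by (simp add: upt_0_numeral)
  show 9: "fps_coeffs 6 (central_moment 9) = [0, 0, 0, 0, 0, 3465]" using s[OF 7 8, of 9] by (simp add: upt_0_numeral)
  show 10: "fps_coeffs 6 (central_moment 10) = [0, 0, 0, 0, 0, 945]" using s[OF 8 9, of 10] by (simp add: upt_0_numeral)
qed

lemma moment_series_coeffs:
  assumes P: "fps_coeffs n P = xs" "2 * k < n" and k: "k < 6"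
  shows "fps_nth (moment_series P) k = (\<Sum>i\<leftarrow>[0..<Suc (2 * k)]. xs ! i * fps_coeffs 6 (central_moment i) ! k)"
proof -
  have "(\<Sum>i\<leftarrow>[0..<Suc (2 * k)]. fps_nth P i * fps_nth (central_moment i) k) = (\<Sum>i\<leftarrow>[0..<Suc (2 * k)]. xs ! i * fps_coeffs 6 (central_moment i) ! k)"
  proof (rule arg_cong[where f = sum_list], rule map_cong[OF refl])
    fix i assume "i \<in> set [0..<Suc (2 * k)]"
    then have "i < n" using P(2) by (auto simp del: upt_Suc)
    moreover have "fps_coeffs 6 (central_moment i) ! k = fps_nth (central_moment i) k"
      using k by (simp add: fps_coeffs_def)
    ultimately show "fps_nth P i * fps_nth (central_moment i) k = xs ! i * fps_coeffs 6 (central_moment i) ! k"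
      using fps_coeffs_nth[OF P(1)] by simp
  qed
  then show ?thesis by (simp only: moment_series_def fps_nth_Abs_fps sum_atMost_list)
qed

lemma gap_moment_coeffs:
  "fps_coeffs 6 (moment_series gap_fps) = [0, -1/24, 23/240, -181/1260, 81217/483840, -8513189/63866880]"
  unfolding fps_coeffs_def[of _ "moment_series _"]
  by (simp add: upt_0_numeral moment_series_coeffs[OF gap_fps_coeffs] central_moment_coeffs central_moment_coeffs(2)[unfolded One_nat_def] del: central_moment.simps)

lemma inverse_1_plus_moment_coeffs:
  "fps_coeffs 5 (moment_series (inverse (2 + fps_X))) = [1/2, -1/8, 1/32, 1/128, -13/512]"
  unfolding fps_coeffs_def[of _ "moment_series _"]
  by (simp add: upt_0_numeral moment_series_coeffs[OF inverse_2_plus_X_coeffs] central_moment_coeffs central_moment_coeffs(2)[unfolded One_nat_def] del: central_moment.simps)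

lemma rec_solution_coeffs_step:
  assumes "fps_coeffs k (Abs_fps (rec_solution (fps_binomial a) B s0)) = xs" "k > 0" "k' = Suc k"
  shows "fps_coeffs k' (Abs_fps (rec_solution (fps_binomial a) B s0)) =
    xs @ [(fps_nth B k' - (\<Sum>j\<leftarrow>[0..<k]. xs ! j * ((a - real j) gchoose (k' - j)))) / (a - real k)]"
  using rec_solution_list[OF assms(1,2)] assms(1) unfolding assms(3) by (simp add: fps_coeffs_Abs_Suc)

text \<open>The nonzero entries are \<open>B / (2 * j * (2 * j - 1))\<close> with \<open>B\<close>
  the Bernoulli number of index \<open>2 * j\<close>. Reading \<open>Q = 1\<close> as
  \<open>fps_binomial 0\<close> makes the evaluation step of the principal value applicable.\<close>

lemma stirling_log_coeffs: "fps_coeffs 6 stirling_log_fps = [0, 1/12, 0, -1/360, 0, 1/1260]"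
proof -
  let ?S = "Abs_fps (rec_solution (fps_binomial 0) stirling_log_rhs 0)"
  note simps = upt_0_numeral gbinomial_numeral stirling_log_rhs_nth
  have 1: "fps_coeffs 1 ?S = [0]" by (simp add: fps_coeffs_def rec_solution.simps)
  have 2: "fps_coeffs 2 ?S = [0, 1/12]" by (subst rec_solution_coeffs_step[OF 1]) (simp_all add: simps)
  have 3: "fps_coeffs 3 ?S = [0, 1/12, 0]" by (subst rec_solution_coeffs_step[OF 2]) (simp_all add: simps)
  have 4: "fps_coeffs 4 ?S = [0, 1/12, 0, -1/360]" by (subst rec_solution_coeffs_step[OF 3]) (simp_all add: simps)
  have 5: "fps_coeffs 5 ?S = [0, 1/12, 0, -1/360, 0]" by (subst rec_solution_coeffs_step[OF 4]) (simp_all add: simps)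
  have 6: "fps_coeffs 6 ?S = [0, 1/12, 0, -1/360, 0, 1/1260]" by (subst rec_solution_coeffs_step[OF 5]) (simp_all add: simps)
  then show ?thesis by (simp add: stirling_log_fps_def)
qed

text \<open>An exponential satisfies \<open>S' = S * L'\<close>; comparing coefficients replaces the
  composition by a convolution recursion.\<close>

lemma stirling_fps_nth_Suc:
  "fps_nth stirling_fps (Suc n) = (\<Sum>i\<leftarrow>[0..<Suc n]. fps_nth stirling_fps i * (real (Suc n - i) * fps_nth stirling_log_fps (Suc n - i))) / real (Suc n)"
proof -
  have "fps_nth stirling_log_fps 0 = 0" by (simp add: stirling_log_fps_def rec_solution.simps)
  then have "fps_deriv stirling_fps = stirling_fps * fps_deriv stirling_log_fps"
    unfolding stirling_fps_def by (subst fps_compose_deriv) simp_all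
  from arg_cong[OF this, of "\<lambda>P. fps_nth P n"]
  have "real (Suc n) * fps_nth stirling_fps (Suc n) = (\<Sum>i\<le>n. fps_nth stirling_fps i * (real (Suc n - i) * fps_nth stirling_log_fps (Suc n - i)))"
    by (simp add: fps_mult_nth atLeast0AtMost Suc_diff_le del: of_nat_Suc)
  then show ?thesis unfolding sum_atMost_list by (simp add: field_simps del: upt_Suc of_nat_Suc)
qed

lemma stirling_coeffs_step:
  assumes "fps_coeffs n stirling_fps = xs" "n > 0" "k = Suc n" "n < 6"
  shows "fps_coeffs k stirling_fps = xs @ [(\<Sum>i\<leftarrow>[0..<n]. xs ! i * (real (n - i) * [0, 1/12, 0, -1/360, 0, 1/1260] ! (n - i))) / real n]"
proof -
  obtain m where m: "n = Suc m" using assms(2) by (cases n) auto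
  have "(\<Sum>i\<leftarrow>[0..<n]. fps_nth stirling_fps i * (real (n - i) * fps_nth stirling_log_fps (n - i))) =
    (\<Sum>i\<leftarrow>[0..<n]. xs ! i * (real (n - i) * [0, 1/12, 0, -1/360, 0, 1/1260] ! (n - i)))"
    using assms(4) fps_coeffs_nth[OF stirling_log_coeffs] fps_coeffs_nth[OF assms(1)]
    by (intro arg_cong[where f = sum_list] map_cong refl) (simp del: nth_Cons_numeral nth_Cons_0 nth_Cons_Suc)
  then show ?thesis using assms(1) stirling_fps_nth_Suc[of m]
    unfolding assms(3) fps_coeffs_Suc by (simp only: m)
qed

lemma stirling_coeffs: "fps_coeffs 6 stirling_fps = [1, 1/12, 1/288, -139/51840, -571/2488320, 163879/209018880]"
proof -
  have 1: "fps_coeffs 1 stirling_fps = [1]" by (simp add: fps_coeffs_def stirling_fps_def)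
  have 2: "fps_coeffs 2 stirling_fps = [1, 1/12]" by (subst stirling_coeffs_step[OF 1]) (simp_all add: upt_0_numeral)
  have 3: "fps_coeffs 3 stirling_fps = [1, 1/12, 1/288]" by (subst stirling_coeffs_step[OF 2]) (simp_all add: upt_0_numeral)
  have 4: "fps_coeffs 4 stirling_fps = [1, 1/12, 1/288, -139/51840]" by (subst stirling_coeffs_step[OF 3]) (simp_all add: upt_0_numeral)
  have 5: "fps_coeffs 5 stirling_fps = [1, 1/12, 1/288, -139/51840, -571/2488320]" by (subst stirling_coeffs_step[OF 4]) (simp_all add: upt_0_numeral)
  show ?thesis by (subst stirling_coeffs_step[OF 5]) (simp_all add: upt_0_numeral)
qed

lemma pv_rhs_coeffs: "fps_coeffs 6 pv_rhs = [0, -1/24, 133/1440, -6571/48384, 194503/1244160, -394326443/3284582400]"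
  unfolding pv_rhs_def fps_coeffs_mult[OF stirling_coeffs gap_moment_coeffs] by (simp add: upt_0_numeral)

lemma pv_coeffs: "fps_coeffs 5 pv_fps = [1/12, -11/270, 323/24192, 1243/311040, -186771877/14780620800]"
proof -
  let ?S = "Abs_fps (rec_solution (fps_binomial (- 1 / 2)) pv_rhs (- 2 * fps_nth pv_rhs 1))"
  note B = fps_coeffs_nth[OF pv_rhs_coeffs]
  note simps = upt_0_numeral gbinomial_numeral B
  have 1: "fps_coeffs 1 ?S = [1/12]" using B[of 1] by (simp add: fps_coeffs_def rec_solution.simps)
  have 2: "fps_coeffs 2 ?S = [1/12, -11/270]" by (subst rec_solution_coeffs_step[OF 1]) (simp_all add: simps)
  have 3: "fps_coeffs 3 ?S = [1/12, -11/270, 323/24192]" by (subst rec_solution_coeffs_step[OF 2]) (simp_all add: simps)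
  have 4: "fps_coeffs 4 ?S = [1/12, -11/270, 323/24192, 1243/311040]" by (subst rec_solution_coeffs_step[OF 3]) (simp_all add: simps)
  show ?thesis unfolding pv_fps_def by (subst rec_solution_coeffs_step[OF 4]) (simp_all add: simps)
qed

section \<open>Coefficients of the Bessel factors and of the error\<close>

lemma pochhammer_numeral: "pochhammer (a :: real) (numeral k) = pochhammer a (pred_numeral k) * (a + real (pred_numeral k))"
  by (simp add: numeral_eq_Suc pochhammer_Suc)

lemma macdonald_coeffs: "fps_coeffs 5 macdonald_fps = [1, -1/8, 9/128, -75/1024, 3675/32768]"
  unfolding macdonald_fps_def fps_coeffs_def by (simp add: upt_0_numeral gbinomial_numeral pochhammer_numeral power_one_over)

lemma macdonald_square_coeffs: "fps_coeffs 5 (macdonald_fps * macdonald_fps) = [1, -1/4, 5/32, -21/128, 507/2048]"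
  unfolding fps_coeffs_mult[OF macdonald_coeffs macdonald_coeffs] by (simp add: upt_0_numeral)

lemma bessel_I0_coeffs: "fps_coeffs 5 bessel_I0_fps = [1, 1/8, 9/128, 75/1024, 3675/32768]"
  unfolding bessel_I0_fps_def fps_coeffs_def by (simp add: upt_0_numeral gbinomial_numeral pochhammer_numeral power_one_over)

lemma geometric_coeffs: "fps_coeffs 5 (inverse (1 - fps_const c * fps_X) :: real fps) = [1, c, c ^ 2, c ^ 3, c ^ 4]"
proof -
  have "inverse (1 - fps_const c * fps_X) = Abs_fps (\<lambda>n. c ^ n)"
  proof (rule fps_inverse_unique, rule fps_ext)
    fix n
    show "fps_nth ((1 - fps_const c * fps_X) * Abs_fps (\<lambda>n. c ^ n)) n = fps_nth 1 n"
      by (cases n) (simp_all add: left_diff_distrib mult.assoc)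
  qed
  then show ?thesis by (simp add: fps_coeffs_def upt_0_numeral)
qed

text \<open>Products of the geometric series \<open>1 / (1 - l * X)\<close> over
  \<open>l < i\<close>; the entries are Stirling numbers of the second kind.\<close>

lemma inverse_power_coeffs:
  "fps_coeffs 5 (inverse_power_fps 1) = [1, 0, 0, 0, 0]"
  "fps_coeffs 5 (inverse_power_fps 2) = [1, 1, 1, 1, 1]"
  "fps_coeffs 5 (inverse_power_fps 3) = [1, 3, 7, 15, 31]"
  "fps_coeffs 5 (inverse_power_fps 4) = [1, 6, 25, 90, 301]"
  "fps_coeffs 5 (inverse_power_fps 5) = [1, 10, 65, 350, 1701]"
proof -
  have s: "fps_coeffs 5 (inverse_power_fps k) =
      map (\<lambda>k. \<Sum>i\<leftarrow>[0..<Suc k]. xs ! i * [1, real l, (real l) ^ 2, (real l) ^ 3, (real l) ^ 4] ! (k - i)) [0..<5]"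
    if "fps_coeffs 5 (inverse_power_fps l) = xs" "k = Suc l" for k l xs
    using fps_coeffs_mult[OF that(1) geometric_coeffs[of "real l"]] that(2) by simp
  show 1: "fps_coeffs 5 (inverse_power_fps 1) = [1, 0, 0, 0, 0]" by (simp add: fps_coeffs_def upt_0_numeral)
  show 2: "fps_coeffs 5 (inverse_power_fps 2) = [1, 1, 1, 1, 1]" using s[OF 1, of 2] by (simp add: upt_0_numeral)
  show 3: "fps_coeffs 5 (inverse_power_fps 3) = [1, 3, 7, 15, 31]" using s[OF 2, of 3] by (simp add: upt_0_numeral)
  show 4: "fps_coeffs 5 (inverse_power_fps 4) = [1, 6, 25, 90, 301]" using s[OF 3, of 4] by (simp add: upt_0_numeral)
  show "fps_coeffs 5 (inverse_power_fps 5) = [1, 10, 65, 350, 1701]" using s[OF 4, of 5] by (simp add: upt_0_numeral)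
qed

lemma power_gap_coeffs:
  "fps_coeffs 5 (power_gap_fps 1) = [1/2, 1/8, -1/32, -1/128, 13/512]"
  "fps_coeffs 5 (power_gap_fps 2) = [1, 1, 1, 1, 1]"
  "fps_coeffs 5 (power_gap_fps 3) = [3/2, 25/8, 223/32, 1919/128, 15885/512]"
  "fps_coeffs 5 (power_gap_fps 4) = [2, 7, 26, 91, 302]"
  "fps_coeffs 5 (power_gap_fps 5) = [5/2, 105/8, 2303/32, 46719/128, 886797/512]"
proof -
  have s: "fps_coeffs 5 (power_gap_fps k) = map2 (+) xs ys"
    if "fps_coeffs 5 (power_gap_fps l) = xs" "fps_coeffs 5 (inverse_power_fps k) = ys" "k = Suc (Suc l)" for k l xs ys
    using fps_coeffs_add[OF that(1,2)] that(3) by simp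
  have 0: "fps_coeffs 5 (power_gap_fps 0) = [0, 0, 0, 0, 0]" by (simp add: fps_coeffs_def upt_0_numeral)
  show 1: "fps_coeffs 5 (power_gap_fps 1) = [1/2, 1/8, -1/32, -1/128, 13/512]"
    using fps_coeffs_diff[OF inverse_power_coeffs(1) inverse_1_plus_moment_coeffs] by simp
  show 2: "fps_coeffs 5 (power_gap_fps 2) = [1, 1, 1, 1, 1]" using s[OF 0 inverse_power_coeffs(2)] by simp
  show 3: "fps_coeffs 5 (power_gap_fps 3) = [3/2, 25/8, 223/32, 1919/128, 15885/512]" using s[OF 1 inverse_power_coeffs(3)] by simp
  show "fps_coeffs 5 (power_gap_fps 4) = [2, 7, 26, 91, 302]" using s[OF 2 inverse_power_coeffs(4)] by simp
  show "fps_coeffs 5 (power_gap_fps 5) = [5/2, 105/8, 2303/32, 46719/128, 886797/512]" using s[OF 3 inverse_power_coeffs(5)] by simp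
qed

lemma dilation_gap_coeffs: "fps_coeffs 5 (dilation_gap_fps (macdonald_fps * macdonald_fps)) = [1/2, -3/8, 13/32, -151/128, 2353/512]"
proof -
  note M = fps_coeffs_nth[OF macdonald_square_coeffs]
  note P = power_gap_coeffs(3-5)[THEN fps_coeffs_nth] power_gap_coeffs(1)[unfolded One_nat_def, THEN fps_coeffs_nth]
    power_gap_coeffs(2)[unfolded numeral_2_eq_2, THEN fps_coeffs_nth]
  show ?thesis
    unfolding fps_coeffs_def dilation_gap_fps_def fps_nth_Abs_fps sum_atMost_list
    by (simp add: upt_0_numeral M P del: power_gap_fps.simps fps_mult_nth_0 fps_mult_nth_1 fps_mult_nth_1')
qed

text \<open>The leading \<open>7 / 12\<close> is \<open>1 / 12\<close> from the principal value plus
  \<open>1 / 2\<close> from the regular part.\<close>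

lemma scaled_error_numerator_coeffs:
  "fps_coeffs 5 scaled_error_numerator = [7/12, -449/1080, 55949/120960, -87499/68040, 504591250451/103464345600]"
proof -
  have 1: "fps_coeffs 5 (fps_scale 2 (macdonald_fps * macdonald_fps)) = [1, -1/2, 5/8, -21/16, 507/128]"
    unfolding fps_coeffs_scale[OF macdonald_square_coeffs] by (simp add: upt_0_numeral)
  have 2: "fps_coeffs 5 stirling_fps = [1, 1/12, 1/288, -139/51840, -571/2488320]"
    using stirling_coeffs fps_coeffs_Suc[of 5 stirling_fps] by simp
  show ?thesis
    unfolding scaled_error_numerator_def
      fps_coeffs_add[OF fps_coeffs_mult[OF 1 pv_coeffs] fps_coeffs_mult[OF 2 dilation_gap_coeffs]]
    by (simp add: upt_0_numeral)
qed

lemma scaled_error_coeffs: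
  "fps_coeffs 5 scaled_error_fps = [7/12, -191/270, 18211/40320, -799201/435456, 427334077931/103464345600]"
proof -
  have I: "fps_coeffs 5 (fps_scale 2 bessel_I0_fps) = [1, 1/4, 9/32, 75/128, 3675/2048]"
    unfolding fps_coeffs_scale[OF bessel_I0_coeffs] by (simp add: upt_0_numeral)
  have I2: "fps_coeffs 5 (fps_scale 2 bessel_I0_fps * fps_scale 2 bessel_I0_fps) = [1, 1/2, 5/8, 21/16, 507/128]"
    unfolding fps_coeffs_mult[OF I I] by (simp add: upt_0_numeral)
  \<comment> \<open>Multiplying back by the denominator gives a triangular linear system for the
    unknown coefficients, so that no inverse series has to be evaluated.\<close>
  have "scaled_error_fps * (fps_scale 2 bessel_I0_fps * fps_scale 2 bessel_I0_fps) = scaled_error_numerator"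
    unfolding scaled_error_fps_def mult.assoc using fps_coeffs_nth[OF I, of 0]
    by (subst inverse_mult_eq_1) auto
  with fps_coeffs_mult[OF refl I2, of scaled_error_fps] scaled_error_numerator_coeffs
  show ?thesis by (simp add: upt_0_numeral fps_coeffs_def)
qed

lemma error_coeffs:
  "fps_coeffs 5 error_fps = [1, -191/630, 18211/376320, -799201/16257024, 427334077931/15450675609600]"
proof -
  note S = fps_coeffs_nth[OF scaled_error_coeffs]
  show ?thesis unfolding fps_coeffs_def error_fps_def fps_scale_def by (simp add: upt_0_numeral S power_one_over)
qed

theorem theorem2:
  shows "(\<forall>x::nat. x > 0 \<longrightarrow>
            bessel_K0 (2 * real x) / bessel_I0 (2 * real x)
              - I0K0_trunc (2 * x) (2 * real x) / (bessel_I0 (2 * real x))\<^sup>2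
            = I0K0_remainder (2 * x) (2 * real x) / (bessel_I0 (2 * real x))\<^sup>2)
       \<and> (\<exists>c :: nat \<Rightarrow> real.
            c 0 = 1 \<and>
            c 1 = - (191 / 630) \<and>
            c 2 = 18211 / 376320 \<and>
            c 3 = - (799201 / 16257024) \<and>
            c 4 = 427334077931 / 15450675609600 \<and>
            (\<forall>M. (\<lambda>x::nat.
                I0K0_remainder (2 * x) (2 * real x) / (bessel_I0 (2 * real x))\<^sup>2
                - 7 * sqrt (2 * pi) * exp (- 8 * real x) / (12 * sqrt (real x))
                    * (\<Sum>k<M. c k / real x ^ k))
              \<in> O(\<lambda>x. 7 * sqrt (2 * pi) * exp (- 8 * real x) / (12 * sqrt (real x))
                    / real x ^ M)))"
proof (intro conjI allI impI exI[of _ "fps_nth error_fps"] error_expansion)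
  fix x :: nat
  have "bessel_I0 (2 * real x) \<noteq> 0" using bessel_I0_pos[of "2 * real x"] by simp
  then show "bessel_K0 (2 * real x) / bessel_I0 (2 * real x) - I0K0_trunc (2 * x) (2 * real x) / (bessel_I0 (2 * real x))\<^sup>2
      = I0K0_remainder (2 * x) (2 * real x) / (bessel_I0 (2 * real x))\<^sup>2"
    by (simp add: I0K0_remainder_def power2_eq_square field_simps)
qed (use fps_coeffs_nth[OF error_coeffs] in simp_all)

end
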